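(* Let $n\ge1$ be an integer, $\gamma>0$, $1<q<\infty$ and $\alpha>-1$. Consider the operators, for $z,w\in\mathbb{B}_n$, $$[T_{\bullet}f(z)](w)=\int_{\mathbb{B}_n}K_{\bullet}(z,u)(w)\,f(u)\,dv_\alpha(u),\qquad \bullet\in\{\mathrm{radial},\mathrm{grad},\mathrm{invgrad}\},$$ with kernels $$K_{\mathrm{radial}}(z,u)(w)=(n+1+\alpha)\frac{(1-|\varphi_z(w)|^2)\,\langle\varphi_z(w),u\rangle}{(1-\langle\varphi_z(w),u\rangle)^{n+2+\alpha}},$$ $$K_{\mathrm{grad}}(z,u)(w)=\frac{(n+1+\alpha)(1-|\varphi_z(w)|^2)\,\overline{u}}{(1-\langle\varphi_z(w),u\rangle)^{n+2+\alpha}},$$ $$K_{\mathrm{invgrad}}(z,u)(w)=(n+1+\alpha)\frac{(1-|\varphi_z(w)|^2)^{n+1+\alpha}\;\overline{\varphi_{\varphi_z(w)}(u)}}{|1-\langle\varphi_z(w),u\rangle|^{2(n+1+\alpha)}} .$$ Then $T_{\mathrm{radial}}$, $T_{\mathrm{grad}}$ and $T_{\mathrm{invgrad}}$ all belong to $\mathrm{BIO}_\alpha(E)$, where $E=L^q(\mathbb{B}_n,\chi_{D(0,\gamma)}\,d\tau)$ (scalar-valued functions for $T_{\mathrm{radial}}$, $\mathbb{C}^n$-valued functions for $T_{\mathrm{grad}}$ and $T_{\mathrm{invgrad}}$). Consequently, the maps $f\mapsto A^{(q)}_\gamma(\mathcal{R}f)$, $f\mapsto A^{(q)}_\gamma(\nabla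 f)$ and $f\mapsto A^{(q)}_\gamma(\widetilde{\nabla}f)$ are all bounded on $\mathcal{A}^p_\alpha$ for every $1<p<\infty$; that is, for each such $p$ there is a constant $C>0$ such that for all $f\in\mathcal{A}^p_\alpha$ each of $\|A^{(q)}_\gamma(\mathcal{R}f)\|_{L^p_\alpha}$, $\|A^{(q)}_\gamma(\nabla f)\|_{L^p_\alpha}$, $\|A^{(q)}_\gamma(\widetilde{\nabla}f)\|_{L^p_\alpha}$ is at most $C\|f\|_{L^p_\alpha}$.
   Context: $\mathbb{B}_n$ is the open unit ball of $\mathbb{C}^n$ and $\langle z,w\rangle=\sum_j z_j\overline{w_j}$; for $u\in\mathbb{C}^n$, $\overline{u}=(\overline{u_1},\dots,\overline{u_n})$. $dv$ is Lebesgue measure on $\mathbb{B}_n$ normalized to have total mass $1$; for $\alpha>-1$, $dv_\alpha(z)=c_\alpha(1-|z|^2)^\alpha dv(z)$ with $c_\alpha=\Gamma(n+\alpha+1)/[n!\,\Gamma(\alpha+1)]$. The invariant measure is $d\tau(z)=(1-|z|^2)^{-(n+1)}dv(z)$. $L^p_\alpha=L^p(\mathbb{B}_n,dv_\alpha)$, and $\mathcal{A}^p_\alpha$ is the space of holomorphic functions on $\mathbb{B}_n$ belonging to $L^p_\alpha$. $\varphi_z$ is the standard involutive automorphism of $\mathbb{B}_n$ with $\varphi_z(0)=z$, $\varphi_z(z)=0$, $\varphi_z\circ\varphi_z=\mathrm{id}$; explicitly $\varphi_0(w)=-w$ and, for $z\ne0$, $\varphi_z(w)=\frac{z-P_z w-\sqrt{1-|z|^2}\,(w-P_zw)}{1-\langle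 w,z\rangle}$ with $P_z w=\frac{\langle w,z\rangle}{|z|^2}z$. The Bergman metric is $\beta(z,w)=\frac12\log\frac{1+|\varphi_z(w)|}{1-|\varphi_z(w)|}$ and $D(z,\gamma)=\{w\in\mathbb{B}_n:\beta(z,w)<\gamma\}$. For $f$ holomorphic on $\mathbb{B}_n$: $\mathcal{R}f(z)=\sum_{j=1}^n z_j\frac{\partial f}{\partial z_j}(z)$, $\nabla f(z)=\big(\frac{\partial f}{\partial z_1}(z),\dots,\frac{\partial f}{\partial z_n}(z)\big)$, $\widetilde{\nabla}f(z)=\nabla(f\circ\varphi_z)(0)$. The area functions are $$A^{(q)}_\gamma(\mathcal{R}f)(z)=\Big(\int_{D(z,\gamma)}|(1-|w|^2)\mathcal{R}f(w)|^q\,d\tau(w)\Big)^{1/q},$$ $$A^{(q)}_\gamma(\nabla f)(z)=\Big(\int_{D(z,\gamma)}|(1-|w|^2)\nabla f(w)|^q\,d\tau(w)\Big)^{1/q},$$ $$A^{(q)}_\gamma(\widetilde{\nabla}f)(z)=\Big(\int_{D(z,\gamma)}|\widetilde{\nabla}f(w)|^q\,d\tau(w)\Big)^{1/q}.$$ The function $\varrho$ on $\mathbb{B}_n\times\mathbb{B}_n$ is $\varrho(z,w)=\big||z|-|w|\big|+\big|1-\frac{1}{|z||w|}\langle z,w\rangle\big|$ if $z,w\in\mathbb{B}_n\setminus\{0\}$, and $\varrho(z,w)=|z|+|w|$ otherwise. Definition of $\mathrm{BIO}_\alpha(E)$: for a Banach space $E$ and $\alpha>-1$, an $\alpha$-time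 Bergman singular integral operator is an operator $Tf(z)=\int_{\mathbb{B}_n}K(z,w)f(w)\,dv_\alpha(w)$ whose kernel $K:\{(z,w)\in\mathbb{B}_n\times\mathbb{B}_n: z\ne w\}\to E$ is continuous and satisfies, for some constants $C>0$, $\delta>0$ and $0<\beta\le1$ (here $\beta$ denotes an exponent), $$\|K(z,w)\|_E\le\frac{C}{\varrho(z,w)^{n+1+\alpha}}\quad\text{for all } z\neq w \text{ in } \mathbb{B}_n,$$ $$\|K(z,w)-K(z,\zeta)\|_E+\|K(w,z)-K(\zeta,z)\|_E\le\frac{C\,\varrho(w,\zeta)^\beta}{\varrho(z,\zeta)^{n+1+\alpha+\beta}}$$ for all $z,w,\zeta\in\mathbb{B}_n$ with $\varrho(z,\zeta)\ge\delta\,\varrho(w,\zeta)$. $\mathrm{BIO}_\alpha(E)$ is the set of all such $T$ that are bounded from $L^p_\alpha$ into the Bochner space $L^p(\mathbb{B}_n,v_\alpha;E)$ for every $1<p<\infty$. *)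

theory Defs
  imports "HOL-Analysis.Analysis" "HOL-Library.Function_Algebras"
begin

text \<open>
  The complex space of dimension n is \<open>complex ^ 'n\<close> with n = \<open>CARD('n)\<close>; its library norm is the
  Euclidean one, so the open unit ball is \<open>ball 0 1\<close>.
\<close>

section \<open>The unit ball, its automorphisms and measures\<close>

abbreviation unit_ball :: "(complex ^ 'n::finite) set" where
  "unit_ball \<equiv> ball 0 1"

definition hprod :: "complex ^ 'n::finite \<Rightarrow> complex ^ 'n \<Rightarrow> complex" where
  "hprod z w = (\<Sum>j\<in>UNIV. z $ j * cnj (w $ j))"

definition cnj_vec :: "complex ^ 'n::finite \<Rightarrow> complex ^ 'n" where
  "cnj_vec u = (\<chi> j. cnj (u $ j))"

definition proj :: "complex ^ 'n::finite \<Rightarrow> complex ^ 'n \<Rightarrow> complex ^ 'n" where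
  "proj z w = (hprod w z / complex_of_real ((norm z)\<^sup>2)) *s z"

definition phi :: "complex ^ 'n::finite \<Rightarrow> complex ^ 'n \<Rightarrow> complex ^ 'n" where
  "phi z w = (if z = 0 then - w else
     (1 / (1 - hprod w z)) *s
       (z - proj z w - complex_of_real (sqrt (1 - (norm z)\<^sup>2)) *s (w - proj z w)))"

definition bergman_metric :: "complex ^ 'n::finite \<Rightarrow> complex ^ 'n \<Rightarrow> real" where
  "bergman_metric z w = 1 / 2 * ln ((1 + norm (phi z w)) / (1 - norm (phi z w)))"

definition bergman_ball :: "complex ^ 'n::finite \<Rightarrow> real \<Rightarrow> (complex ^ 'n) set" where
  "bergman_ball z \<gamma> = {w \<in> unit_ball. bergman_metric z w < \<gamma>}"

definition rho :: "complex ^ 'n::finite \<Rightarrow> complex ^ 'n \<Rightarrow> real" where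
  "rho z w = (if z \<noteq> 0 \<and> w \<noteq> 0
     then \<bar>norm z - norm w\<bar> + cmod (1 - complex_of_real (1 / (norm z * norm w)) * hprod z w)
     else norm z + norm w)"

text \<open>
  All measures below have the unit ball itself as underlying space, so measurability and
  integrability never refer to values of a function outside the ball.
\<close>

definition ball_measure :: "(complex ^ 'n::finite) measure" where
  "ball_measure = uniform_measure (restrict_space lborel unit_ball) unit_ball"

definition v_alpha :: "real \<Rightarrow> (complex ^ 'n::finite) measure" where
  "v_alpha \<alpha> = density ball_measure (\<lambda>z. ennreal
     (Gamma (real CARD('n) + \<alpha> + 1) / (fact CARD('n) * Gamma (\<alpha> + 1)) * (1 - (norm z)\<^sup>2) powr \<alpha>))"

definition tau :: "(complex ^ 'n::finite) measure" where
  "tau = density ball_measure (\<lambda>z. ennreal (1 / (1 - (norm z)\<^sup>2) ^ (CARD('n) + 1)))"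

section \<open>Lebesgue spaces and complex Banach spaces\<close>

definition Lp :: "'a measure \<Rightarrow> real \<Rightarrow> ('a \<Rightarrow> 'b::real_normed_vector) set" where
  "Lp M p = {f \<in> borel_measurable M. integrable M (\<lambda>x. norm (f x) powr p)}"

definition Lp_norm :: "'a measure \<Rightarrow> real \<Rightarrow> ('a \<Rightarrow> 'b::real_normed_vector) \<Rightarrow> real" where
  "Lp_norm M p f = (\<integral>x. norm (f x) powr p \<partial>M) powr (1 / p)"

text \<open>
  The norm of the spaces \<open>L\<^sup>q\<close> depends on the real number q, so it cannot be provided by a type
  class. A complex Banach space is therefore given by an explicit carrier, scalar multiplication
  and norm on a type of vectors. As usual for Lebesgue spaces, the vectors may be representatives:
  those at distance 0 are identified, and every notion below is invariant under this
  identification.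
\<close>

record 'e cspace =
  vecs :: "'e set"
  scl :: "complex \<Rightarrow> 'e \<Rightarrow> 'e"
  nrm :: "'e \<Rightarrow> real"

text \<open>
  The argument \<open>sc\<close> is the scalar multiplication of the value space: \<open>(*)\<close> for scalar-valued
  functions, \<open>(*s)\<close> for vector-valued ones.
\<close>

definition Lp_space ::
  "'a measure \<Rightarrow> real \<Rightarrow> (complex \<Rightarrow> 'b \<Rightarrow> 'b) \<Rightarrow> ('a \<Rightarrow> 'b::real_normed_vector) cspace" where
  "Lp_space M p sc = \<lparr>vecs = Lp M p, scl = (\<lambda>c f x. sc c (f x)), nrm = Lp_norm M p\<rparr>"

section \<open>Bochner integration\<close>

definition simple_in :: "'e cspace \<Rightarrow> 'a measure \<Rightarrow> ('a \<Rightarrow> 'e) \<Rightarrow> bool" where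
  "simple_in E M s \<longleftrightarrow> simple_function M s \<and> s ` space M \<subseteq> vecs E"

definition strongly_measurable_in ::
  "'e::ab_group_add cspace \<Rightarrow> 'a measure \<Rightarrow> ('a \<Rightarrow> 'e) \<Rightarrow> bool" where
  "strongly_measurable_in E M F \<longleftrightarrow>
     (\<exists>s. (\<forall>k. simple_in E M (s k)) \<and>
          (AE x in M. F x \<in> vecs E \<and> (\<lambda>k. nrm E (F x - s k x)) \<longlonglongrightarrow> 0))"

definition simple_integral_in ::
  "'e::ab_group_add cspace \<Rightarrow> 'a measure \<Rightarrow> ('a \<Rightarrow> 'e) \<Rightarrow> 'e" where
  "simple_integral_in E M s =
     (\<Sum>y\<in>s ` space M. scl E (complex_of_real (measure M {x \<in> space M. s x = y})) y)"

text \<open>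
  Only used for finite measures, where every simple function is integrable; compare the library's
  \<^const>\<open>has_bochner_integral\<close>.
\<close>

definition has_integral_in ::
  "'e::ab_group_add cspace \<Rightarrow> 'a measure \<Rightarrow> ('a \<Rightarrow> 'e) \<Rightarrow> 'e \<Rightarrow> bool" where
  "has_integral_in E M F I \<longleftrightarrow> I \<in> vecs E \<and> strongly_measurable_in E M F \<and>
     (\<exists>s. (\<forall>k. simple_in E M (s k)) \<and>
          (\<lambda>k. \<integral>\<^sup>+x. ennreal (nrm E (F x - s k x)) \<partial>M) \<longlonglongrightarrow> 0 \<and>
          (\<lambda>k. nrm E (simple_integral_in E M (s k) - I)) \<longlonglongrightarrow> 0)"

text \<open>
  The norm of a strongly measurable function is only almost everywhere equal to a Borel function,
  hence the nonnegative integral, which respects almost everywhere equality.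
\<close>

definition bochner_Lp ::
  "'e::ab_group_add cspace \<Rightarrow> 'a measure \<Rightarrow> real \<Rightarrow> ('a \<Rightarrow> 'e) set" where
  "bochner_Lp E M p =
     {F. strongly_measurable_in E M F \<and> (\<integral>\<^sup>+x. ennreal (nrm E (F x) powr p) \<partial>M) < \<infinity>}"

definition bochner_Lp_norm ::
  "'e cspace \<Rightarrow> 'a measure \<Rightarrow> real \<Rightarrow> ('a \<Rightarrow> 'e) \<Rightarrow> real" where
  "bochner_Lp_norm E M p F = enn2real (\<integral>\<^sup>+x. ennreal (nrm E (F x) powr p) \<partial>M) powr (1 / p)"

section \<open>Bergman singular integral operators\<close>

text \<open>
  A kernel is a function on pairs of distinct points of the ball; its values elsewhere are
  irrelevant. Hence the side conditions \<open>z \<noteq> w\<close> and \<open>z \<noteq> \<zeta>\<close> in the regularity estimate.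
\<close>

definition bergman_kernel_on ::
  "real \<Rightarrow> 'e::ab_group_add cspace \<Rightarrow> (complex ^ 'n::finite \<Rightarrow> complex ^ 'n \<Rightarrow> 'e) \<Rightarrow> bool"
where
  "bergman_kernel_on \<alpha> E K \<longleftrightarrow>
     (\<forall>z\<in>unit_ball. \<forall>w\<in>unit_ball. z \<noteq> w \<longrightarrow> K z w \<in> vecs E) \<and>
     (\<forall>z\<in>unit_ball. \<forall>w\<in>unit_ball. z \<noteq> w \<longrightarrow>
        ((\<lambda>x. nrm E (K (fst x) (snd x) - K z w)) \<longlongrightarrow> 0)
          (at (z, w) within {x \<in> unit_ball \<times> unit_ball. fst x \<noteq> snd x})) \<and>
     (\<exists>C>0. \<exists>\<delta>>0. \<exists>b>0. b \<le> 1 \<and>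
        (\<forall>z\<in>unit_ball. \<forall>w\<in>unit_ball. z \<noteq> w \<longrightarrow>
           nrm E (K z w) \<le> C / rho z w powr (real CARD('n) + 1 + \<alpha>)) \<and>
        (\<forall>z\<in>unit_ball. \<forall>w\<in>unit_ball. \<forall>\<zeta>\<in>unit_ball.
           z \<noteq> w \<longrightarrow> z \<noteq> \<zeta> \<longrightarrow> rho z \<zeta> \<ge> \<delta> * rho w \<zeta> \<longrightarrow>
           nrm E (K z w - K z \<zeta>) + nrm E (K w z - K \<zeta> z)
             \<le> C * rho w \<zeta> powr b / rho z \<zeta> powr (real CARD('n) + 1 + \<alpha> + b)))"

text \<open>
  The integral representation is required for every f in some \<open>L\<^sup>p\<close> with p > 1, at almost every
  point (operators are determined up to null sets).
\<close>

definition bergman_integral_operator ::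
  "real \<Rightarrow> 'e::ab_group_add cspace \<Rightarrow> (complex ^ 'n::finite \<Rightarrow> complex ^ 'n \<Rightarrow> 'e) \<Rightarrow>
   ((complex ^ 'n \<Rightarrow> complex) \<Rightarrow> complex ^ 'n \<Rightarrow> 'e) \<Rightarrow> bool"
where
  "bergman_integral_operator \<alpha> E K T \<longleftrightarrow>
     (\<forall>p>1. \<forall>f\<in>Lp (v_alpha \<alpha>) p. AE z in v_alpha \<alpha>.
        has_integral_in E (v_alpha \<alpha>) (\<lambda>w. scl E (f w) (K z w)) (T f z))"

definition BIO ::
  "real \<Rightarrow> 'e::ab_group_add cspace \<Rightarrow>
   ((complex ^ 'n::finite \<Rightarrow> complex) \<Rightarrow> complex ^ 'n \<Rightarrow> 'e) set"
where
  "BIO \<alpha> E = {T.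
     (\<exists>K. bergman_kernel_on \<alpha> E K \<and> bergman_integral_operator \<alpha> E K T) \<and>
     (\<forall>p>1. \<exists>C. \<forall>f\<in>Lp (v_alpha \<alpha>) p.
        T f \<in> bochner_Lp E (v_alpha \<alpha>) p \<and>
        bochner_Lp_norm E (v_alpha \<alpha>) p (T f) \<le> C * Lp_norm (v_alpha \<alpha>) p f)}"

section \<open>The three kernels and operators\<close>

text \<open>
  Complex powers are principal branches: the bases \<open>1 - hprod (phi z w) u\<close> have positive real part.
\<close>

definition K_radial ::
  "real \<Rightarrow> complex ^ 'n::finite \<Rightarrow> complex ^ 'n \<Rightarrow> complex ^ 'n \<Rightarrow> complex" where
  "K_radial \<alpha> z u w =
     complex_of_real ((real CARD('n) + 1 + \<alpha>) * (1 - (norm (phi z w))\<^sup>2)) * hprod (phi z w) u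
       / (1 - hprod (phi z w) u) powr complex_of_real (real CARD('n) + 2 + \<alpha>)"

definition K_grad ::
  "real \<Rightarrow> complex ^ 'n::finite \<Rightarrow> complex ^ 'n \<Rightarrow> complex ^ 'n \<Rightarrow> complex ^ 'n" where
  "K_grad \<alpha> z u w =
     (complex_of_real ((real CARD('n) + 1 + \<alpha>) * (1 - (norm (phi z w))\<^sup>2))
       / (1 - hprod (phi z w) u) powr complex_of_real (real CARD('n) + 2 + \<alpha>)) *s cnj_vec u"

definition K_invgrad ::
  "real \<Rightarrow> complex ^ 'n::finite \<Rightarrow> complex ^ 'n \<Rightarrow> complex ^ 'n \<Rightarrow> complex ^ 'n" where
  "K_invgrad \<alpha> z u w =
     complex_of_real ((real CARD('n) + 1 + \<alpha>)
         * (1 - (norm (phi z w))\<^sup>2) powr (real CARD('n) + 1 + \<alpha>)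
         / cmod (1 - hprod (phi z w) u) powr (2 * (real CARD('n) + 1 + \<alpha>)))
       *s cnj_vec (phi (phi z w) u)"

definition T_radial ::
  "real \<Rightarrow> (complex ^ 'n::finite \<Rightarrow> complex) \<Rightarrow> complex ^ 'n \<Rightarrow> complex ^ 'n \<Rightarrow> complex" where
  "T_radial \<alpha> f z = (\<lambda>w. \<integral>u. f u * K_radial \<alpha> z u w \<partial>v_alpha \<alpha>)"

definition T_grad ::
  "real \<Rightarrow> (complex ^ 'n::finite \<Rightarrow> complex) \<Rightarrow> complex ^ 'n \<Rightarrow> complex ^ 'n \<Rightarrow> complex ^ 'n" where
  "T_grad \<alpha> f z = (\<lambda>w. \<integral>u. f u *s K_grad \<alpha> z u w \<partial>v_alpha \<alpha>)"

definition T_invgrad ::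
  "real \<Rightarrow> (complex ^ 'n::finite \<Rightarrow> complex) \<Rightarrow> complex ^ 'n \<Rightarrow> complex ^ 'n \<Rightarrow> complex ^ 'n" where
  "T_invgrad \<alpha> f z = (\<lambda>w. \<integral>u. f u *s K_invgrad \<alpha> z u w \<partial>v_alpha \<alpha>)"

definition tau_on :: "(complex ^ 'n::finite) set \<Rightarrow> (complex ^ 'n) measure" where
  "tau_on D = density tau (indicator D)"

section \<open>Holomorphic functions and area functions\<close>

definition holomorphic_vec_on ::
  "(complex ^ 'n::finite \<Rightarrow> complex) \<Rightarrow> (complex ^ 'n) set \<Rightarrow> bool" where
  "holomorphic_vec_on f S \<longleftrightarrow>
     (\<forall>z\<in>S. \<exists>L. (f has_derivative L) (at z within S) \<and> (\<forall>c v. L (c *s v) = c * L v))"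

definition bergman_space :: "real \<Rightarrow> real \<Rightarrow> (complex ^ 'n::finite \<Rightarrow> complex) set" where
  "bergman_space \<alpha> p = {f. holomorphic_vec_on f unit_ball \<and> f \<in> Lp (v_alpha \<alpha>) p}"

definition partial_deriv ::
  "'n::finite \<Rightarrow> (complex ^ 'n \<Rightarrow> complex) \<Rightarrow> complex ^ 'n \<Rightarrow> complex" where
  "partial_deriv j f z = deriv (\<lambda>t. f (z + axis j t)) 0"

definition radial_deriv :: "(complex ^ 'n::finite \<Rightarrow> complex) \<Rightarrow> complex ^ 'n \<Rightarrow> complex" where
  "radial_deriv f z = (\<Sum>j\<in>UNIV. z $ j * partial_deriv j f z)"

definition grad :: "(complex ^ 'n::finite \<Rightarrow> complex) \<Rightarrow> complex ^ 'n \<Rightarrow> complex ^ 'n" where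
  "grad f z = (\<chi> j. partial_deriv j f z)"

definition inv_grad :: "(complex ^ 'n::finite \<Rightarrow> complex) \<Rightarrow> complex ^ 'n \<Rightarrow> complex ^ 'n" where
  "inv_grad f z = grad (f \<circ> phi z) 0"

text \<open>
  For holomorphic f the integrands below are bounded on the Bergman balls, which are relatively
  compact in the unit ball, so these integrals are finite.
\<close>

definition area_radial ::
  "real \<Rightarrow> real \<Rightarrow> (complex ^ 'n::finite \<Rightarrow> complex) \<Rightarrow> complex ^ 'n \<Rightarrow> real" where
  "area_radial \<gamma> q f z =
     (LINT w:bergman_ball z \<gamma>|tau. cmod (complex_of_real (1 - (norm w)\<^sup>2) * radial_deriv f w) powr q)
       powr (1 / q)"

definition area_grad ::
  "real \<Rightarrow> real \<Rightarrow> (complex ^ 'n::finite \<Rightarrow> complex) \<Rightarrow> complex ^ 'n \<Rightarrow> real" where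
  "area_grad \<gamma> q f z =
     (LINT w:bergman_ball z \<gamma>|tau. norm (complex_of_real (1 - (norm w)\<^sup>2) *s grad f w) powr q)
       powr (1 / q)"

definition area_inv_grad ::
  "real \<Rightarrow> real \<Rightarrow> (complex ^ 'n::finite \<Rightarrow> complex) \<Rightarrow> complex ^ 'n \<Rightarrow> real" where
  "area_inv_grad \<gamma> q f z =
     (LINT w:bergman_ball z \<gamma>|tau. norm (inv_grad f w) powr q) powr (1 / q)"

end

theory Submission
  imports Defs "HOL-Complex_Analysis.Complex_Analysis"
begin

text \<open>With \<open>s = sn z\<close>, the square root of \<open>1 - |z|\<^sup>2\<close>, the automorphism at \<open>z\<close> is
  \<open>z + s / (1 - \<langle>w, z\<rangle>) G\<^sub>z w\<close>, where the linear map \<open>G\<^sub>z\<close> depends smoothly on \<open>(z, s)\<close>. On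
  \<open>|w| \<le> tanh \<gamma> < 1\<close> the three kernels are therefore built from \<open>z\<close>, \<open>s\<close>, \<open>u\<close>, \<open>w\<close> by sums, products and
  powers, and \<open>|1 - \<langle>\<phi>\<^sub>z w, u\<rangle>|\<close> is comparable to \<open>|1 - \<langle>z, u\<rangle>|\<close> uniformly in \<open>w\<close>. Assigning to each factor an
  order in \<open>d = |1 - \<langle>z, u\<rangle>|\<close> and a modulus of continuity at scale \<open>\<varrho>\<^sup>1\<^sup>/\<^sup>2\<close>, and letting these
  orders add up, gives the size estimate \<open>d\<close> to the power \<open>-(n + 1 + \<alpha>)\<close> and the smoothness estimate
  with exponent 1/2. By the size estimate all three operators are dominated by the positive
  Bergman operator, which is bounded on \<open>L\<^sup>p\<close> by Schur's test and the Forelli--Rudin estimates.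
  For holomorphic \<open>f\<close>, Cauchy's formula on discs in the ellipsoid \<open>z + s G\<^sub>z(B) / 4\<close>, averaged over
  the ball \<open>B\<close>, bounds the invariant gradient of \<open>f\<close> at \<open>z\<close> by the same positive operator applied to \<open>|f|\<close>. It
  dominates the two other gradients. As the positive operator varies by a bounded factor over
  \<open>D(z, \<gamma>)\<close>, whose invariant measure is bounded in \<open>z\<close>, the area functions are dominated
  pointwise by the positive operator.\<close>

section \<open>The Hermitian product\<close>

text \<open>Inside the ball \<open>d\<close> stays positive, so the kernels are singular only at the
  boundary, and the comparison with \<open>rho\<close> is one-sided: \<open>rho z u\<close> is at
  most \<open>5 * d\<close> and vanishes on the diagonal. The exponent 1/2 reflects anisotropy:
  \<open>sn\<close> and the tangential part of a vector move by the square root of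
  \<open>rho\<close>, whereas \<open>hprod z u\<close> moves by \<open>r * sqrt d\<close>. A change
  at scale \<open>r\<close> thus costs the kernels a factor \<open>r / sqrt d\<close>, since the
  factors that are only Lipschitz in \<open>r\<close>, such as \<open>sn z\<close> and
  \<open>G z u\<close>, are themselves of size \<open>sqrt d\<close>. The \<open>L^p\<close> bounds
  come from size alone; smoothness serves the kernel conditions and strong measurability in
  \<open>E\<close>. Behind the Forelli-Rudin estimate is the volume of a nonisotropic box. It is
  found by volume comparison: a thin shell of the cone over a spherical cap lies in a Bergman ball
  of fixed radius, this lies in an ellipsoid, and the Jacobian of \<open>G z\<close> gives the
  volume. Holomorphy enters through the mean value property in place of a reproducing formula, so
  the area functions are estimated directly and not read off from the three operators.\<close>

lemma hprod_add_left: "hprod (x + y) z = hprod x z + hprod y z"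
  by (simp add: hprod_def distrib_right sum.distrib)

lemma hprod_add_right: "hprod z (x + y) = hprod z x + hprod z y"
  by (simp add: hprod_def distrib_left sum.distrib)

lemma hprod_diff_left: "hprod (x - y) z = hprod x z - hprod y z"
  by (simp add: hprod_def left_diff_distrib sum_subtractf)

lemma hprod_diff_right: "hprod z (x - y) = hprod z x - hprod z y"
  by (simp add: hprod_def right_diff_distrib sum_subtractf)

lemma hprod_minus_left: "hprod (- x) z = - hprod x z"
  by (simp add: hprod_def sum_negf)

lemma hprod_minus_right: "hprod z (- x) = - hprod z x"
  by (simp add: hprod_def sum_negf)

lemma hprod_scale_left: "hprod (c *s x) z = c * hprod x z"
  by (simp add: hprod_def sum_distrib_left mult.assoc)

lemma hprod_scale_right: "hprod z (c *s x) = cnj c * hprod z x"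
  by (simp add: hprod_def sum_distrib_left algebra_simps)

lemma hprod_zero_left [simp]: "hprod 0 z = 0"
  by (simp add: hprod_def)

lemma hprod_zero_right [simp]: "hprod z 0 = 0"
  by (simp add: hprod_def)

lemmas hprod_linear = hprod_add_left hprod_add_right hprod_diff_left hprod_diff_right
  hprod_minus_left hprod_minus_right hprod_scale_left hprod_scale_right

lemma cnj_hprod: "cnj (hprod z w) = hprod w z"
  by (simp add: hprod_def mult.commute)

lemma hprod_self: "hprod z z = complex_of_real ((norm z)\<^sup>2)"
proof -
  have "(norm z)\<^sup>2 = (\<Sum>j\<in>UNIV. (cmod (z $ j))\<^sup>2)"
    by (simp add: norm_vec_def L2_set_def sum_nonneg)
  then show ?thesis
    unfolding hprod_def by (simp only: complex_norm_square of_real_sum)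
qed

lemma Re_hprod: "Re (hprod z w) = z \<bullet> w"
  by (simp add: hprod_def inner_vec_def inner_complex_def)

lemma norm_scale_vec: "norm (c *s (x :: complex ^ 'n::finite)) = cmod c * norm x"
proof -
  have "complex_of_real ((norm (c *s x))\<^sup>2) = complex_of_real ((cmod c * norm x)\<^sup>2)"
    by (simp only: hprod_self [symmetric] hprod_linear power_mult_distrib of_real_mult
        complex_norm_square) (simp add: hprod_self)
  then have "(norm (c *s x))\<^sup>2 = (cmod c * norm x)\<^sup>2"
    by (simp only: of_real_eq_iff)
  then show ?thesis
    by (metis abs_mult abs_norm_cancel power2_eq_iff_nonneg norm_ge_zero mult_nonneg_nonneg)
qed

lemma of_real_scale_vec: "complex_of_real c *s (x :: complex ^ 'n::finite) = c *\<^sub>R x"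
  by (simp add: vec_eq_iff scaleR_conv_of_real[where 'a = complex])

text \<open>Rotating \<open>z\<close> by a unimodular \<open>c\<close> makes the product real and
  nonnegative, which reduces the claim to the real Cauchy-Schwarz inequality.\<close>

lemma cmod_hprod_le: "cmod (hprod z w) \<le> norm z * norm w"
proof (cases "hprod z w = 0")
  case False
  define c where "c = cnj (hprod z w) / cmod (hprod z w)"
  have c1: "cmod c = 1"
    using False by (simp add: c_def norm_divide)
  have "hprod (c *s z) w = cmod (hprod z w)"
    using False by (simp add: hprod_linear c_def complex_norm_square[symmetric] power2_eq_square
        flip: of_real_mult) (metis complex_norm_square mult.commute of_real_eq_0_iff
        nonzero_mult_div_cancel_left norm_eq_zero power2_eq_square of_real_mult)
  then have "cmod (hprod z w) = (c *s z) \<bullet> w"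
    by (metis Re_complex_of_real Re_hprod)
  also have "\<dots> \<le> norm (c *s z) * norm w"
    by (rule norm_cauchy_schwarz)
  finally show ?thesis
    by (simp add: norm_scale_vec c1)
qed simp

lemma norm_add_sq: "(norm (x + y))\<^sup>2 = (norm x)\<^sup>2 + 2 * Re (hprod x y) + (norm (y::complex^'n::finite))\<^sup>2"
  by (simp add: Re_hprod power2_norm_eq_inner inner_add inner_commute)

lemma cmod_hprod_lt_1:
  assumes "norm z < 1" "norm w \<le> 1"
  shows "cmod (hprod z w) < 1"
proof -
  have "norm z * norm w \<le> norm z"
    using assms by (simp add: mult_left_le)
  then show ?thesis
    using cmod_hprod_le[of z w] assms by linarith
qed

lemma cmod_one_minus_hprod_commute: "cmod (1 - hprod z w) = cmod (1 - hprod w z)"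
  by (metis cnj_hprod complex_cnj_diff complex_cnj_one complex_mod_cnj)

lemma bounded_bilinear_hprod: "bounded_bilinear (hprod :: complex ^ 'n::finite \<Rightarrow> _)"
  by (rule bounded_bilinear.intro)
    (auto simp: hprod_linear scaleR_conv_of_real[where 'a = complex] simp flip: of_real_scale_vec
      intro!: exI[of _ 1] cmod_hprod_le)

lemma bounded_bilinear_scale_vec:
  "bounded_bilinear ((*s) :: complex \<Rightarrow> complex ^ 'n::finite \<Rightarrow> _)"
  by (rule bounded_bilinear.intro)
    (auto simp: vector_add_ldistrib vector_sadd_rdistrib norm_scale_vec vec_eq_iff
      scaleR_conv_of_real[where 'a = complex] intro!: exI[of _ 1])

lemmas continuous_on_hprod [continuous_intros] =
  bounded_bilinear.continuous_on [OF bounded_bilinear_hprod]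

lemmas continuous_on_scale_vec [continuous_intros] =
  bounded_bilinear.continuous_on [OF bounded_bilinear_scale_vec]

lemma borel_measurable_hprod [measurable (raw)]:
  assumes "f \<in> borel_measurable M" "g \<in> borel_measurable M"
  shows "(\<lambda>x. hprod (f x) (g x)) \<in> borel_measurable M"
  by (rule borel_measurable_continuous_Pair [OF assms]) (intro continuous_intros)

lemma borel_measurable_scale_vec [measurable (raw)]:
  assumes "f \<in> borel_measurable M" "g \<in> borel_measurable M"
  shows "(\<lambda>x. f x *s (g x :: complex ^ 'n::finite)) \<in> borel_measurable M"
  by (rule borel_measurable_continuous_Pair [OF assms]) (intro continuous_intros)

section \<open>The automorphisms\<close>

definition sn :: "complex ^ 'n::finite \<Rightarrow> real" where
  "sn z = sqrt (1 - (norm z)\<^sup>2)"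

text \<open>Up to sign, the linear map that shrinks the complex line through \<open>z\<close> by the factor
  \<open>sn z\<close> and fixes its orthogonal complement. Unlike the orthogonal projection it is smooth
  in \<open>z\<close> at the origin.\<close>

definition G :: "complex ^ 'n::finite \<Rightarrow> complex ^ 'n \<Rightarrow> complex ^ 'n" where
  "G z w = (hprod w z / complex_of_real (1 + sn z)) *s z - w"

lemma sn_sq: "norm z \<le> 1 \<Longrightarrow> (sn z)\<^sup>2 = 1 - (norm z)\<^sup>2"
  by (simp add: sn_def power_le_one)

lemma sn_nonneg [simp]: "norm z \<le> 1 \<Longrightarrow> 0 \<le> sn z"
  by (simp add: sn_def power_le_one)

lemma sn_pos: "norm z < 1 \<Longrightarrow> 0 < sn z"
  by (simp add: sn_def power_less_one_iff)

lemma sn_le_1 [simp]: "sn z \<le> 1"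
  by (simp add: sn_def)

lemma hprod_self_sn: "norm z \<le> 1 \<Longrightarrow> hprod z z = (1 - complex_of_real (sn z)) * (1 + complex_of_real (sn z))"
proof -
  assume "norm z \<le> 1"
  then have "(norm z)\<^sup>2 = (1 - sn z) * (1 + sn z)"
    using sn_sq[of z] by (simp add: algebra_simps power2_eq_square)
  then show ?thesis
    by (simp add: hprod_self del: of_real_power)
qed

lemma one_plus_sn_neq_0: "norm z \<le> 1 \<Longrightarrow> 1 + complex_of_real (sn z) \<noteq> 0"
proof -
  assume "norm z \<le> 1"
  then have "1 + sn z \<noteq> 0"
    using sn_nonneg[of z] by linarith
  then show ?thesis
    by (metis of_real_1 of_real_add of_real_eq_0_iff)
qed

lemma G_add: "G z (x + y) = G z x + G z y"
  by (simp add: G_def hprod_linear add_divide_distrib vector_sadd_rdistrib)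

lemma G_scale: "G z (c *s x) = c *s G z x"
  by (simp add: G_def hprod_linear vec_eq_iff algebra_simps)

lemma G_diff: "G z (x - y) = G z x - G z y"
  by (simp add: G_def hprod_linear vec_eq_iff algebra_simps diff_divide_distrib)

text \<open>Self-adjointness allows \<open>G z\<close> to be moved from a parameter \<open>w\<close>
  onto the kernel variable \<open>u\<close>, where \<open>norm_G_le_sqrt\<close> makes it
  small.\<close>

lemma hprod_G: "hprod (G z w) u = hprod w (G z u)"
  by (simp add: G_def hprod_linear cnj_hprod)

lemma hprod_G_self:
  assumes "norm z \<le> 1"
  shows "hprod (G z w) z = - complex_of_real (sn z) * hprod w z"
  using one_plus_sn_neq_0[OF assms]
  by (simp add: G_def hprod_linear hprod_self_sn[OF assms] field_simps)

lemma G_self: "norm z \<le> 1 \<Longrightarrow> G z z = - complex_of_real (sn z) *s z"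
  using one_plus_sn_neq_0[of z]
  by (simp add: G_def hprod_self_sn vec_eq_iff field_simps)

text \<open>On the line through \<open>z\<close> the two factors \<open>sn z\<close> multiply to
  \<open>1 - |z|^2\<close>, so squaring removes the root. This gives the norm of
  \<open>G z w\<close> and the involution property of \<open>phi z\<close>.\<close>

lemma G_G:
  assumes "norm z \<le> 1"
  shows "G z (G z w) = w - hprod w z *s z"
proof -
  have "G z (G z w) = (- complex_of_real (sn z) * hprod w z / complex_of_real (1 + sn z)) *s z - G z w"
    by (simp add: G_def[of z "G z w"] hprod_G_self assms)
  also have "\<dots> = (- complex_of_real (sn z) * hprod w z / complex_of_real (1 + sn z)
      - hprod w z / complex_of_real (1 + sn z)) *s z + w"
    by (simp add: G_def vec_eq_iff algebra_simps)
  also have "- complex_of_real (sn z) * hprod w z / complex_of_real (1 + sn z)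
      - hprod w z / complex_of_real (1 + sn z) = - hprod w z"
  proof -
    have "- s * t / (1 + s) - t / (1 + s) = - t" if "1 + s \<noteq> 0" for s t :: complex
      by (subst diff_divide_distrib [symmetric], subst nonzero_divide_eq_eq [OF that])
        (simp add: algebra_simps)
    from this [OF one_plus_sn_neq_0[OF assms], of "hprod w z"] show ?thesis by simp
  qed
  finally show ?thesis
    by (simp add: vec_eq_iff)
qed

lemma norm_G_sq:
  assumes "norm z \<le> 1"
  shows "(norm (G z w))\<^sup>2 = (norm w)\<^sup>2 - (cmod (hprod w z))\<^sup>2"
proof -
  have "complex_of_real ((norm (G z w))\<^sup>2) = hprod w (G z (G z w))"
    by (simp only: hprod_self [symmetric] hprod_G)
  also have "\<dots> = complex_of_real ((norm w)\<^sup>2 - (cmod (hprod w z))\<^sup>2)"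
    by (simp add: G_G[OF assms] hprod_linear hprod_self cnj_hprod complex_norm_square[of "hprod w z"] mult.commute
        del: of_real_power)
  finally show ?thesis
    by (simp only: of_real_eq_iff)
qed

lemma norm_G_le: "norm z \<le> 1 \<Longrightarrow> norm (G z w) \<le> norm w"
  using norm_G_sq[of z w] by (simp add: power2_le_imp_le)

lemma one_minus_cmod_sq_le:
  assumes "cmod t \<le> 1"
  shows "1 - (cmod t)\<^sup>2 \<le> 2 * cmod (1 - t)"
proof -
  have "1 - cmod t \<le> cmod (1 - t)"
    by (metis norm_one norm_triangle_ineq2)
  moreover have "1 - (cmod t)\<^sup>2 = (1 + cmod t) * (1 - cmod t)"
    by (simp add: power2_eq_square algebra_simps)
  moreover have "(1 + cmod t) * (1 - cmod t) \<le> 2 * (1 - cmod t)"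
    using assms by (intro mult_right_mono) auto
  ultimately show ?thesis by argo
qed

text \<open>By \<open>norm_G_sq\<close> the square of the left side is at most
  \<open>1 - |hprod u z|^2\<close>, and hence at most twice the nonisotropic distance. This is the
  half order in \<open>d\<close> that \<open>G\<close> contributes to the kernels.\<close>

lemma norm_G_le_sqrt:
  assumes "norm z \<le> 1" "norm u \<le> 1"
  shows "norm (G z u) \<le> sqrt (2 * cmod (1 - hprod z u))"
proof (rule real_le_rsqrt)
  have "cmod (hprod u z) \<le> 1"
    using cmod_hprod_le[of u z] assms by (meson mult_le_one norm_ge_zero order_trans)
  then have "1 - (cmod (hprod u z))\<^sup>2 \<le> 2 * cmod (1 - hprod u z)"
    by (rule one_minus_cmod_sq_le)
  moreover have "(norm u)\<^sup>2 \<le> 1"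
    using assms by (simp add: power_le_one)
  ultimately show "(norm (G z u))\<^sup>2 \<le> 2 * cmod (1 - hprod z u)"
    using norm_G_sq[OF assms(1), of u] cmod_one_minus_hprod_commute[of u z] by simp
qed

lemma one_minus_norm_le:
  assumes "norm u \<le> 1"
  shows "1 - norm z \<le> cmod (1 - hprod z u)"
proof -
  have "cmod (hprod z u) \<le> norm z"
    using cmod_hprod_le[of z u] assms by (meson mult_left_le norm_ge_zero order_trans)
  then show ?thesis
    using norm_triangle_ineq2[of 1 "hprod z u"] by simp
qed

lemma sn_le_sqrt:
  assumes "norm z \<le> 1" "norm u \<le> 1"
  shows "sn z \<le> sqrt (2 * cmod (1 - hprod z u))"
proof -
  have "1 - (norm z)\<^sup>2 = (1 + norm z) * (1 - norm z)"
    by (simp add: power2_eq_square algebra_simps)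
  also have "\<dots> \<le> 2 * cmod (1 - hprod z u)"
    using assms one_minus_norm_le[OF assms(2), of z] by (intro mult_mono) auto
  finally show ?thesis
    by (simp add: sn_def)
qed

lemma one_minus_hprod_neq_0:
  assumes "norm z < 1" "norm w \<le> 1"
  shows "1 - hprod w z \<noteq> 0" "1 - hprod z w \<noteq> 0"
proof -
  have "cmod (hprod z w) \<noteq> 1" "cmod (hprod w z) \<noteq> 1"
    using cmod_hprod_lt_1[OF assms] cnj_hprod[of z w] complex_mod_cnj[of "hprod z w"] by auto
  then show "1 - hprod w z \<noteq> 0" "1 - hprod z w \<noteq> 0"
    by auto
qed

text \<open>In the defining formula the projection is divided by
  \<open>|z|^2 = (1 - sn z) * (1 + sn z)\<close>; the coefficient \<open>1 - sn z\<close> in front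
  of it cancels, and only the harmless denominator \<open>1 + sn z\<close> is left, also at
  \<open>z = 0\<close>.\<close>

lemma phi_eq_G:
  assumes z: "norm z < 1" and w: "norm w \<le> 1"
  shows "phi z w = z + (complex_of_real (sn z) / (1 - hprod w z)) *s G z w"
proof (cases "z = 0")
  case True
  then show ?thesis by (simp add: phi_def sn_def G_def)
next
  case False
  have nz: "1 - hprod w z \<noteq> 0" and s: "1 + complex_of_real (sn z) \<noteq> 0"
    using one_minus_hprod_neq_0[OF assms] one_plus_sn_neq_0[of z] z by auto
  have n0: "complex_of_real ((norm z)\<^sup>2) \<noteq> 0"
    using False by simp
  have nn: "complex_of_real ((norm z)\<^sup>2) = (1 - complex_of_real (sn z)) * (1 + complex_of_real (sn z))"
    using hprod_self_sn[of z] z by (simp add: hprod_self)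
  have key: "proj z w - complex_of_real (sn z) *s proj z w = (hprod w z / (1 + complex_of_real (sn z))) *s z"
  proof -
    have "h / ((1 - r) * (1 + r)) - r * (h / ((1 - r) * (1 + r))) = h / (1 + r)"
      if "1 - r \<noteq> 0" "1 + r \<noteq> 0" for h r :: complex
    proof -
      have "h / ((1 - r) * (1 + r)) - r * (h / ((1 - r) * (1 + r))) = (1 - r) * (h / ((1 - r) * (1 + r)))"
        by (simp only: left_diff_distrib mult_1)
      then show ?thesis using that by simp
    qed
    moreover have "1 - complex_of_real (sn z) \<noteq> 0"
      using n0 unfolding nn by auto
    moreover have "proj z w - complex_of_real (sn z) *s proj z w =
       (hprod w z / ((1 - complex_of_real (sn z)) * (1 + complex_of_real (sn z))) -
        complex_of_real (sn z) * (hprod w z / ((1 - complex_of_real (sn z)) * (1 + complex_of_real (sn z))))) *s z"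
      unfolding proj_def nn by (simp only: vec_eq_iff vector_minus_component vector_smult_component
         left_diff_distrib mult.assoc) simp
    ultimately show ?thesis using s by presburger
  qed
  have "z - proj z w - complex_of_real (sn z) *s (w - proj z w) =
      z - complex_of_real (sn z) *s w - (hprod w z / (1 + complex_of_real (sn z))) *s z"
    by (simp add: key [symmetric] vec_eq_iff algebra_simps)
  also have "\<dots> = (1 - hprod w z) *s z + complex_of_real (sn z) *s G z w"
    using s by (simp add: G_def vec_eq_iff field_simps)
  finally have "phi z w = (1 / (1 - hprod w z)) *s ((1 - hprod w z) *s z + complex_of_real (sn z) *s G z w)"
    using False by (simp only: phi_def sn_def if_False)
  also have "\<dots> = z + (complex_of_real (sn z) / (1 - hprod w z)) *s G z w"
    using nz by (simp only: vector_add_ldistrib vector_smult_assoc) simp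
  finally show ?thesis .
qed

text \<open>Both sides equal
  \<open>(1 - hprod z u) * (1 - hprod w z) - sn z * hprod (G z w) u\<close>, by self-adjointness of
  \<open>G z\<close>. The identity trades the moving point \<open>phi z w\<close> for the base point
  \<open>z\<close>.\<close>

lemma one_minus_hprod_phi:
  assumes z: "norm z < 1" and w: "norm w \<le> 1" and u: "norm u \<le> 1"
  shows "(1 - hprod (phi z w) u) * (1 - hprod w z) = (1 - hprod z u) * (1 - hprod w (phi z u))"
  using one_minus_hprod_neq_0[OF z w] one_minus_hprod_neq_0[OF z u]
  by (simp add: phi_eq_G z w u hprod_linear hprod_G cnj_hprod field_simps)

lemma one_minus_hprod_phi_self:
  assumes z: "norm z < 1" and w: "norm w \<le> 1"
  shows "1 - hprod (phi z w) z = complex_of_real ((sn z)\<^sup>2) / (1 - hprod w z)"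
proof -
  define t s where "t = hprod w z" and "s = complex_of_real (sn z)"
  have "hprod (phi z w) z = (1 - s) * (1 + s) + s / (1 - t) * (- s * t)"
    using less_imp_le[OF z] by (simp add: phi_eq_G z w hprod_linear hprod_G_self hprod_self_sn s_def t_def)
  then show ?thesis
    using one_minus_hprod_neq_0[OF z w]
    by (simp add: field_simps power2_eq_square flip: s_def t_def)
qed

lemma one_minus_norm_phi_sq:
  assumes z: "norm z < 1" and w: "norm w \<le> 1"
  shows "1 - (norm (phi z w))\<^sup>2 = (1 - (norm z)\<^sup>2) * (1 - (norm w)\<^sup>2) / (cmod (1 - hprod w z))\<^sup>2"
proof -
  define t s where "t = hprod w z" and "s = complex_of_real (sn z)"
  have t: "1 - t \<noteq> 0"
    using one_minus_hprod_neq_0[OF z w] by (simp add: t_def)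
  then have t': "1 - cnj t \<noteq> 0"
    by (metis complex_cnj_diff complex_cnj_one complex_cnj_zero_iff)
  have s2: "s * s = 1 - complex_of_real ((norm z)\<^sup>2)"
  proof -
    have "sn z * sn z = 1 - (norm z)\<^sup>2"
      using z sn_sq[of z] by (simp add: power2_eq_square)
    then have "complex_of_real (sn z * sn z) = complex_of_real (1 - (norm z)\<^sup>2)"
      by (rule arg_cong)
    then show ?thesis
      by (simp add: s_def)
  qed
  have GG: "hprod (G z w) (G z w) = complex_of_real ((norm w)\<^sup>2) - t * cnj t"
    using z norm_G_sq[of z w] by (simp add: hprod_self[of "G z w"] t_def complex_norm_square [symmetric]
        del: of_real_power)
  have zG: "hprod z (G z w) = - s * cnj t"
    using hprod_G_self[of z w] z by (subst cnj_hprod [symmetric]) (simp add: t_def s_def)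
  have Gz: "hprod (G z w) z = - s * t"
    using hprod_G_self[of z w] z by (simp add: t_def s_def)
  define k where "k = s / (1 - t)"
  have "cnj k = s / (1 - cnj t)"
    by (simp add: k_def s_def)
  moreover have "hprod (phi z w) (phi z w) = complex_of_real ((norm z)\<^sup>2) + k * (- s * t)
     + cnj k * (- s * cnj t) + k * cnj k * (complex_of_real ((norm w)\<^sup>2) - t * cnj t)"
    using phi_eq_G[OF z w]
    by (simp add: hprod_linear GG zG Gz hprod_self[of z] k_def [symmetric] s_def [symmetric]
        t_def [symmetric] del: of_real_power) (simp add: algebra_simps)
  moreover have "complex_of_real ((norm z)\<^sup>2) = 1 - s * s"
    using s2 by simp
  ultimately have hh: "hprod (phi z w) (phi z w) = 1 - s * s + s / (1 - t) * (- s * t)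
     + s / (1 - cnj t) * (- s * cnj t)
     + s / (1 - t) * (s / (1 - cnj t)) * (complex_of_real ((norm w)\<^sup>2) - t * cnj t)"
    by (simp only: k_def)
  \<comment> \<open>The algebra is verified with an independent variable \<open>r\<close> in place
    of \<open>cnj t\<close>, so that it becomes a plain identity of rational functions.\<close>
  have "1 - (1 - s * s + s / (1 - t) * (- s * t) + s / (1 - r) * (- s * r)
     + s / (1 - t) * (s / (1 - r)) * (W - t * r)) = s * s * (1 - W) / ((1 - t) * (1 - r))"
    if "1 - t \<noteq> 0" "1 - r \<noteq> 0" for s t r W :: complex
    using that by (simp add: divide_simps) (simp add: algebra_simps)
  from this [OF t t', of s "complex_of_real ((norm w)\<^sup>2)"]
  have "1 - hprod (phi z w) (phi z w) = s * s * (1 - complex_of_real ((norm w)\<^sup>2)) / ((1 - t) * (1 - cnj t))"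
    by (simp only: hh)
  also have "(1 - t) * (1 - cnj t) = complex_of_real ((cmod (1 - t))\<^sup>2)"
    by (subst complex_norm_square) simp
  finally have "complex_of_real (1 - (norm (phi z w))\<^sup>2) =
      complex_of_real ((1 - (norm z)\<^sup>2) * (1 - (norm w)\<^sup>2) / (cmod (1 - t))\<^sup>2)"
    by (simp add: hprod_self s2)
  then show ?thesis
    by (simp only: of_real_eq_iff t_def)
qed

lemma norm_phi_le_1:
  assumes "norm z < 1" "norm w \<le> 1"
  shows "norm (phi z w) \<le> 1"
proof -
  have "0 \<le> (1 - (norm z)\<^sup>2) * (1 - (norm w)\<^sup>2) / (cmod (1 - hprod w z))\<^sup>2"
    using assms by (intro divide_nonneg_nonneg mult_nonneg_nonneg) (auto simp: power_le_one)
  then have "(norm (phi z w))\<^sup>2 \<le> 1"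
    using one_minus_norm_phi_sq[OF assms] by linarith
  then show ?thesis
    by (simp add: abs_square_le_1)
qed

lemma norm_phi_lt_1:
  assumes "norm z < 1" "norm w < 1"
  shows "norm (phi z w) < 1"
proof -
  have "0 < (1 - (norm z)\<^sup>2) * (1 - (norm w)\<^sup>2) / (cmod (1 - hprod w z))\<^sup>2"
    using assms one_minus_hprod_neq_0[of z w]
    by (intro divide_pos_pos mult_pos_pos) (auto simp: power_less_one_iff)
  then have "(norm (phi z w))\<^sup>2 < 1"
    using one_minus_norm_phi_sq[of z w] assms by linarith
  then show ?thesis
    by (simp add: abs_square_less_1)
qed

lemma sn_phi:
  assumes "norm z < 1" "norm w < 1"
  shows "sn (phi z w) = sn z * sn w / cmod (1 - hprod w z)"
  using assms one_minus_norm_phi_sq[of z w] by (simp add: sn_def real_sqrt_divide real_sqrt_mult)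

lemma phi_phi:
  assumes z: "norm z < 1" and w: "norm w < 1"
  shows "phi z (phi z w) = w"
proof -
  define t s where "t = hprod w z" and "s = complex_of_real (sn z)"
  have t: "1 - t \<noteq> 0" and s: "s \<noteq> 0"
    using one_minus_hprod_neq_0[OF z, of w] sn_pos[OF z] w by (auto simp: t_def s_def)
  have "phi z (phi z w) = z + (s / (s\<^sup>2 / (1 - t))) *s G z (phi z w)"
    using one_minus_hprod_phi_self[OF z, of w] norm_phi_le_1[OF z, of w] w
    by (simp add: phi_eq_G[OF z, of "phi z w"] s_def t_def)
  also have "G z (phi z w) = (- s) *s z + (s / (1 - t)) *s (w - t *s z)"
    using z w by (simp add: phi_eq_G G_add G_scale G_self G_G s_def t_def)
  also have "z + (s / (s\<^sup>2 / (1 - t))) *s ((- s) *s z + (s / (1 - t)) *s (w - t *s z)) = w"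
    using t s by (simp add: vec_eq_iff power2_eq_square)
  finally show ?thesis .
qed

section \<open>Isometries and linear images of Lebesgue measure\<close>

lemma nn_integral_lborel_affine:
  fixes f :: "'a::euclidean_space \<Rightarrow> ennreal"
  assumes [measurable]: "f \<in> borel_measurable borel" and "c \<noteq> 0"
  shows "(\<integral>\<^sup>+x. f x \<partial>lborel) = ennreal (\<bar>c\<bar> ^ DIM('a)) * (\<integral>\<^sup>+x. f (t + c *\<^sub>R x) \<partial>lborel)"
  by (subst lborel_affine[OF \<open>c \<noteq> 0\<close>, of t])
    (simp add: nn_integral_density nn_integral_distr nn_integral_cmult)

text \<open>Weil's uniqueness argument for Haar measure: for a second translation-invariant measure
  \<open>M\<close>, Fubini evaluates \<open>\<integral>\<integral> 1\<^sub>B(x) 1\<^sub>C(x + y)\<close> both as \<open>M(B) \<lambda>(C)\<close> and as \<open>\<lambda>(B) M(C)\<close>.\<close>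

lemma distr_lborel_isometry:
  fixes T :: "'a::euclidean_space \<Rightarrow> 'a"
  assumes lin: "linear T" and iso: "\<And>x. norm (T x) = norm x"
  shows "distr lborel borel T = lborel"
proof -
  define M where "M = distr lborel borel T"
  have [measurable]: "T \<in> borel_measurable borel"
    using lin by (intro borel_measurable_continuous_onI linear_continuous_on) (simp add: linear_linear)
  have [measurable_cong]: "sets M = sets borel" "space M = UNIV"
    by (simp_all add: M_def)
  have inj: "inj T"
    unfolding linear_inj_iff_eq_0[OF lin] by (metis iso norm_eq_zero)
  then have surj: "surj T"
    using lin linear_injective_imp_surjective by blast
  have ballM: "emeasure M (ball 0 r) = emeasure lborel (ball (0::'a) r)" for r
  proof -
    have "T -` ball 0 r = ball 0 r"
      by (auto simp: iso)
    then show ?thesis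
      by (simp add: M_def emeasure_distr)
  qed
  have sf: "sigma_finite_measure M"
  proof
    show "\<exists>A. countable A \<and> A \<subseteq> sets M \<and> \<Union>A = space M \<and> (\<forall>a\<in>A. emeasure M a \<noteq> \<infinity>)"
    proof (intro exI conjI)
      show "countable (range (\<lambda>n::nat. ball (0::'a) (real n)))" by simp
      show "range (\<lambda>n::nat. ball (0::'a) (real n)) \<subseteq> sets M" by (auto simp: \<open>sets M = _\<close>)
      show "\<Union> (range (\<lambda>n::nat. ball (0::'a) (real n))) = space M"
        using reals_Archimedean2 by (auto simp: \<open>space M = _\<close>)
      show "\<forall>a\<in>range (\<lambda>n::nat. ball (0::'a) (real n)). emeasure M a \<noteq> \<infinity>"
        using emeasure_lborel_ball_finite by (auto simp: ballM less_top[symmetric])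
    qed
  qed
  interpret pair_sigma_finite lborel M
    by (intro pair_sigma_finite.intro sf sigma_finite_lborel)
  have trans: "(\<integral>\<^sup>+x. f (c + x) \<partial>M) = (\<integral>\<^sup>+x. f x \<partial>M)" if [measurable]: "f \<in> borel_measurable borel" for f c
  proof -
    obtain c' where c': "c = T c'" using surj by auto
    have "(\<integral>\<^sup>+x. f (c + x) \<partial>M) = (\<integral>\<^sup>+x. f (T (c' + 1 *\<^sub>R x)) \<partial>lborel)"
      by (simp add: M_def nn_integral_distr c' linear_add[OF lin])
    also have "\<dots> = (\<integral>\<^sup>+x. f (T x) \<partial>lborel)"
      by (subst nn_integral_lborel_affine[of "\<lambda>x. f (T x)" 1 c']) simp_all
    finally show ?thesis
      by (simp add: M_def nn_integral_distr)
  qed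
  have shift: "(\<integral>\<^sup>+y. indicator D (x + c *\<^sub>R y) \<partial>lborel) = emeasure lborel D"
    if "D \<in> sets borel" "\<bar>c\<bar> = 1" for D c and x :: 'a
    using nn_integral_lborel_affine[of "indicator D" c x] that by force
  have "emeasure M B = emeasure lborel B" if [measurable]: "B \<in> sets borel" for B
  proof -
    \<comment> \<open>On centred balls the two measures agree because \<open>T\<close> preserves
      norms. Such a ball has positive finite measure, so it can be cancelled from the product
      identity.\<close>
    define C where "C = ball (0::'a) 1"
    have [measurable]: "C \<in> sets borel" by (simp add: C_def)
    have "emeasure M B * emeasure lborel C
        = (\<integral>\<^sup>+x. indicator B x * (\<integral>\<^sup>+y. indicator C y \<partial>lborel) \<partial>M)"
      by (simp add: nn_integral_multc \<open>sets M = _\<close>)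
    also have "\<dots> = (\<integral>\<^sup>+x. (\<integral>\<^sup>+y. indicator B x * indicator C (x + 1 *\<^sub>R y) \<partial>lborel) \<partial>M)"
      by (intro nn_integral_cong, subst nn_integral_cmult)
        (simp_all del: scaleR_one add: shift)
    also have "\<dots> = (\<integral>\<^sup>+y. (\<integral>\<^sup>+x. indicator B x * indicator C (x + 1 *\<^sub>R y) \<partial>M) \<partial>lborel)"
      by (rule Fubini') (simp add: measurable_cong_sets[OF sets_pair_measure_cong[OF sets_lborel \<open>sets M = _\<close>] refl])
    also have "\<dots> = (\<integral>\<^sup>+y. (\<integral>\<^sup>+x. indicator B (x - y) * indicator C x \<partial>M) \<partial>lborel)"
    proof (rule nn_integral_cong)
      fix y :: 'a
      show "(\<integral>\<^sup>+x. indicator B x * indicator C (x + 1 *\<^sub>R y) \<partial>M)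
          = (\<integral>\<^sup>+x. indicator B (x - y) * indicator C x \<partial>M)"
        using trans[of "\<lambda>x. indicator B (x - y) * indicator C x" y]
        by (simp add: algebra_simps)
    qed
    also have "\<dots> = (\<integral>\<^sup>+x. (\<integral>\<^sup>+y. indicator C x * indicator B (x + (-1) *\<^sub>R y) \<partial>lborel) \<partial>M)"
      by (subst Fubini') (simp_all add: measurable_cong_sets[OF sets_pair_measure_cong[OF sets_lborel \<open>sets M = _\<close>] refl] mult.commute)
    also have "\<dots> = (\<integral>\<^sup>+x. indicator C x * (\<integral>\<^sup>+y. indicator B y \<partial>lborel) \<partial>M)"
      by (intro nn_integral_cong, subst nn_integral_cmult)
        (use shift[of B "-1"] in simp_all)
    also have "\<dots> = emeasure M C * emeasure lborel B"
      by (simp add: nn_integral_multc \<open>sets M = _\<close>)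
    finally have eq: "emeasure M B * emeasure lborel C = emeasure lborel C * emeasure lborel B"
      by (simp add: C_def ballM)
    have "emeasure lborel C \<noteq> 0" "emeasure lborel C \<noteq> \<infinity>"
      using emeasure_lborel_ball_finite[of "0::'a" 1] unit_ball_vol_pos[of "real DIM('a)"]
      by (auto simp: C_def less_top[symmetric] emeasure_ball unit_ball_vol_pos order.strict_iff_not)
    with eq show ?thesis
      by (metis ennreal_mult_cancel_left mult.commute infinity_ennreal_def)
  qed
  then show ?thesis
    unfolding M_def [symmetric] by (intro measure_eqI) (auto simp: \<open>sets M = _\<close>)
qed

lemma nn_integral_isometry:
  fixes T :: "'a::euclidean_space \<Rightarrow> 'a"
  assumes lin: "linear T" and iso: "\<And>x. norm (T x) = norm x"
    and [measurable]: "f \<in> borel_measurable borel"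
  shows "(\<integral>\<^sup>+x. f (T x) \<partial>lborel) = (\<integral>\<^sup>+x. f x \<partial>lborel)"
proof -
  have [measurable]: "T \<in> borel_measurable borel"
    using lin by (intro borel_measurable_continuous_onI linear_continuous_on) (simp add: linear_linear)
  show ?thesis
    by (subst (2) distr_lborel_isometry[OF lin iso, symmetric]) (simp_all add: nn_integral_distr)
qed

lemma hprod_axis: "hprod x (axis k 1) = x $ k"
  by (simp add: hprod_def axis_def if_distrib[of cnj] if_distrib[of "(*) _"] sum.delta cong: if_cong)

text \<open>A Householder reflection exchanges \<open>e\<close> with a unimodular multiple of the
  axis. Being its own inverse and unitary, it is also its own adjoint.\<close>

lemma ex_unitary_involution:
  fixes e :: "complex ^ 'n::finite"
  assumes e: "norm e = 1"
  obtains U :: "complex ^ 'n \<Rightarrow> complex ^ 'n" and c where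
    "linear U" "\<And>x y. hprod (U x) (U y) = hprod x y" "\<And>x. U (U x) = x"
    "\<And>a x. U (a *s x) = a *s U x" "U (axis k 1) = c *s e" "cmod c = 1"
proof -
  define a :: "complex ^ 'n" where "a = axis k 1"
  define b where "b = hprod e a"
  \<comment> \<open>The sign makes \<open>hprod e (l *s a) \<le> 0\<close>, so the reflected vector \<open>v\<close> cannot vanish.\<close>
  define l where "l = (if b = 0 then 1 else - b / cmod b)"
  define c :: complex where "c = 1 + cmod b"
  define v where "v = e - l *s a"
  \<comment> \<open>The usual reflection in \<open>v\<close>: \<open>hprod v v = 2 * c\<close>
    below, so \<open>1 / c\<close> is the familiar coefficient \<open>2 / |v|^2\<close>.\<close>
  define U where "U = (\<lambda>x. x - (hprod x v / c) *s v)"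
  have l1: "cmod l = 1"
    by (auto simp: l_def norm_divide)
  then have l0: "l \<noteq> 0" and ll: "cnj l * l = 1"
    using complex_norm_square[of l] by (auto simp: mult.commute)
  have lb: "cnj l * b = - cmod b"
    using complex_norm_square[of b] by (auto simp: l_def power2_eq_square field_simps)
  have lb': "l * cnj b = - cmod b"
    using arg_cong[OF lb, of cnj] by simp
  have c0: "c \<noteq> 0"
  proof -
    have "1 + cmod b \<noteq> 0" using norm_ge_zero[of b] by linarith
    then show ?thesis unfolding c_def by (metis of_real_1 of_real_add of_real_eq_0_iff)
  qed
  have cc: "cnj c = c"
    by (simp add: c_def)
  have aa: "hprod a a = 1"
    by (simp add: a_def hprod_axis)
  have ee: "hprod e e = 1"
    using e by (simp add: hprod_self)
  have ae: "hprod a e = cnj b"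
    by (simp add: b_def cnj_hprod)
  have vv: "hprod v v = 2 * c"
    using lb lb' ll by (simp add: v_def hprod_linear ee aa ae b_def [symmetric] c_def algebra_simps)
  have ev: "hprod e v = c"
    using lb by (simp add: v_def hprod_linear ee b_def [symmetric] c_def)
  have lin: "linear U"
    by (rule linearI) (simp_all add: U_def hprod_linear add_divide_distrib vec_eq_iff algebra_simps
        scaleR_conv_of_real[where 'a = complex] flip: of_real_scale_vec)
  have scl: "U (t *s x) = t *s U x" for t x
    by (simp add: U_def hprod_linear vec_eq_iff algebra_simps)
  have herm: "hprod (U x) (U y) = hprod x y" for x y
    using c0 by (simp add: U_def hprod_linear vv cc cnj_hprod field_simps)
  have Uv: "U v = - v"
    using c0 by (simp add: U_def vv vec_eq_iff)
  have inv: "U (U x) = x" for x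
  proof -
    have "U (U x) = U x - (hprod x v / c) *s U v"
      by (subst (2) U_def) (simp add: linear_diff[OF lin] scl)
    then show ?thesis
      by (simp add: Uv) (simp add: U_def vec_eq_iff)
  qed
  have "U e = e - (c / c) *s v"
    by (simp only: U_def ev)
  then have "U e = l *s a"
    using c0 by (simp add: v_def)
  then have "e = l *s U a"
    using inv[of e] scl by metis
  then have "U a = inverse l *s e"
    using l0 by (simp add: vec_eq_iff)
  moreover have "cmod (inverse l) = 1"
    using l1 by (simp add: norm_inverse)
  ultimately show thesis
    using that lin herm inv scl unfolding a_def by blast
qed

text \<open>A complex coordinate consists of two real ones, collected in \<open>B\<close>; each is
  scaled by \<open>s\<close>, hence the determinant \<open>s^2\<close>.\<close>

lemma nn_integral_shrink_axis:
  fixes f :: "complex ^ 'n::finite \<Rightarrow> ennreal"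
  assumes [measurable]: "f \<in> borel_measurable borel" and s: "0 < s"
  shows "(\<integral>\<^sup>+x. f x \<partial>lborel) =
    ennreal (s\<^sup>2) * (\<integral>\<^sup>+x. f (x - complex_of_real (1 - s) *s (x $ k *s axis k 1)) \<partial>lborel)"
proof -
  define B :: "(complex ^ 'n) set" where "B = {axis k 1, axis k \<i>}"
  define c where "c = (\<lambda>b. if b \<in> B then s else 1)"
  define T where "T = (\<lambda>x::complex^'n. 0 + (\<Sum>j\<in>Basis. (c j * (x \<bullet> j)) *\<^sub>R j))"
  have BB: "B \<subseteq> Basis"
    by (auto simp: B_def Basis_vec_def Basis_complex_def)
  have ne: "axis k 1 \<noteq> (axis k \<i> :: complex ^ 'n)"
    by (simp add: axis_eq_axis complex_eq_iff)
  have T: "T x = x - complex_of_real (1 - s) *s (x $ k *s axis k 1)" for x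
  proof -
    have "T x = (\<Sum>j\<in>Basis. (x \<bullet> j) *\<^sub>R j - (if j \<in> B then ((1 - s) * (x \<bullet> j)) *\<^sub>R j else 0))"
      by (auto simp: T_def c_def algebra_simps intro!: sum.cong)
    also have "\<dots> = x - (\<Sum>j\<in>B. ((1 - s) * (x \<bullet> j)) *\<^sub>R j)"
      using BB by (simp add: sum_subtractf euclidean_representation sum.inter_restrict[symmetric] Int_absorb1)
    also have "(\<Sum>j\<in>B. ((1 - s) * (x \<bullet> j)) *\<^sub>R j) = complex_of_real (1 - s) *s (x $ k *s axis k 1)"
    proof -
      have "x \<bullet> axis k 1 = Re (x $ k)" "x \<bullet> axis k \<i> = Im (x $ k)"
        by (simp_all add: inner_axis inner_complex_def)
      then show ?thesis
        using ne by (simp add: B_def) (simp add: vec_eq_iff axis_def complex_eq_iff)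
    qed
    finally show ?thesis .
  qed
  have "(\<Prod>j\<in>Basis. \<bar>c j\<bar>) = (\<Prod>j\<in>B. \<bar>c j\<bar>)"
    using BB by (intro prod.mono_neutral_right) (auto simp: c_def)
  also have "\<dots> = s\<^sup>2"
    using ne s by (simp add: B_def c_def power2_eq_square)
  finally have prod: "(\<Prod>j\<in>Basis. \<bar>c j\<bar>) = s\<^sup>2" .
  have [measurable]: "T \<in> borel_measurable borel"
    unfolding T_def by simp
  have "lborel = density (distr lborel borel T) (\<lambda>_. (\<Prod>j\<in>Basis. \<bar>c j\<bar>))"
    unfolding T_def using s by (intro lborel_affine_euclidean) (auto simp: c_def)
  then have "(\<integral>\<^sup>+x. f x \<partial>lborel) = (\<integral>\<^sup>+x. f x \<partial>density (distr lborel borel T) (\<lambda>_. ennreal (s\<^sup>2)))"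
    unfolding prod by (rule arg_cong)
  also have "\<dots> = ennreal (s\<^sup>2) * (\<integral>\<^sup>+x. f (T x) \<partial>lborel)"
    by (simp add: nn_integral_density nn_integral_distr nn_integral_cmult)
  finally show ?thesis
    by (simp only: T)
qed

section \<open>Change of variables under \<open>G w\<close> and the ellipsoids around
  \<open>w\<close>\<close>

lemma linear_G: "linear (G z)"
  by (rule linearI) (simp_all add: G_add G_scale flip: of_real_scale_vec)

lemma continuous_G: "continuous_on UNIV (G z)"
  using linear_G by (intro linear_continuous_on) (simp add: linear_linear)

lemma borel_measurable_G [measurable]: "G z \<in> borel_measurable borel"
  by (intro borel_measurable_continuous_onI continuous_G)

text \<open>Conjugation with the reflection \<open>U\<close> turns \<open>- G w\<close> into the map
  that shrinks a single complex axis by \<open>sn w\<close>; the reflection itself preserves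
  Lebesgue measure.\<close>

lemma nn_integral_G:
  fixes f :: "complex ^ 'n::finite \<Rightarrow> ennreal"
  assumes [measurable]: "f \<in> borel_measurable borel" and w: "norm w < 1"
  shows "(\<integral>\<^sup>+x. f x \<partial>lborel) = ennreal ((sn w)\<^sup>2) * (\<integral>\<^sup>+x. f (G w x) \<partial>lborel)"
proof (cases "w = 0")
  case True
  have "(\<integral>\<^sup>+x. f (- x) \<partial>lborel) = (\<integral>\<^sup>+x. f x \<partial>lborel)"
    by (rule nn_integral_isometry) (auto intro: linear_uminus)
  with True show ?thesis
    by (simp add: G_def sn_def)
next
  case False
  define e where "e = complex_of_real (1 / norm w) *s w"
  define s where "s = sn w"
  have s0: "0 < s" using w by (simp add: s_def sn_pos)
  have "norm e = 1"
    using False by (simp add: e_def norm_scale_vec norm_divide)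
  \<comment> \<open>The index \<open>undefined\<close> stands for an arbitrary coordinate; only its
    axis is shrunk.\<close>
  then obtain U :: "complex ^ 'n \<Rightarrow> complex ^ 'n" and c where U: "linear U"
    "\<And>x y. hprod (U x) (U y) = hprod x y" "\<And>x. U (U x) = x"
    "\<And>a x. U (a *s x) = a *s U x" "U (axis undefined 1) = c *s e" "cmod c = 1"
    using ex_unitary_involution[where k = undefined] by metis
  have [measurable]: "U \<in> borel_measurable borel"
    using U(1) by (intro borel_measurable_continuous_onI linear_continuous_on) (simp add: linear_linear)
  have normU: "norm (U x) = norm x" for x
  proof -
    have "complex_of_real ((norm (U x))\<^sup>2) = complex_of_real ((norm x)\<^sup>2)"
      by (simp only: hprod_self [symmetric] U(2))
    then have "(norm (U x))\<^sup>2 = (norm x)\<^sup>2" by (simp only: of_real_eq_iff)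
    then show ?thesis by (simp add: power2_eq_iff_nonneg)
  qed
  define a :: "complex ^ 'n" where "a = axis undefined 1"
  define D where "D = (\<lambda>x. x - complex_of_real (1 - s) *s (x $ undefined *s a))"
  have comp: "x $ undefined = hprod x a" for x :: "complex ^ 'n"
    by (simp add: a_def hprod_axis)
  have [measurable]: "D \<in> borel_measurable borel"
    unfolding D_def comp by measurable
  have key: "G w x = - U (D (U x))" for x
  proof -
    have "hprod (U x) a = hprod x (U a)"
      using U(2)[of x "U a"] by (simp add: U(3))
    then have "hprod (U x) a = cnj c * hprod x e"
      using U(5) by (simp add: a_def hprod_linear)
    then have "U (D (U x)) = x - (complex_of_real (1 - s) * (cnj c * hprod x e) * c) *s e"
      using U(5) by (simp add: D_def comp linear_diff[OF U(1)] U(3,4) a_def [symmetric] mult.assoc)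
    also have "complex_of_real (1 - s) * (cnj c * hprod x e) * c = complex_of_real (1 - s) * hprod x e"
    proof -
      have "cnj c * c = 1"
        using U(6) complex_norm_square[of c] by (simp add: mult.commute)
      then show ?thesis
        by (metis mult.assoc mult.commute mult_1)
    qed
    also have "(complex_of_real (1 - s) * hprod x e) *s e = (hprod x w / complex_of_real (1 + sn w)) *s w"
    proof -
      have "(norm w)\<^sup>2 = (1 - s) * (1 + s)"
        using sn_sq[of w] w by (simp add: s_def algebra_simps power2_eq_square)
      then have "(1 - s) / (norm w)\<^sup>2 = 1 / (1 + s)"
        using False s0 by (simp add: field_simps)
      then have "complex_of_real (1 - s) / (complex_of_real (norm w))\<^sup>2 = 1 / complex_of_real (1 + s)"
        by (metis of_real_1 of_real_divide of_real_power)
      then show ?thesis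
        by (simp add: e_def hprod_linear s_def power2_eq_square vec_eq_iff)
          (metis (no_types, opaque_lifting) divide_divide_eq_left' mult.commute times_divide_eq_right mult_1_right)
    qed
    finally show ?thesis by (simp add: G_def)
  qed
  have "(\<integral>\<^sup>+x. f x \<partial>lborel) = (\<integral>\<^sup>+x. f (- U x) \<partial>lborel)"
    using U(1) by (intro nn_integral_isometry[symmetric]) (auto simp: normU intro: linear_compose_neg)
  also have "\<dots> = ennreal (s\<^sup>2) * (\<integral>\<^sup>+x. f (- U (D x)) \<partial>lborel)"
    unfolding D_def a_def by (rule nn_integral_shrink_axis[OF _ s0]) simp
  also have "(\<integral>\<^sup>+x. f (- U (D x)) \<partial>lborel) = (\<integral>\<^sup>+x. f (- U (D (U x))) \<partial>lborel)"
    using U(1) by (intro nn_integral_isometry[symmetric]) (auto simp: normU)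
  finally show ?thesis
    by (simp add: key s_def)
qed

text \<open>The dilation by \<open>c * sn w\<close> acts in \<open>2 * CARD('n)\<close> real
  dimensions and \<open>G w\<close> contributes two more factors \<open>sn w\<close>. The resulting
  \<open>sn w ^ (2 * CARD('n) + 2)\<close> is \<open>(1 - |w|^2) ^ (CARD('n) + 1)\<close>, the
  reciprocal of the density of \<open>tau\<close>.\<close>

lemma nn_integral_ellipsoid:
  fixes f :: "complex ^ 'n::finite \<Rightarrow> ennreal"
  assumes [measurable]: "f \<in> borel_measurable borel" and w: "norm w < 1" and c: "0 < c"
  shows "(\<integral>\<^sup>+x. f x \<partial>lborel) = ennreal (c ^ (2 * CARD('n)) * sn w ^ (2 * CARD('n) + 2))
     * (\<integral>\<^sup>+x. f (w + complex_of_real (c * sn w) *s G w x) \<partial>lborel)"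
proof -
  have s: "0 < sn w" using w by (rule sn_pos)
  have "(\<integral>\<^sup>+x. f x \<partial>lborel) = ennreal (\<bar>c * sn w\<bar> ^ DIM(complex ^ 'n)) * (\<integral>\<^sup>+x. f (w + (c * sn w) *\<^sub>R x) \<partial>lborel)"
    using c s by (intro nn_integral_lborel_affine) auto
  also have "(\<integral>\<^sup>+x. f (w + (c * sn w) *\<^sub>R x) \<partial>lborel)
     = ennreal ((sn w)\<^sup>2) * (\<integral>\<^sup>+x. f (w + (c * sn w) *\<^sub>R G w x) \<partial>lborel)"
    using w by (intro nn_integral_G) auto
  also have "ennreal (\<bar>c * sn w\<bar> ^ DIM(complex ^ 'n)) * (ennreal ((sn w)\<^sup>2) * (\<integral>\<^sup>+x. f (w + (c * sn w) *\<^sub>R G w x) \<partial>lborel))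
     = ennreal (c ^ (2 * CARD('n)) * sn w ^ (2 * CARD('n) + 2)) * (\<integral>\<^sup>+x. f (w + (c * sn w) *\<^sub>R G w x) \<partial>lborel)"
  proof -
    have "\<bar>c * sn w\<bar> ^ DIM(complex ^ 'n) * (sn w)\<^sup>2 = c ^ (2 * CARD('n)) * sn w ^ (2 * CARD('n) + 2)"
      using c s by (simp add: power_mult_distrib abs_mult power_add mult.commute[of 2] mult.assoc
          power2_eq_square)
    then show ?thesis
      using c s by (simp only: mult.assoc[symmetric]) (simp add: ennreal_mult[symmetric])
  qed
  finally show ?thesis
    by (simp only: of_real_scale_vec)
qed

lemma G_inj: "norm w < 1 \<Longrightarrow> G w x = 0 \<Longrightarrow> x = 0"
proof -
  assume w: "norm w < 1" and G: "G w x = 0"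
  have "hprod x w = 0"
    using hprod_G_self[of w x] sn_pos[of w] w G by simp
  then show "x = 0"
    using G_G[of w x] w G by (simp add: G_def)
qed

lemma emeasure_ellipsoid:
  fixes w :: "complex ^ 'n::finite"
  assumes w: "norm w < 1"
  shows "emeasure lborel ((\<lambda>x. w + complex_of_real (sn w) *s G w x) ` cball 0 r)
    = ennreal (sn w ^ (2 * CARD('n) + 2)) * emeasure lborel (cball (0 :: complex ^ 'n) r)"
proof -
  define T where "T = (\<lambda>x. w + complex_of_real (sn w) *s G w x)"
  have "compact (T ` cball 0 r)"
    unfolding T_def
    by (intro compact_continuous_image continuous_intros continuous_on_subset[OF continuous_G]) auto
  then have [measurable]: "T ` cball 0 r \<in> sets borel"
    by (intro borel_closed compact_imp_closed)
  have "inj T"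
  proof (rule injI)
    fix x y assume "T x = T y"
    then have "complex_of_real (sn w) *s G w (x - y) = 0"
      by (simp add: T_def G_diff vec_eq_iff algebra_simps)
    then have "G w (x - y) = 0"
      using sn_pos[OF w] by (simp add: vec_eq_iff)
    then show "x = y" using G_inj[OF w] by fastforce
  qed
  then have ind: "indicator (T ` cball 0 r) (T x) = (indicator (cball 0 r) x :: ennreal)" for x
    by (simp add: indicator_def inj_image_mem_iff)
  have "emeasure lborel (T ` cball 0 r) = (\<integral>\<^sup>+x. indicator (T ` cball 0 r) x \<partial>lborel)"
    by simp
  also have "\<dots> = ennreal (1 ^ (2 * CARD('n)) * sn w ^ (2 * CARD('n) + 2))
     * (\<integral>\<^sup>+x. indicator (T ` cball 0 r) (w + complex_of_real (1 * sn w) *s G w x) \<partial>lborel)"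
    by (rule nn_integral_ellipsoid[OF _ w]) auto
  also have "(\<lambda>x. indicator (T ` cball 0 r) (w + complex_of_real (1 * sn w) *s G w x)) = (indicator (cball 0 r) :: _ \<Rightarrow> ennreal)"
    by (rule ext) (simp only: ind [unfolded T_def] T_def mult_1)
  finally show ?thesis
    by (simp add: T_def)
qed

text \<open>With \<open>u = phi w om\<close>, the denominator in \<open>phi_eq_G\<close> is absorbed
  into the argument of \<open>G w\<close>. Its modulus is at least \<open>1 - r\<close>, so the
  argument stays in a fixed ball although the map \<open>phi w\<close> is not affine.\<close>

lemma phi_level_subset:
  fixes w :: "complex ^ 'n::finite"
  assumes w: "norm w < 1" and r: "r < 1"
  shows "{u \<in> unit_ball. norm (phi w u) \<le> r} \<subseteq>
    (\<lambda>x. w + complex_of_real (sn w) *s G w x) ` cball 0 (1 / (1 - r))"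
proof
  fix u assume "u \<in> {u \<in> unit_ball. norm (phi w u) \<le> r}"
  then have u: "norm u < 1" and om: "norm (phi w u) \<le> r" by auto
  define om where "om = phi w u"
  have n0: "1 - hprod om w \<noteq> 0" and o1: "norm om < 1"
    using one_minus_hprod_neq_0(1)[OF w, of om] norm_phi_lt_1[OF w u] by (auto simp: om_def)
  have "u = phi w om"
    using phi_phi[OF w u] by (simp add: om_def)
  also have "\<dots> = w + complex_of_real (sn w) *s G w ((1 / (1 - hprod om w)) *s om)"
    using phi_eq_G[OF w, of om] o1 by (simp add: G_scale)
  finally have u_eq: "u = w + complex_of_real (sn w) *s G w ((1 / (1 - hprod om w)) *s om)" .
  have "1 - r \<le> 1 - norm om"
    using om by (simp add: om_def)
  also have "\<dots> \<le> cmod (1 - hprod om w)"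
    using one_minus_norm_le[of w om] w by simp
  finally have "norm om / cmod (1 - hprod om w) \<le> 1 / (1 - r)"
    using r o1 by (intro frac_le) auto
  then have "(1 / (1 - hprod om w)) *s om \<in> cball 0 (1 / (1 - r))"
    by (simp add: norm_scale_vec norm_divide)
  then show "u \<in> (\<lambda>x. w + complex_of_real (sn w) *s G w x) ` cball 0 (1 / (1 - r))"
    using u_eq by blast
qed

section \<open>Volumes of cones and the Forelli--Rudin estimate\<close>

lemma measure_cone_ball:
  fixes \<Omega> :: "'a::euclidean_space set"
  assumes [measurable]: "\<Omega> \<in> sets borel" and cone: "\<And>c x. 0 < c \<Longrightarrow> c *\<^sub>R x \<in> \<Omega> \<longleftrightarrow> x \<in> \<Omega>"
    and b: "0 \<le> b"
  shows "measure lborel (\<Omega> \<inter> ball 0 b) = b ^ DIM('a) * measure lborel (\<Omega> \<inter> ball 0 1)"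
proof (cases "b = 0")
  case False
  with b have b: "0 < b" by simp
  have "indicator (\<Omega> \<inter> ball 0 b) (0 + b *\<^sub>R x) = (indicator (\<Omega> \<inter> ball 0 1) x :: ennreal)" for x
    using cone[OF b, of x] b by (auto simp: indicator_def)
  then have "emeasure lborel (\<Omega> \<inter> ball 0 b) = ennreal (\<bar>b\<bar> ^ DIM('a)) * emeasure lborel (\<Omega> \<inter> ball 0 1)"
    using nn_integral_lborel_affine[of "indicator (\<Omega> \<inter> ball 0 b)" b 0] b
    by (simp add: borel_measurable_indicator)
  then show ?thesis
    using b by (simp add: measure_def enn2real_mult)
qed simp

lemma fmeasurable_subset_ball:
  assumes "S \<in> sets borel" "S \<subseteq> ball (x :: 'a::euclidean_space) r"
  shows "S \<in> fmeasurable lborel"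
proof (rule fmeasurableI)
  have "emeasure lborel S \<le> emeasure lborel (ball x r)"
    using assms by (intro emeasure_mono) auto
  then show "emeasure lborel S < \<infinity>"
    using emeasure_lborel_ball_finite[of x r] by (rule le_less_trans)
qed (use assms in simp)

lemma measure_cone_shell:
  fixes \<Omega> :: "'a::euclidean_space set"
  assumes [measurable]: "\<Omega> \<in> sets borel" and cone: "\<And>c x. 0 < c \<Longrightarrow> c *\<^sub>R x \<in> \<Omega> \<longleftrightarrow> x \<in> \<Omega>"
    and ab: "0 \<le> a" "a \<le> b"
  shows "measure lborel (\<Omega> \<inter> {x. a \<le> norm x \<and> norm x < b})
    = (b ^ DIM('a) - a ^ DIM('a)) * measure lborel (\<Omega> \<inter> ball 0 1)"
proof -
  have "\<Omega> \<inter> {x. a \<le> norm x \<and> norm x < b} = (\<Omega> \<inter> ball 0 b) - (\<Omega> \<inter> ball 0 a)"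
    by auto
  moreover have "\<Omega> \<inter> ball 0 a \<subseteq> \<Omega> \<inter> ball 0 b"
    using ab by auto
  moreover have "\<Omega> \<inter> ball 0 b \<in> fmeasurable lborel" "\<Omega> \<inter> ball 0 a \<in> fmeasurable lborel"
    by (auto intro: fmeasurable_subset_ball)
  ultimately have "measure lborel (\<Omega> \<inter> {x. a \<le> norm x \<and> norm x < b})
      = measure lborel (\<Omega> \<inter> ball 0 b) - measure lborel (\<Omega> \<inter> ball 0 a)"
    by (simp add: measurable_measure_Diff fmeasurableD)
  then show ?thesis
    using ab measure_cone_ball[OF assms(1) cone, of a] measure_cone_ball[OF assms(1) cone, of b]
    by (simp add: left_diff_distrib)
qed

lemma sqrt_power_double:
  assumes "0 \<le> x"
  shows "sqrt x ^ (2 * n) = x ^ n" "sqrt x ^ (n * 2) = x ^ n"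
proof -
  show "sqrt x ^ (2 * n) = x ^ n"
    using assms by (subst power_mult) simp
  then show "sqrt x ^ (n * 2) = x ^ n"
    by (simp only: mult.commute)
qed

text \<open>The defect \<open>1 - c\<close> is itself bounded by the modulus on the right. For
  \<open>c\<close> at least 1/2 the triangle inequality costs a factor 2 and the division by
  \<open>c\<close> another 2; for smaller \<open>c\<close> the right side exceeds 2, which bounds
  the left.\<close>

lemma cmod_one_minus_le_4:
  assumes "cmod l \<le> 1" "0 \<le> c" "c \<le> 1"
  shows "cmod (1 - l) \<le> 4 * cmod (1 - complex_of_real c * l)"
proof -
  have "cmod (complex_of_real c * l) \<le> c"
    using assms by (simp add: norm_mult mult_left_le)
  then have c1: "1 - c \<le> cmod (1 - complex_of_real c * l)"
    using norm_triangle_ineq2[of 1 "complex_of_real c * l"] by simp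
  show ?thesis
  proof (cases "c < 1/2")
    case True
    have "cmod (1 - l) \<le> 2"
      using norm_triangle_ineq4[of 1 l] assms by simp
    then show ?thesis using c1 True by linarith
  next
    case False
    have "complex_of_real c * (1 - l) = (1 - complex_of_real c * l) - complex_of_real (1 - c)"
      by (simp add: algebra_simps)
    then have "c * cmod (1 - l) \<le> cmod (1 - complex_of_real c * l) + (1 - c)"
      using norm_triangle_ineq4[of "1 - complex_of_real c * l" "complex_of_real (1 - c)"] assms
      by (metis norm_mult norm_of_real abs_of_nonneg diff_ge_0_iff_ge)
    moreover have "1/2 * cmod (1 - l) \<le> c * cmod (1 - l)"
      using False by (intro mult_right_mono) auto
    ultimately show ?thesis using c1 by linarith
  qed
qed

text \<open>The cone over a nonisotropic cap of the sphere around \<open>e\<close>. The condition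
  depends only on the direction of \<open>u\<close>, so scaling of volumes takes the place of
  integration in polar coordinates.\<close>

definition cone :: "complex ^ 'n::finite \<Rightarrow> real \<Rightarrow> (complex ^ 'n) set" where
  "cone e r = {u. u \<noteq> 0 \<and> cmod (1 - hprod e u / complex_of_real (norm u)) < r}"

lemma cone_borel [measurable]: "cone e r \<in> sets borel"
  unfolding cone_def by measurable

lemma cone_scale: "0 < c \<Longrightarrow> c *\<^sub>R x \<in> cone e r \<longleftrightarrow> x \<in> cone e r"
  by (simp add: cone_def hprod_linear flip: of_real_scale_vec) (simp add: norm_scale_vec)

text \<open>For small \<open>r\<close> a shell of the cone lies in a Bergman ball of fixed radius
  about \<open>sqrt (1 - r) *s e\<close>, whose volume has order \<open>r ^ (n + 1)\<close>. The
  shell fills at least the proportion \<open>r / 2 ^ n\<close> of the cone, which leaves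
  \<open>r ^ n\<close> for the cone.\<close>

lemma measure_cone_le:
  "\<exists>C>0. \<forall>e :: complex ^ 'n::finite. \<forall>r>0. norm e = 1 \<longrightarrow>
    measure lborel (cone e r \<inter> ball 0 1) \<le> C * r ^ CARD('n)"
proof -
  \<comment> \<open>Chosen so that \<open>1 - R^2 = 1/9\<close>, the lower bound
    \<open>r * r / (3 * r)^2\<close> for \<open>1 - |phi w u|^2\<close> found below.\<close>
  define R where "R = sqrt (8/9 :: real)"
  have R: "R < 1" by (simp add: R_def)
  define C1 where "C1 = measure lborel (cball (0 :: complex ^ 'n) (1 / (1 - R)))"
  define C2 where "C2 = measure lborel (ball (0 :: complex ^ 'n) 1)"
  define n where "n = CARD('n)"
  have n: "n \<ge> 1" by (simp add: n_def Suc_leI)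
  have C: "0 \<le> C1" "0 \<le> C2" by (simp_all add: C1_def C2_def)
  show ?thesis
  proof (intro exI[of _ "1 + 2 ^ n * C1 + 4 ^ n * C2"] conjI allI impI)
    show "0 < 1 + 2 ^ n * C1 + 4 ^ n * C2"
      using C by (simp add: add_pos_nonneg)
  next
    fix e :: "complex ^ 'n" and r :: real
    assume r: "0 < r" and e: "norm e = 1"
    define V where "V = measure lborel (cone e r \<inter> ball 0 1)"
    have V0: "0 \<le> V" by (simp add: V_def)
    have "V \<le> (2 ^ n * C1 + 4 ^ n * C2) * r ^ n"
    proof (cases "r \<le> 1/4")
      case False
      have "V \<le> C2"
        unfolding V_def C2_def
        by (intro measure_mono_fmeasurable fmeasurable_subset_ball[of _ 0 1]) auto
      also have "1 \<le> (4 * r) ^ n"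
        using False by (intro one_le_power) auto
      then have "C2 \<le> C2 * (4 * r) ^ n"
        using C by (simp add: mult_left_le)
          (metis mult.right_neutral mult_left_mono)
      also have "\<dots> \<le> (2 ^ n * C1 + 4 ^ n * C2) * r ^ n"
        using C r by (simp add: power_mult_distrib algebra_simps)
      finally show ?thesis .
    next
      case True
      define w where "w = complex_of_real (sqrt (1 - r)) *s e"
      \<comment> \<open>On this shell \<open>1 - |u|^2\<close> lies between \<open>r\<close> and
        \<open>2 * r\<close>, matching \<open>1 - |w|^2 = r\<close>.\<close>
      define S where "S = cone e r \<inter> {u. sqrt (1 - 2 * r) \<le> norm u \<and> norm u < sqrt (1 - r)}"
      have nw: "norm w = sqrt (1 - r)"
        using e True by (simp add: w_def norm_scale_vec)
      then have w1: "norm w < 1" using r by simp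
      have snw: "sn w = sqrt r"
        using True by (simp add: sn_def nw)
      have sub: "S \<subseteq> {u \<in> unit_ball. norm (phi w u) \<le> R}"
      proof
        fix u assume "u \<in> S"
        then have u: "u \<noteq> 0" "cmod (1 - hprod e u / complex_of_real (norm u)) < r"
          "sqrt (1 - 2 * r) \<le> norm u" "norm u < sqrt (1 - r)"
          by (auto simp: S_def cone_def)
        define l where "l = hprod e u / complex_of_real (norm u)"
        define c where "c = sqrt (1 - r) * norm u"
        have u1: "norm u < 1"
          using u(4) r by (smt (verit) real_sqrt_lt_1_iff)
        have "cmod l \<le> 1"
          using cmod_hprod_le[of e u] e u(1) by (simp add: l_def norm_divide divide_le_eq)
        have nu: "1 - 2 * r \<le> (norm u)\<^sup>2" "(norm u)\<^sup>2 < 1 - r"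
          using u(3,4) True r by (auto simp: real_le_lsqrt real_less_rsqrt)
            (metis norm_ge_zero real_sqrt_le_iff real_sqrt_pow2 real_sqrt_abs abs_norm_cancel,
             metis norm_ge_zero real_sqrt_less_iff real_sqrt_abs abs_norm_cancel)
        have "1 - 2 * r = sqrt ((1 - 2 * r) * (1 - 2 * r))"
          using True by simp
        also have "\<dots> \<le> sqrt ((1 - r) * (1 - 2 * r))"
          using True r by (intro real_sqrt_le_mono mult_right_mono) auto
        also have "\<dots> = sqrt (1 - r) * sqrt (1 - 2 * r)"
          by (rule real_sqrt_mult)
        also have "\<dots> \<le> c"
          unfolding c_def using u(3) True by (intro mult_left_mono) auto
        finally have c: "1 - 2 * r \<le> c" .
        have c1: "c \<le> 1"
          unfolding c_def using u1 r True by (intro mult_le_one) auto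
        have wu: "hprod w u = complex_of_real c * l"
          using u(1) by (simp add: w_def hprod_linear l_def c_def)
        have "1 - complex_of_real c * l = (1 - l) + complex_of_real (1 - c) * l"
          by (simp add: algebra_simps)
        then have "cmod (1 - hprod w u) \<le> cmod (1 - l) + cmod (complex_of_real (1 - c) * l)"
          unfolding wu by (metis norm_triangle_ineq)
        also have "cmod (complex_of_real (1 - c) * l) \<le> 1 - c"
          using c1 \<open>cmod l \<le> 1\<close> by (simp add: norm_mult mult_left_le del: of_real_diff)
        finally have d: "cmod (1 - hprod w u) \<le> 3 * r"
          using c u(2) by (simp add: l_def)
        have d0: "0 < cmod (1 - hprod w u)"
          using one_minus_hprod_neq_0[OF w1, of u] u1 by simp
        have "1 / 9 = r * r / (3 * r)\<^sup>2"
          using r by (simp add: power2_eq_square)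
        also have "\<dots> \<le> (1 - (norm w)\<^sup>2) * (1 - (norm u)\<^sup>2) / (cmod (1 - hprod u w))\<^sup>2"
          using d d0 nu r True
          by (intro frac_le mult_mono power_mono)
            (auto simp: nw cmod_one_minus_hprod_commute[of u w])
        also have "\<dots> = 1 - (norm (phi w u))\<^sup>2"
          using one_minus_norm_phi_sq[OF w1, of u] u1 by simp
        finally have "norm (phi w u) \<le> R"
          unfolding R_def by (intro real_le_rsqrt) simp
        then show "u \<in> {u \<in> unit_ball. norm (phi w u) \<le> R}"
          using u1 by simp
      qed
      have Ssets: "S \<in> sets borel"
        unfolding S_def by measurable
      have "emeasure lborel S \<le> emeasure lborel ((\<lambda>x. w + complex_of_real (sn w) *s G w x) ` cball 0 (1 / (1 - R)))"
        using sub phi_level_subset[OF w1 R]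
        by (intro emeasure_mono)
          (auto intro!: borel_closed compact_imp_closed compact_continuous_image continuous_intros continuous_on_subset[OF continuous_G])
      also have "\<dots> = ennreal (sn w ^ (2 * CARD('n) + 2)) * ennreal C1"
        using emeasure_lborel_cball_finite[of "0 :: complex ^ 'n" "1 / (1 - R)"]
        unfolding C1_def by (subst emeasure_ellipsoid[OF w1], subst emeasure_eq_ennreal_measure) auto
      also have "\<dots> = ennreal (C1 * r ^ (n + 1))"
      proof -
        have "sn w ^ (2 * CARD('n) + 2) = ((sn w)\<^sup>2) ^ (n + 1)"
          by (subst power_mult [symmetric]) (simp add: n_def algebra_simps)
        then show ?thesis
          using r C by (simp add: snw ennreal_mult[symmetric] mult.commute)
      qed
      finally have "measure lborel S \<le> C1 * r ^ (n + 1)"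
        using C r by (simp add: measure_def enn2real_leI)
      moreover have "measure lborel S = ((1 - r) ^ n - (1 - 2 * r) ^ n) * V"
        unfolding S_def V_def using True r
        by (subst measure_cone_shell) (auto simp: cone_scale n_def sqrt_power_double)
      moreover have "r / 2 ^ n \<le> (1 - r) ^ n - (1 - 2 * r) ^ n"
      proof -
        obtain k where k: "n = Suc k" using n by (cases n) auto
        have "(1 - 2 * r) ^ n \<le> (1 - 2 * r) * (1 - r) ^ k"
          unfolding k using True r by (simp add: mult_left_mono power_mono)
        then have "r * (1 - r) ^ k \<le> (1 - r) ^ n - (1 - 2 * r) ^ n"
          unfolding k by (simp add: algebra_simps)
        moreover have "(1/2) ^ k \<le> (1 - r) ^ k"
          using True by (intro power_mono) auto
        moreover have "(1/2 :: real) ^ n \<le> (1/2) ^ k"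
          unfolding k by simp
        ultimately have "r * (1/2) ^ n \<le> (1 - r) ^ n - (1 - 2 * r) ^ n"
          using r by (smt (verit) mult_left_mono)
        then show ?thesis by (simp add: power_divide)
      qed
      ultimately have "r / 2 ^ n * V \<le> C1 * r ^ (n + 1)"
        using V0 by (smt (verit) mult_right_mono)
      then have "r * V \<le> r * (2 ^ n * C1 * r ^ n)"
        by (simp add: divide_simps mult_ac)
      then have "V \<le> 2 ^ n * C1 * r ^ n"
        using r by simp
      then show ?thesis
        using C r by (simp add: algebra_simps add_increasing2)
    qed
    also have "\<dots> \<le> (1 + 2 ^ n * C1 + 4 ^ n * C2) * r ^ n"
      using r by (intro mult_right_mono) auto
    finally show "measure lborel (cone e r \<inter> ball 0 1) \<le> (1 + 2 ^ n * C1 + 4 ^ n * C2) * r ^ CARD('n)"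
      by (simp add: V_def n_def)
  qed
qed

text \<open>Up to the null set of the origin, the box lies in the cone of opening
  \<open>4 * r\<close> around the direction of \<open>z\<close>, cut down to a shell. Bernoulli's
  inequality bounds the proportion of that shell by \<open>n * s\<close>.\<close>

lemma emeasure_bergman_box_le:
  "\<exists>C>0. \<forall>z :: complex ^ 'n::finite. \<forall>r>0. \<forall>s>0. norm z < 1 \<longrightarrow>
    emeasure lborel {u \<in> unit_ball. cmod (1 - hprod z u) < r \<and> 1 - (norm u)\<^sup>2 < s} \<le> ennreal (C * r ^ CARD('n) * s)"
proof -
  obtain C where C: "0 < C" "\<And>(e :: complex ^ 'n) r. norm e = 1 \<Longrightarrow> 0 < r \<Longrightarrow>
    measure lborel (cone e r \<inter> ball 0 1) \<le> C * r ^ CARD('n)"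
    using measure_cone_le[where 'n = 'n] by blast
  define n where "n = CARD('n)"
  have n: "n \<ge> 1" by (simp add: n_def Suc_leI)
  show ?thesis
  proof (intro exI[of _ "n * C * 4 ^ n"] conjI allI impI)
    show "0 < n * C * 4 ^ n" using C n by simp
  next
    fix z :: "complex ^ 'n" and r s :: real
    assume r: "0 < r" and s: "0 < s" and z: "norm z < 1"
    \<comment> \<open>At \<open>z = 0\<close> any unit vector serves, because
      \<open>hprod z u\<close> and the coefficient \<open>norm z * norm u\<close> used below both
      vanish.\<close>
    define e where "e = (if z = 0 then axis undefined 1 else complex_of_real (1 / norm z) *s z)"
    have e: "norm e = 1"
    proof (cases "z = 0")
      case True
      have "complex_of_real ((norm (axis undefined 1 :: complex ^ 'n))\<^sup>2) = 1"
        by (simp only: hprod_self[symmetric] hprod_axis) simp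
      then have "(norm (axis undefined 1 :: complex ^ 'n))\<^sup>2 = 1"
        by (simp only: of_real_eq_1_iff)
      then show ?thesis
        using True by (simp add: e_def power2_eq_1_iff)
    qed (simp add: e_def norm_scale_vec norm_divide)
    \<comment> \<open>The maximum with 0 covers \<open>s > 1\<close>, where the condition on
      \<open>norm u\<close> is void.\<close>
    define S where "S = cone e (4 * r) \<inter> {u. sqrt (max 0 (1 - s)) \<le> norm u \<and> norm u < 1}"
    have sub: "{u \<in> unit_ball. cmod (1 - hprod z u) < r \<and> 1 - (norm u)\<^sup>2 < s} \<subseteq> insert 0 S"
    proof
      fix u assume "u \<in> {u \<in> unit_ball. cmod (1 - hprod z u) < r \<and> 1 - (norm u)\<^sup>2 < s}"
      then have u: "norm u < 1" "cmod (1 - hprod z u) < r" "1 - (norm u)\<^sup>2 < s" by auto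
      show "u \<in> insert 0 S"
      proof (cases "u = 0")
        case False
        define l where "l = hprod e u / complex_of_real (norm u)"
        have "cmod l \<le> 1"
          using cmod_hprod_le[of e u] e False by (simp add: l_def norm_divide divide_le_eq)
        moreover have "hprod z u = complex_of_real (norm z * norm u) * l"
          using False by (auto simp: l_def e_def hprod_linear)
        ultimately have "cmod (1 - l) \<le> 4 * cmod (1 - hprod z u)"
          using cmod_one_minus_le_4[of l "norm z * norm u"] z u by (simp add: mult_le_one)
        then have "u \<in> cone e (4 * r)"
          using False u by (simp add: cone_def l_def)
        moreover have "sqrt (max 0 (1 - s)) \<le> norm u"
          using u by (intro real_le_lsqrt) auto
        ultimately show ?thesis
          using u by (simp add: S_def)
      qed simp
    qed
    have [measurable]: "S \<in> sets borel"
      unfolding S_def by measurable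
    have "emeasure lborel {u \<in> unit_ball. cmod (1 - hprod z u) < r \<and> 1 - (norm u)\<^sup>2 < s} \<le> emeasure lborel ({0} \<union> S)"
      using sub by (intro emeasure_mono) auto
    also have "\<dots> \<le> emeasure lborel {0::complex ^ 'n} + emeasure lborel S"
      by (intro emeasure_subadditive) auto
    also have "\<dots> = emeasure lborel S" by simp
    also have "\<dots> = ennreal (measure lborel S)"
    proof (intro emeasure_eq_ennreal_measure)
      have "emeasure lborel S \<le> emeasure lborel (ball (0 :: complex ^ 'n) 1)"
        by (intro emeasure_mono) (auto simp: S_def)
      then show "emeasure lborel S \<noteq> top"
        using emeasure_lborel_ball_finite[of "0 :: complex ^ 'n" 1] by (auto simp: top_unique)
    qed
    also have "\<dots> \<le> ennreal (n * C * 4 ^ n * r ^ CARD('n) * s)"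
    proof (intro ennreal_leI)
      have "measure lborel S = (1 - (max 0 (1 - s)) ^ n) * measure lborel (cone e (4 * r) \<inter> ball 0 1)"
        unfolding S_def
        by (subst measure_cone_shell) (auto simp: cone_scale n_def sqrt_power_double s less_imp_le)
      also have "\<dots> \<le> (n * s) * (C * (4 * r) ^ n)"
      proof (intro mult_mono)
        show "1 - (max 0 (1 - s)) ^ n \<le> n * s"
        proof (cases "s \<le> 1")
          case True
          then show ?thesis
            using Bernoulli_inequality[of "-s" n] by (simp add: max_def)
        next
          case False
          have "1 * 1 \<le> real n * s" using False n by (intro mult_mono) auto
          then show ?thesis using False n by (simp add: max_def power_0_left)
        qed
      qed (use C(2)[OF e, of "4 * r"] r s in \<open>auto simp: n_def\<close>)
      also have "\<dots> = n * C * 4 ^ n * r ^ CARD('n) * s"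
        by (simp add: power_mult_distrib n_def)
      finally show "measure lborel S \<le> n * C * 4 ^ n * r ^ CARD('n) * s" .
    qed
    finally show "emeasure lborel {u \<in> unit_ball. cmod (1 - hprod z u) < r \<and> 1 - (norm u)\<^sup>2 < s}
        \<le> ennreal (n * C * 4 ^ n * r ^ CARD('n) * s)" .
  qed
qed

text \<open>On a shell where \<open>g\<close> is within a factor 2 of \<open>r * t ^ k\<close>, its
  power \<open>b\<close> costs at most \<open>2 powr |b|\<close>, and the shells form a geometric
  series of ratio \<open>t powr (b + \<kappa>)\<close>. It is applied with \<open>t = 1/2\<close>
  for shells shrinking towards the boundary and with \<open>t = 2\<close> for shells receding from
  \<open>z\<close>.\<close>

lemma nn_integral_dyadic_le:
  fixes g :: "'a \<Rightarrow> real"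
  assumes [measurable]: "g \<in> borel_measurable M" "S \<in> sets M"
    and "0 < r" "0 < t" "0 \<le> C" and conv: "t powr (b + \<kappa>) < 1"
    and cover: "\<And>x. x \<in> S \<Longrightarrow> \<exists>k::nat. r * t ^ k / 2 \<le> g x \<and> g x < r * t ^ k"
    and meas: "\<And>k::nat. emeasure M {x \<in> space M. 0 < g x \<and> g x < r * t ^ k} \<le> ennreal (C * (r * t ^ k) powr \<kappa>)"
  shows "(\<integral>\<^sup>+x. ennreal (g x powr b) * indicator S x \<partial>M)
    \<le> ennreal (C * 2 powr \<bar>b\<bar> * r powr (b + \<kappa>) / (1 - t powr (b + \<kappa>)))"
proof -
  define A where "A k = {x \<in> space M. 0 < g x \<and> g x < r * t ^ k}" for k
  define c where "c k = 2 powr \<bar>b\<bar> * (r * t ^ k) powr b" for k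
  have [measurable]: "A k \<in> sets M" for k
    unfolding A_def by measurable
  have "(\<integral>\<^sup>+x. ennreal (g x powr b) * indicator S x \<partial>M)
     \<le> (\<integral>\<^sup>+x. (\<Sum>k. ennreal (c k) * indicator (A k) x) \<partial>M)"
  proof (intro nn_integral_mono)
    fix x assume x: "x \<in> space M"
    show "ennreal (g x powr b) * indicator S x \<le> (\<Sum>k. ennreal (c k) * indicator (A k) x)"
    proof (cases "x \<in> S")
      case True
      then obtain k where k: "r * t ^ k / 2 \<le> g x" "g x < r * t ^ k"
        using cover by blast
      have rk: "0 < r * t ^ k" using assms by simp
      have "g x powr b \<le> c k"
      proof (cases "0 \<le> b")
        case True
        have "g x powr b \<le> 1 * (r * t ^ k) powr b"
          using True k rk by (simp add: powr_mono2)
        also have "\<dots> \<le> c k"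
          unfolding c_def using True by (intro mult_right_mono ge_one_powr_ge_zero) auto
        finally show ?thesis .
      next
        case False
        then have "g x powr b \<le> (r * t ^ k / 2) powr b"
          using k rk by (intro powr_mono2') auto
        also have "\<dots> = c k"
          using False rk by (simp add: c_def powr_divide powr_minus_divide)
        finally show ?thesis .
      qed
      moreover have "x \<in> A k"
        using k rk x by (auto simp: A_def)
      ultimately have "ennreal (g x powr b) * indicator S x \<le> ennreal (c k) * indicator (A k) x"
        using True by (simp add: ennreal_leI)
      also have "F k \<le> suminf F" for F :: "nat \<Rightarrow> ennreal"
        using sum_le_suminf[of F "{k}"] by simp
      finally show ?thesis .
    qed simp
  qed
  also have "\<dots> = (\<Sum>k. ennreal (c k) * emeasure M (A k))"
    by (subst nn_integral_suminf) (auto simp: nn_integral_cmult)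
  also have "\<dots> \<le> (\<Sum>k. ennreal (C * 2 powr \<bar>b\<bar> * r powr (b + \<kappa>) * (t powr (b + \<kappa>)) ^ k))"
  proof (intro suminf_le allI)
    fix k
    have "ennreal (c k) * emeasure M (A k) \<le> ennreal (c k) * ennreal (C * (r * t ^ k) powr \<kappa>)"
      using meas[of k] by (intro mult_left_mono) (auto simp: A_def)
    also have "\<dots> = ennreal (C * 2 powr \<bar>b\<bar> * (r * t ^ k) powr (b + \<kappa>))"
      using assms by (simp add: c_def ennreal_mult[symmetric] powr_add algebra_simps)
    also have "(r * t ^ k) powr (b + \<kappa>) = r powr (b + \<kappa>) * (t powr (b + \<kappa>)) ^ k"
      using assms by (simp add: powr_mult powr_power flip: powr_realpow) (simp add: powr_powr mult.commute)
    finally show "ennreal (c k) * emeasure M (A k) \<le> ennreal (C * 2 powr \<bar>b\<bar> * r powr (b + \<kappa>) * (t powr (b + \<kappa>)) ^ k)"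
      by (simp add: mult.assoc)
  qed auto
  also have "\<dots> = ennreal (C * 2 powr \<bar>b\<bar> * r powr (b + \<kappa>) / (1 - t powr (b + \<kappa>)))"
  proof (rule suminf_ennreal_eq)
    have "(\<lambda>k. (t powr (b + \<kappa>)) ^ k) sums (1 / (1 - t powr (b + \<kappa>)))"
      using conv by (intro geometric_sums) simp
    from sums_mult[OF this, of "C * 2 powr \<bar>b\<bar> * r powr (b + \<kappa>)"]
    show "(\<lambda>k. C * 2 powr \<bar>b\<bar> * r powr (b + \<kappa>) * (t powr (b + \<kappa>)) ^ k) sums
        (C * 2 powr \<bar>b\<bar> * r powr (b + \<kappa>) / (1 - t powr (b + \<kappa>)))"
      by simp
  qed (use assms in auto)
  finally show ?thesis .
qed

lemma ex_dyadic_shell_near: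
  fixes x r :: real
  assumes "0 < x" "x < r"
  shows "\<exists>k::nat. r * (1/2) ^ k / 2 \<le> x \<and> x < r * (1/2) ^ k"
proof -
  obtain k0 :: nat where "(1/2) ^ k0 < x / r"
    using real_arch_pow_inv[of "x / r" "1/2"] assms by auto
  then have ex: "r * (1/2) ^ k0 \<le> x"
    using assms by (simp add: field_simps)
  define k where "k = (LEAST k::nat. r * (1/2) ^ k \<le> x)"
  have k: "r * (1/2) ^ k \<le> x"
    unfolding k_def by (rule LeastI[of _ k0]) (rule ex)
  then obtain j where j: "k = Suc j"
    using assms by (cases k) auto
  have "\<not> r * (1/2) ^ j \<le> x"
    using not_less_Least[of j "\<lambda>k. r * (1/2) ^ k \<le> x"] j unfolding k_def by auto
  then show ?thesis
    using k j by (intro exI[of _ j]) auto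
qed

lemma ex_dyadic_shell_far:
  fixes x r :: real
  assumes "0 < r" "r \<le> x"
  shows "\<exists>k::nat. 2 * r * 2 ^ k / 2 \<le> x \<and> x < 2 * r * 2 ^ k"
proof -
  obtain k0 :: nat where "x / r < 2 ^ k0"
    using real_arch_pow[of 2 "x / r"] by auto
  then have ex: "x < r * 2 ^ k0"
    using assms by (simp add: field_simps)
  define k where "k = (LEAST k::nat. x < r * 2 ^ k)"
  have k: "x < r * 2 ^ k"
    unfolding k_def by (rule LeastI[of _ k0]) (rule ex)
  then obtain j where j: "k = Suc j"
    using assms by (cases k) auto
  have "\<not> x < r * 2 ^ j"
    using not_less_Least[of j "\<lambda>k. x < r * 2 ^ k"] j unfolding k_def by auto
  then show ?thesis
    using k j by (intro exI[of _ j]) auto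
qed

section \<open>The Forelli-Rudin integral\<close>

lemma one_minus_norm_sq_le:
  fixes z u :: "complex ^ 'n::finite"
  assumes "norm z \<le> 1" "norm u \<le> 1"
  shows "1 - (norm u)\<^sup>2 \<le> 2 * cmod (1 - hprod z u)" "1 - (norm z)\<^sup>2 \<le> 2 * cmod (1 - hprod z u)"
proof -
  have sq: "1 - (norm x)\<^sup>2 \<le> 2 * (1 - norm x)" if "norm x \<le> 1" for x :: "complex ^ 'n"
    using sum_power2_ge_zero[of "1 - norm x" 0] by (simp add: power2_eq_square algebra_simps)
  show "1 - (norm u)\<^sup>2 \<le> 2 * cmod (1 - hprod z u)"
    using sq[OF assms(2)] one_minus_norm_le[OF assms(1), of u] cmod_one_minus_hprod_commute[of z u] by argo
  show "1 - (norm z)\<^sup>2 \<le> 2 * cmod (1 - hprod z u)"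
    using sq[OF assms(1)] one_minus_norm_le[OF assms(2), of z] by argo
qed

text \<open>Two nested dyadic sums. The inner one decomposes by \<open>1 - |u|^2\<close> and shows
  that a nonisotropic ball of radius \<open>r\<close> has weighted mass of order
  \<open>r powr (n + 1 + b)\<close>; it converges because \<open>b > -1\<close>. The outer one
  decomposes by \<open>|1 - hprod z u|\<close>, starting at \<open>1 - |z|\<close>, and converges
  because \<open>t > 0\<close>.\<close>

theorem Forelli_Rudin:
  fixes b t :: real
  assumes b: "-1 < b" and t: "0 < t"
  shows "\<exists>C>0. \<forall>z :: complex ^ 'n::finite. norm z < 1 \<longrightarrow>
    (\<integral>\<^sup>+u. indicator unit_ball u * ennreal ((1 - (norm u)\<^sup>2) powr b *
        cmod (1 - hprod z u) powr - (real CARD('n) + 1 + b + t)) \<partial>lborel)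
      \<le> ennreal (C * (1 - (norm z)\<^sup>2) powr - t)"
proof -
  obtain C0 where C0: "0 < C0" "\<And>(z :: complex ^ 'n) r s. norm z < 1 \<Longrightarrow> 0 < r \<Longrightarrow> 0 < s \<Longrightarrow>
    emeasure lborel {u \<in> unit_ball. cmod (1 - hprod z u) < r \<and> 1 - (norm u)\<^sup>2 < s} \<le> ennreal (C0 * r ^ CARD('n) * s)"
    using emeasure_bergman_box_le[where 'n = 'n] by blast
  define n where "n = real CARD('n)"
  define q where "q = (1/2 :: real) powr (b + 1)"
  have q: "q < 1" using b using powr_less_mono2[of "b + 1" "1/2" 1] by (simp add: q_def)
  define C1 where "C1 = C0 * 2 powr \<bar>b\<bar> * 2 powr (b + 1) / (1 - q)"
  have C1: "0 < C1" using C0 q by (simp add: C1_def)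
  have inner: "(\<integral>\<^sup>+u. ennreal ((1 - (norm u)\<^sup>2) powr b) * indicator {u \<in> unit_ball. cmod (1 - hprod z u) < r} u \<partial>lborel)
      \<le> ennreal (C1 * r powr (n + 1 + b))" if z: "norm z < 1" and r: "0 < r" for z :: "complex ^ 'n" and r
  proof -
    define S where "S = {u \<in> unit_ball. cmod (1 - hprod z u) < r}"
    have [measurable]: "S \<in> sets borel"
      unfolding S_def by measurable
    define M where "M = density lborel (indicator S :: complex ^ 'n \<Rightarrow> ennreal)"
    have [measurable_cong]: "sets M = sets borel" by (simp add: M_def)
    have "(\<integral>\<^sup>+u. ennreal ((1 - (norm u)\<^sup>2) powr b) * indicator S u \<partial>M)
       \<le> ennreal (C0 * r ^ CARD('n) * 2 powr \<bar>b\<bar> * (2 * r) powr (b + 1) / (1 - (1/2) powr (b + 1)))"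
    proof (rule nn_integral_dyadic_le)
      show "\<exists>k::nat. 2 * r * (1/2) ^ k / 2 \<le> 1 - (norm u)\<^sup>2 \<and> 1 - (norm u)\<^sup>2 < 2 * r * (1/2) ^ k"
        if "u \<in> S" for u
        using that one_minus_norm_sq_le(1)[of z u] z
        by (intro ex_dyadic_shell_near) (auto simp: S_def power_less_one_iff)
      show "emeasure M {u \<in> space M. 0 < 1 - (norm u)\<^sup>2 \<and> 1 - (norm u)\<^sup>2 < 2 * r * (1/2) ^ k}
          \<le> ennreal (C0 * r ^ CARD('n) * (2 * r * (1/2) ^ k) powr 1)" for k
      proof -
        have "emeasure M {u \<in> space M. 0 < 1 - (norm u)\<^sup>2 \<and> 1 - (norm u)\<^sup>2 < 2 * r * (1/2) ^ k}
           = emeasure lborel (S \<inter> {u. 0 < 1 - (norm u)\<^sup>2 \<and> 1 - (norm u)\<^sup>2 < 2 * r * (1/2) ^ k})"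
          unfolding M_def by (subst emeasure_restricted) auto
        also have "\<dots> \<le> emeasure lborel {u \<in> unit_ball. cmod (1 - hprod z u) < r \<and> 1 - (norm u)\<^sup>2 < 2 * r * (1/2) ^ k}"
          by (intro emeasure_mono) (auto simp: S_def)
        also have "\<dots> \<le> ennreal (C0 * r ^ CARD('n) * (2 * r * (1/2) ^ k))"
          using r by (intro C0 z) auto
        finally show ?thesis using r by simp
      qed
      show "(1/2) powr (b + 1) < (1::real)" using q by (simp add: q_def)
    qed (use r C0 in auto)
    also have "(\<integral>\<^sup>+u. ennreal ((1 - (norm u)\<^sup>2) powr b) * indicator S u \<partial>M)
        = (\<integral>\<^sup>+u. ennreal ((1 - (norm u)\<^sup>2) powr b) * indicator S u \<partial>lborel)"
      unfolding M_def by (subst nn_integral_density) (auto intro!: nn_integral_cong simp: indicator_def)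
    also have "C0 * r ^ CARD('n) * 2 powr \<bar>b\<bar> * (2 * r) powr (b + 1) / (1 - (1/2) powr (b + 1))
        = C1 * r powr (n + 1 + b)"
      using r by (simp add: C1_def q_def n_def powr_mult powr_add powr_realpow)
    finally show ?thesis
      by (simp add: S_def)
  qed
  define a where "a = n + 1 + b + t"
  define C2 where "C2 = C1 * 2 powr \<bar>a\<bar> * 2 powr - t / (1 - 2 powr - t)"
  have "2 powr - t < (1::real)" using t by (simp add: powr_less_one)
  with C1 have C2: "0 < C2" by (simp add: C2_def)
  show ?thesis
  proof (intro exI[of _ "C2 * 2 powr t"] conjI allI impI)
    show "0 < C2 * 2 powr t" using C2 by simp
  next
    fix z :: "complex ^ 'n"
    assume z: "norm z < 1"
    \<comment> \<open>For this weighted measure the bound \<open>inner\<close> is the growth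
      condition with exponent \<open>n + 1 + b\<close>, so the ratio of the outer series is
      \<open>2 powr - t\<close>.\<close>
    define M where "M = density lborel (\<lambda>u::complex ^ 'n. ennreal ((1 - (norm u)\<^sup>2) powr b) * indicator unit_ball u)"
    have [measurable_cong]: "sets M = sets borel" by (simp add: M_def)
    have "(\<integral>\<^sup>+u. ennreal (cmod (1 - hprod z u) powr - a) * indicator unit_ball u \<partial>M)
       \<le> ennreal (C1 * 2 powr \<bar>- a\<bar> * (2 * (1 - norm z)) powr (- a + (n + 1 + b)) / (1 - 2 powr (- a + (n + 1 + b))))"
    proof (rule nn_integral_dyadic_le)
      show "\<exists>k::nat. 2 * (1 - norm z) * 2 ^ k / 2 \<le> cmod (1 - hprod z u) \<and> cmod (1 - hprod z u) < 2 * (1 - norm z) * 2 ^ k"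
        if "u \<in> unit_ball" for u
        using that one_minus_norm_le[of u z] z by (intro ex_dyadic_shell_far) auto
      show "emeasure M {u \<in> space M. 0 < cmod (1 - hprod z u) \<and> cmod (1 - hprod z u) < 2 * (1 - norm z) * 2 ^ k}
          \<le> ennreal (C1 * (2 * (1 - norm z) * 2 ^ k) powr (n + 1 + b))" for k
      proof -
        have "emeasure M {u \<in> space M. 0 < cmod (1 - hprod z u) \<and> cmod (1 - hprod z u) < 2 * (1 - norm z) * 2 ^ k}
          \<le> (\<integral>\<^sup>+u. ennreal ((1 - (norm u)\<^sup>2) powr b) * indicator {u \<in> unit_ball. cmod (1 - hprod z u) < 2 * (1 - norm z) * 2 ^ k} u \<partial>lborel)"
          unfolding M_def by (subst emeasure_density) (auto intro!: nn_integral_mono simp: indicator_def)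
        also have "\<dots> \<le> ennreal (C1 * (2 * (1 - norm z) * 2 ^ k) powr (n + 1 + b))"
          using z by (intro inner) auto
        finally show ?thesis .
      qed
    qed (use z C1 t in \<open>auto simp: a_def powr_less_one\<close>)
    also have "C1 * 2 powr \<bar>- a\<bar> * (2 * (1 - norm z)) powr (- a + (n + 1 + b)) / (1 - 2 powr (- a + (n + 1 + b)))
        = C2 * (1 - norm z) powr - t"
    proof -
      have "- a + (n + 1 + b) = - t" by (simp add: a_def)
      moreover have "(2 * (1 - norm z)) powr - t = 2 powr - t * (1 - norm z) powr - t"
        by (rule powr_mult)
      ultimately show ?thesis by (simp only: C2_def abs_minus_cancel times_divide_eq_left mult.assoc)
    qed
    also have "(\<integral>\<^sup>+u. ennreal (cmod (1 - hprod z u) powr - a) * indicator unit_ball u \<partial>M)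
      = (\<integral>\<^sup>+u. indicator unit_ball u * ennreal ((1 - (norm u)\<^sup>2) powr b *
        cmod (1 - hprod z u) powr - (real CARD('n) + 1 + b + t)) \<partial>lborel)"
      unfolding M_def by (subst nn_integral_density)
        (auto intro!: nn_integral_cong simp: indicator_def ennreal_mult a_def n_def)
    also have "ennreal (C2 * (1 - norm z) powr - t) \<le> ennreal (C2 * 2 powr t * (1 - (norm z)\<^sup>2) powr - t)"
    proof (intro ennreal_leI)
      have x: "0 < 1 - (norm z)\<^sup>2" using z by (simp add: power_less_one_iff)
      moreover have "(1 - (norm z)\<^sup>2) / 2 \<le> 1 - norm z"
      proof -
        have "1 - (norm z)\<^sup>2 \<le> 2 * (1 - norm z)"
          using sum_power2_ge_zero[of "1 - norm z" 0] by (simp add: power2_eq_square algebra_simps)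
        then show ?thesis by argo
      qed
      ultimately have "(1 - norm z) powr - t \<le> ((1 - (norm z)\<^sup>2) / 2) powr - t"
        using t by (intro powr_mono2') auto
      also have "\<dots> = 2 powr t * (1 - (norm z)\<^sup>2) powr - t"
        using x by (simp add: powr_divide powr_minus_divide)
      finally show "C2 * (1 - norm z) powr - t \<le> C2 * 2 powr t * (1 - (norm z)\<^sup>2) powr - t"
        using C2 by simp
    qed
    finally show "(\<integral>\<^sup>+u. indicator unit_ball u * ennreal ((1 - (norm u)\<^sup>2) powr b *
        cmod (1 - hprod z u) powr - (real CARD('n) + 1 + b + t)) \<partial>lborel)
      \<le> ennreal (C2 * 2 powr t * (1 - (norm z)\<^sup>2) powr - t)" .
  qed
qed

section \<open>The weighted measures and the Schur test\<close>

lemma sets_ball_measure [measurable_cong]: "sets ball_measure = sets (restrict_space borel unit_ball)"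
  by (simp add: ball_measure_def cong: sets_restrict_space_cong)

lemma sets_v_alpha [measurable_cong]: "sets (v_alpha \<alpha>) = sets (restrict_space borel unit_ball)"
  by (simp add: v_alpha_def sets_ball_measure)

lemma sets_tau [measurable_cong]: "sets tau = sets (restrict_space borel unit_ball)"
  by (simp add: tau_def sets_ball_measure)

lemma space_ball_measure [simp]: "space ball_measure = unit_ball"
  by (simp add: ball_measure_def space_restrict_space)

lemma space_v_alpha [simp]: "space (v_alpha \<alpha>) = unit_ball"
  by (simp add: v_alpha_def)

lemma space_tau [simp]: "space tau = unit_ball"
  by (simp add: tau_def)

lemma borel_measurable_restrict_ball:
  "f \<in> borel_measurable borel \<Longrightarrow> f \<in> borel_measurable (restrict_space borel S)"
  by (rule measurable_restrict_space1)

lemma borel_measurable_v_alpha: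
  "f \<in> borel_measurable borel \<Longrightarrow> f \<in> borel_measurable (v_alpha \<alpha>)"
  by (simp cong: measurable_cong_sets[OF sets_v_alpha] add: borel_measurable_restrict_ball)

lemma ident_v_alpha [measurable]: "(\<lambda>x. x) \<in> borel_measurable (v_alpha \<alpha>)"
  by (rule borel_measurable_v_alpha) simp

lemma ident_tau [measurable]: "(\<lambda>x. x) \<in> borel_measurable tau"
  by (simp cong: measurable_cong_sets[OF sets_tau] add: borel_measurable_restrict_ball)

lemma nn_integral_ball_measure:
  fixes f :: "complex ^ 'n::finite \<Rightarrow> ennreal"
  assumes f: "f \<in> borel_measurable ball_measure"
  shows "(\<integral>\<^sup>+x. f x \<partial>ball_measure) =
    ennreal (1 / measure lborel (unit_ball :: (complex ^ 'n) set)) * (\<integral>\<^sup>+x. indicator unit_ball x * f x \<partial>lborel)"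
proof -
  let ?B = "unit_ball :: (complex ^ 'n) set"
  have [measurable]: "f \<in> borel_measurable (restrict_space lborel ?B)"
    using f by (simp cong: measurable_cong_sets[OF sets_ball_measure] measurable_cong_sets[OF sets_restrict_space_cong[OF sets_lborel]])
  have B: "emeasure lborel ?B = ennreal (measure lborel ?B)"
    using emeasure_lborel_ball_finite[of "0 :: complex ^ 'n" 1]
    by (intro emeasure_eq_ennreal_measure) auto
  have pos: "0 < measure lborel ?B"
    by (simp add: content_ball unit_ball_vol_pos)
  have BB: "?B \<in> sets (restrict_space lborel ?B)"
    by (simp add: sets_restrict_space_iff)
  have em: "emeasure (restrict_space lborel ?B) ?B = emeasure lborel ?B"
    by (subst emeasure_restrict_space) auto
  have "(\<integral>\<^sup>+x. f x \<partial>ball_measure) = (\<integral>\<^sup>+x. f x * indicator ?B x \<partial>restrict_space lborel ?B) / emeasure lborel ?B"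
    unfolding ball_measure_def using pos B em
    by (subst nn_integral_uniform_measure[OF _ BB]) (auto simp: ennreal_zero_less_divide)
  also have "(\<integral>\<^sup>+x. f x * indicator ?B x \<partial>restrict_space lborel ?B) = (\<integral>\<^sup>+x. indicator ?B x * f x \<partial>lborel)"
    by (subst nn_integral_restrict_space) (auto intro!: nn_integral_cong simp: indicator_def)
  finally show ?thesis
    using pos by (simp add: B divide_ennreal_def inverse_ennreal mult.commute divide_inverse)
qed

text \<open>The constant of \<open>v_alpha\<close> relative to plain Lebesgue measure, with the
  volume of the ball absorbed. The dimension is carried by a type, hence the \<open>itself\<close>
  argument.\<close>

definition v_const :: "real \<Rightarrow> 'n::finite itself \<Rightarrow> real" where
  "v_const \<alpha> _ = Gamma (real CARD('n) + \<alpha> + 1) / (fact CARD('n) * Gamma (\<alpha> + 1))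
     / measure lborel (unit_ball :: (complex ^ 'n) set)"

lemma ball_content_pos: "0 < measure lborel (unit_ball :: (complex ^ 'n::finite) set)"
  by (simp add: content_ball unit_ball_vol_pos)

lemma v_const_pos: "-1 < \<alpha> \<Longrightarrow> 0 < v_const \<alpha> TYPE('n::finite)"
  using ball_content_pos[where 'n = 'n] unfolding v_const_def
  by (intro divide_pos_pos mult_pos_pos) (auto intro!: Gamma_real_pos)

lemma nn_integral_v_alpha:
  fixes f :: "complex ^ 'n::finite \<Rightarrow> ennreal"
  assumes \<alpha>: "-1 < \<alpha>" and f [measurable]: "f \<in> borel_measurable (v_alpha \<alpha>)"
  shows "(\<integral>\<^sup>+x. f x \<partial>v_alpha \<alpha>) = ennreal (v_const \<alpha> TYPE('n)) *
    (\<integral>\<^sup>+x. indicator unit_ball x * (ennreal ((1 - (norm x)\<^sup>2) powr \<alpha>) * f x) \<partial>lborel)"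
proof -
  define c where "c = Gamma (real CARD('n) + \<alpha> + 1) / (fact CARD('n) * Gamma (\<alpha> + 1))"
  have c: "0 \<le> c"
    unfolding c_def using \<alpha> by (intro divide_nonneg_nonneg mult_nonneg_nonneg) (auto intro!: less_imp_le[OF Gamma_real_pos])
  have [measurable]: "f \<in> borel_measurable ball_measure"
    using f by (simp cong: measurable_cong_sets[OF sets_ball_measure] measurable_cong_sets[OF sets_v_alpha])
  have "(\<integral>\<^sup>+x. f x \<partial>v_alpha \<alpha>) = (\<integral>\<^sup>+x. ennreal (c * (1 - (norm x)\<^sup>2) powr \<alpha>) * f x \<partial>ball_measure)"
    unfolding v_alpha_def c_def[symmetric] by (subst nn_integral_density) auto
  also have "\<dots> = (\<integral>\<^sup>+x. ennreal c * (ennreal ((1 - (norm x)\<^sup>2) powr \<alpha>) * f x) \<partial>ball_measure)"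
    using c by (simp add: ennreal_mult mult.assoc)
  also have "\<dots> = ennreal c * (\<integral>\<^sup>+x. (ennreal ((1 - (norm x)\<^sup>2) powr \<alpha>) * f x) \<partial>ball_measure)"
    by (intro nn_integral_cmult) auto
  also have "\<dots> = ennreal c * (ennreal (1 / measure lborel (unit_ball :: (complex ^ 'n) set)) *
       (\<integral>\<^sup>+x. indicator unit_ball x * (ennreal ((1 - (norm x)\<^sup>2) powr \<alpha>) * f x) \<partial>lborel))"
    by (subst nn_integral_ball_measure) auto
  finally show ?thesis
    using c by (simp add: v_const_def c_def[symmetric] mult.assoc[symmetric] ennreal_mult[symmetric])
qed

lemma nn_integral_tau:
  fixes f :: "complex ^ 'n::finite \<Rightarrow> ennreal"
  assumes f [measurable]: "f \<in> borel_measurable tau"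
  shows "(\<integral>\<^sup>+x. f x \<partial>tau) = ennreal (1 / measure lborel (unit_ball :: (complex ^ 'n) set)) *
    (\<integral>\<^sup>+x. indicator unit_ball x * (ennreal (1 / (1 - (norm x)\<^sup>2) ^ (CARD('n) + 1)) * f x) \<partial>lborel)"
proof -
  have [measurable]: "f \<in> borel_measurable ball_measure"
    using f by (simp cong: measurable_cong_sets[OF sets_ball_measure] measurable_cong_sets[OF sets_tau])
  have "(\<integral>\<^sup>+x. f x \<partial>tau) = (\<integral>\<^sup>+x. ennreal (1 / (1 - (norm x)\<^sup>2) ^ (CARD('n) + 1)) * f x \<partial>ball_measure)"
    unfolding tau_def by (subst nn_integral_density) auto
  then show ?thesis
    by (subst (asm) nn_integral_ball_measure) auto
qed

text \<open>The case \<open>b = \<alpha> - \<epsilon>\<close> and \<open>t = \<epsilon>\<close>, in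
  which the shifts cancel in the kernel exponent; \<open>\<epsilon> < \<alpha> + 1\<close> says
  \<open>b > -1\<close>. The power of \<open>1 - |u|^2\<close> is thereby reproduced up to a
  constant, as the Schur test requires.\<close>

lemma Forelli_Rudin_v_alpha:
  fixes \<alpha> \<epsilon> :: real
  assumes "-1 < \<alpha>" "0 < \<epsilon>" "\<epsilon> < \<alpha> + 1"
  shows "\<exists>C>0. \<forall>z :: complex ^ 'n::finite. norm z < 1 \<longrightarrow>
    (\<integral>\<^sup>+u. ennreal (cmod (1 - hprod z u) powr - (real CARD('n) + 1 + \<alpha>) * (1 - (norm u)\<^sup>2) powr - \<epsilon>) \<partial>v_alpha \<alpha>)
      \<le> ennreal (C * (1 - (norm z)\<^sup>2) powr - \<epsilon>)"
proof -
  obtain C where C: "0 < C" "\<And>z :: complex ^ 'n. norm z < 1 \<Longrightarrow>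
    (\<integral>\<^sup>+u. indicator unit_ball u * ennreal ((1 - (norm u)\<^sup>2) powr (\<alpha> - \<epsilon>) *
        cmod (1 - hprod z u) powr - (real CARD('n) + 1 + (\<alpha> - \<epsilon>) + \<epsilon>)) \<partial>lborel)
      \<le> ennreal (C * (1 - (norm z)\<^sup>2) powr - \<epsilon>)"
    using Forelli_Rudin[of "\<alpha> - \<epsilon>" \<epsilon>, where 'n = 'n] assms by auto
  define K where "K = v_const \<alpha> TYPE('n)"
  have K: "0 < K" using assms by (simp add: K_def v_const_pos)
  show ?thesis
  proof (intro exI[of _ "K * C"] conjI allI impI)
    fix z :: "complex ^ 'n" assume z: "norm z < 1"
    have "(\<integral>\<^sup>+u. ennreal (cmod (1 - hprod z u) powr - (real CARD('n) + 1 + \<alpha>) * (1 - (norm u)\<^sup>2) powr - \<epsilon>) \<partial>v_alpha \<alpha>)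
      = ennreal K * (\<integral>\<^sup>+u. indicator unit_ball u * (ennreal ((1 - (norm u)\<^sup>2) powr \<alpha>) *
         ennreal (cmod (1 - hprod z u) powr - (real CARD('n) + 1 + \<alpha>) * (1 - (norm u)\<^sup>2) powr - \<epsilon>)) \<partial>lborel)"
      unfolding K_def by (rule nn_integral_v_alpha[OF assms(1)]) measurable
    also have "(\<integral>\<^sup>+u. indicator unit_ball u * (ennreal ((1 - (norm u)\<^sup>2) powr \<alpha>) *
         ennreal (cmod (1 - hprod z u) powr - (real CARD('n) + 1 + \<alpha>) * (1 - (norm u)\<^sup>2) powr - \<epsilon>)) \<partial>lborel)
       = (\<integral>\<^sup>+u. indicator unit_ball u * ennreal ((1 - (norm u)\<^sup>2) powr (\<alpha> - \<epsilon>) *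
        cmod (1 - hprod z u) powr - (real CARD('n) + 1 + (\<alpha> - \<epsilon>) + \<epsilon>)) \<partial>lborel)"
      by (intro nn_integral_cong) (simp add: ennreal_mult[symmetric] powr_diff powr_minus divide_inverse mult_ac)
    also have "ennreal K * \<dots> \<le> ennreal K * ennreal (C * (1 - (norm z)\<^sup>2) powr - \<epsilon>)"
      by (intro mult_left_mono C z) auto
    also have "\<dots> = ennreal (K * C * (1 - (norm z)\<^sup>2) powr - \<epsilon>)"
      using K C by (simp add: ennreal_mult[symmetric] mult.assoc)
    finally show "(\<integral>\<^sup>+u. ennreal (cmod (1 - hprod z u) powr - (real CARD('n) + 1 + \<alpha>) * (1 - (norm u)\<^sup>2) powr - \<epsilon>) \<partial>v_alpha \<alpha>)
      \<le> ennreal (K * C * (1 - (norm z)\<^sup>2) powr - \<epsilon>)" .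
  qed (use K C in auto)
qed

text \<open>At \<open>z = 0\<close> the kernel in the Forelli-Rudin integral is identically 1, so
  the integral there is the total mass up to a constant.\<close>

lemma finite_measure_v_alpha:
  assumes "-1 < \<alpha>"
  shows "finite_measure (v_alpha \<alpha> :: (complex ^ 'n::finite) measure)"
proof (rule finite_measureI)
  obtain C where C: "0 < C" "\<And>z :: complex ^ 'n. norm z < 1 \<Longrightarrow>
    (\<integral>\<^sup>+u. indicator unit_ball u * ennreal ((1 - (norm u)\<^sup>2) powr \<alpha> *
        cmod (1 - hprod z u) powr - (real CARD('n) + 1 + \<alpha> + 1)) \<partial>lborel)
      \<le> ennreal (C * (1 - (norm z)\<^sup>2) powr - 1)"
    using Forelli_Rudin[of \<alpha> 1, where 'n = 'n] assms by auto
  have "emeasure (v_alpha \<alpha> :: (complex ^ 'n) measure) (space (v_alpha \<alpha>)) = (\<integral>\<^sup>+u. 1 \<partial>(v_alpha \<alpha> :: (complex ^ 'n) measure))"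
    by simp
  also have "\<dots> = ennreal (v_const \<alpha> TYPE('n)) * (\<integral>\<^sup>+u. indicator unit_ball u * (ennreal ((1 - (norm (u :: complex ^ 'n))\<^sup>2) powr \<alpha>) * 1) \<partial>lborel)"
    by (rule nn_integral_v_alpha[OF assms]) measurable
  also have "\<dots> < \<infinity>"
    using C(2)[of 0] by (auto simp: ennreal_mult_less_top intro: le_less_trans)
  finally show "emeasure (v_alpha \<alpha> :: (complex ^ 'n) measure) (space (v_alpha \<alpha>)) \<noteq> \<infinity>" by simp
qed

text \<open>Hoelder's inequality in the form needed for the Schur test; the weight \<open>h\<close> of the test
  contributes \<open>B = C * h z powr p'\<close>.\<close>

lemma powr_nn_integral_mult_le:
  fixes H f h :: "'a \<Rightarrow> real"
  assumes [measurable]: "H \<in> borel_measurable M" "f \<in> borel_measurable M" "h \<in> borel_measurable M"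
    and nonneg: "\<And>x. x \<in> space M \<Longrightarrow> 0 \<le> H x" "\<And>x. x \<in> space M \<Longrightarrow> 0 \<le> f x"
      "\<And>x. x \<in> space M \<Longrightarrow> 0 < h x"
    and p: "1 < p" "1 < p'" "1 / p + 1 / p' = 1"
    and B: "(\<integral>\<^sup>+x. ennreal (H x * h x powr p') \<partial>M) \<le> ennreal (C * k powr p')" and C: "0 < C" "0 < k"
  shows "ennreal (enn2real (\<integral>\<^sup>+x. ennreal (H x * f x) \<partial>M) powr p)
    \<le> ennreal ((1 + C) powr p * k powr p) * (\<integral>\<^sup>+x. ennreal (H x * (f x powr p * h x powr - p)) \<partial>M)"
    (is "?L \<le> _ * ?\<Phi>")
proof (cases "?\<Phi>")
  case top
  then show ?thesis using C by (simp add: ennreal_mult_top)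
next
  case (real \<phi>)
  show ?thesis
  proof (cases "\<phi> = 0")
    case True
    then have "AE x in M. ennreal (H x * (f x powr p * h x powr - p)) = 0"
      using real by (subst nn_integral_0_iff_AE[symmetric]) auto
    then have "AE x in M. ennreal (H x * f x) = 0"
      using AE_space
    proof eventually_elim
      case (elim x)
      then have "H x * (f x powr p * h x powr - p) = 0"
        using nonneg(1)[OF elim(2)] by (intro order.antisym mult_nonneg_nonneg) (simp_all add: ennreal_eq_0_iff)
      then have "H x = 0 \<or> f x = 0"
        using nonneg(3)[OF elim(2)] by simp
      then show ?case by auto
    qed
    then have "(\<integral>\<^sup>+x. ennreal (H x * f x) \<partial>M) = 0"
      by (subst nn_integral_0_iff_AE) auto
    then show ?thesis using p by simp
  next
    case False
    with real have \<phi>: "0 < \<phi>" by simp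
    \<comment> \<open>The parameter in Young's inequality that makes both terms multiples of
      \<open>k * \<phi> powr (1/p)\<close>. It involves a negative power of \<open>\<phi>\<close>,
      hence the separate treatment of the values 0 and infinity.\<close>
    define l where "l = k powr (1/p) * \<phi> powr - (1 / (p * p'))"
    have l: "0 < l" using C \<phi> by (simp add: l_def)
    have pp: "p + p' = p * p'"
      using p by (simp add: field_simps)
    have lp: "l powr p = k * \<phi> powr - (1 / p')"
      using C p \<phi> by (simp add: l_def powr_mult powr_powr)
    have lp': "l powr - p' = k powr (- (p' / p)) * \<phi> powr (1 / p)"
      using C p \<phi> by (simp add: l_def powr_mult powr_powr mult.commute)
    have young: "f x \<le> l powr p * (f x powr p * h x powr - p) + l powr - p' * h x powr p'" if "x \<in> space M" for x
    proof -
      have "f x = (l * (f x / h x)) * (h x / l)"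
        using nonneg(3)[OF that] l by simp
      also have "\<dots> \<le> (l * (f x / h x)) powr p / p + (h x / l) powr p' / p'"
        using nonneg[OF that] l p by (intro Youngs_inequality) auto
      also have "\<dots> \<le> (l * (f x / h x)) powr p / 1 + (h x / l) powr p' / 1"
        using p by (intro add_mono divide_left_mono) auto
      also have "\<dots> = l powr p * (f x powr p * h x powr - p) + l powr - p' * h x powr p'"
        using nonneg[OF that] l by (simp add: powr_mult powr_divide powr_minus divide_inverse inverse_powr mult_ac)
      finally show ?thesis .
    qed
    have "(\<integral>\<^sup>+x. ennreal (H x * f x) \<partial>M) \<le> (\<integral>\<^sup>+x. ennreal (l powr p) * ennreal (H x * (f x powr p * h x powr - p))
        + ennreal (l powr - p') * ennreal (H x * h x powr p') \<partial>M)"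
    proof (intro nn_integral_mono)
      fix x assume x: "x \<in> space M"
      have "H x * f x \<le> H x * (l powr p * (f x powr p * h x powr - p) + l powr - p' * h x powr p')"
        using nonneg(1)[OF x] young[OF x] by (intro mult_left_mono)
      then have "ennreal (H x * f x) \<le> ennreal (l powr p * (H x * (f x powr p * h x powr - p)) + l powr - p' * (H x * h x powr p'))"
        by (intro ennreal_leI) (simp add: algebra_simps)
      then show "ennreal (H x * f x) \<le> ennreal (l powr p) * ennreal (H x * (f x powr p * h x powr - p))
        + ennreal (l powr - p') * ennreal (H x * h x powr p')"
        using nonneg[OF x] by (simp add: ennreal_mult ennreal_plus)
    qed
    also have "\<dots> = ennreal (l powr p) * ?\<Phi> + ennreal (l powr - p') * (\<integral>\<^sup>+x. ennreal (H x * h x powr p') \<partial>M)"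
      by (simp add: nn_integral_add nn_integral_cmult)
    also have "\<dots> \<le> ennreal (l powr p) * ennreal \<phi> + ennreal (l powr - p') * ennreal (C * k powr p')"
      using B real by (intro add_mono mult_left_mono) auto
    also have "\<dots> = ennreal (l powr p * \<phi> + l powr - p' * (C * k powr p'))"
      using C \<phi> by (simp add: ennreal_mult[symmetric] ennreal_plus[symmetric] del: ennreal_plus)
    also have "l powr p * \<phi> + l powr - p' * (C * k powr p') = (1 + C) * k * \<phi> powr (1 / p)"
    proof -
      have 1: "\<phi> powr - (1 / p') * \<phi> = \<phi> powr (1 / p)"
      proof -
        have "1 / p = - (1 / p') + 1" using p(3) by simp
        then show ?thesis using \<phi> by (simp only: powr_add powr_one)
      qed
      have 2: "k powr (- (p' / p)) * k powr p' = k"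
      proof -
        have "- (p' / p) + p' = 1"
          using pp p by (simp add: field_simps)
        then show ?thesis using C by (simp add: powr_add[symmetric])
      qed
      have "l powr p * \<phi> = k * \<phi> powr (1 / p)"
        by (simp only: lp mult.assoc 1)
      moreover have "l powr - p' * (C * k powr p') = C * (k powr (- (p' / p)) * k powr p') * \<phi> powr (1 / p)"
        by (simp only: lp' mult_ac)
      ultimately show ?thesis
        unfolding 2 by (simp add: distrib_right)
    qed
    finally have "enn2real (\<integral>\<^sup>+x. ennreal (H x * f x) \<partial>M) \<le> (1 + C) * k * \<phi> powr (1 / p)"
      using C by (intro enn2real_leI) auto
    then have "enn2real (\<integral>\<^sup>+x. ennreal (H x * f x) \<partial>M) powr p \<le> ((1 + C) * k * \<phi> powr (1 / p)) powr p"
      using p by (intro powr_mono2) auto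
    also have "\<dots> = (1 + C) powr p * k powr p * \<phi>"
      using C p \<phi> by (simp add: powr_mult powr_powr)
    finally show ?thesis
      using C \<phi> real by (simp add: ennreal_mult[symmetric] ennreal_leI)
  qed
qed

text \<open>The positive operator that dominates all three singular integrals.\<close>

definition Bop :: "real \<Rightarrow> (complex ^ 'n::finite \<Rightarrow> complex) \<Rightarrow> complex ^ 'n \<Rightarrow> real" where
  "Bop \<alpha> f z = (\<integral>u. cmod (1 - hprod z u) powr - (real CARD('n) + 1 + \<alpha>) * cmod (f u) \<partial>v_alpha \<alpha>)"

section \<open>Boundedness of the positive Bergman operator\<close>

lemma Lp_integrable_norm:
  fixes f :: "'a \<Rightarrow> 'b::{banach, second_countable_topology}"
  assumes "finite_measure M" "1 < p" "f \<in> Lp M p"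
  shows "integrable M f" "integrable M (\<lambda>x. norm (f x))"
proof -
  interpret finite_measure M by fact
  have [measurable]: "f \<in> borel_measurable M" and int: "integrable M (\<lambda>x. norm (f x) powr p)"
    using assms by (auto simp: Lp_def)
  show "integrable M f"
  proof (rule Bochner_Integration.integrable_bound)
    show "integrable M (\<lambda>x. 1 + norm (f x) powr p)"
      using int by (intro Bochner_Integration.integrable_add) auto
    show "AE x in M. norm (f x) \<le> norm (1 + norm (f x) powr p)"
    proof (intro AE_I2)
      fix x
      have "norm (f x) \<le> 1 + norm (f x) powr p"
      proof (cases "norm (f x) \<le> 1")
        case False
        then have "norm (f x) powr 1 \<le> norm (f x) powr p"
          using assms by (intro powr_mono) auto
        then show ?thesis using False by simp
      qed (simp add: add_increasing2)
      then show "norm (f x) \<le> norm (1 + norm (f x) powr p)" by simp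
    qed
  qed simp
  then show "integrable M (\<lambda>x. norm (f x))" by simp
qed

lemma Bop_integrable:
  fixes f :: "complex ^ 'n::finite \<Rightarrow> complex"
  assumes \<alpha>: "-1 < \<alpha>" and z: "norm z < 1" and f: "integrable (v_alpha \<alpha>) f"
  shows "integrable (v_alpha \<alpha>) (\<lambda>u. cmod (1 - hprod z u) powr - (real CARD('n) + 1 + \<alpha>) * cmod (f u))"
proof (rule Bochner_Integration.integrable_bound)
  have [measurable]: "f \<in> borel_measurable (v_alpha \<alpha>)" using f by auto
  show "integrable (v_alpha \<alpha>) (\<lambda>u. (1 - norm z) powr - (real CARD('n) + 1 + \<alpha>) * cmod (f u))"
    using f by simp
  show "AE u in v_alpha \<alpha>. norm (cmod (1 - hprod z u) powr - (real CARD('n) + 1 + \<alpha>) * cmod (f u))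
      \<le> norm ((1 - norm z) powr - (real CARD('n) + 1 + \<alpha>) * cmod (f u))"
  proof (intro AE_I2)
    fix u assume "u \<in> space (v_alpha \<alpha> :: (complex ^ 'n) measure)"
    then have "cmod (1 - hprod z u) powr - (real CARD('n) + 1 + \<alpha>) \<le> (1 - norm z) powr - (real CARD('n) + 1 + \<alpha>)"
      using one_minus_norm_le[of u z] z \<alpha> by (intro powr_mono2') auto
    then show "norm (cmod (1 - hprod z u) powr - (real CARD('n) + 1 + \<alpha>) * cmod (f u))
      \<le> norm ((1 - norm z) powr - (real CARD('n) + 1 + \<alpha>) * cmod (f u))"
      by (simp add: abs_mult mult_right_mono)
  qed
  show "(\<lambda>u. cmod (1 - hprod z u) powr - (real CARD('n) + 1 + \<alpha>) * cmod (f u)) \<in> borel_measurable (v_alpha \<alpha>)"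
    by measurable
qed

text \<open>Schur test with the weight \<open>h\<close>: the Forelli-Rudin estimate with
  \<open>p'\<close> feeds Hoelder's inequality in \<open>u\<close>. After exchanging the integrals,
  the one with \<open>p\<close> is used in \<open>z\<close>, which is the same estimate because the
  modulus of the kernel is symmetric.\<close>

theorem Bop_bounded:
  fixes \<alpha> p :: real
  assumes \<alpha>: "-1 < \<alpha>" and p: "1 < p"
  shows "\<exists>C>0. \<forall>f \<in> Lp (v_alpha \<alpha>) p.
    Bop \<alpha> (f :: complex ^ 'n::finite \<Rightarrow> complex) \<in> Lp (v_alpha \<alpha>) p \<and>
    (\<integral>z. Bop \<alpha> f z powr p \<partial>v_alpha \<alpha>) \<le> C * (\<integral>z. cmod (f z) powr p \<partial>v_alpha \<alpha>)"
proof -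
  let ?V = "v_alpha \<alpha> :: (complex ^ 'n) measure"
  let ?m = "real CARD('n) + 1 + \<alpha>"
  interpret finite_measure ?V by (rule finite_measure_v_alpha[OF \<alpha>])
  interpret pair_sigma_finite ?V ?V ..
  define p' where "p' = p / (p - 1)"
  have p': "1 < p'" "1 / p + 1 / p' = 1"
    using p by (auto simp: p'_def field_simps)
  \<comment> \<open>Both products \<open>\<epsilon> * p\<close> and \<open>\<epsilon> * p'\<close>
    must stay below \<open>\<alpha> + 1\<close>; here their sum is half of it.\<close>
  define \<epsilon> where "\<epsilon> = (\<alpha> + 1) / (2 * (p + p'))"
  have \<epsilon>: "0 < \<epsilon>" "\<epsilon> * p < \<alpha> + 1" "\<epsilon> * p' < \<alpha> + 1"
  proof -
    have "0 < p + p'" using p p' by simp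
    then show "0 < \<epsilon>" using \<alpha> by (simp add: \<epsilon>_def)
    have "\<epsilon> * (2 * (p + p')) = \<alpha> + 1"
      using \<open>0 < p + p'\<close> by (simp add: \<epsilon>_def)
    then have e: "\<epsilon> * p + \<epsilon> * p' + (\<epsilon> * p + \<epsilon> * p') = \<alpha> + 1"
      by (simp add: algebra_simps)
    have "0 < \<epsilon> * p" "0 < \<epsilon> * p'" using p p' \<open>0 < \<epsilon>\<close> by auto
    with e show "\<epsilon> * p < \<alpha> + 1" "\<epsilon> * p' < \<alpha> + 1" by linarith+
  qed
  obtain C1 where C1: "0 < C1" "\<And>z :: complex ^ 'n. norm z < 1 \<Longrightarrow>
    (\<integral>\<^sup>+u. ennreal (cmod (1 - hprod z u) powr - ?m * (1 - (norm u)\<^sup>2) powr - (\<epsilon> * p)) \<partial>?V)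
      \<le> ennreal (C1 * (1 - (norm z)\<^sup>2) powr - (\<epsilon> * p))"
    using Forelli_Rudin_v_alpha[OF \<alpha>, of "\<epsilon> * p", where 'n = 'n] \<epsilon> p by auto
  obtain C2 where C2: "0 < C2" "\<And>z :: complex ^ 'n. norm z < 1 \<Longrightarrow>
    (\<integral>\<^sup>+u. ennreal (cmod (1 - hprod z u) powr - ?m * (1 - (norm u)\<^sup>2) powr - (\<epsilon> * p')) \<partial>?V)
      \<le> ennreal (C2 * (1 - (norm z)\<^sup>2) powr - (\<epsilon> * p'))"
    using Forelli_Rudin_v_alpha[OF \<alpha>, of "\<epsilon> * p'", where 'n = 'n] \<epsilon> p' by auto
  define h :: "complex ^ 'n \<Rightarrow> real" where "h u = (1 - (norm u)\<^sup>2) powr - \<epsilon>" for u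
  have h_pos: "0 < h u" if "norm u < 1" for u
  proof -
    have "(norm u)\<^sup>2 < 1" using that by (simp add: abs_square_less_1)
    then show ?thesis by (simp add: h_def)
  qed
  have h_powr: "h u powr r = (1 - (norm u)\<^sup>2) powr - (\<epsilon> * r)" for u r
    by (simp add: h_def powr_powr)
  have [measurable]: "h \<in> borel_measurable ?V"
    unfolding h_def by measurable
  define K where "K = (1 + C2) powr p * C1"
  have K: "0 < K" using C1 C2 by (simp add: K_def)
  show ?thesis
  proof (intro exI[of _ K] conjI ballI K)
    fix f :: "complex ^ 'n \<Rightarrow> complex" assume f: "f \<in> Lp ?V p"
    then have [measurable]: "f \<in> borel_measurable ?V" and fp: "integrable ?V (\<lambda>u. cmod (f u) powr p)"
      by (auto simp: Lp_def)
    have fi: "integrable ?V f"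
      using Lp_integrable_norm[OF finite_measure_axioms p f] by simp
    have [measurable]: "Bop \<alpha> f \<in> borel_measurable ?V"
      unfolding Bop_def by measurable
    have Bop_nn: "Bop \<alpha> f z = enn2real (\<integral>\<^sup>+u. ennreal (cmod (1 - hprod z u) powr - ?m * cmod (f u)) \<partial>?V)" if "norm z < 1" for z
      unfolding Bop_def by (rule integral_eq_nn_integral) auto
    have Bop0: "0 \<le> Bop \<alpha> f z" for z
      unfolding Bop_def by (rule integral_nonneg_AE) simp
    have "(\<integral>\<^sup>+z. ennreal (Bop \<alpha> f z powr p) \<partial>?V)
      \<le> (\<integral>\<^sup>+z. ennreal ((1 + C2) powr p) * (\<integral>\<^sup>+u. ennreal (cmod (1 - hprod z u) powr - ?m * h z powr p * (cmod (f u) powr p * h u powr - p)) \<partial>?V) \<partial>?V)"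
    proof (intro nn_integral_mono)
      fix z assume "z \<in> space ?V"
      then have z: "norm z < 1" by simp
      have "ennreal (Bop \<alpha> f z powr p) \<le> ennreal ((1 + C2) powr p * h z powr p) *
          (\<integral>\<^sup>+u. ennreal (cmod (1 - hprod z u) powr - ?m * (cmod (f u) powr p * h u powr - p)) \<partial>?V)"
        unfolding Bop_nn[OF z]
        using C2(2)[OF z] h_pos[OF z]
        by (intro powr_nn_integral_mult_le[OF _ _ _ _ _ _ p p'] C2(1))
          (auto simp: h_powr h_pos mult.commute)
      also have "\<dots> = ennreal ((1 + C2) powr p) * (\<integral>\<^sup>+u. ennreal (h z powr p) * ennreal (cmod (1 - hprod z u) powr - ?m * (cmod (f u) powr p * h u powr - p)) \<partial>?V)"
        by (subst nn_integral_cmult) (auto simp: ennreal_mult mult.assoc)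
      finally show "ennreal (Bop \<alpha> f z powr p) \<le> ennreal ((1 + C2) powr p) * (\<integral>\<^sup>+u. ennreal (cmod (1 - hprod z u) powr - ?m * h z powr p * (cmod (f u) powr p * h u powr - p)) \<partial>?V)"
        by (simp add: ennreal_mult[symmetric] mult_ac)
    qed
    also have "\<dots> = ennreal ((1 + C2) powr p) * (\<integral>\<^sup>+z. (\<integral>\<^sup>+u. ennreal (cmod (1 - hprod z u) powr - ?m * h z powr p * (cmod (f u) powr p * h u powr - p)) \<partial>?V) \<partial>?V)"
      by (intro nn_integral_cmult) measurable
    also have "(\<integral>\<^sup>+z. (\<integral>\<^sup>+u. ennreal (cmod (1 - hprod z u) powr - ?m * h z powr p * (cmod (f u) powr p * h u powr - p)) \<partial>?V) \<partial>?V)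
       = (\<integral>\<^sup>+u. (\<integral>\<^sup>+z. ennreal (cmod (1 - hprod z u) powr - ?m * h z powr p * (cmod (f u) powr p * h u powr - p)) \<partial>?V) \<partial>?V)"
      by (rule Fubini'[symmetric]) measurable
    also have "\<dots> \<le> (\<integral>\<^sup>+u. ennreal C1 * ennreal (cmod (f u) powr p) \<partial>?V)"
    proof (intro nn_integral_mono)
      fix u assume "u \<in> space ?V"
      then have u: "norm u < 1" by simp
      have "(\<integral>\<^sup>+z. ennreal (cmod (1 - hprod z u) powr - ?m * h z powr p * (cmod (f u) powr p * h u powr - p)) \<partial>?V)
        = (\<integral>\<^sup>+z. ennreal (cmod (1 - hprod u z) powr - ?m * (1 - (norm z)\<^sup>2) powr - (\<epsilon> * p)) * ennreal (cmod (f u) powr p * h u powr - p) \<partial>?V)"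
        by (intro nn_integral_cong) (simp add: ennreal_mult[symmetric] h_powr cmod_one_minus_hprod_commute[of _ u])
      also have "\<dots> = (\<integral>\<^sup>+z. ennreal (cmod (1 - hprod u z) powr - ?m * (1 - (norm z)\<^sup>2) powr - (\<epsilon> * p)) \<partial>?V) * ennreal (cmod (f u) powr p * h u powr - p)"
        by (intro nn_integral_multc) measurable
      also have "\<dots> \<le> ennreal (C1 * (1 - (norm u)\<^sup>2) powr - (\<epsilon> * p)) * ennreal (cmod (f u) powr p * h u powr - p)"
        by (intro mult_right_mono C1(2) u) auto
      also have "\<dots> = ennreal (C1 * h u powr p * (cmod (f u) powr p * h u powr - p))"
        using C1 by (simp add: ennreal_mult[symmetric] h_powr)
      also have "C1 * h u powr p * (cmod (f u) powr p * h u powr - p) = C1 * cmod (f u) powr p"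
        using h_pos[OF u] by (simp add: powr_minus)
      finally show "(\<integral>\<^sup>+z. ennreal (cmod (1 - hprod z u) powr - ?m * h z powr p * (cmod (f u) powr p * h u powr - p)) \<partial>?V)
        \<le> ennreal C1 * ennreal (cmod (f u) powr p)"
        using C1 by (simp add: ennreal_mult)
    qed
    also have "(\<integral>\<^sup>+u. ennreal C1 * ennreal (cmod (f u) powr p) \<partial>?V) = ennreal C1 * ennreal (\<integral>u. cmod (f u) powr p \<partial>?V)"
      using fp by (subst nn_integral_cmult) (auto simp: nn_integral_eq_integral)
    finally have "(\<integral>\<^sup>+z. ennreal (Bop \<alpha> f z powr p) \<partial>?V) \<le> ennreal ((1 + C2) powr p) * (ennreal C1 * ennreal (\<integral>u. cmod (f u) powr p \<partial>?V))"
      by (simp add: mult_left_mono)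
    also have "\<dots> = ennreal (K * (\<integral>u. cmod (f u) powr p \<partial>?V))"
      using C1 by (simp add: K_def ennreal_mult[symmetric] mult.assoc)
    finally have main: "(\<integral>\<^sup>+z. ennreal (Bop \<alpha> f z powr p) \<partial>?V) \<le> ennreal (K * (\<integral>u. cmod (f u) powr p \<partial>?V))" .
    have int: "integrable ?V (\<lambda>z. Bop \<alpha> f z powr p)"
      using le_less_trans[OF main] by (intro integrableI_nonneg) auto
    then show "Bop \<alpha> f \<in> Lp ?V p"
      by (simp add: Lp_def Bop0)
    show "(\<integral>z. Bop \<alpha> f z powr p \<partial>?V) \<le> K * (\<integral>z. cmod (f z) powr p \<partial>?V)"
      using main K by (subst (asm) nn_integral_eq_integral[OF int]) (auto simp: ennreal_le_iff)
  qed
qed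

section \<open>A calculus of size and smoothness orders\<close>

text \<open>Two nearby pairs \<open>(z, u)\<close> and \<open>(z', u')\<close>: \<open>d\<close> is the common size of
  \<open>\<bar>1 - hprod z u\<bar>\<close> and \<open>r\<close> plays the role of the square root of \<open>rho\<close>, the scale on which all
  ingredients of the kernels are Lipschitz.\<close>

definition near ::
  "real \<Rightarrow> complex ^ 'n::finite \<Rightarrow> complex ^ 'n \<Rightarrow> complex ^ 'n \<Rightarrow> complex ^ 'n \<Rightarrow> real \<Rightarrow> real \<Rightarrow> bool"
where
  "near A z u z' u' r d \<longleftrightarrow> norm z < 1 \<and> norm u < 1 \<and> norm z' < 1 \<and> norm u' < 1 \<and> 0 \<le> r \<and> 0 < d \<and> d \<le> 2 \<and>
     norm (z - z') \<le> A * r \<and> norm (u - u') \<le> A * r \<and> \<bar>sn z - sn z'\<bar> \<le> A * r \<and>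
     cmod (hprod z u - hprod z' u') \<le> A * r * sqrt d \<and>
     d \<le> A * cmod (1 - hprod z u) \<and> cmod (1 - hprod z u) \<le> A * d \<and>
     d \<le> A * cmod (1 - hprod z' u') \<and> cmod (1 - hprod z' u') \<le> A * d"

lemma near_sym: "near A z u z' u' r d \<Longrightarrow> near A z' u' z u r d"
  by (simp add: near_def norm_minus_commute abs_minus_commute)

text \<open>The number \<open>k\<close> is the order of the size and \<open>l\<close> the order of
  the difference quotient in \<open>r\<close>; a drop of 1/2 from \<open>k\<close> to
  \<open>l\<close> corresponds to the loss \<open>r / sqrt d\<close>. As \<open>d\<close> is at most
  2, lowering either order weakens the statement. Uniformity in \<open>w\<close> later turns the
  bounds into norm bounds in \<open>E\<close>.\<close>

definition bnd :: "real \<Rightarrow> real \<Rightarrow> real \<Rightarrow> real \<Rightarrow>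
  (complex ^ 'n::finite \<Rightarrow> complex ^ 'n \<Rightarrow> complex ^ 'n \<Rightarrow> 'b::real_normed_vector) \<Rightarrow> bool" where
  "bnd A R k l X \<longleftrightarrow> (\<exists>C\<ge>0. \<forall>z u z' u' r d w. near A z u z' u' r d \<longrightarrow> norm w \<le> R \<longrightarrow>
     norm (X z u w) \<le> C * d powr k \<and> norm (X z u w - X z' u' w) \<le> C * r * d powr l)"

lemma bndI:
  assumes "\<And>z u z' u' r d w. near A z u z' u' r d \<Longrightarrow> norm w \<le> R \<Longrightarrow> norm (X z u w) \<le> C1 * d powr k"
    and "\<And>z u z' u' r d w. near A z u z' u' r d \<Longrightarrow> norm w \<le> R \<Longrightarrow>
      norm (X z u w - X z' u' w) \<le> C2 * r * d powr l"
  shows "bnd A R k l X"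
  unfolding bnd_def
proof (intro exI[of _ "max 0 (max C1 C2)"] conjI allI impI)
  fix z u z' u' w :: "complex ^ 'a" and r d :: real
  assume *: "near A z u z' u' r d" "norm w \<le> R"
  then have "0 \<le> r" by (simp add: near_def)
  have "C1 * d powr k \<le> max 0 (max C1 C2) * d powr k"
    by (intro mult_right_mono) auto
  then show "norm (X z u w) \<le> max 0 (max C1 C2) * d powr k"
    using assms(1)[OF *] by linarith
  have "C2 * (r * d powr l) \<le> max 0 (max C1 C2) * (r * d powr l)"
    using \<open>0 \<le> r\<close> by (intro mult_right_mono) auto
  then show "norm (X z u w - X z' u' w) \<le> max 0 (max C1 C2) * r * d powr l"
    using assms(2)[OF *] by (simp add: mult.assoc)
qed simp

text \<open>By symmetry of \<open>near\<close> the size bound holds at the second pair too, with the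
  same \<open>d\<close>.\<close>

lemma bndD:
  assumes "bnd A R k l X"
  shows "\<exists>C\<ge>0. \<forall>z u z' u' r d w. near A z u z' u' r d \<and> norm w \<le> R \<longrightarrow>
    norm (X z u w) \<le> C * d powr k \<and> norm (X z' u' w) \<le> C * d powr k \<and>
    norm (X z u w - X z' u' w) \<le> C * r * d powr l"
proof -
  obtain C where C: "0 \<le> C" "\<forall>z u z' u' r d w. near A z u z' u' r d \<longrightarrow> norm w \<le> R \<longrightarrow>
     norm (X z u w) \<le> C * d powr k \<and> norm (X z u w - X z' u' w) \<le> C * r * d powr l"
    using assms unfolding bnd_def by blast
  then show ?thesis
    by (intro exI[of _ C]) (meson near_sym)
qed

lemma powr_le_2_powr:
  fixes d k k' :: real
  assumes "0 < d" "d \<le> 2" "k' \<le> k"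
  shows "d powr k \<le> 2 powr (k - k') * d powr k'"
proof -
  have "d powr k = d powr (k - k') * d powr k'"
    by (simp add: powr_add[symmetric])
  also have "\<dots> \<le> 2 powr (k - k') * d powr k'"
    using assms by (intro mult_right_mono powr_mono2) auto
  finally show ?thesis .
qed

lemma bnd_mono:
  fixes X :: "complex ^ 'n::finite \<Rightarrow> complex ^ 'n \<Rightarrow> complex ^ 'n \<Rightarrow> 'b::real_normed_vector"
  assumes "bnd A R k l X" "k' \<le> k" "l' \<le> l"
  shows "bnd A R k' l' X"
proof -
  from bndD[OF assms(1)] obtain C where C: "0 \<le> C"
    "\<And>z u z' u' r d w. near A z u z' u' r d \<Longrightarrow> norm w \<le> R \<Longrightarrow> norm (X z u w) \<le> C * d powr k"
    "\<And>z u z' u' r d w. near A z u z' u' r d \<Longrightarrow> norm w \<le> R \<Longrightarrow> norm (X z u w - X z' u' w) \<le> C * r * d powr l"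
    by blast
  show ?thesis
  proof (rule bndI)
    fix z u z' u' w :: "complex ^ 'n" and r d assume *: "near A z u z' u' r d" "norm w \<le> R"
    then have d: "0 < d" "d \<le> 2" "0 \<le> r" by (simp_all add: near_def)
    have "C * d powr k \<le> C * (2 powr (k - k') * d powr k')"
      using C d assms by (intro mult_left_mono powr_le_2_powr) auto
    then show "norm (X z u w) \<le> (C * 2 powr (k - k')) * d powr k'"
      using C(2)[OF *] by simp
    have "(C * r) * d powr l \<le> (C * r) * (2 powr (l - l') * d powr l')"
      using C d assms by (intro mult_left_mono powr_le_2_powr) auto
    then show "norm (X z u w - X z' u' w) \<le> (C * 2 powr (l - l')) * r * d powr l'"
      using C(3)[OF *] by (simp add: mult_ac)
  qed
qed

text \<open>The calculus sees only how a factor is built. For factors such as \<open>sn z\<close> or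
  \<open>G z u\<close>, which vanish like \<open>sqrt d\<close> for geometric reasons, a better size
  order is inserted here by hand.\<close>

lemma bnd_improve:
  fixes X :: "complex ^ 'n::finite \<Rightarrow> complex ^ 'n \<Rightarrow> complex ^ 'n \<Rightarrow> 'b::real_normed_vector"
  assumes "bnd A R k l X"
    and "\<And>z u z' u' r d w. near A z u z' u' r d \<Longrightarrow> norm w \<le> R \<Longrightarrow> norm (X z u w) \<le> C * d powr k'"
  shows "bnd A R k' l X"
proof -
  from bndD[OF assms(1)] obtain D where "0 \<le> D"
    "\<And>z u z' u' r d w. near A z u z' u' r d \<Longrightarrow> norm w \<le> R \<Longrightarrow> norm (X z u w - X z' u' w) \<le> D * r * d powr l"
    by blast
  with assms(2) show ?thesis
    by (intro bndI)
qed

lemma bnd_cong: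
  fixes X Y :: "complex ^ 'n::finite \<Rightarrow> complex ^ 'n \<Rightarrow> complex ^ 'n \<Rightarrow> 'b::real_normed_vector"
  assumes "bnd A R k l X"
    and "\<And>z u w. norm z < 1 \<Longrightarrow> norm u < 1 \<Longrightarrow> norm w \<le> R \<Longrightarrow> Y z u w = X z u w"
  shows "bnd A R k l Y"
proof -
  from bndD[OF assms(1)] obtain C where C: "0 \<le> C"
    "\<And>z u z' u' r d w. near A z u z' u' r d \<Longrightarrow> norm w \<le> R \<Longrightarrow> norm (X z u w) \<le> C * d powr k"
    "\<And>z u z' u' r d w. near A z u z' u' r d \<Longrightarrow> norm w \<le> R \<Longrightarrow> norm (X z u w - X z' u' w) \<le> C * r * d powr l"
    by blast
  show ?thesis
    by (rule bndI[of _ _ _ C _ C]) (use C assms(2) in \<open>auto simp: near_def\<close>)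
qed

lemma bnd_const:
  assumes "\<And>w. norm w \<le> R \<Longrightarrow> norm (X w) \<le> C"
  shows "bnd A R 0 l (\<lambda>z u w. X w)"
  by (rule bndI[where ?C1.0 = C and ?C2.0 = 0]) (use assms in \<open>auto simp: near_def\<close>)

lemma bnd_add:
  fixes X Y :: "complex ^ 'n::finite \<Rightarrow> complex ^ 'n \<Rightarrow> complex ^ 'n \<Rightarrow> 'b::real_normed_vector"
  assumes "bnd A R k l X" "bnd A R k l Y"
  shows "bnd A R k l (\<lambda>z u w. X z u w + Y z u w)"
proof -
  from bndD[OF assms(1)] obtain C where C: "0 \<le> C"
    "\<And>z u z' u' r d w. near A z u z' u' r d \<Longrightarrow> norm w \<le> R \<Longrightarrow> norm (X z u w) \<le> C * d powr k"
    "\<And>z u z' u' r d w. near A z u z' u' r d \<Longrightarrow> norm w \<le> R \<Longrightarrow> norm (X z u w - X z' u' w) \<le> C * r * d powr l"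
    by blast
  from bndD[OF assms(2)] obtain D where D: "0 \<le> D"
    "\<And>z u z' u' r d w. near A z u z' u' r d \<Longrightarrow> norm w \<le> R \<Longrightarrow> norm (Y z u w) \<le> D * d powr k"
    "\<And>z u z' u' r d w. near A z u z' u' r d \<Longrightarrow> norm w \<le> R \<Longrightarrow> norm (Y z u w - Y z' u' w) \<le> D * r * d powr l"
    by blast
  show ?thesis
  proof (rule bndI)
    fix z u z' u' w :: "complex ^ 'n" and r d assume *: "near A z u z' u' r d" "norm w \<le> R"
    show "norm (X z u w + Y z u w) \<le> (C + D) * d powr k"
      using C(2)[OF *] D(2)[OF *] by (simp add: distrib_right norm_triangle_le)
    have "X z u w + Y z u w - (X z' u' w + Y z' u' w) = (X z u w - X z' u' w) + (Y z u w - Y z' u' w)"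
      by simp
    then show "norm (X z u w + Y z u w - (X z' u' w + Y z' u' w)) \<le> (C + D) * r * d powr l"
      using C(3)[OF *] D(3)[OF *] by (simp only: distrib_right norm_triangle_le add_mono)
  qed
qed

text \<open>The Leibniz rule: the difference of products is split so that one factor changes at a
  time, and \<open>m\<close> may not exceed the order of either term.\<close>

lemma bnd_bilinear:
  fixes X :: "complex ^ 'n::finite \<Rightarrow> complex ^ 'n \<Rightarrow> complex ^ 'n \<Rightarrow> 'b::real_normed_vector" and Y :: "complex ^ 'n::finite \<Rightarrow> complex ^ 'n \<Rightarrow> complex ^ 'n \<Rightarrow> 'c::real_normed_vector"
    and pr :: "'b \<Rightarrow> 'c \<Rightarrow> 'd::real_normed_vector"
  assumes bil: "bounded_bilinear pr" and "bnd A R k l X" "bnd A R k' l' Y"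
    and "m \<le> l + k'" "m \<le> k + l'"
  shows "bnd A R (k + k') m (\<lambda>z u w. pr (X z u w) (Y z u w))"
proof -
  from bndD[OF assms(2)] obtain C where C: "0 \<le> C"
    "\<And>z u z' u' r d w. near A z u z' u' r d \<Longrightarrow> norm w \<le> R \<Longrightarrow> norm (X z u w) \<le> C * d powr k"
    "\<And>z u z' u' r d w. near A z u z' u' r d \<Longrightarrow> norm w \<le> R \<Longrightarrow> norm (X z' u' w) \<le> C * d powr k"
    "\<And>z u z' u' r d w. near A z u z' u' r d \<Longrightarrow> norm w \<le> R \<Longrightarrow> norm (X z u w - X z' u' w) \<le> C * r * d powr l"
    by blast
  from bndD[OF assms(3)] obtain D where D: "0 \<le> D"
    "\<And>z u z' u' r d w. near A z u z' u' r d \<Longrightarrow> norm w \<le> R \<Longrightarrow> norm (Y z u w) \<le> D * d powr k'"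
    "\<And>z u z' u' r d w. near A z u z' u' r d \<Longrightarrow> norm w \<le> R \<Longrightarrow> norm (Y z' u' w) \<le> D * d powr k'"
    "\<And>z u z' u' r d w. near A z u z' u' r d \<Longrightarrow> norm w \<le> R \<Longrightarrow> norm (Y z u w - Y z' u' w) \<le> D * r * d powr l'"
    by blast
  obtain K where K: "0 \<le> K" "\<And>a b. norm (pr a b) \<le> norm a * norm b * K"
    using bounded_bilinear.nonneg_bounded[OF bil] by blast
  show ?thesis
  proof (rule bndI)
    fix z u z' u' w :: "complex ^ 'n" and r d assume *: "near A z u z' u' r d" "norm w \<le> R"
    then have d: "0 < d" "d \<le> 2" "0 \<le> r" by (simp_all add: near_def)
    have "norm (pr (X z u w) (Y z u w)) \<le> (C * d powr k) * (D * d powr k') * K"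
      using K C(1) D(1) C(2)[OF *] D(2)[OF *]
      by (intro order_trans[OF K(2)] mult_right_mono mult_mono) auto
    then show "norm (pr (X z u w) (Y z u w)) \<le> (C * D * K) * d powr (k + k')"
      by (simp add: powr_add mult_ac)
    have "norm (pr (X z u w) (Y z u w) - pr (X z' u' w) (Y z' u' w))
       = norm (pr (X z u w - X z' u' w) (Y z u w) + pr (X z' u' w) (Y z u w - Y z' u' w))"
      by (simp add: bounded_bilinear.diff_left[OF bil] bounded_bilinear.diff_right[OF bil])
    also have "\<dots> \<le> (C * r * d powr l) * (D * d powr k') * K + (C * d powr k) * (D * r * d powr l') * K"
      using K C(1) D(1) C(3,4)[OF *] D(2,4)[OF *] d
      by (intro order_trans[OF norm_triangle_ineq] add_mono order_trans[OF K(2)] mult_right_mono mult_mono) auto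
    also have "\<dots> = (C * D * K * r) * d powr (l + k') + (C * D * K * r) * d powr (k + l')"
      by (simp add: powr_add mult_ac)
    also have "\<dots> \<le> (C * D * K * r) * (2 powr (l + k' - m) * d powr m) + (C * D * K * r) * (2 powr (k + l' - m) * d powr m)"
      using C(1) D(1) K(1) d assms(4,5) by (intro add_mono mult_left_mono powr_le_2_powr) auto
    also have "\<dots> = (C * D * K * (2 powr (l + k' - m) + 2 powr (k + l' - m))) * r * d powr m"
      by (simp add: algebra_simps)
    finally show "norm (pr (X z u w) (Y z u w) - pr (X z' u' w) (Y z' u' w))
      \<le> (C * D * K * (2 powr (l + k' - m) + 2 powr (k + l' - m))) * r * d powr m" .
  qed
qed

lemma bnd_linear:
  fixes X :: "complex ^ 'n::finite \<Rightarrow> complex ^ 'n \<Rightarrow> complex ^ 'n \<Rightarrow> 'b::real_normed_vector"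
  assumes lin: "bounded_linear f" and "bnd A R k l X"
  shows "bnd A R k l (\<lambda>z u w. f (X z u w))"
proof -
  from bndD[OF assms(2)] obtain C where C: "0 \<le> C"
    "\<And>z u z' u' r d w. near A z u z' u' r d \<Longrightarrow> norm w \<le> R \<Longrightarrow> norm (X z u w) \<le> C * d powr k"
    "\<And>z u z' u' r d w. near A z u z' u' r d \<Longrightarrow> norm w \<le> R \<Longrightarrow> norm (X z u w - X z' u' w) \<le> C * r * d powr l"
    by blast
  obtain K where K: "0 \<le> K" "\<And>a. norm (f a) \<le> norm a * K"
    using bounded_linear.nonneg_bounded[OF lin] by blast
  show ?thesis
  proof (rule bndI)
    fix z u z' u' w :: "complex ^ 'n" and r d assume *: "near A z u z' u' r d" "norm w \<le> R"
    show "norm (f (X z u w)) \<le> (K * C) * d powr k"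
      using mult_left_mono[OF C(2)[OF *] K(1)] K(2)[of "X z u w"] by (simp add: mult_ac)
    have "f (X z u w) - f (X z' u' w) = f (X z u w - X z' u' w)"
      by (simp add: linear_diff bounded_linear.linear[OF lin])
    then show "norm (f (X z u w) - f (X z' u' w)) \<le> (K * C) * r * d powr l"
      using mult_left_mono[OF C(3)[OF *] K(1)] K(2)[of "X z u w - X z' u' w"] by (simp add: mult_ac)
  qed
qed

lemma bnd_norm:
  fixes X :: "complex ^ 'n::finite \<Rightarrow> complex ^ 'n \<Rightarrow> complex ^ 'n \<Rightarrow> 'b::real_normed_vector"
  assumes "bnd A R k l X"
  shows "bnd A R k l (\<lambda>z u w. norm (X z u w))"
proof -
  from bndD[OF assms] obtain C where C: "0 \<le> C"
    "\<And>z u z' u' r d w. near A z u z' u' r d \<Longrightarrow> norm w \<le> R \<Longrightarrow> norm (X z u w) \<le> C * d powr k"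
    "\<And>z u z' u' r d w. near A z u z' u' r d \<Longrightarrow> norm w \<le> R \<Longrightarrow> norm (X z u w - X z' u' w) \<le> C * r * d powr l"
    by blast
  show ?thesis
  proof (rule bndI)
    fix z u z' u' w :: "complex ^ 'n" and r d assume *: "near A z u z' u' r d" "norm w \<le> R"
    show "norm (norm (X z u w)) \<le> C * d powr k"
      using C(2)[OF *] by simp
    show "norm (norm (X z u w) - norm (X z' u' w)) \<le> C * r * d powr l"
      using C(3)[OF *] norm_triangle_ineq3[of "X z u w" "X z' u' w"] by simp
  qed
qed

text \<open>Adding the two constants covers both signs of \<open>b\<close>: the upper bound for
  \<open>t\<close> is used when \<open>b\<close> is nonnegative, the lower one when it is
  negative.\<close>

lemma powr_le_of_bounds:
  fixes lo hi m t b :: real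
  assumes "0 < lo" "0 < m" "lo * m \<le> t" "t \<le> hi * m"
  shows "t powr b \<le> (lo powr b + hi powr b) * m powr b"
proof -
  have t: "0 < t" using assms by (meson less_le_trans mult_pos_pos)
  then have "0 < hi * m" using assms by linarith
  then have hi: "0 < hi" using assms by (simp add: zero_less_mult_iff)
  show ?thesis
  proof (cases "0 \<le> b")
    case True
    have "t powr b \<le> (hi * m) powr b"
      using True assms t by (intro powr_mono2) auto
    also have "\<dots> = hi powr b * m powr b" by (rule powr_mult)
    finally show ?thesis by (simp add: distrib_right add_increasing)
  next
    case False
    then have "t powr b \<le> (lo * m) powr b"
      using assms by (intro powr_mono2') auto
    also have "\<dots> = lo powr b * m powr b" by (rule powr_mult)
    finally show ?thesis by (simp add: distrib_right add_increasing2)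
  qed
qed

lemma cmod_powr_real: "x \<noteq> 0 \<Longrightarrow> cmod (x powr complex_of_real a) = cmod x powr a"
  by (simp add: powr_def)

text \<open>If \<open>x\<close> and \<open>y\<close> are at least \<open>lo * m / 2\<close> apart,
  their sizes suffice. Otherwise the segment between them stays in the right half plane and outside
  the disc of radius \<open>lo * m / 2\<close>, where the mean value inequality applies to the
  principal branch. The two summands of the constant belong to these two cases.\<close>

lemma cpowr_diff_le:
  fixes x y :: complex
  assumes lo: "0 < lo" and m: "0 < m" and x: "0 < Re x" "lo * m \<le> cmod x" "cmod x \<le> hi * m"
    and y: "0 < Re y" "lo * m \<le> cmod y" "cmod y \<le> hi * m"
  shows "cmod (x powr complex_of_real a - y powr complex_of_real a) \<le>
    (2 * (lo powr a + hi powr a) * (2 / lo) + \<bar>a\<bar> * ((lo / 2) powr (a - 1) + hi powr (a - 1))) * m powr (a - 1) * cmod (x - y)"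
    (is "_ \<le> (?P + ?Q) * _ * _")
proof -
  have nn: "0 \<le> ?P" "0 \<le> ?Q"
    using lo by (auto intro!: mult_nonneg_nonneg add_nonneg_nonneg)
  show ?thesis
  proof (cases "cmod (x - y) \<ge> lo * m / 2")
    case True
    have "cmod (x powr complex_of_real a - y powr complex_of_real a) \<le> cmod x powr a + cmod y powr a"
    proof -
      have "x \<noteq> 0" "y \<noteq> 0" using x(1) y(1) by auto
      then show ?thesis
        using norm_triangle_ineq4[of "x powr complex_of_real a" "y powr complex_of_real a"]
        by (simp add: cmod_powr_real)
    qed
    also have "\<dots> \<le> (lo powr a + hi powr a) * m powr a + (lo powr a + hi powr a) * m powr a"
      using assms by (intro add_mono powr_le_of_bounds) auto
    also have "\<dots> = 2 * (lo powr a + hi powr a) * (2 / lo) * m powr (a - 1) * (lo * m / 2)"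
      using lo m by (simp add: powr_diff)
    also have "\<dots> \<le> ?P * m powr (a - 1) * cmod (x - y)"
      using nn True lo by (intro mult_left_mono mult_nonneg_nonneg) auto
    also have "\<dots> \<le> (?P + ?Q) * m powr (a - 1) * cmod (x - y)"
      using nn by (intro mult_right_mono) auto
    finally show ?thesis .
  next
    case False
    define S where "S = closed_segment x y"
    have S: "0 < Re t \<and> lo / 2 * m \<le> cmod t \<and> cmod t \<le> hi * m" if "t \<in> S" for t
    proof -
      have "t \<in> closed_segment x y" using that by (simp add: S_def)
      then obtain v where v: "0 \<le> v" "v \<le> 1" "t = (1 - v) *\<^sub>R x + v *\<^sub>R y"
        unfolding in_segment by blast
      have re: "0 < Re t"
      proof (cases "v = 0")
        case False
        then have "0 < v * Re y" using v(1) y(1) by simp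
        moreover have "0 \<le> (1 - v) * Re x" using v(2) x(1) by simp
        ultimately show ?thesis by (simp add: v(3) add_nonneg_pos)
      qed (use v(3) x(1) in simp)
      have "cmod (x - t) \<le> cmod (x - y)"
        using that segment_bound(1)[of t x y] by (simp add: S_def norm_minus_commute)
      then have lower: "lo / 2 * m \<le> cmod t"
        using False x(2) norm_triangle_ineq2[of x "x - t"] by (simp add: algebra_simps)
      have "cmod t \<le> (1 - v) * cmod x + v * cmod y"
        using v norm_triangle_ineq[of "(1 - v) *\<^sub>R x" "v *\<^sub>R y"] by simp
      also have "\<dots> \<le> (1 - v) * (hi * m) + v * (hi * m)"
        using v x y by (intro add_mono mult_left_mono) auto
      finally show ?thesis using re lower by (simp add: algebra_simps)
    qed
    have "cmod (x powr complex_of_real a - y powr complex_of_real a) \<le> (?Q * m powr (a - 1)) * cmod (x - y)"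
    proof (rule field_differentiable_bound)
      show "convex S" "x \<in> S" "y \<in> S" by (auto simp: S_def)
      fix t assume t: "t \<in> S"
      then have "t \<notin> \<real>\<^sub>\<le>\<^sub>0" using S[OF t] by (auto elim!: nonpos_Reals_cases)
      then show "((\<lambda>t. t powr complex_of_real a) has_field_derivative complex_of_real a * t powr (complex_of_real a - 1)) (at t within S)"
        using has_field_derivative_powr has_field_derivative_at_within by blast
      have "cmod (complex_of_real a * t powr complex_of_real (a - 1)) = \<bar>a\<bar> * cmod t powr (a - 1)"
        using S[OF t] by (subst norm_mult, subst cmod_powr_real) auto
      also have "\<dots> \<le> \<bar>a\<bar> * (((lo / 2) powr (a - 1) + hi powr (a - 1)) * m powr (a - 1))"
        using S[OF t] lo m by (intro mult_left_mono powr_le_of_bounds) auto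
      finally show "cmod (complex_of_real a * t powr (complex_of_real a - 1)) \<le> ?Q * m powr (a - 1)"
        by (simp add: mult.assoc)
    qed
    also have "\<dots> \<le> (?P + ?Q) * m powr (a - 1) * cmod (x - y)"
      using nn by (intro mult_right_mono) auto
    finally show ?thesis .
  qed
qed

text \<open>Together with \<open>bnd\<close> of the same order this pins the modulus to
  \<open>d powr k\<close> from both sides, which inverses and negative powers require.\<close>

definition lbnd :: "real \<Rightarrow> real \<Rightarrow> real \<Rightarrow>
  (complex ^ 'n::finite \<Rightarrow> complex ^ 'n \<Rightarrow> complex ^ 'n \<Rightarrow> 'b::real_normed_vector) \<Rightarrow> bool" where
  "lbnd A R k X \<longleftrightarrow> (\<exists>c>0. \<forall>z u z' u' r d w. near A z u z' u' r d \<longrightarrow> norm w \<le> R \<longrightarrow>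
     c * d powr k \<le> norm (X z u w))"

text \<open>A chain rule for orders: the derivative of the power has order
  \<open>k * (a - 1)\<close>, to which the order \<open>l\<close> of the inner change is
  added.\<close>

lemma bnd_cpowr:
  fixes X :: "complex ^ 'n::finite \<Rightarrow> complex ^ 'n \<Rightarrow> complex ^ 'n \<Rightarrow> complex"
  assumes "bnd A R k l X" "lbnd A R k X"
    and re: "\<And>z u w. norm z < 1 \<Longrightarrow> norm u < 1 \<Longrightarrow> norm w \<le> R \<Longrightarrow> 0 < Re (X z u w)"
  shows "bnd A R (k * a) (k * (a - 1) + l) (\<lambda>z u w. X z u w powr complex_of_real a)"
proof -
  from bndD[OF assms(1)] obtain C where C: "0 \<le> C"
    "\<And>z u z' u' r d w. near A z u z' u' r d \<Longrightarrow> norm w \<le> R \<Longrightarrow> norm (X z u w) \<le> C * d powr k"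
    "\<And>z u z' u' r d w. near A z u z' u' r d \<Longrightarrow> norm w \<le> R \<Longrightarrow> norm (X z' u' w) \<le> C * d powr k"
    "\<And>z u z' u' r d w. near A z u z' u' r d \<Longrightarrow> norm w \<le> R \<Longrightarrow> norm (X z u w - X z' u' w) \<le> C * r * d powr l"
    by blast
  from assms(2) obtain c where c: "0 < c"
    "\<And>z u z' u' r d w. near A z u z' u' r d \<Longrightarrow> norm w \<le> R \<Longrightarrow> c * d powr k \<le> norm (X z u w)"
    unfolding lbnd_def by blast
  define P where "P = 2 * (c powr a + C powr a) * (2 / c) + \<bar>a\<bar> * ((c / 2) powr (a - 1) + C powr (a - 1))"
  have P: "0 \<le> P"
    using c unfolding P_def by (intro add_nonneg_nonneg mult_nonneg_nonneg) auto
  show ?thesis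
  proof (rule bndI)
    fix z u z' u' w :: "complex ^ 'n" and r d assume *: "near A z u z' u' r d" "norm w \<le> R"
    then have d: "0 < d" "d \<le> 2" "0 \<le> r" and pts: "norm z < 1" "norm u < 1" "norm z' < 1" "norm u' < 1"
      by (simp_all add: near_def)
    have x: "0 < Re (X z u w)" "0 < Re (X z' u' w)" using re pts * by auto
    have "cmod (X z u w powr complex_of_real a) = cmod (X z u w) powr a"
      using x by (intro cmod_powr_real) auto
    also have "\<dots> \<le> (c powr a + C powr a) * (d powr k) powr a"
      using c(1) c(2)[OF *] C(2)[OF *] d by (intro powr_le_of_bounds) auto
    finally show "cmod (X z u w powr complex_of_real a) \<le> (c powr a + C powr a) * d powr (k * a)"
      by (simp add: powr_powr)
    have "cmod (X z u w powr complex_of_real a - X z' u' w powr complex_of_real a)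
       \<le> P * (d powr k) powr (a - 1) * cmod (X z u w - X z' u' w)"
      unfolding P_def using c(1) c(2)[OF *] c(2)[OF near_sym[OF *(1)] *(2)] C(2,3)[OF *] d x
      by (intro cpowr_diff_le) auto
    also have "\<dots> \<le> P * (d powr k) powr (a - 1) * (C * r * d powr l)"
      using P C(4)[OF *] by (intro mult_left_mono) auto
    finally show "cmod (X z u w powr complex_of_real a - X z' u' w powr complex_of_real a)
      \<le> (P * C) * r * d powr (k * (a - 1) + l)"
      by (simp add: powr_powr powr_add mult_ac)
  qed
qed

lemma bnd_rpowr:
  fixes X :: "complex ^ 'n::finite \<Rightarrow> complex ^ 'n \<Rightarrow> complex ^ 'n \<Rightarrow> real"
  assumes "bnd A R k l X" "lbnd A R k X"
    and pos: "\<And>z u w. norm z < 1 \<Longrightarrow> norm u < 1 \<Longrightarrow> norm w \<le> R \<Longrightarrow> 0 < X z u w"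
  shows "bnd A R (k * a) (k * (a - 1) + l) (\<lambda>z u w. X z u w powr a)"
proof -
  have "bnd A R (k * a) (k * (a - 1) + l) (\<lambda>z u w. complex_of_real (X z u w) powr complex_of_real a)"
    using assms by (intro bnd_cpowr bnd_linear[OF bounded_linear_of_real]) (auto simp: lbnd_def)
  from bnd_linear[OF bounded_linear_Re this] show ?thesis
    by (rule bnd_cong) (use pos in \<open>simp add: powr_of_real less_imp_le\<close>)
qed

lemma bnd_inverse:
  fixes X :: "complex ^ 'n::finite \<Rightarrow> complex ^ 'n \<Rightarrow> complex ^ 'n \<Rightarrow> 'b::real_normed_field"
  assumes "bnd A R k l X" "lbnd A R k X"
  shows "bnd A R (- k) (l - 2 * k) (\<lambda>z u w. inverse (X z u w))"
proof -
  from bndD[OF assms(1)] obtain C where C: "0 \<le> C"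
    "\<And>z u z' u' r d w. near A z u z' u' r d \<Longrightarrow> norm w \<le> R \<Longrightarrow> norm (X z u w - X z' u' w) \<le> C * r * d powr l"
    by blast
  from assms(2) obtain c where c: "0 < c"
    "\<And>z u z' u' r d w. near A z u z' u' r d \<Longrightarrow> norm w \<le> R \<Longrightarrow> c * d powr k \<le> norm (X z u w)"
    unfolding lbnd_def by blast
  show ?thesis
  proof (rule bndI)
    fix z u z' u' w :: "complex ^ 'n" and r d assume *: "near A z u z' u' r d" "norm w \<le> R"
    then have d: "0 < d" "0 \<le> r" by (simp_all add: near_def)
    have cd: "0 < c * d powr k" using c d by simp
    have x: "c * d powr k \<le> norm (X z u w)" "c * d powr k \<le> norm (X z' u' w)"
      using c(2)[OF *] c(2)[OF near_sym[OF *(1)] *(2)] by auto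
    then have nz: "X z u w \<noteq> 0" "X z' u' w \<noteq> 0" using cd by auto
    have inv: "inverse (norm (X z u w)) \<le> inverse (c * d powr k)" "inverse (norm (X z' u' w)) \<le> inverse (c * d powr k)"
      using x cd by (blast intro: le_imp_inverse_le)+
    have cd': "inverse (c * d powr k) = inverse c * d powr - k"
      by (simp add: powr_minus)
    show "norm (inverse (X z u w)) \<le> inverse c * d powr - k"
      using inv(1) unfolding cd' norm_inverse .
    have "inverse (X z u w) - inverse (X z' u' w) = - (inverse (X z u w) * (X z u w - X z' u' w) * inverse (X z' u' w))"
      using nz by (rule inverse_diff_inverse)
    then have "norm (inverse (X z u w) - inverse (X z' u' w)) = inverse (norm (X z u w)) * norm (X z u w - X z' u' w) * inverse (norm (X z' u' w))"
      by (simp add: norm_mult norm_inverse)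
    also have "\<dots> \<le> inverse (c * d powr k) * (C * r * d powr l) * inverse (c * d powr k)"
      using inv C(2)[OF *] C(1) c d by (intro mult_mono) auto
    also have "\<dots> = (inverse c * C * inverse c) * r * d powr (l - 2 * k)"
    proof -
      have "d powr (l - 2 * k) = d powr l * d powr - k * d powr - k"
        by (simp add: powr_add[symmetric])
      then show ?thesis by (simp only: cd' mult_ac)
    qed
    finally show "norm (inverse (X z u w) - inverse (X z' u' w)) \<le> (inverse c * C * inverse c) * r * d powr (l - 2 * k)" .
  qed
qed

text \<open>Unlike in \<open>bnd_rpowr\<close>, no lower bound is available; the exponent is at least 1 instead.\<close>

lemma bnd_rpowr_ge1:
  fixes X :: "complex ^ 'n::finite \<Rightarrow> complex ^ 'n \<Rightarrow> complex ^ 'n \<Rightarrow> real"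
  assumes "bnd A R k l X" and a: "1 \<le> a"
    and pos: "\<And>z u w. norm z < 1 \<Longrightarrow> norm u < 1 \<Longrightarrow> norm w \<le> R \<Longrightarrow> 0 < X z u w"
  shows "bnd A R (k * a) (k * (a - 1) + l) (\<lambda>z u w. X z u w powr a)"
proof -
  from bndD[OF assms(1)] obtain C where C: "0 \<le> C"
    "\<And>z u z' u' r d w. near A z u z' u' r d \<Longrightarrow> norm w \<le> R \<Longrightarrow> norm (X z u w) \<le> C * d powr k"
    "\<And>z u z' u' r d w. near A z u z' u' r d \<Longrightarrow> norm w \<le> R \<Longrightarrow> norm (X z' u' w) \<le> C * d powr k"
    "\<And>z u z' u' r d w. near A z u z' u' r d \<Longrightarrow> norm w \<le> R \<Longrightarrow> norm (X z u w - X z' u' w) \<le> C * r * d powr l"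
    by blast
  have mvt: "\<bar>x powr a - y powr a\<bar> \<le> a * M powr (a - 1) * \<bar>x - y\<bar>" if "0 < x" "x \<le> M" "0 < y" "y \<le> M" for x y M :: real
  proof -
    have "norm (x powr a - y powr a) \<le> a * M powr (a - 1) * norm (x - y)"
    proof (rule field_differentiable_bound[where S = "{0<..M}" and f' = "\<lambda>t. a * t powr (a - 1)"])
      fix t assume t: "t \<in> {0<..M}"
      then show "((\<lambda>t. t powr a) has_field_derivative a * t powr (a - 1)) (at t within {0<..M})"
        by (auto intro!: derivative_eq_intros)
      show "norm (a * t powr (a - 1)) \<le> a * M powr (a - 1)"
        using t a by (auto simp: abs_mult intro!: mult_left_mono powr_mono2)
    qed (use that in auto)
    then show ?thesis by simp
  qed
  show ?thesis
  proof (rule bndI)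
    fix z u z' u' w :: "complex ^ 'n" and r d assume *: "near A z u z' u' r d" "norm w \<le> R"
    then have d: "0 < d" "d \<le> 2" "0 \<le> r" and pts: "norm z < 1" "norm u < 1" "norm z' < 1" "norm u' < 1"
      by (simp_all add: near_def)
    have x: "0 < X z u w" "0 < X z' u' w" using pos pts * by auto
    have xC: "X z u w \<le> C * d powr k" "X z' u' w \<le> C * d powr k"
      using C(2,3)[OF *] by auto
    have "X z u w powr a \<le> (C * d powr k) powr a"
      using x xC a by (intro powr_mono2) auto
    then show "norm (X z u w powr a) \<le> C powr a * d powr (k * a)"
      by (simp add: powr_mult powr_powr)
    have "\<bar>X z u w powr a - X z' u' w powr a\<bar> \<le> a * (C * d powr k) powr (a - 1) * \<bar>X z u w - X z' u' w\<bar>"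
      using x xC by (intro mvt) auto
    also have "\<dots> \<le> a * (C * d powr k) powr (a - 1) * (C * r * d powr l)"
      using C(4)[OF *] a by (intro mult_left_mono) auto
    finally show "norm (X z u w powr a - X z' u' w powr a) \<le> (a * C powr (a - 1) * C) * r * d powr (k * (a - 1) + l)"
      by (simp add: powr_mult powr_powr powr_add mult_ac)
  qed
qed

section \<open>Orders of the kernels\<close>

lemma bnd_z: "bnd A R 0 0 (\<lambda>z u w. z)"
  by (rule bndI[of _ _ _ 1 _ A]) (auto simp: near_def)

lemma bnd_u: "bnd A R 0 0 (\<lambda>z u w. u)"
  by (rule bndI[of _ _ _ 1 _ A]) (auto simp: near_def)

lemma bnd_w: "bnd A R 0 l (\<lambda>z u w. w)"
  by (rule bnd_const) auto

lemma powr_half_le: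
  fixes x y d A :: real
  assumes "x \<le> sqrt (2 * y)" "y \<le> A * d" "0 < d"
  shows "x \<le> sqrt (2 * A) * d powr (1/2)"
proof -
  have "x \<le> sqrt (2 * (A * d))"
    using assms(1) real_sqrt_le_mono[of "2 * y" "2 * (A * d)"] assms(2) by linarith
  then show ?thesis
    using assms(3) by (simp add: real_sqrt_mult powr_half_sqrt)
qed

text \<open>Two orders are recorded: order 0 for the denominators \<open>1 + sn z\<close> inside
  \<open>G\<close>, and order 1/2 for \<open>sn z\<close> as a prefactor, where its smallness
  counts.\<close>

lemma bnd_sn: "bnd A R 0 0 (\<lambda>z u w. sn z)" "bnd A R (1/2) 0 (\<lambda>z u w. sn z)"
proof -
  show *: "bnd A R 0 0 (\<lambda>z u w. sn z)"
    by (rule bndI[of _ _ _ 1 _ A]) (auto simp: near_def)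
  show "bnd A R (1/2) 0 (\<lambda>z u w. sn z)"
  proof (rule bnd_improve[OF *])
    fix z u z' u' w :: "complex ^ 'n" and r d assume "near A z u z' u' r d"
    then show "norm (sn z) \<le> sqrt (2 * A) * d powr (1/2)"
      using sn_le_sqrt[of z u] by (intro powr_half_le[of _ "cmod (1 - hprod z u)"]) (auto simp: near_def)
  qed
qed

lemma bnd_one: "bnd A R 0 l (\<lambda>z u w. 1 :: 'b::real_normed_algebra_1)"
  by (rule bnd_const[of _ _ 1]) auto

lemma bnd_uminus: "bnd A R k l X \<Longrightarrow> bnd A R k l (\<lambda>z u w. - X z u w)"
  by (rule bnd_linear[OF bounded_linear_minus[OF bounded_linear_ident]])

lemma bnd_diff: "bnd A R k l X \<Longrightarrow> bnd A R k l Y \<Longrightarrow> bnd A R k l (\<lambda>z u w. X z u w - Y z u w)"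
  using bnd_add[OF _ bnd_uminus, of A R k l X Y] by simp

lemma bnd_of_real: "bnd A R k l X \<Longrightarrow> bnd A R k l (\<lambda>z u w. complex_of_real (X z u w))"
  by (rule bnd_linear[OF bounded_linear_of_real])

text \<open>The base point \<open>Z\<close> is kept general because the invariant kernel involves
  \<open>G\<close> at \<open>phi z w\<close> as well as at \<open>z\<close>. The denominator
  \<open>1 + sn\<close> is at least 1 and hence of order 0 from both sides.\<close>

lemma bnd_G:
  fixes Z :: "complex ^ 'n::finite \<Rightarrow> complex ^ 'n \<Rightarrow> complex ^ 'n \<Rightarrow> complex ^ 'm::finite"
  assumes Z: "bnd A R 0 0 Z" and sZ: "bnd A R 0 0 (\<lambda>z u w. sn (Z z u w))" and W: "bnd A R 0 0 W"
    and Z1: "\<And>z u w. norm z < 1 \<Longrightarrow> norm u < 1 \<Longrightarrow> norm w \<le> R \<Longrightarrow> norm (Z z u w) \<le> 1"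
  shows "bnd A R 0 0 (\<lambda>z u w. G (Z z u w) (W z u w :: complex ^ 'm))"
proof -
  have "lbnd A R 0 (\<lambda>z u w. complex_of_real (1 + sn (Z z u w)))"
    unfolding lbnd_def
  proof (intro exI[of _ 1] conjI allI impI)
    fix z u z' u' w :: "complex ^ 'n" and r d assume "near A z u z' u' r d" "norm w \<le> R"
    then have "0 \<le> sn (Z z u w)" "0 < d" using Z1[of z u w] by (auto simp: near_def)
    then show "1 * d powr 0 \<le> cmod (complex_of_real (1 + sn (Z z u w)))"
      by (simp del: of_real_add)
  qed simp
  moreover have "bnd A R 0 0 (\<lambda>z u w. complex_of_real (1 + sn (Z z u w)))"
    by (intro bnd_of_real bnd_add bnd_one sZ)
  ultimately have inv: "bnd A R 0 0 (\<lambda>z u w. inverse (complex_of_real (1 + sn (Z z u w))))"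
    using bnd_inverse[of A R 0 0] by simp
  have "bnd A R (0 + 0) 0 (\<lambda>z u w. hprod (W z u w) (Z z u w))"
    by (rule bnd_bilinear[OF bounded_bilinear_hprod W Z]) auto
  then have "bnd A R (0 + 0 + 0) 0 (\<lambda>z u w. hprod (W z u w) (Z z u w) * inverse (complex_of_real (1 + sn (Z z u w))))"
    by (rule bnd_bilinear[OF bounded_bilinear_mult _ inv]) auto
  then have "bnd A R (0 + 0 + 0 + 0) 0 (\<lambda>z u w. (hprod (W z u w) (Z z u w) * inverse (complex_of_real (1 + sn (Z z u w)))) *s Z z u w)"
    by (rule bnd_bilinear[OF bounded_bilinear_scale_vec _ Z]) auto
  then have "bnd A R 0 0 (\<lambda>z u w. (hprod (W z u w) (Z z u w) * inverse (complex_of_real (1 + sn (Z z u w)))) *s Z z u w - W z u w)"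
    using W by (intro bnd_diff) simp_all
  then show ?thesis
    by (simp only: G_def divide_inverse)
qed

lemma bounded_linear_cnj_vec: "bounded_linear (cnj_vec :: complex ^ 'n::finite \<Rightarrow> _)"
proof (rule bounded_linear_intro)
  fix x y :: "complex ^ 'n" and r
  show "cnj_vec (x + y) = cnj_vec x + cnj_vec y" by (simp add: cnj_vec_def vec_eq_iff)
  show "cnj_vec (r *\<^sub>R x) = r *\<^sub>R cnj_vec x" by (simp add: cnj_vec_def vec_eq_iff)
  show "norm (cnj_vec x) \<le> norm x * 1" by (simp add: cnj_vec_def norm_vec_def L2_set_def)
qed

context
  fixes A R :: real
  assumes A: "1 \<le> A" and R: "0 \<le> R" "R < 1"
begin

lemma bnd_inverse_1_hprod_wz: "bnd A R 0 0 (\<lambda>z u w. inverse (1 - hprod w z))"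
proof -
  have "bnd A R (0 + 0) 0 (\<lambda>z u w. hprod w z)"
    by (rule bnd_bilinear[OF bounded_bilinear_hprod bnd_w bnd_z]) auto
  then have "bnd A R 0 0 (\<lambda>z u w. 1 - hprod w z)"
    by (intro bnd_diff bnd_one) simp
  moreover have "lbnd A R 0 (\<lambda>z u w. 1 - hprod w z)"
    unfolding lbnd_def
  proof (intro exI[of _ "1 - R"] conjI allI impI)
    fix z u z' u' :: "complex ^ 'n" and r d and w :: "complex ^ 'n" assume "near A z u z' u' r d" "norm w \<le> R"
    then show "(1 - R) * d powr 0 \<le> cmod (1 - hprod w z)"
      using one_minus_norm_le[of z w] by (auto simp: near_def)
  qed (use R in auto)
  ultimately show ?thesis
    using bnd_inverse[of A R 0 0] by simp
qed

lemma bnd_G_zw: "bnd A R 0 0 (\<lambda>z u w. G z w)"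
  by (rule bnd_G[OF bnd_z bnd_sn(1) bnd_w]) auto

lemma bnd_G_zu: "bnd A R (1/2) 0 (\<lambda>z u w. G z u)"
proof (rule bnd_improve)
  show "bnd A R 0 0 (\<lambda>z u w. G z u)"
    by (rule bnd_G[OF bnd_z bnd_sn(1) bnd_u]) auto
  fix z u z' u' :: "complex ^ 'n" and r d and w :: "complex ^ 'n" assume "near A z u z' u' r d"
  then show "norm (G z u) \<le> sqrt (2 * A) * d powr (1/2)"
    using norm_G_le_sqrt[of z u] by (intro powr_half_le[of _ "cmod (1 - hprod z u)"]) (auto simp: near_def)
qed

lemma bnd_phi_factor: "bnd A R (1/2) 0 (\<lambda>z u w. complex_of_real (sn z) * inverse (1 - hprod w z))"
proof -
  have "bnd A R (1/2 + 0) 0 (\<lambda>z u w. complex_of_real (sn z) * inverse (1 - hprod w z))"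
    by (rule bnd_bilinear[OF bounded_bilinear_mult bnd_of_real[OF bnd_sn(2)] bnd_inverse_1_hprod_wz]) auto
  then show ?thesis by simp
qed

lemma bnd_phi: "bnd A R 0 0 (\<lambda>z u w. phi z w)"
proof -
  have "bnd A R (0 + 0) 0 (\<lambda>z u w. (complex_of_real (sn z) * inverse (1 - hprod w z)) *s G z w)"
    by (rule bnd_bilinear[OF bounded_bilinear_scale_vec bnd_mono[OF bnd_phi_factor] bnd_G_zw]) auto
  then have "bnd A R 0 0 (\<lambda>z u w. z + (complex_of_real (sn z) * inverse (1 - hprod w z)) *s G z w)"
    by (intro bnd_add bnd_z) simp
  then show ?thesis
    by (rule bnd_cong) (use R in \<open>auto simp: phi_eq_G divide_inverse\<close>)
qed

text \<open>By \<open>phi_eq_G\<close> and self-adjointness this is \<open>1 - hprod z u\<close>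
  minus a multiple of \<open>sn z * hprod w (G z u)\<close>. The first term has the right orders by
  the definition of \<open>near\<close>; in the second, two factors of order 1/2 meet, and the one
  that is differenced loses its half.\<close>

lemma bnd_1_hprod_phi: "bnd A R 1 (1/2) (\<lambda>z u w. 1 - hprod (phi z w) u)"
proof -
  have "bnd A R (0 + 1/2) 0 (\<lambda>z u w. hprod w (G z u))"
    by (rule bnd_bilinear[OF bounded_bilinear_hprod bnd_w[where l = 0] bnd_G_zu]) auto
  then have "bnd A R (1/2 + (0 + 1/2)) (1/2) (\<lambda>z u w. complex_of_real (sn z) * inverse (1 - hprod w z) * hprod w (G z u))"
    by (rule bnd_bilinear[OF bounded_bilinear_mult bnd_phi_factor]) auto
  moreover have "bnd A R 1 (1/2) (\<lambda>z u w. 1 - hprod z u)"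
  proof (rule bndI)
    fix z u z' u' :: "complex ^ 'n" and r d and w :: "complex ^ 'n" assume *: "near A z u z' u' r d"
    then show "cmod (1 - hprod z u) \<le> A * d powr 1" by (auto simp: near_def)
    from * show "cmod (1 - hprod z u - (1 - hprod z' u')) \<le> A * r * d powr (1/2)"
      by (auto simp: near_def powr_half_sqrt norm_minus_commute)
  qed
  ultimately have "bnd A R 1 (1/2) (\<lambda>z u w. 1 - hprod z u - complex_of_real (sn z) * inverse (1 - hprod w z) * hprod w (G z u))"
    by (intro bnd_diff[where X = "\<lambda>z u w. 1 - hprod z u"]) simp_all
  then show ?thesis
    by (rule bnd_cong) (use R in \<open>auto simp: phi_eq_G hprod_linear hprod_G divide_inverse algebra_simps\<close>)
qed

text \<open>By \<open>one_minus_hprod_phi\<close> the quotient of the two moduli is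
  \<open>|1 - hprod w (phi z u)| / |1 - hprod w z|\<close>, with numerator at least
  \<open>1 - R\<close> and denominator at most 2.\<close>

lemma cmod_1_hprod_phi_ge:
  assumes z: "norm z < 1" and u: "norm u < 1" and w: "norm w \<le> R"
  shows "(1 - R) / 2 * cmod (1 - hprod z u) \<le> cmod (1 - hprod (phi z w) u)"
proof -
  have w1: "norm w < 1" using w R by simp
  have "(1 - hprod (phi z w) u) * (1 - hprod w z) = (1 - hprod z u) * (1 - hprod w (phi z u))"
    using one_minus_hprod_phi[OF z, of w u] w1 u by simp
  then have eq: "cmod (1 - hprod (phi z w) u) * cmod (1 - hprod w z) = cmod (1 - hprod z u) * cmod (1 - hprod w (phi z u))"
    by (metis norm_mult)
  have "1 - R \<le> cmod (1 - hprod w (phi z u))"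
    using one_minus_norm_le[of "phi z u" w] norm_phi_le_1[OF z, of u] u w by simp
  then have "cmod (1 - hprod z u) * (1 - R) \<le> cmod (1 - hprod z u) * cmod (1 - hprod w (phi z u))"
    by (intro mult_left_mono) auto
  also have "\<dots> = cmod (1 - hprod (phi z w) u) * cmod (1 - hprod w z)"
    by (simp only: eq)
  also have "cmod (1 - hprod w z) \<le> 2"
    using norm_triangle_ineq4[of 1 "hprod w z"] cmod_hprod_lt_1[OF w1, of z] z by simp
  then have "cmod (1 - hprod (phi z w) u) * cmod (1 - hprod w z) \<le> cmod (1 - hprod (phi z w) u) * 2"
    by (intro mult_left_mono) auto
  finally show ?thesis by (simp add: mult.commute)
qed

lemma lbnd_1_hprod_phi: "lbnd A R 1 (\<lambda>z u w. 1 - hprod (phi z w) u)"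
  unfolding lbnd_def
proof (intro exI[of _ "(1 - R) / 2 / A"] conjI allI impI)
  fix z u z' u' :: "complex ^ 'n" and r d and w :: "complex ^ 'n" assume *: "near A z u z' u' r d" "norm w \<le> R"
  then have "(1 - R) / 2 * (d / A) \<le> (1 - R) / 2 * cmod (1 - hprod z u)"
    using R A by (intro mult_left_mono) (auto simp: near_def divide_le_eq mult.commute)
  also have "\<dots> \<le> cmod (1 - hprod (phi z w) u)"
    using * by (intro cmod_1_hprod_phi_ge) (auto simp: near_def)
  finally show "(1 - R) / 2 / A * d powr 1 \<le> cmod (1 - hprod (phi z w) u)"
    using * by (simp add: near_def)
qed (use R A in auto)

lemma Re_1_hprod_phi:
  assumes "norm z < 1" "norm u < 1" "norm w \<le> R"
  shows "0 < Re (1 - hprod (phi z w) u)"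
  using cmod_hprod_lt_1[of "phi z w" u] norm_phi_lt_1[of z w] assms R abs_Re_le_cmod[of "hprod (phi z w) u"]
  by auto

lemma bnd_sn_phi: "bnd A R (1/2) 0 (\<lambda>z u w. sn (phi z w))"
proof -
  have "bnd A R 0 0 (\<lambda>z u w. sn w * cmod (inverse (1 - hprod w z)))"
  proof -
    have "bnd A R (0 + 0) 0 (\<lambda>z u w. sn w * cmod (inverse (1 - hprod w z)))"
      using R by (intro bnd_bilinear[OF bounded_bilinear_mult bnd_const[of _ sn 1 _ 0] bnd_norm[OF bnd_inverse_1_hprod_wz]]) auto
    then show ?thesis by simp
  qed
  then have "bnd A R (1/2 + 0) 0 (\<lambda>z u w. sn z * (sn w * cmod (inverse (1 - hprod w z))))"
    by (rule bnd_bilinear[OF bounded_bilinear_mult bnd_sn(2)]) auto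
  then have "bnd A R (1/2) 0 (\<lambda>z u w. sn z * (sn w * cmod (inverse (1 - hprod w z))))"
    by simp
  then show ?thesis
    by (rule bnd_cong) (use R in \<open>auto simp: sn_phi norm_inverse divide_inverse\<close>)
qed

lemma bnd_1_norm_phi: "bnd A R 1 (1/2) (\<lambda>z u w. 1 - (norm (phi z w))\<^sup>2)"
proof -
  have "bnd A R (1/2 + 1/2) (1/2) (\<lambda>z u w. sn (phi z w) * sn (phi z w))"
    by (rule bnd_bilinear[OF bounded_bilinear_mult bnd_sn_phi bnd_sn_phi]) auto
  then have "bnd A R 1 (1/2) (\<lambda>z u w. sn (phi z w) * sn (phi z w))"
    by simp
  then show ?thesis
  proof (rule bnd_cong)
    fix z u w :: "complex ^ 'n" assume "norm z < 1" "norm w \<le> R"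
    then have "norm (phi z w) \<le> 1" using norm_phi_le_1[of z w] R by simp
    then show "1 - (norm (phi z w))\<^sup>2 = sn (phi z w) * sn (phi z w)"
      using sn_sq[of "phi z w"] by (simp add: power2_eq_square)
  qed
qed

text \<open>Counting orders: \<open>1 - |phi z w|^2\<close> has order 1,
  \<open>hprod (phi z w) u\<close> order 0 and the power order \<open>-(n + 2 + \<alpha>)\<close>;
  no factor loses more than 1/2 when differenced.\<close>

lemma bnd_K_radial:
  "bnd A R (- (real CARD('n) + 1 + \<alpha>)) (- (real CARD('n) + 1 + \<alpha>) - 1/2)
     (K_radial \<alpha> :: complex ^ 'n::finite \<Rightarrow> complex ^ 'n \<Rightarrow> complex ^ 'n \<Rightarrow> complex)"
proof -
  let ?a = "- (real CARD('n) + 2 + \<alpha>)"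
  have "bnd A R (1 * ?a) (1 * (?a - 1) + 1/2) (\<lambda>z u w :: complex ^ 'n. (1 - hprod (phi z w) u) powr complex_of_real ?a)"
    by (rule bnd_cpowr[OF bnd_1_hprod_phi lbnd_1_hprod_phi]) (rule Re_1_hprod_phi)
  then have P: "bnd A R ?a (?a - 1/2) (\<lambda>z u w :: complex ^ 'n. (1 - hprod (phi z w) u) powr complex_of_real ?a)"
    by (rule bnd_mono) auto
  have "bnd A R (0 + 0) 0 (\<lambda>z u w :: complex ^ 'n. hprod (phi z w) u)"
    by (rule bnd_bilinear[OF bounded_bilinear_hprod bnd_phi bnd_u]) auto
  then have "bnd A R (1 + (0 + 0)) (1/2) (\<lambda>z u w :: complex ^ 'n. complex_of_real (1 - (norm (phi z w))\<^sup>2) * hprod (phi z w) u)"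
    by (rule bnd_bilinear[OF bounded_bilinear_mult bnd_of_real[OF bnd_1_norm_phi]]) auto
  then have "bnd A R (1 + (0 + 0) + ?a) (?a + 1/2) (\<lambda>z u w :: complex ^ 'n. complex_of_real (1 - (norm (phi z w))\<^sup>2) * hprod (phi z w) u
      * (1 - hprod (phi z w) u) powr complex_of_real ?a)"
    by (rule bnd_bilinear[OF bounded_bilinear_mult _ P]) auto
  from bnd_linear[OF bounded_linear_mult_right[of "complex_of_real (real CARD('n) + 1 + \<alpha>)"] this]
  have "bnd A R (1 + (0 + 0) + ?a) (?a + 1/2) (K_radial \<alpha> :: complex ^ 'n::finite \<Rightarrow> complex ^ 'n \<Rightarrow> complex ^ 'n \<Rightarrow> complex)"
    by (rule bnd_cong) (simp only: K_radial_def of_real_minus powr_minus divide_inverse of_real_mult mult_ac)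
  then show ?thesis by (rule bnd_mono) auto
qed

lemma bnd_K_grad:
  "bnd A R (- (real CARD('n) + 1 + \<alpha>)) (- (real CARD('n) + 1 + \<alpha>) - 1/2)
     (K_grad \<alpha> :: complex ^ 'n::finite \<Rightarrow> complex ^ 'n \<Rightarrow> complex ^ 'n \<Rightarrow> complex ^ 'n)"
proof -
  let ?a = "- (real CARD('n) + 2 + \<alpha>)"
  have "bnd A R (1 * ?a) (1 * (?a - 1) + 1/2) (\<lambda>z u w :: complex ^ 'n. (1 - hprod (phi z w) u) powr complex_of_real ?a)"
    by (rule bnd_cpowr[OF bnd_1_hprod_phi lbnd_1_hprod_phi]) (rule Re_1_hprod_phi)
  then have P: "bnd A R ?a (?a - 1/2) (\<lambda>z u w :: complex ^ 'n. (1 - hprod (phi z w) u) powr complex_of_real ?a)"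
    by (rule bnd_mono) auto
  have "bnd A R (1 + ?a) (?a + 1/2) (\<lambda>z u w :: complex ^ 'n. complex_of_real (1 - (norm (phi z w))\<^sup>2)
      * (1 - hprod (phi z w) u) powr complex_of_real ?a)"
    by (rule bnd_bilinear[OF bounded_bilinear_mult bnd_of_real[OF bnd_1_norm_phi] P]) auto
  from bnd_linear[OF bounded_linear_mult_right[of "complex_of_real (real CARD('n) + 1 + \<alpha>)"] this]
  have "bnd A R (1 + ?a + 0) (?a + 1/2) (\<lambda>z u w :: complex ^ 'n. (complex_of_real (real CARD('n) + 1 + \<alpha>) * (complex_of_real (1 - (norm (phi z w))\<^sup>2)
      * (1 - hprod (phi z w) u) powr complex_of_real ?a)) *s cnj_vec u)"
    by (rule bnd_bilinear[OF bounded_bilinear_scale_vec _ bnd_linear[OF bounded_linear_cnj_vec bnd_u]]) auto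
  then have "bnd A R (1 + ?a + 0) (?a + 1/2) (K_grad \<alpha> :: complex ^ 'n::finite \<Rightarrow> complex ^ 'n \<Rightarrow> complex ^ 'n \<Rightarrow> complex ^ 'n)"
    by (rule bnd_cong) (simp only: K_grad_def of_real_minus powr_minus divide_inverse of_real_mult mult_ac)
  then show ?thesis by (rule bnd_mono) auto
qed

text \<open>In the formula for the automorphism at \<open>phi z w\<close>, the factors
  \<open>sn\<close> and \<open>G\<close> of order 1/2 together compensate the denominator of order
  1. The sum is bounded, and differencing costs 1/2.\<close>

lemma bnd_phi_phi: "bnd A R 0 (- 1/2) (\<lambda>z u w :: complex ^ 'n::finite. phi (phi z w) u)"
proof -
  have G0: "bnd A R 0 0 (\<lambda>z u w. G (phi z w) u)"
    using R norm_phi_le_1 by (intro bnd_G bnd_phi bnd_mono[OF bnd_sn_phi] bnd_u) (auto intro!: norm_phi_le_1)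
  obtain C where C: "0 \<le> C" "\<And>z u z' u' :: complex ^ 'n. \<And>r d w. near A z u z' u' r d \<Longrightarrow> norm w \<le> R \<Longrightarrow>
      cmod (1 - hprod (phi z w) u) \<le> C * d powr 1"
    using bndD[OF bnd_1_hprod_phi] by blast
  have G: "bnd A R (1/2) 0 (\<lambda>z u w :: complex ^ 'n. G (phi z w) u)"
  proof (rule bnd_improve[OF G0])
    fix z u z' u' :: "complex ^ 'n" and r d and w :: "complex ^ 'n" assume *: "near A z u z' u' r d" "norm w \<le> R"
    then show "norm (G (phi z w) u) \<le> sqrt (2 * C) * d powr (1/2)"
      using norm_G_le_sqrt[of "phi z w" u] norm_phi_le_1[of z w] C(2)[OF *] R
      by (intro powr_half_le[of _ "cmod (1 - hprod (phi z w) u)"]) (auto simp: near_def)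
  qed
  have "bnd A R (- 1) (1/2 - 2 * 1) (\<lambda>z u w :: complex ^ 'n. inverse (1 - hprod (phi z w) u))"
    by (rule bnd_inverse[OF bnd_1_hprod_phi lbnd_1_hprod_phi])
  from bnd_linear[OF bounded_linear_cnj this]
  have "bnd A R (1/2 + - 1) (- 1) (\<lambda>z u w :: complex ^ 'n. complex_of_real (sn (phi z w)) * cnj (inverse (1 - hprod (phi z w) u)))"
    by (rule bnd_bilinear[OF bounded_bilinear_mult bnd_of_real[OF bnd_sn_phi]]) auto
  then have "bnd A R (1/2 + - 1 + 1/2) (- 1/2) (\<lambda>z u w :: complex ^ 'n. (complex_of_real (sn (phi z w)) * cnj (inverse (1 - hprod (phi z w) u))) *s G (phi z w) u)"
    by (rule bnd_bilinear[OF bounded_bilinear_scale_vec _ G]) auto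
  then have "bnd A R 0 (- 1/2) (\<lambda>z u w :: complex ^ 'n. phi z w + (complex_of_real (sn (phi z w)) * cnj (inverse (1 - hprod (phi z w) u))) *s G (phi z w) u)"
    by (intro bnd_add bnd_mono[OF bnd_phi]) simp_all
  then show ?thesis
  proof (rule bnd_cong)
    fix z u w :: "complex ^ 'n" assume *: "norm z < 1" "norm u < 1" "norm w \<le> R"
    then have "norm (phi z w) < 1" using norm_phi_lt_1[of z w] R by simp
    from phi_eq_G[OF this, of u] show "phi (phi z w) u = phi z w +
        (complex_of_real (sn (phi z w)) * cnj (inverse (1 - hprod (phi z w) u))) *s G (phi z w) u"
      using * by (simp add: cnj_hprod divide_inverse)
  qed
qed

lemma bnd_K_invgrad:
  assumes \<alpha>: "-1 < \<alpha>"
  shows "bnd A R (- (real CARD('n) + 1 + \<alpha>)) (- (real CARD('n) + 1 + \<alpha>) - 1/2)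
     (K_invgrad \<alpha> :: complex ^ 'n::finite \<Rightarrow> complex ^ 'n \<Rightarrow> complex ^ 'n \<Rightarrow> complex ^ 'n)"
proof -
  define m where "m = real CARD('n) + 1 + \<alpha>"
  have m: "1 \<le> m"
  proof -
    have "1 \<le> real CARD('n)" by (simp add: Suc_leI)
    then show ?thesis using \<alpha> unfolding m_def by linarith
  qed
  have pos: "0 < 1 - (norm (phi z w))\<^sup>2" if "norm z < 1" "norm w \<le> R" for z w :: "complex ^ 'n"
    using norm_phi_lt_1[of z w] that R by (simp add: abs_square_less_1)
  \<comment> \<open>When \<open>z\<close> is close to the sphere and \<open>u\<close> is not,
    \<open>1 - |phi z w|^2\<close> is far smaller than \<open>d\<close>. The power is therefore
    controlled through \<open>1 \<le> m\<close>, without a lower bound of order 1.\<close>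
  have P1: "bnd A R (1 * m) (1 * (m - 1) + 1/2) (\<lambda>z u w :: complex ^ 'n. (1 - (norm (phi z w))\<^sup>2) powr m)"
    by (rule bnd_rpowr_ge1[OF bnd_1_norm_phi m]) (rule pos)
  have "bnd A R (1 * (- 2 * m)) (1 * (- 2 * m - 1) + 1/2) (\<lambda>z u w :: complex ^ 'n. cmod (1 - hprod (phi z w) u) powr (- 2 * m))"
  proof (rule bnd_rpowr[OF bnd_norm[OF bnd_1_hprod_phi]])
    show "lbnd A R 1 (\<lambda>z u w :: complex ^ 'n. cmod (1 - hprod (phi z w) u))"
      using lbnd_1_hprod_phi by (simp add: lbnd_def)
    fix z u w :: "complex ^ 'n" assume "norm z < 1" "norm u < 1" "norm w \<le> R"
    then have "1 - hprod (phi z w) u \<noteq> 0"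
      using Re_1_hprod_phi[of z u w] by auto
    then show "0 < cmod (1 - hprod (phi z w) u)" by simp
  qed
  then have "bnd A R (1 * m + 1 * (- 2 * m)) (- m - 1/2) (\<lambda>z u w :: complex ^ 'n. (1 - (norm (phi z w))\<^sup>2) powr m * cmod (1 - hprod (phi z w) u) powr (- 2 * m))"
    by (rule bnd_bilinear[OF bounded_bilinear_mult P1]) auto
  from bnd_of_real[OF bnd_linear[OF bounded_linear_mult_right[of m] this]]
  have "bnd A R (1 * m + 1 * (- 2 * m) + 0) (- m - 1/2) (\<lambda>z u w :: complex ^ 'n. complex_of_real (m * ((1 - (norm (phi z w))\<^sup>2) powr m * cmod (1 - hprod (phi z w) u) powr (- 2 * m)))
     *s cnj_vec (phi (phi z w) u))"
    by (rule bnd_bilinear[OF bounded_bilinear_scale_vec _ bnd_linear[OF bounded_linear_cnj_vec bnd_phi_phi]]) auto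
  then have "bnd A R (1 * m + 1 * (- 2 * m) + 0) (- m - 1/2) (K_invgrad \<alpha> :: complex ^ 'n \<Rightarrow> complex ^ 'n \<Rightarrow> complex ^ 'n \<Rightarrow> complex ^ 'n)"
    by (rule bnd_cong) (simp add: K_invgrad_def m_def [symmetric] powr_minus divide_inverse mult.assoc)
  then show ?thesis
    unfolding m_def [symmetric] by (rule bnd_mono) auto
qed

end

section \<open>The pseudo-metric \<open>rho\<close>\<close>

lemma cmod_hprod_normalized_le: "cmod (complex_of_real (1 / (norm z * norm w)) * hprod z w) \<le> 1"
proof -
  have "cmod (complex_of_real (1 / (norm z * norm w)) * hprod z w) = cmod (hprod z w) / (norm z * norm w)"
    unfolding norm_mult norm_of_real by simp
  also have "\<dots> \<le> 1"
    using cmod_hprod_le[of z w] by (auto simp: divide_le_eq mult_less_0_iff)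
  finally show ?thesis .
qed

lemma rho_pos:
  fixes z w :: "complex ^ 'n::finite"
  assumes "z \<noteq> w"
  shows "0 < rho z w"
proof (cases "z \<noteq> 0 \<and> w \<noteq> 0")
  case True
  define l where "l = complex_of_real (1 / (norm z * norm w)) * hprod z w"
  have "\<not> (norm z = norm w \<and> l = 1)"
  proof
    assume *: "norm z = norm w \<and> l = 1"
    then have "hprod z w = complex_of_real ((norm z)\<^sup>2)"
      using True by (simp add: l_def power2_eq_square field_simps)
    then have "z \<bullet> w = (norm z)\<^sup>2"
      by (metis Re_hprod Re_complex_of_real)
    then have "(norm (z - w))\<^sup>2 = 0"
      using * by (simp add: power2_norm_eq_inner inner_diff inner_commute) (simp add: power2_norm_eq_inner[symmetric])
    then show False using assms by simp
  qed
  then have "0 < \<bar>norm z - norm w\<bar> \<or> 0 < cmod (1 - l)"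
    by auto
  then have "0 < \<bar>norm z - norm w\<bar> + cmod (1 - l)"
    by (auto intro: add_pos_nonneg add_nonneg_pos)
  then show ?thesis
    using True by (simp add: rho_def l_def)
next
  case False
  then show ?thesis
    using assms by (auto simp: rho_def)
qed

lemma rho_nonneg: "0 \<le> rho z w"
  by (simp add: rho_def)

text \<open>Restoring the moduli of \<open>z\<close> and \<open>u\<close> costs the factor 4 of
  \<open>cmod_one_minus_le_4\<close>, and the difference of the moduli adds 1. On the diagonal
  \<open>rho\<close> vanishes while the right side is positive, so the comparison goes one
  way.\<close>

lemma rho_le:
  fixes z u :: "complex ^ 'n::finite"
  assumes z: "norm z < 1" and u: "norm u < 1"
  shows "rho z u \<le> 5 * cmod (1 - hprod z u)"
proof (cases "z \<noteq> 0 \<and> u \<noteq> 0")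
  case True
  define l where "l = complex_of_real (1 / (norm z * norm u)) * hprod z u"
  have "cmod l \<le> 1"
    unfolding l_def by (rule cmod_hprod_normalized_le)
  moreover have "hprod z u = complex_of_real (norm z * norm u) * l"
    using True by (simp add: l_def)
  ultimately have 1: "cmod (1 - l) \<le> 4 * cmod (1 - hprod z u)"
    using cmod_one_minus_le_4[of l "norm z * norm u"] z u by (simp add: mult_le_one)
  have "cmod (1 - hprod z u) \<ge> 1 - norm z" "cmod (1 - hprod z u) \<ge> 1 - norm u"
    using one_minus_norm_le[of u z] one_minus_norm_le[of z u] cmod_one_minus_hprod_commute[of z u] z u by auto
  then have 2: "\<bar>norm z - norm u\<bar> \<le> cmod (1 - hprod z u)"
    using z u by linarith
  show ?thesis
    using 1 2 True by (simp add: rho_def l_def)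
next
  case False
  then have "hprod z u = 0" by auto
  with False z u show ?thesis by (auto simp: rho_def)
qed

text \<open>The law of cosines: with moduli \<open>a\<close>, \<open>b\<close> and normalized
  product \<open>l\<close>, the left side is \<open>(a - b)^2 + 2 * a * b * (1 - Re l)\<close>. This
  is why Euclidean distances scale like the square root of \<open>rho\<close>.\<close>

lemma norm_diff_sq_le_rho:
  fixes w v :: "complex ^ 'n::finite"
  assumes w: "norm w < 1" and v: "norm v < 1"
  shows "(norm (w - v))\<^sup>2 \<le> 2 * rho w v"
proof (cases "w \<noteq> 0 \<and> v \<noteq> 0")
  case True
  define a b where "a = norm w" and "b = norm v"
  have ab: "0 < a" "0 < b" "a < 1" "b < 1" using True w v by (auto simp: a_def b_def)
  define l where "l = complex_of_real (1 / (a * b)) * hprod w v"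
  have h: "hprod w v = complex_of_real (a * b) * l"
    using ab by (simp add: l_def)
  have re: "w \<bullet> v = a * b * Re l"
    by (simp add: h flip: Re_hprod)
  have "(norm (w - v))\<^sup>2 = a\<^sup>2 + b\<^sup>2 - 2 * (a * b * Re l)"
    by (simp add: power2_norm_eq_inner inner_diff inner_commute re[symmetric])
      (simp add: a_def b_def power2_norm_eq_inner[symmetric])
  also have "\<dots> = (a - b)\<^sup>2 + 2 * (a * b) * (1 - Re l)"
    by (simp add: power2_eq_square algebra_simps)
  also have "\<dots> \<le> \<bar>a - b\<bar> + 2 * 1 * cmod (1 - l)"
  proof (intro add_mono mult_mono)
    have "\<bar>a - b\<bar> * \<bar>a - b\<bar> \<le> \<bar>a - b\<bar> * 1"
      using ab by (intro mult_left_mono) auto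
    then show "(a - b)\<^sup>2 \<le> \<bar>a - b\<bar>"
      by (simp add: power2_eq_square)
    show "a * b \<le> 1" using ab by (simp add: mult_le_one)
    show "1 - Re l \<le> cmod (1 - l)"
      using complex_Re_le_cmod[of "1 - l"] by simp
    have "cmod l \<le> 1"
      unfolding l_def a_def b_def by (rule cmod_hprod_normalized_le)
    then show "0 \<le> 1 - Re l"
      using abs_Re_le_cmod[of l] by linarith
  qed (use ab in auto)
  also have "\<dots> \<le> 2 * rho w v"
    using True by (simp add: rho_def l_def a_def b_def)
  finally show ?thesis .
next
  case False
  have *: "x\<^sup>2 \<le> 2 * x" if "0 \<le> x" "x < 1" for x :: real
    using that mult_left_mono[of x 2 x] by (simp add: power2_eq_square)
  show ?thesis
    using False *[of "norm w"] *[of "norm v"] w v by (auto simp: rho_def)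
qed

lemma abs_sqrt_diff_le:
  assumes "0 \<le> x" "0 \<le> y"
  shows "\<bar>sqrt x - sqrt y\<bar> \<le> sqrt \<bar>x - y\<bar>"
proof -
  have *: "sqrt x \<le> sqrt y + sqrt \<bar>x - y\<bar>" if "0 \<le> x" "0 \<le> y" for x y :: real
    using real_sqrt_le_mono[of x "y + \<bar>x - y\<bar>"] sqrt_add_le_add_sqrt[of y "\<bar>x - y\<bar>"] that by linarith
  show ?thesis
    using *[OF assms] *[OF assms(2,1)] by (simp add: abs_minus_commute abs_le_iff)
qed

lemma sn_diff_le_rho:
  fixes w v :: "complex ^ 'n::finite"
  assumes w: "norm w < 1" and v: "norm v < 1"
  shows "\<bar>sn w - sn v\<bar> \<le> sqrt (2 * rho w v)"
proof -
  have "\<bar>sn w - sn v\<bar> \<le> sqrt \<bar>(1 - (norm w)\<^sup>2) - (1 - (norm v)\<^sup>2)\<bar>"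
    unfolding sn_def using w v by (intro abs_sqrt_diff_le) (simp_all add: power_le_one)
  also have "\<dots> \<le> sqrt (2 * rho w v)"
  proof (intro real_sqrt_le_mono)
    have "\<bar>(1 - (norm w)\<^sup>2) - (1 - (norm v)\<^sup>2)\<bar> = \<bar>norm w - norm v\<bar> * (norm w + norm v)"
    proof -
      have "(1 - (norm w)\<^sup>2) - (1 - (norm v)\<^sup>2) = - (norm w - norm v) * (norm w + norm v)"
        by (simp add: power2_eq_square algebra_simps)
      then show ?thesis by (simp only: abs_mult abs_minus_cancel) simp
    qed
    also have "\<dots> \<le> \<bar>norm w - norm v\<bar> * 2"
      using w v by (intro mult_left_mono) auto
    also have "\<dots> \<le> 2 * rho w v"
    proof -
      have "\<bar>norm w - norm v\<bar> \<le> rho w v"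
        by (auto simp: rho_def)
      then show ?thesis by simp
    qed
    finally show "\<bar>(1 - (norm w)\<^sup>2) - (1 - (norm v)\<^sup>2)\<bar> \<le> 2 * rho w v" .
  qed
  finally show ?thesis .
qed

text \<open>Split \<open>w - v\<close> along and across \<open>v\<close>; the cross term pairs two tangential components, each of
  which is the square root of an anisotropic distance.\<close>

lemma hprod_diff_le_rho:
  fixes z w v :: "complex ^ 'n::finite"
  assumes z: "norm z < 1" and w: "norm w < 1" and v: "norm v < 1"
  shows "cmod (hprod z w - hprod z v) \<le> rho w v + 2 * sqrt (rho w v * cmod (1 - hprod z v))"
proof (cases "w \<noteq> 0 \<and> v \<noteq> 0")
  case False
  have "cmod (hprod z w - hprod z v) \<le> norm z * norm (w - v)"
    using cmod_hprod_le[of z "w - v"] by (simp add: hprod_linear)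
  also have "\<dots> \<le> norm (w - v)"
    using z by (simp add: mult_left_le_one_le)
  also have "\<dots> \<le> rho w v"
    using False by (auto simp: rho_def)
  finally show ?thesis
    by (simp add: rho_nonneg add_increasing2)
next
  case True
  define a b where "a = norm w" and "b = norm v"
  have ab: "0 < a" "0 < b" "a < 1" "b < 1" using True w v by (auto simp: a_def b_def)
  define e where "e = complex_of_real (1 / b) *s v"
  have ne: "norm e = 1" using ab by (simp add: e_def norm_scale_vec norm_divide b_def)
  then have ee: "hprod e e = 1" by (simp add: hprod_self)
  have v_eq: "v = complex_of_real b *s e" using ab by (simp add: e_def vec_eq_iff)
  define l where "l = complex_of_real (1 / (a * b)) * hprod w v"
  have we: "hprod w e = complex_of_real a * l"
    using ab by (simp add: e_def l_def hprod_linear field_simps)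
  define zp wp where "zp = z - hprod z e *s e" and "wp = w - hprod w e *s e"
  have nrm_perp: "(norm (x - hprod x e *s e))\<^sup>2 = (norm x)\<^sup>2 - (cmod (hprod x e))\<^sup>2" for x
  proof -
    have "complex_of_real ((norm (x - hprod x e *s e))\<^sup>2) = complex_of_real ((norm x)\<^sup>2 - (cmod (hprod x e))\<^sup>2)"
      unfolding hprod_self[symmetric] of_real_diff complex_norm_square
      by (simp add: hprod_linear ee cnj_hprod)
    then show ?thesis by (simp only: of_real_eq_iff)
  qed
  have split: "hprod z w - hprod z v = hprod z e * cnj (hprod w e - complex_of_real b) + hprod zp wp"
  proof -
    have "hprod zp wp = hprod z w - cnj (hprod w e) * hprod z e"
      by (simp add: zp_def wp_def hprod_linear ee cnj_hprod algebra_simps)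
    moreover have "hprod z v = complex_of_real b * hprod z e"
      by (subst v_eq) (simp add: hprod_linear)
    ultimately show ?thesis by (simp add: algebra_simps)
  qed
  have ze1: "cmod (hprod z e) \<le> 1"
    using cmod_hprod_le[of z e] ne z by simp
  have l1: "cmod l \<le> 1"
    unfolding l_def a_def b_def by (rule cmod_hprod_normalized_le)
  have rho: "rho w v = \<bar>a - b\<bar> + cmod (1 - l)"
    using True by (simp add: rho_def a_def b_def l_def)
  have "hprod w e - complex_of_real b = complex_of_real (a - b) - complex_of_real a * (1 - l)"
    by (simp add: we algebra_simps)
  then have "cmod (hprod w e - complex_of_real b) \<le> \<bar>a - b\<bar> + a * cmod (1 - l)"
    using norm_triangle_ineq4[of "complex_of_real (a - b)" "complex_of_real a * (1 - l)"] ab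
    by (simp add: norm_mult del: of_real_diff)
  also have "\<dots> \<le> rho w v"
    unfolding rho using ab by (intro add_left_mono) (simp add: mult_left_le_one_le)
  finally have first: "cmod (hprod w e - complex_of_real b) \<le> rho w v" .
  have zp: "norm zp \<le> sqrt (2 * cmod (1 - hprod z v))"
  proof (rule real_le_rsqrt)
    have "cmod (hprod z v) = b * cmod (hprod z e)"
      using ab by (subst v_eq) (simp add: hprod_linear norm_mult)
    then have "cmod (hprod z v) \<le> cmod (hprod z e)"
      using ab by (simp add: mult_left_le_one_le)
    then have "(cmod (hprod z v))\<^sup>2 \<le> (cmod (hprod z e))\<^sup>2"
      by (intro power_mono) auto
    moreover have "(norm z)\<^sup>2 \<le> 1" using z by (simp add: power_le_one)
    moreover have "1 - (cmod (hprod z v))\<^sup>2 \<le> 2 * cmod (1 - hprod z v)"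
      using cmod_hprod_lt_1[OF z, of v] v by (intro one_minus_cmod_sq_le) auto
    ultimately show "(norm zp)\<^sup>2 \<le> 2 * cmod (1 - hprod z v)"
      unfolding zp_def nrm_perp by linarith
  qed
  have wp: "norm wp \<le> sqrt (2 * rho w v)"
  proof (rule real_le_rsqrt)
    have "(norm wp)\<^sup>2 = a\<^sup>2 * (1 - (cmod l)\<^sup>2)"
    proof -
      have "(norm wp)\<^sup>2 = (norm w)\<^sup>2 - (cmod (hprod w e))\<^sup>2"
        unfolding wp_def by (rule nrm_perp)
      then show ?thesis
        using ab by (simp add: we norm_mult power_mult_distrib algebra_simps) (simp add: a_def)
    qed
    also have "\<dots> \<le> 1 * (2 * cmod (1 - l))"
      using ab l1 by (intro mult_mono one_minus_cmod_sq_le) (auto simp: power_le_one)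
    also have "\<dots> \<le> 2 * rho w v" by (simp add: rho)
    finally show "(norm wp)\<^sup>2 \<le> 2 * rho w v" .
  qed
  have "cmod (hprod z w - hprod z v) \<le> cmod (hprod z e * cnj (hprod w e - complex_of_real b)) + cmod (hprod zp wp)"
    unfolding split by (rule norm_triangle_ineq)
  also have "cmod (hprod z e * cnj (hprod w e - complex_of_real b)) \<le> 1 * rho w v"
    unfolding norm_mult complex_mod_cnj using ze1 first by (intro mult_mono) auto
  also have "cmod (hprod zp wp) \<le> sqrt (2 * cmod (1 - hprod z v)) * sqrt (2 * rho w v)"
    using zp wp rho_nonneg[of w v] by (intro order_trans[OF cmod_hprod_le] mult_mono) auto
  also have "\<dots> = 2 * sqrt (rho w v * cmod (1 - hprod z v))"
    by (simp add: real_sqrt_mult)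
  finally show ?thesis by simp
qed

text \<open>Since \<open>rho z v\<close> is at most \<open>5 * d\<close>, the constant 320 = 5 * 64
  yields \<open>8 * r \<le> sqrt d\<close>. Then \<open>hprod z w\<close> and
  \<open>hprod z v\<close> differ by at most \<open>3 * r * sqrt d\<close>, less than
  \<open>d / 2\<close>, and both nonisotropic distances stay comparable to \<open>d\<close>. The two
  conclusions serve the differences in the second and in the first kernel variable.\<close>

lemma near_of_rho:
  fixes z w v :: "complex ^ 'n::finite"
  assumes z: "norm z < 1" and w: "norm w < 1" and v: "norm v < 1"
    and far: "320 * rho w v \<le> rho z v"
  shows "near 4 z w z v (sqrt (rho w v)) (cmod (1 - hprod z v))"
    "near 4 w z v z (sqrt (rho w v)) (cmod (1 - hprod z v))"
proof -
  define d where "d = cmod (1 - hprod z v)"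
  define r where "r = sqrt (rho w v)"
  have d0: "0 < d" using one_minus_hprod_neq_0[OF z, of v] v by (simp add: d_def)
  have d2: "d \<le> 2"
    using norm_triangle_ineq4[of 1 "hprod z v"] cmod_hprod_lt_1[OF z, of v] v by (simp add: d_def)
  have r0: "0 \<le> r" by (simp add: r_def rho_nonneg)
  have rr: "r * r = rho w v" by (simp add: r_def rho_nonneg)
  have "320 * (r * r) \<le> 5 * d"
    using far rho_le[OF z v] by (simp add: rr d_def)
  then have "64 * (r * r) \<le> sqrt d * sqrt d"
    using d0 by simp
  then have "(8 * r)\<^sup>2 \<le> (sqrt d)\<^sup>2"
    by (simp add: power2_eq_square)
  then have rd: "8 * r \<le> sqrt d"
    by (rule power2_le_imp_le) (use d0 in simp)
  have "r * r \<le> r * sqrt d"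
    using rd r0 by (intro mult_left_mono) auto
  have "cmod (hprod z w - hprod z v) \<le> r * r + 2 * (r * sqrt d)"
    using hprod_diff_le_rho[OF z w v] rho_nonneg[of w v] by (simp add: rr d_def r_def real_sqrt_mult)
  also have "\<dots> \<le> 3 * (r * sqrt d)"
    using \<open>r * r \<le> r * sqrt d\<close> by simp
  finally have hd: "cmod (hprod z w - hprod z v) \<le> 3 * (r * sqrt d)" .
  have "8 * (r * sqrt d) \<le> sqrt d * sqrt d"
    using mult_right_mono[OF rd, of "sqrt d"] d0 by simp
  then have "8 * (r * sqrt d) \<le> d" using d0 by simp
  with hd have hd': "cmod (hprod z w - hprod z v) \<le> d / 2" using d0 by argo
  have dw: "d \<le> 4 * cmod (1 - hprod z w)" "cmod (1 - hprod z w) \<le> 4 * d"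
  proof -
    have "cmod (1 - hprod z w) \<le> d + cmod (hprod z w - hprod z v)"
      using norm_triangle_ineq4[of "1 - hprod z v" "hprod z w - hprod z v"] by (simp add: d_def)
    then show "cmod (1 - hprod z w) \<le> 4 * d" using hd' d0 by linarith
    have "d \<le> cmod (1 - hprod z w) + cmod (hprod z w - hprod z v)"
      using norm_triangle_ineq[of "1 - hprod z w" "hprod z w - hprod z v"] by (simp add: d_def)
    then show "d \<le> 4 * cmod (1 - hprod z w)" using hd' d0 by linarith
  qed
  have "norm (w - v) \<le> sqrt (2 * rho w v)"
    using norm_diff_sq_le_rho[OF w v] by (rule real_le_rsqrt)
  moreover have s2: "sqrt (2 * rho w v) \<le> 4 * r"
  proof -
    have "sqrt 2 * r \<le> 4 * r"
      using r0 real_sqrt_le_mono[of 2 16] by (intro mult_right_mono) auto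
    then show ?thesis by (simp add: r_def real_sqrt_mult)
  qed
  ultimately have nwv: "norm (w - v) \<le> 4 * r" by linarith
  have swv: "\<bar>sn w - sn v\<bar> \<le> 4 * r"
    using sn_diff_le_rho[OF w v] s2 by linarith
  have hd4: "cmod (hprod z w - hprod z v) \<le> 4 * r * sqrt d"
  proof -
    have "0 \<le> r * sqrt d" using r0 d0 by simp
    then have "3 * (r * sqrt d) \<le> 4 * r * sqrt d" by simp
    with hd show ?thesis by (rule order_trans)
  qed
  show "near 4 z w z v (sqrt (rho w v)) (cmod (1 - hprod z v))"
    unfolding near_def r_def[symmetric] d_def[symmetric]
    using z w v r0 d0 d2 nwv swv hd4 dw by (simp add: d_def)
  have "cmod (hprod w z - hprod v z) = cmod (hprod z w - hprod z v)"
    by (metis cnj_hprod complex_cnj_diff complex_mod_cnj)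
  then show "near 4 w z v z (sqrt (rho w v)) (cmod (1 - hprod z v))"
    unfolding near_def r_def[symmetric] d_def[symmetric]
    using z w v r0 d0 d2 nwv swv hd4 dw cmod_one_minus_hprod_commute[of w z] cmod_one_minus_hprod_commute[of v z]
    by (simp add: d_def)
qed

section \<open>Near pairs with a fixed base point\<close>

lemma cmod_1_hprod_le_2:
  assumes "norm z < 1" "norm u < 1"
  shows "cmod (1 - hprod z u) \<le> 2"
  using norm_triangle_ineq4[of 1 "hprod z u"] cmod_hprod_lt_1[OF assms(1), of u] assms(2) by simp

lemma near_refl:
  assumes "norm z < 1" "norm u < 1" "1 \<le> A"
  shows "near A z u z u 0 (cmod (1 - hprod z u))"
  using assms one_minus_hprod_neq_0[of z u] cmod_1_hprod_le_2[of z u]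
  by (simp add: near_def mult_le_cancel_right1)

text \<open>For fixed \<open>z\<close> the nonisotropic distances are bounded below by
  \<open>1 - norm z\<close>, so the Euclidean distance is an admissible scale once the constant may
  depend on \<open>z\<close>. This gives Lipschitz continuity of the kernel in
  \<open>u\<close>.\<close>

lemma near_second:
  fixes z u u' :: "complex ^ 'n::finite"
  assumes z: "norm z < 1" and u: "norm u < 1" "norm u' < 1"
  shows "near (2 / (1 - norm z)) z u z u' (norm (u - u')) (cmod (1 - hprod z u))"
proof -
  define A where "A = 2 / (1 - norm z)"
  have A: "A * (1 - norm z) = 2" "2 \<le> A" using z by (auto simp: A_def field_simps)
  have lo: "1 - norm z \<le> cmod (1 - hprod z x)" if "norm x < 1" for x
    using one_minus_norm_le[of x z] that by simp
  have ratio: "cmod (1 - hprod z x) \<le> A * cmod (1 - hprod z y)" if "norm x < 1" "norm y < 1" for x y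
    using cmod_1_hprod_le_2[OF z, of x] mult_left_mono[OF lo, of y A] A that by linarith
  have d0: "0 < cmod (1 - hprod z u)" using lo[of u] u z by linarith
  have "1 - norm z \<le> sqrt (cmod (1 - hprod z u))"
  proof (rule real_le_rsqrt)
    have "(1 - norm z)\<^sup>2 \<le> 1 - norm z" using z by (simp add: power2_eq_square mult_left_le)
    then show "(1 - norm z)\<^sup>2 \<le> cmod (1 - hprod z u)" using lo[of u] u by linarith
  qed
  then have "2 \<le> A * sqrt (cmod (1 - hprod z u))"
    using A mult_left_mono[of "1 - norm z" "sqrt (cmod (1 - hprod z u))" A] by linarith
  then have "2 * norm (u - u') \<le> A * sqrt (cmod (1 - hprod z u)) * norm (u - u')"
    by (intro mult_right_mono) auto
  moreover have "cmod (hprod z u - hprod z u') \<le> norm (u - u')"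
    using cmod_hprod_le[of z "u - u'"] z mult_left_le_one_le[of "norm (u - u')" "norm z"] by (simp add: hprod_linear)
  moreover have "norm (u - u') \<le> A * norm (u - u')"
    using A mult_right_mono[of 1 A "norm (u - u')"] by simp
  moreover have "0 \<le> A * norm (u - u')"
    using A by simp
  moreover have "norm (u - u') \<le> 2 * norm (u - u')" by simp
  ultimately have "cmod (hprod z u - hprod z u') \<le> A * sqrt (cmod (1 - hprod z u)) * norm (u - u')"
    "norm (u - u') \<le> A * norm (u - u')" "0 \<le> A * norm (u - u')"
    by (meson order_trans)+
  then show ?thesis
    unfolding near_def A_def[symmetric]
    using z u d0 cmod_1_hprod_le_2[OF z u(1)] ratio by (auto simp: mult_ac)
qed

text \<open>Keeping \<open>z'\<close> within half the distance to the sphere retains the lower bound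
  \<open>(1 - norm z) / 2\<close>. The scale contains the change of \<open>sn\<close> itself, so
  that continuity of \<open>sn\<close> suffices to make it tend to 0.\<close>

lemma near_first:
  fixes z z' u :: "complex ^ 'n::finite"
  assumes z: "norm z < 1" and z': "norm (z - z') \<le> (1 - norm z) / 2" and u: "norm u < 1"
  shows "near (4 / (1 - norm z)) z u z' u (norm (z - z') + \<bar>sn z - sn z'\<bar>) (cmod (1 - hprod z u))"
proof -
  define A where "A = 4 / (1 - norm z)"
  have A: "A * (1 - norm z) = 4" "4 \<le> A" using z by (auto simp: A_def field_simps)
  have nz': "norm z' \<le> norm z + (1 - norm z) / 2"
    using z' norm_triangle_ineq2[of z' z] norm_minus_commute[of z' z] by argo
  then have z'1: "norm z' < 1" using z by argo
  have lo: "1 - norm z \<le> cmod (1 - hprod z u)"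
    using one_minus_norm_le[of u z] u by simp
  have lo': "(1 - norm z) / 2 \<le> cmod (1 - hprod z' u)"
    using one_minus_norm_le[of u z'] u nz' by argo
  have a1: "2 \<le> A * cmod (1 - hprod z u)" "2 \<le> A * cmod (1 - hprod z' u)"
    using mult_left_mono[OF lo, of A] mult_left_mono[OF lo', of A] A by argo+
  have a2: "2 \<le> A * cmod (1 - hprod z u)" using a1 by simp
  define d where "d = cmod (1 - hprod z u)"
  define r where "r = norm (z - z') + \<bar>sn z - sn z'\<bar>"
  have d0: "0 < d" using lo z unfolding d_def by linarith
  have "1 - norm z \<le> sqrt d"
  proof (rule real_le_rsqrt)
    have "(1 - norm z)\<^sup>2 \<le> 1 - norm z" using z by (simp add: power2_eq_square mult_left_le)
    then show "(1 - norm z)\<^sup>2 \<le> d" using lo unfolding d_def by linarith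
  qed
  then have "4 \<le> A * sqrt d"
    using A mult_left_mono[of "1 - norm z" "sqrt d" A] by linarith
  then have "4 * r \<le> A * sqrt d * r"
    by (intro mult_right_mono) (auto simp: r_def)
  moreover have "cmod (hprod z u - hprod z' u) \<le> norm (z - z') * 1"
    using cmod_hprod_le[of "z - z'" u] u mult_left_mono[of "norm u" 1 "norm (z - z')"] by (simp add: hprod_linear)
  moreover have "norm (z - z') * 1 \<le> 4 * r"
    by (simp add: r_def)
  ultimately have "cmod (hprod z u - hprod z' u) \<le> A * sqrt d * r"
    by (meson order_trans)
  then have h: "cmod (hprod z u - hprod z' u) \<le> A * r * sqrt d"
    by (simp only: mult_ac)
  have r: "r \<le> A * r"
    using A mult_right_mono[of 1 A r] by (simp add: r_def)
  have r0: "0 \<le> r" and "norm (z - z') \<le> r" "\<bar>sn z - sn z'\<bar> \<le> r"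
    by (simp_all add: r_def)
  then have r12: "norm (z - z') \<le> A * r" "\<bar>sn z - sn z'\<bar> \<le> A * r"
    using r by (auto intro: order_trans)
  have a3: "cmod (1 - hprod z u) \<le> A * cmod (1 - hprod z' u)" "cmod (1 - hprod z' u) \<le> A * cmod (1 - hprod z u)"
    using cmod_1_hprod_le_2[OF z u] cmod_1_hprod_le_2[OF z'1 u] a1 by linarith+
  have a4: "cmod (1 - hprod z u) \<le> A * cmod (1 - hprod z u)"
    using cmod_1_hprod_le_2[OF z u] a1 by linarith
  show ?thesis
    unfolding near_def A_def[symmetric] r_def[symmetric] d_def[symmetric]
    using z z'1 u d0 h r12 a3 a4 cmod_1_hprod_le_2[OF z u] r0 by (simp add: d_def)
qed

lemma isCont_sn: "isCont sn z"
  unfolding sn_def by (intro continuous_intros)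

text \<open>The third summand of \<open>rr\<close> is chosen to meet the third condition of \<open>near\<close>.\<close>

lemma eventually_near:
  fixes z u :: "complex ^ 'n::finite"
  assumes z: "norm z < 1" and u: "norm u < 1"
  defines "rr \<equiv> (\<lambda>x. norm (z - fst x) + norm (u - snd x) + \<bar>sn z - sn (fst x)\<bar>
      + cmod (hprod z u - hprod (fst x) (snd x)) / sqrt (cmod (1 - hprod z u)))"
  shows "(rr \<longlongrightarrow> 0) (at (z, u) within S)"
    and "\<forall>\<^sub>F x in at (z, u) within S. x \<in> unit_ball \<times> unit_ball \<longrightarrow>
      near 2 z u (fst x) (snd x) (rr x) (cmod (1 - hprod z u))"
proof -
  define d where "d = cmod (1 - hprod z u)"
  have d0: "0 < d" using one_minus_hprod_neq_0[OF z, of u] u by (simp add: d_def)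
  have lim_fst: "((\<lambda>x. fst x) \<longlongrightarrow> z) (at (z, u) within S)" and lim_snd: "((\<lambda>x. snd x) \<longlongrightarrow> u) (at (z, u) within S)"
    by (auto intro!: tendsto_eq_intros)
  have lim_h: "((\<lambda>x. hprod (fst x) (snd x)) \<longlongrightarrow> hprod z u) (at (z, u) within S)"
    by (rule bounded_bilinear.tendsto[OF bounded_bilinear_hprod lim_fst lim_snd])
  have lim_sn: "((\<lambda>x. sn (fst x)) \<longlongrightarrow> sn z) (at (z, u) within S)"
    by (rule isCont_tendsto_compose[OF isCont_sn lim_fst])
  have "(rr \<longlongrightarrow> norm (z - z) + norm (u - u) + \<bar>sn z - sn z\<bar> + cmod (hprod z u - hprod z u) / sqrt (cmod (1 - hprod z u)))
     (at (z, u) within S)"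
    unfolding rr_def using d0 by (intro tendsto_intros lim_fst lim_snd lim_h lim_sn) (simp add: d_def)
  then show "(rr \<longlongrightarrow> 0) (at (z, u) within S)" by simp
  have lim_d: "((\<lambda>x. cmod (1 - hprod (fst x) (snd x))) \<longlongrightarrow> d) (at (z, u) within S)"
    unfolding d_def by (intro tendsto_intros lim_h)
  have "\<forall>\<^sub>F x in at (z, u) within S. d / 2 < cmod (1 - hprod (fst x) (snd x))"
    by (rule order_tendstoD(1)[OF lim_d]) (use d0 in simp)
  moreover have "\<forall>\<^sub>F x in at (z, u) within S. cmod (1 - hprod (fst x) (snd x)) < 2 * d"
    by (rule order_tendstoD(2)[OF lim_d]) (use d0 in simp)
  ultimately show "\<forall>\<^sub>F x in at (z, u) within S. x \<in> unit_ball \<times> unit_ball \<longrightarrow>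
      near 2 z u (fst x) (snd x) (rr x) (cmod (1 - hprod z u))"
  proof eventually_elim
    case (elim x)
    define h where "h = cmod (hprod z u - hprod (fst x) (snd x))"
    have "0 \<le> h / sqrt d" using d0 by (simp add: h_def)
    then have r: "norm (z - fst x) \<le> rr x" "norm (u - snd x) \<le> rr x" "\<bar>sn z - sn (fst x)\<bar> \<le> rr x" "h / sqrt d \<le> rr x" "0 \<le> rr x"
      by (auto simp: rr_def h_def d_def)
    have "h = h / sqrt d * sqrt d" using d0 by simp
    also have "\<dots> \<le> rr x * sqrt d" using r d0 by (intro mult_right_mono) auto
    also have "\<dots> \<le> 2 * rr x * sqrt d" using r d0 by simp
    finally have "h \<le> 2 * rr x * sqrt d" .
    then show ?case
      using elim z u d0 r cmod_1_hprod_le_2[OF z u]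
      by (auto simp: near_def h_def d_def[symmetric])
  qed
qed

section \<open>The Banach space of the kernels\<close>

text \<open>This is \<open>tanh \<gamma>\<close>, the norm at which the Bergman distance from the
  origin equals \<open>\<gamma>\<close>.\<close>

definition bradius :: "real \<Rightarrow> real" where
  "bradius \<gamma> = (exp (2 * \<gamma>) - 1) / (exp (2 * \<gamma>) + 1)"

lemma bradius_bounds: "0 < \<gamma> \<Longrightarrow> 0 \<le> bradius \<gamma>" "bradius \<gamma> < 1"
  by (auto simp: bradius_def divide_less_eq add_pos_pos)

lemma norm_phi_le_bradius:
  assumes z: "norm z < 1" and w: "w \<in> bergman_ball z \<gamma>"
  shows "norm w < 1" "norm (phi z w) \<le> bradius \<gamma>"
proof -
  show w1: "norm w < 1" using w by (simp add: bergman_ball_def)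
  define x where "x = norm (phi z w)"
  have x: "0 \<le> x" "x < 1" using norm_phi_lt_1[OF z w1] by (auto simp: x_def)
  have "ln ((1 + x) / (1 - x)) < 2 * \<gamma>"
    using w by (simp add: bergman_ball_def bergman_metric_def x_def)
  then have "(1 + x) / (1 - x) < exp (2 * \<gamma>)"
    using x by (metis add_pos_nonneg diff_gt_0_iff_gt divide_pos_pos exp_less_cancel_iff exp_ln zero_less_one)
  then have "1 + x < exp (2 * \<gamma>) * (1 - x)"
    using x by (simp add: divide_less_eq)
  then have "x * (exp (2 * \<gamma>) + 1) \<le> exp (2 * \<gamma>) - 1"
    by (simp add: algebra_simps)
  then show "norm (phi z w) \<le> bradius \<gamma>"
    by (simp add: bradius_def x_def le_divide_eq add_pos_pos)
qed

lemma norm_le_bradius: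
  assumes "w \<in> bergman_ball 0 \<gamma>"
  shows "norm w \<le> bradius \<gamma>"
  using norm_phi_le_bradius(2)[OF _ assms] by (simp add: phi_def)

lemma borel_measurable_phi [measurable (raw)]:
  assumes [measurable]: "f \<in> borel_measurable M" "g \<in> borel_measurable M"
  shows "(\<lambda>x. phi (f x) (g x)) \<in> borel_measurable M"
  unfolding phi_def proj_def by measurable

lemma bergman_ball_sets: "bergman_ball z \<gamma> \<in> sets borel"
proof -
  have [measurable]: "(\<lambda>w. bergman_metric z w) \<in> borel_measurable borel"
    unfolding bergman_metric_def by measurable
  have "{w \<in> space borel. norm w < 1 \<and> bergman_metric z w < \<gamma>} \<in> sets borel"
    by measurable
  then show ?thesis by (simp add: bergman_ball_def)
qed

lemma bergman_ball_sets_tau [measurable]: "bergman_ball z \<gamma> \<in> sets tau"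
proof -
  have "bergman_ball z \<gamma> \<subseteq> unit_ball" by (auto simp: bergman_ball_def)
  then show ?thesis by (simp add: sets_tau sets_restrict_space_iff bergman_ball_sets)
qed

lemma sets_tau_on [measurable_cong]: "sets (tau_on D) = sets tau"
  by (simp add: tau_on_def)

lemma space_tau_on [simp]: "space (tau_on D) = unit_ball"
  by (simp add: tau_on_def)

lemma AE_tau_on:
  assumes "\<And>w. w \<in> bergman_ball 0 \<gamma> \<Longrightarrow> P w"
  shows "AE w in tau_on (bergman_ball 0 \<gamma>). P w"
  unfolding tau_on_def by (subst AE_density) (auto simp: assms indicator_def)

lemma finite_measure_tau_on:
  assumes "0 < \<gamma>"
  shows "finite_measure (tau_on (bergman_ball 0 \<gamma>) :: (complex ^ 'n::finite) measure)"
proof (rule finite_measureI)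
  let ?D = "bergman_ball 0 \<gamma> :: (complex ^ 'n) set"
  let ?R = "bradius \<gamma>"
  have R: "0 \<le> ?R" "?R < 1" using bradius_bounds assms by auto
  have R2: "0 < 1 - ?R\<^sup>2" using R by (simp add: power_less_one_iff abs_square_less_1)
  have "emeasure (tau_on ?D) (space (tau_on ?D)) = (\<integral>\<^sup>+w. indicator ?D w * indicator (space tau) w \<partial>tau)"
    unfolding tau_on_def space_density by (rule emeasure_density) measurable
  also have "\<dots> = (\<integral>\<^sup>+w. indicator ?D w \<partial>tau)"
    by (rule nn_integral_cong) simp
  also have "\<dots> = ennreal (1 / measure lborel (unit_ball :: (complex ^ 'n) set)) *
    (\<integral>\<^sup>+x. indicator unit_ball x * (ennreal (1 / (1 - (norm x)\<^sup>2) ^ (CARD('n) + 1)) * indicator ?D x) \<partial>lborel)"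
    by (rule nn_integral_tau) measurable
  also have "\<dots> \<le> ennreal (1 / measure lborel (unit_ball :: (complex ^ 'n) set)) *
    (\<integral>\<^sup>+x. ennreal (1 / (1 - ?R\<^sup>2) ^ (CARD('n) + 1)) * indicator (unit_ball :: (complex ^ 'n) set) x \<partial>lborel)"
  proof (intro mult_left_mono nn_integral_mono)
    fix x :: "complex ^ 'n"
    show "indicator unit_ball x * (ennreal (1 / (1 - (norm x)\<^sup>2) ^ (CARD('n) + 1)) * indicator ?D x)
      \<le> ennreal (1 / (1 - ?R\<^sup>2) ^ (CARD('n) + 1)) * indicator unit_ball x"
    proof (cases "x \<in> ?D")
      case True
      then have "(norm x)\<^sup>2 \<le> ?R\<^sup>2" "norm x < 1"
        using norm_le_bradius[OF True] R by (auto intro!: power_mono)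
      moreover from this have "0 < 1 - (norm x)\<^sup>2" using R2 by linarith
      ultimately have "1 / (1 - (norm x)\<^sup>2) ^ (CARD('n) + 1) \<le> 1 / (1 - ?R\<^sup>2) ^ (CARD('n) + 1)"
        using R2 by (intro divide_left_mono power_mono mult_pos_pos zero_less_power) linarith+
      then show ?thesis by (auto simp: indicator_def intro!: ennreal_leI)
    qed simp
  qed simp
  also have "\<dots> = ennreal (1 / measure lborel (unit_ball :: (complex ^ 'n) set)) *
      (ennreal (1 / (1 - ?R\<^sup>2) ^ (CARD('n) + 1)) * emeasure lborel (unit_ball :: (complex ^ 'n) set))"
    by (subst nn_integral_cmult) (auto intro!: borel_measurable_indicator)
  also have "\<dots> < \<infinity>"
    using emeasure_lborel_ball_finite[of "0 :: complex ^ 'n" 1] by (simp add: ennreal_mult_less_top)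
  finally show "emeasure (tau_on ?D) (space (tau_on ?D)) \<noteq> \<infinity>" by simp
qed

lemma Lp_norm_nonneg: "0 \<le> Lp_norm M q X"
  by (simp add: Lp_norm_def)

text \<open>The measure is finite, so bounds uniform in \<open>w\<close> pass to the norm of
  \<open>E\<close>. All norm estimates in \<open>E\<close> are obtained this way.\<close>

lemma Lp_norm_tau_on_le:
  fixes X :: "complex ^ 'n::finite \<Rightarrow> 'b::real_normed_vector"
  assumes \<gamma>: "0 < \<gamma>" and q: "1 < q" and B: "0 \<le> B"
    and X: "\<And>w. norm w < 1 \<Longrightarrow> norm w \<le> bradius \<gamma> \<Longrightarrow> norm (X w) \<le> B"
  shows "Lp_norm (tau_on (bergman_ball 0 \<gamma>)) q X
    \<le> measure (tau_on (bergman_ball 0 \<gamma>) :: (complex ^ 'n) measure) unit_ball powr (1 / q) * B"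
proof -
  let ?T = "tau_on (bergman_ball 0 \<gamma>) :: (complex ^ 'n) measure"
  interpret finite_measure ?T by (rule finite_measure_tau_on[OF \<gamma>])
  have "(\<integral>w. norm (X w) powr q \<partial>?T) \<le> measure ?T unit_ball * B powr q"
  proof (cases "integrable ?T (\<lambda>w. norm (X w) powr q)")
    case True
    have "(\<integral>w. norm (X w) powr q \<partial>?T) \<le> (\<integral>w. B powr q \<partial>?T)"
    proof (rule integral_mono_AE[OF True])
      show "AE w in ?T. norm (X w) powr q \<le> B powr q"
      proof (rule AE_tau_on)
        fix w :: "complex ^ 'n" assume "w \<in> bergman_ball 0 \<gamma>"
        then have "norm (X w) \<le> B"
          using norm_le_bradius[of w \<gamma>] by (intro X) (auto simp: bergman_ball_def)
        then show "norm (X w) powr q \<le> B powr q" using q by (intro powr_mono2) auto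
      qed
    qed simp
    then show ?thesis by simp
  next
    \<comment> \<open>A non-integrable integrand has integral 0 by convention, so the bound remains
      true without measurability of \<open>X\<close>.\<close>
    case False
    then show ?thesis by (simp add: not_integrable_integral_eq)
  qed
  then have "Lp_norm ?T q X \<le> (measure ?T unit_ball * B powr q) powr (1 / q)"
    unfolding Lp_norm_def using q by (intro powr_mono2) auto
  also have "\<dots> = measure ?T unit_ball powr (1 / q) * B"
    using B q by (simp add: powr_mult powr_powr)
  finally show ?thesis .
qed

lemma Lp_tau_onI:
  fixes X :: "complex ^ 'n::finite \<Rightarrow> 'b::real_normed_vector"
  assumes \<gamma>: "0 < \<gamma>" and q: "1 < q" and meas: "X \<in> borel_measurable tau"
    and X: "\<And>w. norm w < 1 \<Longrightarrow> norm w \<le> bradius \<gamma> \<Longrightarrow> norm (X w) \<le> B"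
  shows "X \<in> Lp (tau_on (bergman_ball 0 \<gamma>)) q"
proof -
  let ?T = "tau_on (bergman_ball 0 \<gamma>) :: (complex ^ 'n) measure"
  interpret finite_measure ?T by (rule finite_measure_tau_on[OF \<gamma>])
  have [measurable]: "X \<in> borel_measurable ?T"
    using meas by (simp cong: measurable_cong_sets[OF sets_tau_on])
  have "integrable ?T (\<lambda>w. norm (X w) powr q)"
  proof (rule integrable_const_bound[where B = "B powr q"])
    show "AE w in ?T. norm (norm (X w) powr q) \<le> B powr q"
    proof (rule AE_tau_on)
      fix w :: "complex ^ 'n" assume "w \<in> bergman_ball 0 \<gamma>"
      then have "norm (X w) \<le> B"
        using norm_le_bradius[of w \<gamma>] by (intro X) (auto simp: bergman_ball_def)
      then show "norm (norm (X w) powr q) \<le> B powr q" using q by (simp add: powr_mono2)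
    qed
  qed measurable
  then show ?thesis by (simp add: Lp_def)
qed

section \<open>A criterion for membership in BIO\<close>

text \<open>Composing a norm-continuous \<open>E\<close>-valued function with these approximations
  gives simple functions converging to it. Strong measurability in \<open>E\<close> is obtained in
  this way both in the integration variable and in \<open>z\<close>.\<close>

lemma simple_approx_ident:
  obtains \<pi> :: "nat \<Rightarrow> complex ^ 'n::finite \<Rightarrow> complex ^ 'n" where
    "\<And>k. simple_function (v_alpha \<alpha>) (\<pi> k)" "\<And>k u. norm (\<pi> k u) < 1"
    "\<And>u. norm u < 1 \<Longrightarrow> (\<lambda>k. \<pi> k u) \<longlonglongrightarrow> u"
proof -
  obtain F :: "nat \<Rightarrow> complex ^ 'n \<Rightarrow> complex ^ 'n" where F': "\<forall>i. simple_function (v_alpha \<alpha>) (F i)"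
    "\<forall>x \<in> space (v_alpha \<alpha> :: (complex ^ 'n) measure). (\<lambda>i. F i x) \<longlonglongrightarrow> x"
    using borel_measurable_implies_sequence_metric[OF ident_v_alpha[of \<alpha>], of 0] by blast
  note F = F'[rule_format]
  \<comment> \<open>Values outside the ball are reset to 0 so that the kernel bounds apply to them;
    at a fixed point of the ball this happens only finitely often.\<close>
  define \<pi> where "\<pi> k u = (if norm (F k u) < 1 then F k u else 0)" for k u
  show ?thesis
  proof
    show "simple_function (v_alpha \<alpha>) (\<pi> k)" for k
      unfolding \<pi>_def by (rule simple_function_compose1[OF F(1), of "\<lambda>v. if norm v < 1 then v else 0"])
    show "norm (\<pi> k u) < 1" for k u by (simp add: \<pi>_def)
    fix u :: "complex ^ 'n" assume u: "norm u < 1"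
    then have lim: "(\<lambda>k. F k u) \<longlonglongrightarrow> u" by (intro F(2)) simp
    have "\<forall>\<^sub>F k in sequentially. norm (F k u) < 1"
      by (rule order_tendstoD(2)[OF tendsto_norm[OF lim] u])
    then have "\<forall>\<^sub>F k in sequentially. F k u = \<pi> k u"
      by eventually_elim (simp add: \<pi>_def)
    with lim show "(\<lambda>k. \<pi> k u) \<longlonglongrightarrow> u"
      by (rule Lim_transform_eventually)
  qed
qed

lemma sum_fun_apply: "(\<Sum>y\<in>S. f y) w = (\<Sum>y\<in>S. f y w)" for f :: "'a \<Rightarrow> 'b \<Rightarrow> 'c::comm_monoid_add"
  by (induction S rule: infinite_finite_induct) simp_all

text \<open>Taken with evaluation at a point \<open>w\<close> for \<open>g\<close>, it identifies
  the abstract integral of a simple \<open>E\<close>-valued function with an ordinary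
  integral.\<close>

lemma integral_simple_function_comp:
  fixes g :: "'e \<Rightarrow> 'b::{banach, second_countable_topology}"
  assumes "finite_measure M" and s: "simple_function M s"
  shows "integrable M (\<lambda>u. g (s u))"
    "(\<integral>u. g (s u) \<partial>M) = (\<Sum>y\<in>s ` space M. measure M {u \<in> space M. s u = y} *\<^sub>R g y)"
proof -
  interpret finite_measure M by fact
  have fin: "finite (s ` space M)" and sets: "\<And>y. {u \<in> space M. s u = y} \<in> sets M"
  proof -
    show "finite (s ` space M)" using s by (simp add: simple_function_def)
    fix y
    show "{u \<in> space M. s u = y} \<in> sets M"
      using simple_functionD(2)[OF s, of "{y}"] by (simp add: vimage_def Int_def conj_commute)
  qed
  have eq: "g (s u) = (\<Sum>y\<in>s ` space M. indicator {u \<in> space M. s u = y} u *\<^sub>R g y)" if "u \<in> space M" for u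
  proof -
    have "(\<Sum>y\<in>s ` space M. indicator {u \<in> space M. s u = y} u *\<^sub>R g y) = (\<Sum>y\<in>s ` space M. if y = s u then g y else 0)"
      using that by (intro sum.cong) (auto simp: indicator_def)
    then show ?thesis using that fin by simp
  qed
  have int: "integrable M (\<lambda>u. \<Sum>y\<in>s ` space M. indicator {u \<in> space M. s u = y} u *\<^sub>R g y)"
    using sets by (intro Bochner_Integration.integrable_sum integrable_scaleR_left) (auto simp: emeasure_eq_measure)
  show "integrable M (\<lambda>u. g (s u))"
    using int by (subst Bochner_Integration.integrable_cong[OF refl eq])
  have "(\<integral>u. g (s u) \<partial>M) = (\<integral>u. (\<Sum>y\<in>s ` space M. indicator {u \<in> space M. s u = y} u *\<^sub>R g y) \<partial>M)"
    by (rule Bochner_Integration.integral_cong[OF refl eq])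
  also have "\<dots> = (\<Sum>y\<in>s ` space M. \<integral>u. indicator {u \<in> space M. s u = y} u *\<^sub>R g y \<partial>M)"
    using sets by (intro Bochner_Integration.integral_sum integrable_scaleR_left) (auto simp: emeasure_eq_measure)
  also have "\<dots> = (\<Sum>y\<in>s ` space M. measure M {u \<in> space M. s u = y} *\<^sub>R g y)"
    using sets by (intro sum.cong refl, subst integral_scaleR_left)
      (auto simp: emeasure_eq_measure intro!: arg_cong2[where f = scaleR] arg_cong[where f = "measure M"])
  finally show "(\<integral>u. g (s u) \<partial>M) = (\<Sum>y\<in>s ` space M. measure M {u \<in> space M. s u = y} *\<^sub>R g y)" .
qed

text \<open>What the three kernels share: joint measurability and the orders \<open>- m\<close> and
  \<open>- m - 1/2\<close>. The multiplication \<open>sc\<close> covers scalar and vector values at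
  once.\<close>

locale bergman_estimates =
  fixes \<alpha> \<gamma> q m :: real
    and sc :: "complex \<Rightarrow> 'b \<Rightarrow> 'b::{banach, second_countable_topology}"
    and K :: "complex ^ 'n::finite \<Rightarrow> complex ^ 'n \<Rightarrow> complex ^ 'n \<Rightarrow> 'b"
  assumes \<alpha>: "-1 < \<alpha>" and \<gamma>: "0 < \<gamma>" and q: "1 < q"
    and m: "m = real CARD('n) + 1 + \<alpha>"
    and sc: "bounded_bilinear sc" and norm_sc: "\<And>c x. norm (sc c x) = cmod c * norm x"
    and sc_one: "\<And>x. sc 1 x = x"
    and meas: "\<And>z. norm z < 1 \<Longrightarrow> (\<lambda>(w, u). K z u w) \<in> borel_measurable (tau \<Otimes>\<^sub>M v_alpha \<alpha>)"
    and bnd: "\<And>A. 1 \<le> A \<Longrightarrow>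
      bnd A (bradius \<gamma>) (- m) (- m - 1/2) K"
begin

abbreviation "V \<equiv> v_alpha \<alpha> :: (complex ^ 'n) measure"
abbreviation "D \<equiv> bergman_ball 0 \<gamma> :: (complex ^ 'n) set"
abbreviation "E \<equiv> Lp_space (tau_on D) q sc"
definition "Mq = measure (tau_on D) unit_ball powr (1 / q)"

definition T :: "(complex ^ 'n \<Rightarrow> complex) \<Rightarrow> complex ^ 'n \<Rightarrow> complex ^ 'n \<Rightarrow> 'b" where
  "T f z w = (\<integral>u. sc (f u) (K z u w) \<partial>V)"

lemma Mq_nonneg: "0 \<le> Mq"
  by (simp add: Mq_def)

lemma m_pos: "0 < m"
  using \<alpha> by (simp add: m add_pos_nonneg)

lemma nrm_E_le:
  assumes "0 \<le> B" "\<And>w. norm w < 1 \<Longrightarrow> norm w \<le> bradius \<gamma> \<Longrightarrow> norm (X w) \<le> B"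
  shows "nrm E X \<le> Mq * B"
  using Lp_norm_tau_on_le[OF \<gamma> q assms] by (simp add: Lp_space_def Mq_def)

lemma nrm_E_nonneg: "0 \<le> nrm E X"
  by (simp add: Lp_space_def Lp_norm_nonneg)

lemma vecs_EI:
  assumes "X \<in> borel_measurable tau" "\<And>w. norm w < 1 \<Longrightarrow> norm w \<le> bradius \<gamma> \<Longrightarrow> norm (X w) \<le> B"
  shows "X \<in> vecs E"
  using Lp_tau_onI[OF \<gamma> q assms] by (simp add: Lp_space_def)

lemma K_bounds:
  assumes "1 \<le> A"
  obtains C where "0 \<le> C" "\<And>z u z' u' r d w. near A z u z' u' r d \<Longrightarrow> norm w \<le> bradius \<gamma> \<Longrightarrow>
      norm (K z u w) \<le> C * d powr - m"
    "\<And>z u z' u' r d w. near A z u z' u' r d \<Longrightarrow> norm w \<le> bradius \<gamma> \<Longrightarrow>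
      norm (K z u w - K z' u' w) \<le> C * r * d powr (- m - 1/2)"
  using bndD[OF bnd[OF assms]] by blast

lemma K_size:
  obtains C where "0 \<le> C" "\<And>z u w. norm z < 1 \<Longrightarrow> norm u < 1 \<Longrightarrow> norm w \<le> bradius \<gamma> \<Longrightarrow>
      norm (K z u w) \<le> C * cmod (1 - hprod z u) powr - m"
proof -
  obtain C where C: "0 \<le> C" "\<And>z u z' u' r d w. near 2 z u z' u' r d \<Longrightarrow> norm w \<le> bradius \<gamma> \<Longrightarrow>
      norm (K z u w) \<le> C * d powr - m"
    by (rule K_bounds[of 2]) (auto intro: that)
  show ?thesis
    using that[OF C(1)] C(2)[OF near_refl] by simp
qed

lemma K_lipschitz_second:
  assumes z: "norm z < 1"
  obtains B L where "0 \<le> B" "0 \<le> L" "\<And>u w. norm u < 1 \<Longrightarrow> norm w \<le> bradius \<gamma> \<Longrightarrow> norm (K z u w) \<le> B"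
    "\<And>u u' w. norm u < 1 \<Longrightarrow> norm u' < 1 \<Longrightarrow> norm w \<le> bradius \<gamma> \<Longrightarrow> norm (K z u w - K z u' w) \<le> L * norm (u - u')"
proof -
  define A where "A = 2 / (1 - norm z)"
  have A: "1 \<le> A"
    unfolding A_def by (rule iffD2[OF pos_le_divide_eq]) (use z norm_ge_zero[of z] in argo)+
  obtain C where C: "0 \<le> C" "\<And>z u z' u' r d w. near A z u z' u' r d \<Longrightarrow> norm w \<le> bradius \<gamma> \<Longrightarrow>
      norm (K z u w) \<le> C * d powr - m"
    "\<And>z u z' u' r d w. near A z u z' u' r d \<Longrightarrow> norm w \<le> bradius \<gamma> \<Longrightarrow>
      norm (K z u w - K z' u' w) \<le> C * r * d powr (- m - 1/2)"
    by (rule K_bounds[OF A]) blast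
  have d: "cmod (1 - hprod z u) powr - e \<le> (1 - norm z) powr - e" if "norm u < 1" "0 \<le> e" for u e
    using one_minus_norm_le[of u z] that z by (intro powr_mono2') auto
  show ?thesis
  proof (rule that)
    fix u w :: "complex ^ 'n" assume *: "norm u < 1" "norm w \<le> bradius \<gamma>"
    have "norm (K z u w) \<le> C * cmod (1 - hprod z u) powr - m"
      using near_second[OF z *(1) *(1)] *(2) unfolding A_def[symmetric] by (rule C(2))
    also have "\<dots> \<le> C * (1 - norm z) powr - m"
      using C(1) d[OF *(1), of m] m_pos by (intro mult_left_mono) auto
    finally show "norm (K z u w) \<le> C * (1 - norm z) powr - m" .
  next
    fix u u' w :: "complex ^ 'n" assume *: "norm u < 1" "norm u' < 1" "norm w \<le> bradius \<gamma>"
    have "norm (K z u w - K z u' w) \<le> C * norm (u - u') * cmod (1 - hprod z u) powr (- m - 1/2)"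
      using near_second[OF z *(1) *(2)] *(3) unfolding A_def[symmetric] by (rule C(3))
    also have "\<dots> \<le> C * norm (u - u') * (1 - norm z) powr (- m - 1/2)"
      using C(1) d[OF *(1), of "m + 1/2"] m_pos by (intro mult_left_mono) auto
    finally show "norm (K z u w - K z u' w) \<le> C * (1 - norm z) powr (- m - 1/2) * norm (u - u')"
      by (simp add: mult_ac)
  qed (use C in auto)
qed

lemma K_measurable_second:
  assumes "norm z < 1" "norm w < 1"
  shows "(\<lambda>u. K z u w) \<in> borel_measurable V"
  using measurable_compose[OF measurable_Pair1'[of w tau V] meas[OF assms(1)]] assms(2) by simp

lemma K_measurable_third:
  assumes "norm z < 1" "norm u < 1"
  shows "(\<lambda>w. K z u w) \<in> borel_measurable tau"
  using measurable_compose[OF measurable_Pair2'[of u V tau] meas[OF assms(1)]] assms(2) by simp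

lemma K_vecs: "norm z < 1 \<Longrightarrow> norm u < 1 \<Longrightarrow> K z u \<in> vecs E"
  by (rule K_lipschitz_second, assumption) (rule vecs_EI[OF K_measurable_third], auto)

lemma bergman_kernel: "bergman_kernel_on \<alpha> E K"
  unfolding bergman_kernel_on_def m [symmetric]
proof (intro conjI ballI impI)
  fix z w :: "complex ^ 'n" assume "z \<in> unit_ball" "w \<in> unit_ball"
  then show "K z w \<in> vecs E" by (simp add: K_vecs)
next
  fix z u :: "complex ^ 'n" assume "z \<in> unit_ball" "u \<in> unit_ball"
  then have z: "norm z < 1" and u: "norm u < 1" by auto
  let ?S = "{x \<in> unit_ball \<times> unit_ball. fst x \<noteq> snd x} :: ((complex ^ 'n) \<times> (complex ^ 'n)) set"
  obtain C where C: "0 \<le> C" "\<And>z u z' u' r d w. near 2 z u z' u' r d \<Longrightarrow> norm w \<le> bradius \<gamma> \<Longrightarrow>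
      norm (K z u w - K z' u' w) \<le> C * r * d powr (- m - 1/2)"
    by (rule K_bounds[of 2]) (auto intro: that)
  define rr where "rr = (\<lambda>x. norm (z - fst x) + norm (u - snd x) + \<bar>sn z - sn (fst x)\<bar>
      + cmod (hprod z u - hprod (fst x) (snd x)) / sqrt (cmod (1 - hprod z u)))"
  define B where "B = C * cmod (1 - hprod z u) powr (- m - 1/2)"
  show "((\<lambda>x. nrm E (K (fst x) (snd x) - K z u)) \<longlongrightarrow> 0) (at (z, u) within ?S)"
  proof (rule Lim_null_comparison)
    have "\<forall>\<^sub>F x in at (z, u) within ?S. x \<in> ?S"
      by (simp add: eventually_at_filter)
    with eventually_near(2)[OF z u, of ?S]
    show "\<forall>\<^sub>F x in at (z, u) within ?S. norm (nrm E (K (fst x) (snd x) - K z u)) \<le> Mq * (B * rr x)"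
    proof eventually_elim
      case (elim x)
      then have nr: "near 2 z u (fst x) (snd x) (rr x) (cmod (1 - hprod z u))"
        by (auto simp: rr_def)
      then have "0 \<le> rr x" by (simp add: near_def)
      have "nrm E (K (fst x) (snd x) - K z u) \<le> Mq * (B * rr x)"
      proof (rule nrm_E_le)
        show "0 \<le> B * rr x" using C \<open>0 \<le> rr x\<close> by (simp add: B_def)
        fix w :: "complex ^ 'n" assume "norm w \<le> bradius \<gamma>"
        from C(2)[OF nr this] show "norm ((K (fst x) (snd x) - K z u) w) \<le> B * rr x"
          by (simp add: B_def norm_minus_commute mult_ac)
      qed
      then show ?case using nrm_E_nonneg by simp
    qed
    have "((\<lambda>x. Mq * (B * rr x)) \<longlongrightarrow> Mq * (B * 0)) (at (z, u) within ?S)"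
      unfolding rr_def by (intro tendsto_mult tendsto_const eventually_near(1)[OF z u])
    then show "((\<lambda>x. Mq * (B * rr x)) \<longlongrightarrow> 0) (at (z, u) within ?S)" by simp
  qed
next
  obtain C0 where C0: "0 \<le> C0" "\<And>z u w. norm z < 1 \<Longrightarrow> norm u < 1 \<Longrightarrow> norm w \<le> bradius \<gamma> \<Longrightarrow>
      norm (K z u w) \<le> C0 * cmod (1 - hprod z u) powr - m"
    by (rule K_size) blast
  obtain C1 where C1: "0 \<le> C1" "\<And>z u z' u' r d w. near 4 z u z' u' r d \<Longrightarrow> norm w \<le> bradius \<gamma> \<Longrightarrow>
      norm (K z u w - K z' u' w) \<le> C1 * r * d powr (- m - 1/2)"
    by (rule K_bounds[of 4]) (auto intro: that)
  define P where "P = Mq * C0 * 5 powr m"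
  \<comment> \<open>The powers of 5 in \<open>P\<close> and \<open>Q\<close> come from
    \<open>rho_le\<close>, which replaces negative powers of \<open>d\<close> by those of
    \<open>rho\<close>.\<close>
  define Q where "Q = Mq * C1 * 5 powr (m + 1/2)"
  define C where "C = 1 + P + 2 * Q"
  have PQ: "0 \<le> P" "0 \<le> Q" using C0 C1 Mq_nonneg by (auto simp: P_def Q_def)
  have d_le: "cmod (1 - hprod z u) powr - e \<le> 5 powr e / rho z u powr e"
    if "norm z < 1" "norm u < 1" "z \<noteq> u" "0 \<le> e" for z u :: "complex ^ 'n" and e
  proof -
    have "rho z u / 5 \<le> cmod (1 - hprod z u)" "0 < rho z u / 5"
      using rho_le[OF that(1,2)] rho_pos[OF that(3)] by auto
    then have "cmod (1 - hprod z u) powr - e \<le> (rho z u / 5) powr - e"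
      using that by (intro powr_mono2') auto
    also have "\<dots> = 5 powr e / rho z u powr e"
      by (simp add: powr_divide powr_minus_divide)
    finally show ?thesis .
  qed
  have size: "nrm E (K z u) \<le> P / rho z u powr m" if "norm z < 1" "norm u < 1" "z \<noteq> u" for z u :: "complex ^ 'n"
  proof -
    have "nrm E (K z u) \<le> Mq * (C0 * cmod (1 - hprod z u) powr - m)"
      using C0 that by (intro nrm_E_le) auto
    also have "\<dots> \<le> Mq * (C0 * (5 powr m / rho z u powr m))"
      using C0 Mq_nonneg d_le[OF that, of m] m_pos by (intro mult_left_mono) auto
    finally show ?thesis by (simp add: P_def)
  qed
  have regularity: "nrm E (K z w - K z v) + nrm E (K w z - K v z) \<le> 2 * Q * rho w v powr (1/2) / rho z v powr (m + 1/2)"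
    if "norm z < 1" "norm w < 1" "norm v < 1" "z \<noteq> v" "rho z v \<ge> 320 * rho w v" for z w v :: "complex ^ 'n"
  proof -
    define d where "d = cmod (1 - hprod z v)"
    define r where "r = sqrt (rho w v)"
    have r0: "0 \<le> r" by (simp add: r_def rho_nonneg)
    define X where "X = Mq * (C1 * r * (5 powr (m + 1/2) / rho z v powr (m + 1/2)))"
    have "Mq * (C1 * r * d powr (- m - 1/2)) \<le> X"
      unfolding X_def using C1 Mq_nonneg r0 d_le[OF that(1,3,4), of "m + 1/2"] m_pos
      by (intro mult_left_mono) (auto simp: d_def)
    moreover have "nrm E (K z w - K z v) \<le> Mq * (C1 * r * d powr (- m - 1/2))"
      using near_of_rho(1)[OF that(1,2,3,5)] C1 r0
      by (intro nrm_E_le) (auto simp: r_def[symmetric] d_def[symmetric])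
    moreover have "nrm E (K w z - K v z) \<le> Mq * (C1 * r * d powr (- m - 1/2))"
      using near_of_rho(2)[OF that(1,2,3,5)] C1 r0
      by (intro nrm_E_le) (auto simp: r_def[symmetric] d_def[symmetric])
    ultimately have "nrm E (K z w - K z v) + nrm E (K w z - K v z) \<le> 2 * X"
      by linarith
    also have "r = rho w v powr (1/2)"
      by (simp add: r_def powr_half_sqrt rho_nonneg)
    then have "2 * X = 2 * Q * rho w v powr (1/2) / rho z v powr (m + 1/2)"
      by (simp add: X_def Q_def mult_ac)
    finally show ?thesis .
  qed
  show "\<exists>C>0. \<exists>\<delta>>0. \<exists>b>0. b \<le> 1 \<and>
        (\<forall>z\<in>unit_ball. \<forall>w\<in>unit_ball. z \<noteq> w \<longrightarrow>
           nrm E (K z w) \<le> C / rho z w powr m) \<and>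
        (\<forall>z\<in>unit_ball. \<forall>w\<in>unit_ball. \<forall>\<zeta>\<in>unit_ball.
           z \<noteq> w \<longrightarrow> z \<noteq> \<zeta> \<longrightarrow> rho z \<zeta> \<ge> \<delta> * rho w \<zeta> \<longrightarrow>
           nrm E (K z w - K z \<zeta>) + nrm E (K w z - K \<zeta> z)
             \<le> C * rho w \<zeta> powr b / rho z \<zeta> powr (m + b))"
  proof (rule exI[of _ C], rule conjI, goal_cases)
    case 1
    show "0 < C" using PQ by (simp add: C_def)
  next
    case 2
    show ?case
    \<comment> \<open>The separation constant 320 is that of \<open>near_of_rho\<close>, and the
      exponent is 1/2 because the scale \<open>r\<close> is the square root of
      \<open>rho\<close>.\<close>
    proof (rule exI[of _ 320], rule conjI, simp, rule exI[of _ "1/2"], intro conjI ballI impI)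
      fix z u :: "complex ^ 'n" assume "z \<in> unit_ball" "u \<in> unit_ball" "z \<noteq> u"
      then have "nrm E (K z u) \<le> P / rho z u powr m" by (intro size) auto
      also have "\<dots> \<le> C / rho z u powr m"
        using PQ by (intro divide_right_mono) (auto simp: C_def)
      finally show "nrm E (K z u) \<le> C / rho z u powr m" .
    next
      fix z w v :: "complex ^ 'n"
      assume "z \<in> unit_ball" "w \<in> unit_ball" "v \<in> unit_ball" "z \<noteq> v" "320 * rho w v \<le> rho z v"
      then have "nrm E (K z w - K z v) + nrm E (K w z - K v z) \<le> 2 * Q * rho w v powr (1/2) / rho z v powr (m + 1/2)"
        by (intro regularity) auto
      also have "\<dots> \<le> C * rho w v powr (1/2) / rho z v powr (m + 1/2)"
        using PQ by (intro divide_right_mono mult_right_mono) (auto simp: C_def)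
      finally show "nrm E (K z w - K z v) + nrm E (K w z - K v z) \<le> C * rho w v powr (1/2) / rho z v powr (m + 1/2)" .
    qed auto
  qed
qed

section \<open>The operator as an \<open>E\<close>-valued Bochner integral\<close>

lemma sc_measurable [measurable (raw)]:
  assumes "f \<in> borel_measurable M" "g \<in> borel_measurable M"
  shows "(\<lambda>x. sc (f x) (g x)) \<in> borel_measurable M"
  by (rule borel_measurable_continuous_Pair[OF assms])
    (intro bounded_bilinear.continuous_on[OF sc] continuous_intros)

context
  fixes f :: "complex ^ 'n \<Rightarrow> complex" assumes f: "integrable V f"
begin

lemma f_meas [measurable]: "f \<in> borel_measurable V"
  using f by simp

lemma sc_K_integrable:
  assumes z: "norm z < 1" and w: "norm w < 1" "norm w \<le> bradius \<gamma>"
  shows "integrable V (\<lambda>u. sc (f u) (K z u w))"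
proof -
  note [measurable] = K_measurable_second[OF z w(1)]
  obtain B L where B: "0 \<le> B" "\<And>u w. norm u < 1 \<Longrightarrow> norm w \<le> bradius \<gamma> \<Longrightarrow> norm (K z u w) \<le> B"
    by (rule K_lipschitz_second[OF z]) blast
  show ?thesis
  proof (rule Bochner_Integration.integrable_bound)
    show "integrable V (\<lambda>u. B * cmod (f u))" using f by simp
    show "AE u in V. norm (sc (f u) (K z u w)) \<le> norm (B * cmod (f u))"
    proof (intro AE_I2)
      fix u assume "u \<in> space V"
      then have "cmod (f u) * norm (K z u w) \<le> cmod (f u) * B"
        using w by (intro mult_left_mono B(2)) auto
      then show "norm (sc (f u) (K z u w)) \<le> norm (B * cmod (f u))"
        using B(1) by (simp add: norm_sc mult.commute)
    qed
  qed measurable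
qed

lemma T_measurable:
  assumes z: "norm z < 1"
  shows "T f z \<in> borel_measurable tau"
proof -
  interpret finite_measure V by (rule finite_measure_v_alpha[OF \<alpha>])
  note [measurable] = meas[OF z]
  have "(\<lambda>(w, u). sc (f u) (K z u w)) \<in> borel_measurable (tau \<Otimes>\<^sub>M V)"
    using sc_measurable[OF measurable_compose[OF measurable_snd f_meas] meas[OF z]]
    by (simp add: split_beta')
  then show ?thesis
    unfolding T_def[abs_def] by (rule borel_measurable_lebesgue_integral)
qed



lemma scl_E: "scl E c X = (\<lambda>w. sc c (X w))"
  by (simp add: Lp_space_def)

lemma T_vecs:
  assumes z: "norm z < 1"
  shows "T f z \<in> vecs E"
proof -
  obtain B L where B: "0 \<le> B" "\<And>u w. norm u < 1 \<Longrightarrow> norm w \<le> bradius \<gamma> \<Longrightarrow> norm (K z u w) \<le> B"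
    by (rule K_lipschitz_second[OF z]) blast
  have bound: "norm (T f z w) \<le> (\<integral>u. B * cmod (f u) \<partial>V)"
    if w: "norm w < 1" "norm w \<le> bradius \<gamma>" for w
  proof -
  have "norm (T f z w) \<le> (\<integral>u. norm (sc (f u) (K z u w)) \<partial>V)"
    unfolding T_def by (rule integral_norm_bound)
  also have "\<dots> \<le> (\<integral>u. B * cmod (f u) \<partial>V)"
  proof (rule integral_mono)
    show "integrable V (\<lambda>u. norm (sc (f u) (K z u w)))"
      using sc_K_integrable[OF z w] by simp
    show "integrable V (\<lambda>u. B * cmod (f u))" using f by simp
    fix u assume "u \<in> space V"
    then have "cmod (f u) * norm (K z u w) \<le> cmod (f u) * B"
      using w by (intro mult_left_mono B(2)) auto
    then show "norm (sc (f u) (K z u w)) \<le> B * cmod (f u)"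
      by (simp add: norm_sc mult.commute)
  qed
  finally show ?thesis .
  qed
  show ?thesis
    by (rule vecs_EI[OF T_measurable[OF z] bound])
qed

text \<open>Both \<open>f\<close> and the point \<open>u\<close> inside the kernel are replaced by
  simple approximations. The error \<open>b k u\<close> is independent of \<open>w\<close>, hence
  bounds the norm in \<open>E\<close>, and it is dominated by a multiple of \<open>|f|\<close>;
  dominated convergence then gives the two limits in the definition of the integral.\<close>

lemma has_integral_T:
  assumes z: "norm z < 1"
  shows "has_integral_in E V (\<lambda>u. scl E (f u) (K z u)) (T f z)"
proof -
  interpret finite_measure V by (rule finite_measure_v_alpha[OF \<alpha>])
  obtain B L where B: "0 \<le> B" "0 \<le> L" "\<And>u w. norm u < 1 \<Longrightarrow> norm w \<le> bradius \<gamma> \<Longrightarrow> norm (K z u w) \<le> B"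
    "\<And>u u' w. norm u < 1 \<Longrightarrow> norm u' < 1 \<Longrightarrow> norm w \<le> bradius \<gamma> \<Longrightarrow> norm (K z u w - K z u' w) \<le> L * norm (u - u')"
    by (rule K_lipschitz_second[OF z]) blast
  obtain \<pi> :: "nat \<Rightarrow> complex ^ 'n \<Rightarrow> complex ^ 'n" where \<pi>:
    "\<And>k. simple_function V (\<pi> k)" "\<And>k u. norm (\<pi> k u) < 1"
    "\<And>u. norm u < 1 \<Longrightarrow> (\<lambda>k. \<pi> k u) \<longlonglongrightarrow> u"
    by (rule simple_approx_ident[of \<alpha>]) blast
  obtain g :: "nat \<Rightarrow> complex ^ 'n \<Rightarrow> complex" where g': "\<forall>k. simple_function V (g k)"
    "\<forall>u \<in> space V. (\<lambda>k. g k u) \<longlonglongrightarrow> f u"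
    "\<forall>k. \<forall>u \<in> space V. dist (g k u) 0 \<le> 2 * dist (f u) 0"
    using borel_measurable_implies_sequence_metric[OF f_meas, of 0] by blast
  have g: "\<And>k. simple_function V (g k)" "\<And>u. u \<in> space V \<Longrightarrow> (\<lambda>k. g k u) \<longlonglongrightarrow> f u"
    "\<And>k u. u \<in> space V \<Longrightarrow> norm (g k u) \<le> 2 * norm (f u)"
    using g' by (auto simp: dist_norm)
  have [measurable]: "\<pi> k \<in> borel_measurable V" "g k \<in> borel_measurable V" for k
    using \<pi>(1) g(1) by (auto intro: borel_measurable_simple_function)
  define s where "s k u = (\<lambda>w. sc (g k u) (K z (\<pi> k u) w))" for k u
  \<comment> \<open>The first summand is the error from replacing \<open>f\<close>, with the bound
    \<open>B\<close> of the kernel; the second is the error from moving \<open>u\<close>, with its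
    Lipschitz constant \<open>L\<close>.\<close>
  define b where "b k u = cmod (f u - g k u) * B + cmod (f u) * (L * norm (u - \<pi> k u))" for k u
  have b_nonneg: "0 \<le> b k u" for k u
    using B by (simp add: b_def)
  have [measurable]: "b k \<in> borel_measurable V" for k
    unfolding b_def by measurable
  have b_bound: "norm (b k u) \<le> (3 * B + 2 * L) * cmod (f u)" if "u \<in> space V" for k u
  proof -
    have "cmod (f u - g k u) \<le> 3 * cmod (f u)"
      using norm_triangle_ineq4[of "f u" "g k u"] g(3)[OF that, of k] by simp
    then have 1: "cmod (f u - g k u) * B \<le> 3 * cmod (f u) * B"
      using B by (intro mult_right_mono) auto
    have "norm (u - \<pi> k u) \<le> 2"
      using norm_triangle_ineq4[of u "\<pi> k u"] \<pi>(2)[of k u] that by simp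
    then have "cmod (f u) * (L * norm (u - \<pi> k u)) \<le> cmod (f u) * (L * 2)"
      using B by (intro mult_left_mono) auto
    with 1 show ?thesis
      using b_nonneg[of k u] by (simp add: b_def algebra_simps)
  qed
  have b_lim: "(\<lambda>k. b k u) \<longlonglongrightarrow> 0" if "u \<in> space V" for u
  proof -
    have "(\<lambda>k. b k u) \<longlonglongrightarrow> cmod (f u - f u) * B + cmod (f u) * (L * norm (u - u))"
      unfolding b_def using that by (intro tendsto_intros g(2) \<pi>(3)) auto
    then show ?thesis by simp
  qed
  have dom: "integrable V (\<lambda>u. (3 * B + 2 * L) * cmod (f u))" using f by simp
  have b_int: "integrable V (b k)" for k
  proof (rule Bochner_Integration.integrable_bound[OF dom])
    show "AE u in V. norm (b k u) \<le> norm ((3 * B + 2 * L) * cmod (f u))"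
    proof (intro AE_I2)
      fix u assume "u \<in> space V"
      from b_bound[OF this, of k] show "norm (b k u) \<le> norm ((3 * B + 2 * L) * cmod (f u))"
        using abs_ge_self[of "(3 * B + 2 * L) * cmod (f u)"] unfolding real_norm_def by linarith
    qed
  qed measurable
  have b_int_lim: "(\<lambda>k. \<integral>u. b k u \<partial>V) \<longlonglongrightarrow> 0"
  proof -
    have "(\<lambda>k. \<integral>u. b k u \<partial>V) \<longlonglongrightarrow> (\<integral>u. 0 \<partial>V)"
    proof (rule integral_dominated_convergence[OF _ _ dom])
      show "AE u in V. (\<lambda>k. b k u) \<longlonglongrightarrow> 0" using b_lim by (intro AE_I2)
      show "AE u in V. norm (b k u) \<le> (3 * B + 2 * L) * cmod (f u)" for k using b_bound by (intro AE_I2)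
    qed auto
    then show ?thesis by simp
  qed
  have diff: "norm (sc (f u) (K z u w) - s k u w) \<le> b k u"
    if "norm u < 1" "norm w \<le> bradius \<gamma>" for k u w
  proof -
    have "sc (f u) (K z u w) - s k u w = sc (f u - g k u) (K z (\<pi> k u) w) + sc (f u) (K z u w - K z (\<pi> k u) w)"
      by (simp add: s_def bounded_bilinear.diff_left[OF sc] bounded_bilinear.diff_right[OF sc])
    then have "norm (sc (f u) (K z u w) - s k u w) \<le> cmod (f u - g k u) * norm (K z (\<pi> k u) w) + cmod (f u) * norm (K z u w - K z (\<pi> k u) w)"
      using norm_triangle_ineq[of "sc (f u - g k u) (K z (\<pi> k u) w)" "sc (f u) (K z u w - K z (\<pi> k u) w)"] by (simp add: norm_sc)
    also have "\<dots> \<le> b k u"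
      unfolding b_def using that \<pi>(2) by (intro add_mono mult_left_mono B(3,4)) auto
    finally show ?thesis .
  qed
  have nrm_diff: "nrm E ((\<lambda>w. sc (f u) (K z u w)) - s k u) \<le> Mq * b k u" if "u \<in> space V" for k u
  proof (rule nrm_E_le[OF b_nonneg])
    fix w :: "complex ^ 'n" assume "norm w \<le> bradius \<gamma>"
    from diff[of u w k] this that show "norm (((\<lambda>w. sc (f u) (K z u w)) - s k u) w) \<le> b k u" by simp
  qed
  have sf: "simple_function V (s k)" for k
    unfolding s_def by (rule simple_function_compose2[OF g(1) \<pi>(1), of "\<lambda>a v w. sc a (K z v w)"])
  have s_vecs: "s k u \<in> vecs E" for k u
  proof (rule vecs_EI)
    note [measurable] = K_measurable_third[OF z \<pi>(2)[of k u]]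
    show "s k u \<in> borel_measurable tau" unfolding s_def by measurable
    fix w :: "complex ^ 'n" assume "norm w \<le> bradius \<gamma>"
    then show "norm (s k u w) \<le> cmod (g k u) * B"
      unfolding s_def norm_sc using \<pi>(2) by (intro mult_left_mono B(3)) auto
  qed
  have simple: "simple_in E V (s k)" for k
    unfolding simple_in_def using sf s_vecs by auto
  have F_vecs: "(\<lambda>w. sc (f u) (K z u w)) \<in> vecs E" if "u \<in> space V" for u
  proof (rule vecs_EI)
    have u: "norm u < 1" using that by simp
    note [measurable] = K_measurable_third[OF z u]
    show "(\<lambda>w. sc (f u) (K z u w)) \<in> borel_measurable tau" by measurable
    fix w :: "complex ^ 'n" assume "norm w \<le> bradius \<gamma>"
    then show "norm (sc (f u) (K z u w)) \<le> cmod (f u) * B"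
      unfolding norm_sc using u by (intro mult_left_mono B(3)) auto
  qed
  have strong: "strongly_measurable_in E V (\<lambda>u. scl E (f u) (K z u))"
    unfolding strongly_measurable_in_def scl_E
  proof (intro exI[of _ s] conjI allI simple AE_I2)
    fix u assume u: "u \<in> space V"
    then show "(\<lambda>w. sc (f u) (K z u w)) \<in> vecs E" by (rule F_vecs)
    show "(\<lambda>k. nrm E ((\<lambda>w. sc (f u) (K z u w)) - s k u)) \<longlonglongrightarrow> 0"
    proof (rule Lim_null_comparison)
      show "\<forall>\<^sub>F k in sequentially. norm (nrm E ((\<lambda>w. sc (f u) (K z u w)) - s k u)) \<le> Mq * b k u"
        using nrm_diff[OF u] nrm_E_nonneg by simp
      show "(\<lambda>k. Mq * b k u) \<longlonglongrightarrow> 0"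
        using tendsto_mult[OF tendsto_const b_lim[OF u], of Mq] by simp
    qed
  qed
  have L1: "(\<lambda>k. \<integral>\<^sup>+u. ennreal (nrm E (scl E (f u) (K z u) - s k u)) \<partial>V) \<longlonglongrightarrow> 0"
  proof (rule tendsto_sandwich)
    show "\<forall>\<^sub>F k in sequentially. 0 \<le> (\<integral>\<^sup>+u. ennreal (nrm E (scl E (f u) (K z u) - s k u)) \<partial>V)" by simp
    show "(\<lambda>k. 0 :: ennreal) \<longlonglongrightarrow> 0" by simp
    show "\<forall>\<^sub>F k in sequentially. (\<integral>\<^sup>+u. ennreal (nrm E (scl E (f u) (K z u) - s k u)) \<partial>V) \<le> ennreal (Mq * (\<integral>u. b k u \<partial>V))"
    proof (intro always_eventually allI)
      fix k
      have "(\<integral>\<^sup>+u. ennreal (nrm E (scl E (f u) (K z u) - s k u)) \<partial>V) \<le> (\<integral>\<^sup>+u. ennreal (Mq * b k u) \<partial>V)"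
        unfolding scl_E by (intro nn_integral_mono ennreal_leI nrm_diff)
      also have "\<dots> = ennreal (\<integral>u. Mq * b k u \<partial>V)"
        using b_int Mq_nonneg b_nonneg by (intro nn_integral_eq_integral) auto
      finally show "(\<integral>\<^sup>+u. ennreal (nrm E (scl E (f u) (K z u) - s k u)) \<partial>V) \<le> ennreal (Mq * (\<integral>u. b k u \<partial>V))"
        by simp
    qed
    have "(\<lambda>k. ennreal (Mq * (\<integral>u. b k u \<partial>V))) \<longlonglongrightarrow> ennreal (Mq * 0)"
      by (intro tendsto_ennrealI tendsto_mult tendsto_const b_int_lim)
    then show "(\<lambda>k. ennreal (Mq * (\<integral>u. b k u \<partial>V))) \<longlonglongrightarrow> 0" by simp
  qed
  have simple_int: "simple_integral_in E V (s k) w = (\<integral>u. s k u w \<partial>V)" for k w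
  proof -
    have sc_real: "sc (complex_of_real c) x = c *\<^sub>R x" for c x
      using bounded_bilinear.scaleR_left[OF sc, of c 1 x] by (simp add: sc_one scaleR_conv_of_real)
    show ?thesis
      unfolding simple_integral_in_def sum_fun_apply scl_E sc_real
      using integral_simple_function_comp(2)[OF finite_measure_axioms sf, of "\<lambda>X. X w" k] by simp
  qed
  have "(\<lambda>k. nrm E (simple_integral_in E V (s k) - T f z)) \<longlonglongrightarrow> 0"
  proof (rule Lim_null_comparison)
    show "(\<lambda>k. Mq * (\<integral>u. b k u \<partial>V)) \<longlonglongrightarrow> 0"
      using tendsto_mult[OF tendsto_const b_int_lim, of Mq] by simp
    show "\<forall>\<^sub>F k in sequentially. norm (nrm E (simple_integral_in E V (s k) - T f z)) \<le> Mq * (\<integral>u. b k u \<partial>V)"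
    proof (intro always_eventually allI)
      fix k
      have "nrm E (simple_integral_in E V (s k) - T f z) \<le> Mq * (\<integral>u. b k u \<partial>V)"
      proof (rule nrm_E_le)
        show "0 \<le> (\<integral>u. b k u \<partial>V)" using b_nonneg by (intro integral_nonneg_AE) simp
        fix w :: "complex ^ 'n" assume w: "norm w < 1" "norm w \<le> bradius \<gamma>"
        have i1: "integrable V (\<lambda>u. s k u w)"
          using integral_simple_function_comp(1)[OF finite_measure_axioms sf, of "\<lambda>X. X w" k] .
        have i2: "integrable V (\<lambda>u. sc (f u) (K z u w))" by (rule sc_K_integrable[OF z w])
        have "norm ((simple_integral_in E V (s k) - T f z) w) = norm (\<integral>u. (sc (f u) (K z u w) - s k u w) \<partial>V)"
          using i1 i2 by (simp add: simple_int T_def norm_minus_commute)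
        also have "\<dots> \<le> (\<integral>u. norm (sc (f u) (K z u w) - s k u w) \<partial>V)"
          by (rule integral_norm_bound)
        also have "\<dots> \<le> (\<integral>u. b k u \<partial>V)"
          using i1 i2 b_int diff w by (intro integral_mono) auto
        finally show "norm ((simple_integral_in E V (s k) - T f z) w) \<le> (\<integral>u. b k u \<partial>V)" .
      qed
      then show "norm (nrm E (simple_integral_in E V (s k) - T f z)) \<le> Mq * (\<integral>u. b k u \<partial>V)"
        using nrm_E_nonneg by simp
    qed
  qed
  then show ?thesis
    unfolding has_integral_in_def using T_vecs[OF z] strong simple L1 by blast
qed

text \<open>By \<open>near_first\<close> the function \<open>T f\<close> is norm continuous on the
  ball, so its compositions with the simple approximations of the identity converge to it
  pointwise.\<close>

lemma T_strongly_measurable: "strongly_measurable_in E V (T f)"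
proof -
  obtain \<pi> :: "nat \<Rightarrow> complex ^ 'n \<Rightarrow> complex ^ 'n" where \<pi>:
    "\<And>k. simple_function V (\<pi> k)" "\<And>k u. norm (\<pi> k u) < 1"
    "\<And>u. norm u < 1 \<Longrightarrow> (\<lambda>k. \<pi> k u) \<longlonglongrightarrow> u"
    by (rule simple_approx_ident[of \<alpha>]) blast
  show ?thesis
    unfolding strongly_measurable_in_def
  proof (intro exI[of _ "\<lambda>k z. T f (\<pi> k z)"] conjI allI AE_I2)
    fix k
    show "simple_in E V (\<lambda>z. T f (\<pi> k z))"
      unfolding simple_in_def using simple_function_compose1[OF \<pi>(1), of "T f" k] T_vecs[OF \<pi>(2)] by auto
  next
    fix z assume "z \<in> space V"
    then have z: "norm z < 1" by simp
    then show "T f z \<in> vecs E" by (rule T_vecs)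
    define A where "A = 4 / (1 - norm z)"
    have A: "1 \<le> A"
    unfolding A_def by (rule iffD2[OF pos_le_divide_eq]) (use z norm_ge_zero[of z] in argo)+
    obtain C where C: "0 \<le> C" "\<And>z u z' u' r d w. near A z u z' u' r d \<Longrightarrow> norm w \<le> bradius \<gamma> \<Longrightarrow>
        norm (K z u w - K z' u' w) \<le> C * r * d powr (- m - 1/2)"
      by (rule K_bounds[OF A]) blast
    define r where "r k = norm (z - \<pi> k z) + \<bar>sn z - sn (\<pi> k z)\<bar>" for k
    have r_lim: "r \<longlonglongrightarrow> 0"
    proof -
      have "r \<longlonglongrightarrow> norm (z - z) + \<bar>sn z - sn z\<bar>"
        unfolding r_def[abs_def] by (intro tendsto_intros \<pi>(3)[OF z] isCont_tendsto_compose[OF isCont_sn])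
      then show ?thesis by simp
    qed
    define P where "P = C * (1 - norm z) powr (- m - 1/2) * (\<integral>u. cmod (f u) \<partial>V)"
    have P: "0 \<le> P" using C by (auto simp: P_def intro!: mult_nonneg_nonneg integral_nonneg_AE)
    show "(\<lambda>k. nrm E (T f z - T f (\<pi> k z))) \<longlonglongrightarrow> 0"
    proof (rule Lim_null_comparison)
      show "(\<lambda>k. Mq * (P * r k)) \<longlonglongrightarrow> 0"
        using tendsto_mult[OF tendsto_const tendsto_mult[OF tendsto_const r_lim], of Mq P] by simp
      have "(\<lambda>k. norm (z - \<pi> k z)) \<longlonglongrightarrow> norm (z - z)"
        by (intro tendsto_intros \<pi>(3)[OF z])
      then have "\<forall>\<^sub>F k in sequentially. norm (z - \<pi> k z) < (1 - norm z) / 2"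
        by (rule order_tendstoD) (use z in simp)
      then show "\<forall>\<^sub>F k in sequentially. norm (nrm E (T f z - T f (\<pi> k z))) \<le> Mq * (P * r k)"
      proof eventually_elim
        case (elim k)
        have r0: "0 \<le> r k" by (simp add: r_def)
        have "nrm E (T f z - T f (\<pi> k z)) \<le> Mq * (P * r k)"
        proof (rule nrm_E_le)
          show "0 \<le> P * r k" using P r0 by simp
          fix w :: "complex ^ 'n" assume w: "norm w < 1" "norm w \<le> bradius \<gamma>"
          have i: "integrable V (\<lambda>u. sc (f u) (K z u w))" "integrable V (\<lambda>u. sc (f u) (K (\<pi> k z) u w))"
            using sc_K_integrable[OF z w] sc_K_integrable[OF \<pi>(2) w] by auto
          have "norm ((T f z - T f (\<pi> k z)) w) = norm (\<integral>u. sc (f u) (K z u w) - sc (f u) (K (\<pi> k z) u w) \<partial>V)"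
            using i by (simp add: T_def)
          also have "\<dots> \<le> (\<integral>u. norm (sc (f u) (K z u w) - sc (f u) (K (\<pi> k z) u w)) \<partial>V)"
            by (rule integral_norm_bound)
          also have "\<dots> \<le> (\<integral>u. C * r k * (1 - norm z) powr (- m - 1/2) * cmod (f u) \<partial>V)"
          proof (rule integral_mono)
            show "integrable V (\<lambda>u. norm (sc (f u) (K z u w) - sc (f u) (K (\<pi> k z) u w)))" using i by simp
            show "integrable V (\<lambda>u. C * r k * (1 - norm z) powr (- m - 1/2) * cmod (f u))" using f by simp
            fix u assume "u \<in> space V"
            then have u: "norm u < 1" by simp
            have "norm (K z u w - K (\<pi> k z) u w) \<le> C * r k * cmod (1 - hprod z u) powr (- m - 1/2)"
              using near_first[OF z _ u, of "\<pi> k z"] elim w unfolding A_def[symmetric] r_def[symmetric]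
              by (intro C(2)) auto
            also have "\<dots> \<le> C * r k * (1 - norm z) powr (- m - 1/2)"
              using C(1) r0 m_pos z one_minus_norm_le[of u z] u by (intro mult_left_mono powr_mono2') auto
            finally have "cmod (f u) * norm (K z u w - K (\<pi> k z) u w) \<le> cmod (f u) * (C * r k * (1 - norm z) powr (- m - 1/2))"
              by (intro mult_left_mono) auto
            then show "norm (sc (f u) (K z u w) - sc (f u) (K (\<pi> k z) u w)) \<le> C * r k * (1 - norm z) powr (- m - 1/2) * cmod (f u)"
              by (simp add: bounded_bilinear.diff_right[OF sc, symmetric] norm_sc mult.commute)
          qed
          finally show "norm ((T f z - T f (\<pi> k z)) w) \<le> P * r k"
            by (simp add: P_def mult_ac)
        qed
        then show ?case using nrm_E_nonneg by simp
      qed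
    qed
  qed
qed

end

section \<open>Domination by the positive operator and boundedness\<close>

lemma T_le_Bop:
  obtains C where "0 \<le> C" "\<And>f z w. integrable V f \<Longrightarrow> norm z < 1 \<Longrightarrow> norm w < 1 \<Longrightarrow> norm w \<le> bradius \<gamma> \<Longrightarrow>
    norm (T f z w) \<le> C * Bop \<alpha> f z"
proof -
  obtain C where C: "0 \<le> C" "\<And>z u w. norm z < 1 \<Longrightarrow> norm u < 1 \<Longrightarrow> norm w \<le> bradius \<gamma> \<Longrightarrow>
      norm (K z u w) \<le> C * cmod (1 - hprod z u) powr - m"
    by (rule K_size) blast
  show ?thesis
  proof (rule that[OF C(1)])
    fix f :: "complex ^ 'n \<Rightarrow> complex" and z w :: "complex ^ 'n"
    assume f: "integrable V f" and z: "norm z < 1" and w: "norm w < 1" "norm w \<le> bradius \<gamma>"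
    have int: "integrable V (\<lambda>u. cmod (1 - hprod z u) powr - m * cmod (f u))"
      unfolding m by (rule Bop_integrable[OF \<alpha> z f])
    have "norm (T f z w) \<le> (\<integral>u. norm (sc (f u) (K z u w)) \<partial>V)"
      unfolding T_def by (rule integral_norm_bound)
    also have "\<dots> \<le> (\<integral>u. C * (cmod (1 - hprod z u) powr - m * cmod (f u)) \<partial>V)"
    proof (rule integral_mono)
      show "integrable V (\<lambda>u. norm (sc (f u) (K z u w)))"
        using sc_K_integrable[OF f z w] by simp
      show "integrable V (\<lambda>u. C * (cmod (1 - hprod z u) powr - m * cmod (f u)))" using int by simp
      fix u assume "u \<in> space V"
      then have "cmod (f u) * norm (K z u w) \<le> cmod (f u) * (C * cmod (1 - hprod z u) powr - m)"
        using w z by (intro mult_left_mono C(2)) auto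
      then show "norm (sc (f u) (K z u w)) \<le> C * (cmod (1 - hprod z u) powr - m * cmod (f u))"
        by (simp add: norm_sc mult_ac)
    qed
    also have "\<dots> = C * Bop \<alpha> f z"
      by (simp add: Bop_def m)
    finally show "norm (T f z w) \<le> C * Bop \<alpha> f z" .
  qed
qed

lemma T_bounded:
  assumes p: "1 < p"
  shows "\<exists>C. \<forall>f\<in>Lp V p. T f \<in> bochner_Lp E V p \<and> bochner_Lp_norm E V p (T f) \<le> C * Lp_norm V p f"
proof -
  obtain C where C: "0 \<le> C" "\<And>f z w. integrable V f \<Longrightarrow> norm z < 1 \<Longrightarrow> norm w < 1 \<Longrightarrow> norm w \<le> bradius \<gamma> \<Longrightarrow>
    norm (T f z w) \<le> C * Bop \<alpha> f z"
    by (rule T_le_Bop) blast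
  obtain C1 where C1: "0 < C1" "\<And>f :: complex ^ 'n \<Rightarrow> complex. f \<in> Lp V p \<Longrightarrow> Bop \<alpha> f \<in> Lp V p"
    "\<And>f :: complex ^ 'n \<Rightarrow> complex. f \<in> Lp V p \<Longrightarrow>
      (\<integral>z. Bop \<alpha> f z powr p \<partial>V) \<le> C1 * (\<integral>z. cmod (f z) powr p \<partial>V)"
    using Bop_bounded[OF \<alpha> p, where 'n = 'n] by blast
  show ?thesis
  proof (intro exI[of _ "((Mq * C) powr p * C1) powr (1 / p)"] ballI)
    fix f :: "complex ^ 'n \<Rightarrow> complex" assume f: "f \<in> Lp V p"
    have fi: "integrable V f"
      by (rule Lp_integrable_norm(1)[OF finite_measure_v_alpha[OF \<alpha>] p f])
    have Bop0: "0 \<le> Bop \<alpha> f z" for z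
      unfolding Bop_def by (rule integral_nonneg_AE) simp
    have Bint: "integrable V (\<lambda>z. Bop \<alpha> f z powr p)"
      using C1(2)[OF f] Bop0 by (simp add: Lp_def)
    define I where "I = (\<integral>\<^sup>+z. ennreal (nrm E (T f z) powr p) \<partial>V)"
    have "I \<le> (\<integral>\<^sup>+z. ennreal ((Mq * C) powr p * Bop \<alpha> f z powr p) \<partial>V)"
      unfolding I_def
    proof (intro nn_integral_mono ennreal_leI)
      fix z assume "z \<in> space V"
      then have z: "norm z < 1" by simp
      have "nrm E (T f z) \<le> Mq * (C * Bop \<alpha> f z)"
        using C(1) Bop0 C(2)[OF fi z] by (intro nrm_E_le) auto
      then have "nrm E (T f z) powr p \<le> (Mq * (C * Bop \<alpha> f z)) powr p"
        using p nrm_E_nonneg by (intro powr_mono2) auto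
      also have "\<dots> = (Mq * C) powr p * Bop \<alpha> f z powr p"
        by (simp add: powr_mult)
      finally show "nrm E (T f z) powr p \<le> (Mq * C) powr p * Bop \<alpha> f z powr p" .
    qed
    also have "\<dots> = ennreal (\<integral>z. (Mq * C) powr p * Bop \<alpha> f z powr p \<partial>V)"
      using Bint by (intro nn_integral_eq_integral) auto
    also have "\<dots> \<le> ennreal ((Mq * C) powr p * C1 * (\<integral>z. cmod (f z) powr p \<partial>V))"
      using C1(3)[OF f] by (intro ennreal_leI) (simp add: mult_left_mono mult.assoc)
    finally have I: "I \<le> ennreal ((Mq * C) powr p * C1 * (\<integral>z. cmod (f z) powr p \<partial>V))" .
    then have "I < \<infinity>" by (auto intro: le_less_trans)
    with T_strongly_measurable[OF fi] show "T f \<in> bochner_Lp E V p \<and>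
        bochner_Lp_norm E V p (T f) \<le> ((Mq * C) powr p * C1) powr (1 / p) * Lp_norm V p f"
    proof (intro conjI)
      show "T f \<in> bochner_Lp E V p"
        using T_strongly_measurable[OF fi] \<open>I < \<infinity>\<close> by (simp add: bochner_Lp_def I_def)
      have "enn2real I \<le> (Mq * C) powr p * C1 * (\<integral>z. cmod (f z) powr p \<partial>V)"
        using I C1(1) by (intro enn2real_leI) (auto intro!: mult_nonneg_nonneg integral_nonneg_AE)
      then have "enn2real I powr (1 / p) \<le> ((Mq * C) powr p * C1 * (\<integral>z. cmod (f z) powr p \<partial>V)) powr (1 / p)"
        using p by (intro powr_mono2) auto
      then show "bochner_Lp_norm E V p (T f) \<le> ((Mq * C) powr p * C1) powr (1 / p) * Lp_norm V p f"
        by (simp add: bochner_Lp_norm_def I_def Lp_norm_def powr_mult)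
    qed
  qed
qed

theorem T_in_BIO: "T \<in> BIO \<alpha> E"
  unfolding BIO_def
proof (intro CollectI conjI allI impI exI[of _ K])
  show "bergman_kernel_on \<alpha> E K" by (rule bergman_kernel)
  show "bergman_integral_operator \<alpha> E K T"
    unfolding bergman_integral_operator_def
  proof (intro allI impI ballI AE_I2)
    fix p :: real and f :: "complex ^ 'n \<Rightarrow> complex" and z
    assume "1 < p" "f \<in> Lp V p" "z \<in> space V"
    then show "has_integral_in E V (\<lambda>w. scl E (f w) (K z w)) (T f z)"
      using Lp_integrable_norm(1)[OF finite_measure_v_alpha[OF \<alpha>]] by (intro has_integral_T) auto
  qed
  fix p :: real assume "1 < p"
  then show "\<exists>C. \<forall>f\<in>Lp V p. T f \<in> bochner_Lp E V p \<and> bochner_Lp_norm E V p (T f) \<le> C * Lp_norm V p f"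
    by (rule T_bounded)
qed

end

section \<open>The three operators\<close>

text \<open>The principal branch jumps across the negative axis. Cut off to the right half plane,
  which contains all bases \<open>1 - hprod (phi z w) u\<close>, the power is Borel because it is
  continuous there.\<close>

lemma borel_measurable_cpowr_restrict:
  "(\<lambda>x. if 0 < Re x then x powr c else 0) \<in> borel_measurable borel" for c :: complex
proof -
  have "continuous_on {x. 0 < Re x} (\<lambda>x. x powr c)"
  proof (rule continuous_at_imp_continuous_on, rule ballI)
    fix x :: complex assume "x \<in> {x. 0 < Re x}"
    then have "x \<notin> \<real>\<^sub>\<le>\<^sub>0" by (auto elim!: nonpos_Reals_cases)
    then show "isCont (\<lambda>x. x powr c) x"
      using has_field_derivative_powr DERIV_isCont by blast
  qed
  moreover have "open {x. 0 < Re x}"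
    by (rule open_halfspace_Re_gt)
  ultimately have "(\<lambda>x. if x \<in> {x. 0 < Re x} then x powr c else 0) \<in> borel_measurable borel"
    by (intro borel_measurable_continuous_on_if) (auto intro: borel_open)
  then show ?thesis by simp
qed

lemma measurable_pair_tau_v_alpha:
  "g \<in> borel_measurable (borel \<Otimes>\<^sub>M borel) \<Longrightarrow> g \<in> borel_measurable (tau \<Otimes>\<^sub>M v_alpha \<alpha>)"
proof -
  assume g: "g \<in> borel_measurable (borel \<Otimes>\<^sub>M borel)"
  have "(\<lambda>x. (fst x, snd x)) \<in> measurable (tau \<Otimes>\<^sub>M v_alpha \<alpha>) (borel \<Otimes>\<^sub>M borel)"
    by (intro measurable_Pair measurable_compose[OF measurable_fst ident_tau] measurable_compose[OF measurable_snd ident_v_alpha])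
  from measurable_compose[OF this g] show ?thesis by simp
qed

lemma Re_one_minus_hprod_pos:
  assumes "norm z < 1" "norm w < 1" "norm u < 1"
  shows "0 < Re (1 - hprod (phi z w) u)"
  using cmod_hprod_lt_1[of "phi z w" u] norm_phi_lt_1[of z w] assms abs_Re_le_cmod[of "hprod (phi z w) u"]
  by auto

lemma borel_measurable_cnj_vec [measurable]: "cnj_vec \<in> borel_measurable borel"
  by (intro borel_measurable_continuous_onI linear_continuous_on bounded_linear_cnj_vec)

theorem T_radial_BIO:
  assumes "0 < \<gamma>" "1 < q" "-1 < \<alpha>"
  shows "(T_radial \<alpha> :: (complex ^ 'n::finite \<Rightarrow> complex) \<Rightarrow> complex ^ 'n \<Rightarrow> complex ^ 'n \<Rightarrow> complex)
    \<in> BIO \<alpha> (Lp_space (tau_on (bergman_ball 0 \<gamma>)) q (*))"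
proof -
  interpret bergman_estimates \<alpha> \<gamma> q "real CARD('n) + 1 + \<alpha>" "(*)"
    "K_radial \<alpha> :: complex ^ 'n \<Rightarrow> complex ^ 'n \<Rightarrow> complex ^ 'n \<Rightarrow> complex"
  proof (rule bergman_estimates.intro)
    show "bounded_bilinear ((*) :: complex \<Rightarrow> _)" by (rule bounded_bilinear_mult)
    fix z :: "complex ^ 'n" assume z: "norm z < 1"
    define cp where "cp x = (if 0 < Re x then x powr complex_of_real (real CARD('n) + 2 + \<alpha>) else 0)" for x
    have [measurable]: "cp \<in> borel_measurable borel"
      unfolding cp_def by (rule borel_measurable_cpowr_restrict)
    have "(\<lambda>(w, u). complex_of_real ((real CARD('n) + 1 + \<alpha>) * (1 - (norm (phi z w))\<^sup>2)) * hprod (phi z w) u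
       / cp (1 - hprod (phi z w) u)) \<in> borel_measurable (tau \<Otimes>\<^sub>M v_alpha \<alpha>)"
      by (rule measurable_pair_tau_v_alpha) measurable
    then show "(\<lambda>(w, u). K_radial \<alpha> z u w) \<in> borel_measurable (tau \<Otimes>\<^sub>M v_alpha \<alpha>)"
      by (rule measurable_cong[THEN iffD1, rotated])
        (auto simp: space_pair_measure K_radial_def cp_def Re_one_minus_hprod_pos[simplified] z)
  next
    fix A :: real assume "1 \<le> A"
    then show "bnd A (bradius \<gamma>) (- (real CARD('n) + 1 + \<alpha>)) (- (real CARD('n) + 1 + \<alpha>) - 1 / 2)
        (K_radial \<alpha> :: complex ^ 'n \<Rightarrow> complex ^ 'n \<Rightarrow> complex ^ 'n \<Rightarrow> complex)"
      using bradius_bounds assms by (intro bnd_K_radial) auto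
  qed (use assms in \<open>auto simp: norm_mult\<close>)
  have "T_radial \<alpha> = T"
    by (simp add: fun_eq_iff T_radial_def T_def)
  with T_in_BIO show ?thesis by simp
qed

theorem T_grad_BIO:
  assumes "0 < \<gamma>" "1 < q" "-1 < \<alpha>"
  shows "(T_grad \<alpha> :: (complex ^ 'n::finite \<Rightarrow> complex) \<Rightarrow> complex ^ 'n \<Rightarrow> complex ^ 'n \<Rightarrow> complex ^ 'n)
    \<in> BIO \<alpha> (Lp_space (tau_on (bergman_ball 0 \<gamma>)) q (*s))"
proof -
  interpret bergman_estimates \<alpha> \<gamma> q "real CARD('n) + 1 + \<alpha>" "(*s)"
    "K_grad \<alpha> :: complex ^ 'n \<Rightarrow> complex ^ 'n \<Rightarrow> complex ^ 'n \<Rightarrow> complex ^ 'n"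
  proof (rule bergman_estimates.intro)
    show "bounded_bilinear ((*s) :: complex \<Rightarrow> complex ^ 'n \<Rightarrow> _)" by (rule bounded_bilinear_scale_vec)
    fix z :: "complex ^ 'n" assume z: "norm z < 1"
    define cp where "cp x = (if 0 < Re x then x powr complex_of_real (real CARD('n) + 2 + \<alpha>) else 0)" for x
    have [measurable]: "cp \<in> borel_measurable borel"
      unfolding cp_def by (rule borel_measurable_cpowr_restrict)
    have "(\<lambda>(w, u). (complex_of_real ((real CARD('n) + 1 + \<alpha>) * (1 - (norm (phi z w))\<^sup>2))
       / cp (1 - hprod (phi z w) u)) *s cnj_vec u) \<in> borel_measurable (tau \<Otimes>\<^sub>M v_alpha \<alpha>)"
      by (rule measurable_pair_tau_v_alpha) measurable
    then show "(\<lambda>(w, u). K_grad \<alpha> z u w) \<in> borel_measurable (tau \<Otimes>\<^sub>M v_alpha \<alpha>)"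
      by (rule measurable_cong[THEN iffD1, rotated])
        (auto simp: space_pair_measure K_grad_def cp_def Re_one_minus_hprod_pos[simplified] z)
  next
    fix A :: real assume "1 \<le> A"
    then show "bnd A (bradius \<gamma>) (- (real CARD('n) + 1 + \<alpha>)) (- (real CARD('n) + 1 + \<alpha>) - 1 / 2)
        (K_grad \<alpha> :: complex ^ 'n \<Rightarrow> complex ^ 'n \<Rightarrow> complex ^ 'n \<Rightarrow> complex ^ 'n)"
      using bradius_bounds assms by (intro bnd_K_grad) auto
  qed (use assms in \<open>auto simp: norm_scale_vec\<close>)
  have "T_grad \<alpha> = T"
    by (simp add: fun_eq_iff T_grad_def T_def)
  with T_in_BIO show ?thesis by simp
qed

theorem T_invgrad_BIO:
  assumes "0 < \<gamma>" "1 < q" "-1 < \<alpha>"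
  shows "(T_invgrad \<alpha> :: (complex ^ 'n::finite \<Rightarrow> complex) \<Rightarrow> complex ^ 'n \<Rightarrow> complex ^ 'n \<Rightarrow> complex ^ 'n)
    \<in> BIO \<alpha> (Lp_space (tau_on (bergman_ball 0 \<gamma>)) q (*s))"
proof -
  interpret bergman_estimates \<alpha> \<gamma> q "real CARD('n) + 1 + \<alpha>" "(*s)"
    "K_invgrad \<alpha> :: complex ^ 'n \<Rightarrow> complex ^ 'n \<Rightarrow> complex ^ 'n \<Rightarrow> complex ^ 'n"
  proof (rule bergman_estimates.intro)
    show "bounded_bilinear ((*s) :: complex \<Rightarrow> complex ^ 'n \<Rightarrow> _)" by (rule bounded_bilinear_scale_vec)
    fix z :: "complex ^ 'n" assume z: "norm z < 1"
    show "(\<lambda>(w, u). K_invgrad \<alpha> z u w) \<in> borel_measurable (tau \<Otimes>\<^sub>M v_alpha \<alpha>)"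
      unfolding K_invgrad_def by (rule measurable_pair_tau_v_alpha) measurable
  next
    fix A :: real assume "1 \<le> A"
    then show "bnd A (bradius \<gamma>) (- (real CARD('n) + 1 + \<alpha>)) (- (real CARD('n) + 1 + \<alpha>) - 1 / 2)
        (K_invgrad \<alpha> :: complex ^ 'n \<Rightarrow> complex ^ 'n \<Rightarrow> complex ^ 'n \<Rightarrow> complex ^ 'n)"
      using bradius_bounds assms by (intro bnd_K_invgrad) auto
  qed (use assms in \<open>auto simp: norm_scale_vec\<close>)
  have "T_invgrad \<alpha> = T"
    by (simp add: fun_eq_iff T_invgrad_def T_def)
  with T_in_BIO show ?thesis by simp
qed

section \<open>Derivatives of holomorphic functions\<close>

lemma axis_eq_scale: "axis j t = t *s (axis j 1 :: complex ^ 'n::finite)"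
  by (simp add: vec_eq_iff axis_def)

lemma vec_eq_sum_axis: "v = (\<Sum>j\<in>UNIV. v $ j *s (axis j 1 :: complex ^ 'n::finite))"
  by (simp add: vec_eq_iff axis_def if_distrib[of "(*) _"] cong: if_cong)

text \<open>A complex linear map is determined by its values on the axes, which are the partial
  derivatives. Writing it as \<open>hprod\<close> with the conjugated gradient makes
  self-adjointness of \<open>G\<close> applicable.\<close>

lemma holomorphic_vec_derivative:
  fixes f :: "complex ^ 'n::finite \<Rightarrow> complex"
  assumes f: "holomorphic_vec_on f unit_ball" and z: "norm z < 1"
  shows "(f has_derivative (\<lambda>v. hprod v (cnj_vec (grad f z)))) (at z)"
proof -
  have "z \<in> unit_ball" using z by simp
  then obtain L where L: "(f has_derivative L) (at z)" "\<And>c v. L (c *s v) = c * L v"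
    using f z unfolding holomorphic_vec_on_def by (metis at_within_open open_ball)
  have lin: "linear L" using L(1) by (rule has_derivative_linear)
  have pd: "partial_deriv j f z = L (axis j 1)" for j
  proof -
    have "((\<lambda>t. f (z + t *s axis j 1)) has_derivative (\<lambda>t. L (t *s axis j 1))) (at 0)"
    proof (rule has_derivative_compose[of "\<lambda>t. z + t *s axis j 1" _ _ _ f L])
      show "((\<lambda>t. z + t *s axis j 1) has_derivative (\<lambda>t. t *s axis j 1)) (at 0)"
        by (rule has_derivative_eq_rhs[OF has_derivative_add[OF has_derivative_const
          bounded_linear_imp_has_derivative[OF bounded_bilinear.bounded_linear_left[OF bounded_bilinear_scale_vec]]]])
          (simp add: fun_eq_iff)
      show "(f has_derivative L) (at (z + 0 *s axis j 1))" using L(1) by simp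
    qed
    then have "((\<lambda>t. f (z + t *s axis j 1)) has_field_derivative L (axis j 1)) (at 0)"
      unfolding has_field_derivative_def by (rule has_derivative_eq_rhs) (simp add: L(2) fun_eq_iff)
    then show ?thesis
      unfolding partial_deriv_def by (subst axis_eq_scale) (rule DERIV_imp_deriv)
  qed
  have "L v = hprod v (cnj_vec (grad f z))" for v
  proof -
    have "L v = L (\<Sum>j\<in>UNIV. v $ j *s axis j 1)"
      by (subst vec_eq_sum_axis[of v]) simp
    also have "\<dots> = (\<Sum>j\<in>UNIV. v $ j * L (axis j 1))"
      by (simp add: linear_sum[OF lin] L(2))
    finally show ?thesis
      by (simp add: hprod_def cnj_vec_def grad_def pd)
  qed
  then have "L = (\<lambda>v. hprod v (cnj_vec (grad f z)))" by (rule ext)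
  with L(1) show ?thesis by simp
qed

lemma partial_deriv_of_derivative:
  fixes f :: "complex ^ 'n::finite \<Rightarrow> complex"
  assumes "(f has_derivative (\<lambda>v. hprod v a)) (at z)"
  shows "partial_deriv j f z = cnj (a $ j)"
proof -
  have "((\<lambda>t. f (z + t *s axis j 1)) has_derivative (\<lambda>t. hprod (t *s axis j 1) a)) (at 0)"
  proof (rule has_derivative_compose[of "\<lambda>t. z + t *s axis j 1" _ _ _ f "\<lambda>v. hprod v a"])
    show "((\<lambda>t. z + t *s axis j 1) has_derivative (\<lambda>t. t *s axis j 1)) (at 0)"
      by (rule has_derivative_eq_rhs[OF has_derivative_add[OF has_derivative_const
        bounded_linear_imp_has_derivative[OF bounded_bilinear.bounded_linear_left[OF bounded_bilinear_scale_vec]]]])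
        (simp add: fun_eq_iff)
    show "(f has_derivative (\<lambda>v. hprod v a)) (at (z + 0 *s axis j 1))" using assms by simp
  qed
  moreover have "hprod (axis j 1) a = cnj (a $ j)"
    using cnj_hprod[of a "axis j 1"] by (simp add: hprod_axis)
  ultimately have "((\<lambda>t. f (z + t *s axis j 1)) has_field_derivative cnj (a $ j)) (at 0)"
    unfolding has_field_derivative_def by (elim has_derivative_eq_rhs) (simp add: hprod_linear fun_eq_iff)
  then show ?thesis
    unfolding partial_deriv_def by (subst axis_eq_scale) (rule DERIV_imp_deriv)
qed

text \<open>Since \<open>G z 0 = 0\<close>, the derivative of the scalar factor drops out of the
  product rule.\<close>

lemma phi_has_derivative_0:
  fixes z :: "complex ^ 'n::finite"
  assumes z: "norm z < 1"
  shows "(phi z has_derivative (\<lambda>v. complex_of_real (sn z) *s G z v)) (at 0)"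
proof -
  have h: "((\<lambda>v. hprod v z) has_derivative (\<lambda>v. hprod v z)) (at 0)"
    by (rule bounded_linear_imp_has_derivative[OF bounded_bilinear.bounded_linear_left[OF bounded_bilinear_hprod]])
  have c: "((\<lambda>v. complex_of_real (sn z) / (1 - hprod v z)) has_derivative (\<lambda>v. complex_of_real (sn z) * hprod v z)) (at 0)"
    by (auto intro!: derivative_eq_intros h simp: fun_eq_iff)
  have "bounded_linear (G z)"
    using linear_G by (simp add: linear_linear)
  then have g: "(G z has_derivative G z) (at 0)"
    by (rule bounded_linear_imp_has_derivative)
  have "((\<lambda>v. z + (complex_of_real (sn z) / (1 - hprod v z)) *s G z v) has_derivative
      (\<lambda>v. 0 + ((complex_of_real (sn z) / (1 - hprod 0 z)) *s G z v + (complex_of_real (sn z) * hprod v z) *s G z 0))) (at 0)"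
    by (intro has_derivative_add has_derivative_const bounded_bilinear.FDERIV[OF bounded_bilinear_scale_vec c g])
  then have "((\<lambda>v. z + (complex_of_real (sn z) / (1 - hprod v z)) *s G z v) has_derivative
      (\<lambda>v. complex_of_real (sn z) *s G z v)) (at 0)"
    by (rule has_derivative_eq_rhs) (simp add: G_def fun_eq_iff)
  then show ?thesis
    by (rule has_derivative_transform_within_open[of _ _ _ _ "ball 0 1"]) (use z in \<open>auto simp: phi_eq_G\<close>)
qed

lemma cnj_vec_cnj_vec [simp]: "cnj_vec (cnj_vec v) = v"
  by (simp add: cnj_vec_def vec_eq_iff)

lemma norm_cnj_vec [simp]: "norm (cnj_vec v) = norm v"
  by (simp add: cnj_vec_def norm_vec_def L2_set_def)

text \<open>The chain rule at the origin, followed by moving \<open>G z\<close> from the direction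
  onto the gradient.\<close>

lemma inv_grad_eq:
  fixes f :: "complex ^ 'n::finite \<Rightarrow> complex"
  assumes f: "holomorphic_vec_on f unit_ball" and z: "norm z < 1"
  shows "inv_grad f z = cnj_vec (complex_of_real (sn z) *s G z (cnj_vec (grad f z)))"
proof -
  define a where "a = complex_of_real (sn z) *s G z (cnj_vec (grad f z))"
  have "phi z 0 = z" by (simp add: phi_def proj_def)
  then have "(f has_derivative (\<lambda>v. hprod v (cnj_vec (grad f z)))) (at (phi z 0))"
    using holomorphic_vec_derivative[OF f z] by simp
  from has_derivative_compose[OF phi_has_derivative_0[OF z] this]
  have "((f \<circ> phi z) has_derivative (\<lambda>v. hprod (complex_of_real (sn z) *s G z v) (cnj_vec (grad f z)))) (at 0)"
    by (simp add: o_def)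
  then have "((f \<circ> phi z) has_derivative (\<lambda>v. hprod v a)) (at 0)"
    by (rule has_derivative_eq_rhs) (simp add: a_def hprod_linear hprod_G fun_eq_iff)
  from partial_deriv_of_derivative[OF this] have "inv_grad f z = cnj_vec a"
    by (simp add: inv_grad_def grad_def cnj_vec_def)
  then show ?thesis by (simp only: a_def)
qed

text \<open>By \<open>norm_G_sq\<close> and Cauchy-Schwarz, \<open>G z\<close> shrinks norms at most
  by the factor \<open>sn z\<close>; a second factor \<open>sn z\<close> comes from
  \<open>inv_grad_eq\<close>, which makes \<open>1 - |z|^2\<close> in total.\<close>

lemma grad_le_inv_grad:
  fixes f :: "complex ^ 'n::finite \<Rightarrow> complex"
  assumes f: "holomorphic_vec_on f unit_ball" and z: "norm z < 1"
  shows "(1 - (norm z)\<^sup>2) * norm (grad f z) \<le> norm (inv_grad f z)"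
proof (rule power2_le_imp_le)
  define g where "g = cnj_vec (grad f z)"
  have ng: "norm g = norm (grad f z)" by (simp add: g_def)
  have s: "(sn z)\<^sup>2 = 1 - (norm z)\<^sup>2" using z by (simp add: sn_sq)
  have "(cmod (hprod g z))\<^sup>2 \<le> (norm g * norm z)\<^sup>2"
    by (intro power_mono cmod_hprod_le) auto
  then have "(sn z)\<^sup>2 * (norm g)\<^sup>2 \<le> (norm (G z g))\<^sup>2"
    using z by (simp add: norm_G_sq s power_mult_distrib algebra_simps)
  then have "(sn z)\<^sup>2 * ((sn z)\<^sup>2 * (norm g)\<^sup>2) \<le> (sn z)\<^sup>2 * (norm (G z g))\<^sup>2"
    by (intro mult_left_mono) auto
  also have "\<dots> = (norm (inv_grad f z))\<^sup>2"
    by (simp add: inv_grad_eq[OF f z] norm_scale_vec g_def power_mult_distrib)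
  also have "(sn z)\<^sup>2 * ((sn z)\<^sup>2 * (norm g)\<^sup>2) = ((1 - (norm z)\<^sup>2) * norm (grad f z))\<^sup>2"
    unfolding s[symmetric] ng power_mult_distrib by (simp add: power2_eq_square mult_ac)
  finally show "((1 - (norm z)\<^sup>2) * norm (grad f z))\<^sup>2 \<le> (norm (inv_grad f z))\<^sup>2" .
qed simp

lemma radial_le_grad:
  fixes f :: "complex ^ 'n::finite \<Rightarrow> complex"
  assumes z: "norm z < 1"
  shows "cmod (radial_deriv f z) \<le> norm (grad f z)"
proof -
  have "radial_deriv f z = hprod z (cnj_vec (grad f z))"
    by (simp add: radial_deriv_def hprod_def cnj_vec_def grad_def)
  then have "cmod (radial_deriv f z) \<le> norm z * norm (grad f z)"
    using cmod_hprod_le[of z "cnj_vec (grad f z)"] by simp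
  also have "\<dots> \<le> norm (grad f z)"
    using z by (simp add: mult_left_le_one_le)
  finally show ?thesis .
qed

section \<open>Mean value estimates\<close>

text \<open>Cauchy's formula on the unit circle, parametrized over an interval of length 1 so that
  no constant remains. The nonnegative integral is chosen with the later exchange of integrals in
  view.\<close>

lemma cauchy_circle_bound:
  fixes g :: "complex \<Rightarrow> complex"
  assumes g: "g holomorphic_on S" and S: "open S" "cball 0 1 \<subseteq> S"
  shows "ennreal (cmod (deriv g 0)) \<le> (\<integral>\<^sup>+x. indicator {0..1} x * ennreal (cmod (g (exp (2 * of_real pi * \<i> * of_real x)))) \<partial>lborel)"
proof -
  define e where "e x = exp (2 * of_real pi * \<i> * of_real x)" for x :: real
  have cont: "continuous_on (cball 0 1) g"
    using g S by (meson holomorphic_on_imp_continuous_on holomorphic_on_subset)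
  have "g holomorphic_on ball 0 1"
    using g S by (meson ball_subset_cball holomorphic_on_subset order_trans)
  from Cauchy_has_contour_integral_higher_derivative_circlepath[OF cont this, of 0 1]
  have "((\<lambda>u. g u / u\<^sup>2) has_contour_integral (2 * pi * \<i>) * deriv g 0) (circlepath 0 1)"
    by (simp add: power2_eq_square)
  then have "((\<lambda>x. g (circlepath 0 1 x) / (circlepath 0 1 x)\<^sup>2 * vector_derivative (circlepath 0 1) (at x within {0..1}))
      has_integral (2 * pi * \<i>) * deriv g 0) {0..1}"
    unfolding has_contour_integral_def .
  then have "((\<lambda>x. g (e x) / (e x)\<^sup>2 * (2 * pi * \<i> * e x)) has_integral (2 * pi * \<i>) * deriv g 0) {0..1}"
  proof (rule has_integral_eq[rotated])
    fix x :: real assume "x \<in> {0..1}"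
    then show "g (circlepath 0 1 x) / (circlepath 0 1 x)\<^sup>2 * vector_derivative (circlepath 0 1) (at x within {0..1})
       = g (e x) / (e x)\<^sup>2 * (2 * pi * \<i> * e x)"
      by (simp only: atLeastAtMost_iff vector_derivative_circlepath01) (simp add: circlepath e_def)
  qed
  then have "((\<lambda>x. inverse (2 * pi * \<i>) * (g (e x) / (e x)\<^sup>2 * (2 * pi * \<i> * e x))) has_integral inverse (2 * pi * \<i>) * ((2 * pi * \<i>) * deriv g 0)) {0..1}"
    by (rule has_integral_mult_right)
  moreover have "inverse (2 * pi * \<i>) * (g (e x) / (e x)\<^sup>2 * (2 * pi * \<i> * e x)) = g (e x) / e x" for x
  proof -
    have "e x \<noteq> 0" by (simp add: e_def)
    then show ?thesis by (simp add: power2_eq_square field_simps)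
  qed
  moreover have "inverse (2 * pi * \<i>) * ((2 * pi * \<i>) * deriv g 0) = deriv g 0"
  proof -
    have "inverse c * (c * x) = x" if "c \<noteq> 0" for c x :: complex
      using that by simp
    from this[of "2 * pi * \<i>"] show ?thesis by simp
  qed
  ultimately have int: "((\<lambda>x. g (e x) / e x) has_integral deriv g 0) {0..1}"
    by (simp only:)
  have e_norm: "cmod (e x) = 1" for x by (simp add: e_def)
  have cont_e: "continuous_on {0..1} (\<lambda>x. cmod (g (e x)))"
    unfolding e_def by (intro continuous_intros continuous_on_compose2[OF cont]) auto
  then have "(\<lambda>x. cmod (g (e x))) integrable_on {0..1}"
    by (rule integrable_continuous_real)
  then obtain I where I: "((\<lambda>x. cmod (g (e x))) has_integral I) {0..1}" by blast
  have "cmod (integral {0..1} (\<lambda>x. g (e x) / e x)) \<le> integral {0..1} (\<lambda>x. cmod (g (e x)))"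
    using int I by (intro integral_norm_bound_integral) (auto simp: e_norm norm_divide)
  then have "cmod (deriv g 0) \<le> I"
    using int I by (simp add: integral_unique)
  also have "ennreal I = (\<integral>\<^sup>+x. indicator {0..1} x * ennreal (cmod (g (e x))) \<partial>lborel)"
    using nn_integral_has_integral_lebesgue[OF _ I] by (simp add: ennreal_mult' ennreal_indicator)
  finally show ?thesis
    by (simp add: e_def ennreal_leI)
qed

text \<open>At \<open>e\<close>, the multiple of \<open>a\<close> of norm 1/2, the product has
  modulus \<open>norm a / 2\<close>. On the ball of radius 1/4 about \<open>e\<close>, still inside
  the unit ball, it changes by at most \<open>norm a / 4\<close>.\<close>

lemma nn_integral_hprod_ge:
  fixes a :: "complex ^ 'n::finite"
  shows "ennreal (norm a / 4 * measure lborel (ball (0 :: complex ^ 'n) (1/4)))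
    \<le> (\<integral>\<^sup>+v. indicator unit_ball v * ennreal (cmod (hprod v a)) \<partial>lborel)"
proof (cases "a = 0")
  case False
  define e where "e = (1 / (2 * norm a)) *\<^sub>R a"
  have ne: "norm e = 1/2" using False by (simp add: e_def)
  have he: "cmod (hprod e a) = norm a / 2"
  proof -
    have "hprod e a = complex_of_real (norm a / 2)"
      using False by (simp add: e_def hprod_linear hprod_self power2_eq_square flip: of_real_scale_vec)
    then have "cmod (hprod e a) = \<bar>norm a / 2\<bar>" by (simp only: norm_of_real)
    then show ?thesis by simp
  qed
  have sub: "norm v < 1 \<and> norm a / 4 \<le> cmod (hprod v a)" if "v \<in> ball e (1/4)" for v
  proof -
    have d: "norm (e - v) < 1/4" using that by (simp add: dist_norm)
    have "norm v \<le> norm e + norm (e - v)"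
      using norm_triangle_ineq4[of e "e - v"] by simp
    then have 1: "norm v < 1" using d ne by linarith
    have "cmod (hprod e a) \<le> cmod (hprod v a) + cmod (hprod (e - v) a)"
      using norm_triangle_ineq[of "hprod v a" "hprod (e - v) a"] by (simp add: hprod_linear)
    moreover have "cmod (hprod (e - v) a) \<le> 1/4 * norm a"
      using d by (intro order_trans[OF cmod_hprod_le] mult_right_mono) auto
    ultimately show ?thesis using 1 he by simp
  qed
  have "ennreal (norm a / 4 * measure lborel (ball (0 :: complex ^ 'n) (1/4))) = ennreal (norm a / 4) * emeasure lborel (ball e (1/4))"
  proof -
    have "emeasure lborel (ball e (1/4)) = ennreal (measure lborel (ball e (1/4)))"
      using emeasure_lborel_ball_finite[of e "1/4"] by (intro emeasure_eq_ennreal_measure) auto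
    also have "measure lborel (ball e (1/4)) = measure lborel (ball (0 :: complex ^ 'n) (1/4))"
      by (simp add: content_ball)
    finally show ?thesis by (simp only: ennreal_mult'[symmetric] divide_nonneg_nonneg norm_ge_zero zero_le_numeral)
  qed
  also have "\<dots> = (\<integral>\<^sup>+v. ennreal (norm a / 4) * indicator (ball e (1/4)) v \<partial>lborel)"
    by (subst nn_integral_cmult) (auto intro!: borel_measurable_indicator)
  also have "\<dots> \<le> (\<integral>\<^sup>+v. indicator unit_ball v * ennreal (cmod (hprod v a)) \<partial>lborel)"
    using sub by (intro nn_integral_mono) (auto simp: indicator_def intro!: ennreal_leI)
  finally show ?thesis .
qed simp

text \<open>With the factor 1/4 the linear term of \<open>|u|^2 - |z|^2\<close> is at most
  \<open>(sn z)^2 / 2\<close> and the quadratic one at most \<open>(sn z)^2 / 16\<close>, so a fixed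
  part of \<open>1 - |z|^2\<close> survives. On the ellipsoid the weight and the Bergman kernel are
  thus comparable to powers of \<open>sn z\<close>.\<close>

lemma ellipsoid_bounds:
  fixes z v :: "complex ^ 'n::finite"
  assumes z: "norm z < 1" and v: "norm v \<le> 1"
  defines "u \<equiv> z + complex_of_real (1/4 * sn z) *s G z v"
  shows "(sn z)\<^sup>2 / 4 \<le> 1 - (norm u)\<^sup>2" "cmod (1 - hprod z u) \<le> 2 * (sn z)\<^sup>2" "norm u < 1"
proof -
  have s: "(sn z)\<^sup>2 = 1 - (norm z)\<^sup>2" "0 < sn z" using z by (simp_all add: sn_sq sn_pos)
  have tz: "hprod (complex_of_real (1/4 * sn z) *s G z v) z = complex_of_real (- (sn z)\<^sup>2 / 4) * hprod v z"
    using hprod_G_self[of z v] z by (simp add: hprod_linear power2_eq_square)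
  have t1: "cmod (hprod v z) \<le> 1"
    using cmod_hprod_lt_1[OF z v] cnj_hprod[of v z] by (metis complex_mod_cnj less_imp_le)
  have nG: "(norm (G z v))\<^sup>2 \<le> 1"
    using norm_G_le[of z v] z v by (simp add: power_le_one)
  have "hprod z (complex_of_real (1/4 * sn z) *s G z v) = cnj (complex_of_real (- (sn z)\<^sup>2 / 4) * hprod v z)"
    by (metis cnj_hprod tz)
  then have re: "Re (hprod z (complex_of_real (1/4 * sn z) *s G z v)) = - (sn z)\<^sup>2 / 4 * Re (hprod v z)"
    by simp
  have nrm: "norm (complex_of_real (1/4 * sn z) *s G z v) = 1/4 * sn z * norm (G z v)"
    using s by (simp add: norm_scale_vec)
  have "(norm u)\<^sup>2 = (norm z)\<^sup>2 + 2 * (- (sn z)\<^sup>2 / 4 * Re (hprod v z)) + (1/4 * sn z)\<^sup>2 * (norm (G z v))\<^sup>2"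
    by (simp only: u_def norm_add_sq re nrm power_mult_distrib)
  moreover have "- Re (hprod v z) \<le> 1"
    using abs_Re_le_cmod[of "hprod v z"] t1 by linarith
  then have "(sn z)\<^sup>2 * (- Re (hprod v z)) \<le> (sn z)\<^sup>2 * 1"
    by (intro mult_left_mono) auto
  moreover have "(1/4 * sn z)\<^sup>2 * (norm (G z v))\<^sup>2 \<le> (1/4 * sn z)\<^sup>2 * 1"
    using nG by (intro mult_left_mono) auto
  ultimately have "(norm u)\<^sup>2 \<le> (norm z)\<^sup>2 + (sn z)\<^sup>2 / 2 + (sn z)\<^sup>2 / 16"
    by (simp add: power2_eq_square)
  then show x: "(sn z)\<^sup>2 / 4 \<le> 1 - (norm u)\<^sup>2"
    using s(1) zero_le_power2[of "sn z"] by argo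
  have "0 < (sn z)\<^sup>2 / 4" using s(2) by simp
  then have "(norm u)\<^sup>2 < 1" using x by linarith
  then show "norm u < 1" by (simp add: abs_square_less_1)
  have "hprod u z = complex_of_real ((norm z)\<^sup>2) + complex_of_real (- (sn z)\<^sup>2 / 4) * hprod v z"
    unfolding u_def hprod_add_left tz by (simp add: hprod_self)
  moreover have "complex_of_real ((norm z)\<^sup>2) = 1 - complex_of_real ((sn z)\<^sup>2)"
    by (simp only: s(1) of_real_diff of_real_1) simp
  moreover have "complex_of_real (- (sn z)\<^sup>2 / 4) = - complex_of_real ((sn z)\<^sup>2) / 4"
    by simp
  moreover have "1 - (1 - c + - c / 4 * h) = c * (1 + h / 4)" for c h :: complex
    by (simp add: algebra_simps)
  ultimately have "1 - hprod u z = complex_of_real ((sn z)\<^sup>2) * (1 + hprod v z / 4)"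
    by (simp only:)
  then have "cmod (1 - hprod u z) = (sn z)\<^sup>2 * cmod (1 + hprod v z / 4)"
    by (simp add: norm_mult del: of_real_power)
  also have "\<dots> \<le> (sn z)\<^sup>2 * 2"
  proof (rule mult_left_mono)
    show "cmod (1 + hprod v z / 4) \<le> 2"
      using norm_triangle_ineq[of 1 "hprod v z / 4"] t1 by (simp add: norm_divide)
  qed simp
  finally show "cmod (1 - hprod z u) \<le> 2 * (sn z)\<^sup>2"
    by (simp add: cmod_one_minus_hprod_commute[of z u] mult.commute)
qed

lemma holomorphic_slice:
  fixes f :: "complex ^ 'n::finite \<Rightarrow> complex"
  assumes f: "holomorphic_vec_on f unit_ball" and S: "\<And>t. t \<in> S \<Longrightarrow> norm (z + t *s b) < 1" and "open S"
  shows "(\<lambda>t. f (z + t *s b)) holomorphic_on S"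
    "0 \<in> S \<Longrightarrow> deriv (\<lambda>t. f (z + t *s b)) 0 = hprod b (cnj_vec (grad f z))"
proof -
  have der: "((\<lambda>t. f (z + t *s b)) has_field_derivative hprod b (cnj_vec (grad f (z + t *s b)))) (at t)" if "t \<in> S" for t
  proof -
    have "((\<lambda>t. z + t *s b) has_derivative (\<lambda>t. t *s b)) (at t)"
      by (rule has_derivative_eq_rhs[OF has_derivative_add[OF has_derivative_const
        bounded_linear_imp_has_derivative[OF bounded_bilinear.bounded_linear_left[OF bounded_bilinear_scale_vec]]]])
        (simp add: fun_eq_iff)
    from has_derivative_compose[OF this holomorphic_vec_derivative[OF f S[OF that]]]
    show ?thesis
      unfolding has_field_derivative_def by (rule has_derivative_eq_rhs) (simp add: hprod_linear fun_eq_iff)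
  qed
  then show "(\<lambda>t. f (z + t *s b)) holomorphic_on S"
    by (auto simp: holomorphic_on_open \<open>open S\<close>)
  show "deriv (\<lambda>t. f (z + t *s b)) 0 = hprod b (cnj_vec (grad f z))" if "0 \<in> S"
    using DERIV_imp_deriv[OF der[OF that]] by simp
qed

text \<open>On the disc through \<open>L v\<close>, Cauchy's formula controls
  \<open>hprod v a / 4\<close>, where 1/4 is the scale of the ellipsoid; integrating over
  \<open>v\<close> recovers \<open>norm a\<close> at the cost of another factor 4. Together these
  make the 16.\<close>

lemma inv_grad_mean_value:
  fixes f :: "complex ^ 'n::finite \<Rightarrow> complex"
  assumes f: "holomorphic_vec_on f unit_ball" and meas: "f \<in> borel_measurable (restrict_space borel unit_ball)"
    and z: "norm z < 1"
  shows "ennreal (norm (inv_grad f z) / 16 * measure lborel (ball (0 :: complex ^ 'n) (1/4)))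
    \<le> (\<integral>\<^sup>+v. indicator unit_ball v * ennreal (cmod (f (z + complex_of_real (1/4 * sn z) *s G z v))) \<partial>lborel)"
proof -
  \<comment> \<open>Extension by 0 gives a Borel function on the whole space, so that Fubini and the
    change of variables apply.\<close>
  define F where "F u = indicator unit_ball u *\<^sub>R f u" for u
  have [measurable]: "F \<in> borel_measurable borel"
    using meas unfolding F_def by (subst (asm) borel_measurable_restrict_space_iff) auto
  define L where "L v = z + complex_of_real (1/4 * sn z) *s G z v" for v
  have [measurable]: "L \<in> borel_measurable borel"
    unfolding L_def by measurable
  define e where "e x = exp (2 * of_real pi * \<i> * of_real x)" for x :: real
  have e1: "cmod (e x) = 1" for x by (simp add: e_def)
  have [measurable]: "e \<in> borel_measurable borel"
    unfolding e_def by (intro borel_measurable_continuous_onI continuous_intros)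
  have L1: "norm (L v) < 1" if "norm v \<le> 1" for v
    using ellipsoid_bounds(3)[OF z that] by (simp add: L_def)
  define a where "a = cnj_vec (inv_grad f z)"
  have a: "a = complex_of_real (sn z) *s G z (cnj_vec (grad f z))"
    by (simp add: a_def inv_grad_eq[OF f z])
  have pt: "ennreal (1/4 * cmod (hprod v a)) \<le> (\<integral>\<^sup>+x. indicator {0..1} x * ennreal (cmod (F (L (e x *s v)))) \<partial>lborel)"
    if v: "norm v < 1" for v
  proof -
    define b where "b = complex_of_real (1/4 * sn z) *s G z v"
    define S where "S = {t. cmod t * norm v < 1}"
    have "open S" unfolding S_def by (intro open_Collect_less continuous_intros)
    have L_eq: "z + t *s b = L (t *s v)" for t
      by (simp add: L_def b_def G_scale vec_eq_iff mult_ac)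
    have inS: "norm (z + t *s b) < 1" if "t \<in> S" for t
      unfolding L_eq using that by (intro L1) (simp add: S_def norm_scale_vec)
    have "cball 0 1 \<subseteq> S"
    proof
      fix t :: complex assume "t \<in> cball 0 1"
      then have "cmod t * norm v \<le> 1 * norm v" by (intro mult_right_mono) auto
      then show "t \<in> S" using v by (simp add: S_def)
    qed
    have "hprod b (cnj_vec (grad f z)) = 1/4 * hprod v a"
      by (simp add: b_def a hprod_linear hprod_G)
    then have d: "deriv (\<lambda>t. f (z + t *s b)) 0 = 1/4 * hprod v a"
      using holomorphic_slice(2)[OF f inS \<open>open S\<close>] by (simp add: S_def)
    have "ennreal (1/4 * cmod (hprod v a)) = ennreal (cmod (deriv (\<lambda>t. f (z + t *s b)) 0))"
      unfolding d norm_mult by simp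
    also have "\<dots> \<le> (\<integral>\<^sup>+x. indicator {0..1} x * ennreal (cmod (f (z + e x *s b))) \<partial>lborel)"
      unfolding e_def by (rule cauchy_circle_bound[OF holomorphic_slice(1)[OF f inS \<open>open S\<close>] \<open>open S\<close> \<open>cball 0 1 \<subseteq> S\<close>])
    also have "\<dots> = (\<integral>\<^sup>+x. indicator {0..1} x * ennreal (cmod (F (L (e x *s v)))) \<partial>lborel)"
    proof (rule nn_integral_cong)
      fix x :: real
      have "norm (L (e x *s v)) < 1" using v by (intro L1) (simp add: norm_scale_vec e1)
      then show "indicator {0..1} x * ennreal (cmod (f (z + e x *s b))) = indicator {0..1} x * ennreal (cmod (F (L (e x *s v))))"
        by (simp add: L_eq F_def)
    qed
    finally show ?thesis .
  qed
  have "ennreal (norm (inv_grad f z) / 16 * measure lborel (ball (0 :: complex ^ 'n) (1/4)))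
     = ennreal (1/4) * ennreal (norm a / 4 * measure lborel (ball (0 :: complex ^ 'n) (1/4)))"
    by (subst ennreal_mult[symmetric]) (auto simp: a_def)
  also have "\<dots> \<le> ennreal (1/4) * (\<integral>\<^sup>+v. indicator unit_ball v * ennreal (cmod (hprod v a)) \<partial>lborel)"
    by (intro mult_left_mono nn_integral_hprod_ge) simp
  also have "\<dots> = (\<integral>\<^sup>+v. ennreal (1/4) * (indicator unit_ball v * ennreal (cmod (hprod v a))) \<partial>lborel)"
  proof (rule nn_integral_cmult[symmetric])
    have "(unit_ball :: (complex ^ 'n) set) \<in> sets lborel" by simp
    moreover have "(\<lambda>v. ennreal (cmod (hprod v a))) \<in> borel_measurable lborel"
      by (intro measurable_compose[OF _ measurable_ennreal] borel_measurable_norm borel_measurable_hprod) simp_all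
    ultimately show "(\<lambda>v. indicator unit_ball v * ennreal (cmod (hprod v a))) \<in> borel_measurable lborel"
      by (intro borel_measurable_times_ennreal borel_measurable_indicator)
  qed
  also have "\<dots> \<le> (\<integral>\<^sup>+v. (\<integral>\<^sup>+x. indicator unit_ball v * (indicator {0..1} x * ennreal (cmod (F (L (e x *s v))))) \<partial>lborel) \<partial>lborel)"
  proof (rule nn_integral_mono)
    fix v :: "complex ^ 'n"
    have "ennreal (1/4) * (indicator unit_ball v * ennreal (cmod (hprod v a))) = indicator unit_ball v * ennreal (1/4 * cmod (hprod v a))"
      by (subst ennreal_mult) (auto simp: mult_ac)
    also have "\<dots> \<le> indicator unit_ball v * (\<integral>\<^sup>+x. indicator {0..1} x * ennreal (cmod (F (L (e x *s v)))) \<partial>lborel)"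
      using pt[of v] by (auto simp: indicator_def)
    also have "\<dots> = (\<integral>\<^sup>+x. indicator unit_ball v * (indicator {0..1} x * ennreal (cmod (F (L (e x *s v))))) \<partial>lborel)"
      by (rule nn_integral_cmult[symmetric]) measurable
    finally show "ennreal (1/4) * (indicator unit_ball v * ennreal (cmod (hprod v a)))
      \<le> (\<integral>\<^sup>+x. indicator unit_ball v * (indicator {0..1} x * ennreal (cmod (F (L (e x *s v))))) \<partial>lborel)" .
  qed
  \<comment> \<open>With the order exchanged, the rotation of \<open>v\<close> by the unimodular
    \<open>e x\<close> preserves both the ball and Lebesgue measure. The inner integral is then
    independent of \<open>x\<close>, and the average over the circle disappears.\<close>
  also have "\<dots> = (\<integral>\<^sup>+x. (\<integral>\<^sup>+v. indicator unit_ball v * (indicator {0..1} x * ennreal (cmod (F (L (e x *s v))))) \<partial>lborel) \<partial>lborel)"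
  proof (rule lborel_pair.Fubini'[symmetric])
    have "(unit_ball :: (complex ^ 'n) set) \<in> sets lborel" by simp
    then have "(\<lambda>p. indicator unit_ball (fst p) :: ennreal)
        \<in> borel_measurable ((lborel :: (complex ^ 'n) measure) \<Otimes>\<^sub>M (lborel :: real measure))"
      by (intro measurable_compose[OF measurable_fst] borel_measurable_indicator)
    moreover have "(\<lambda>p. indicator {0..1} (snd p) * ennreal (cmod (F (L (e (snd p) *s fst p)))))
        \<in> borel_measurable (lborel \<Otimes>\<^sub>M lborel)"
      by measurable
    ultimately show "(\<lambda>(v, x). indicator unit_ball v * (indicator {0..1} x * ennreal (cmod (F (L (e x *s v))))))
        \<in> borel_measurable (lborel \<Otimes>\<^sub>M lborel)"
      unfolding case_prod_beta by (rule borel_measurable_times_ennreal)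
  qed
  also have "\<dots> = (\<integral>\<^sup>+x. indicator {0..1 :: real} x * (\<integral>\<^sup>+v. indicator unit_ball v * ennreal (cmod (F (L v))) \<partial>lborel) \<partial>lborel)"
  proof (rule nn_integral_cong)
    fix x :: real
    have lin: "linear (\<lambda>v :: complex ^ 'n. e x *s v)"
      by (rule linearI) (simp_all add: vec_eq_iff algebra_simps)
    have iso: "norm (e x *s v) = norm v" for v :: "complex ^ 'n"
      by (simp add: norm_scale_vec e1)
    have "(\<integral>\<^sup>+v. indicator unit_ball v * (indicator {0..1} x * ennreal (cmod (F (L (e x *s v))))) \<partial>lborel)
       = (\<integral>\<^sup>+v. indicator {0..1} x * (indicator unit_ball (e x *s v) * ennreal (cmod (F (L (e x *s v))))) \<partial>lborel)"
      by (intro nn_integral_cong) (simp add: indicator_def iso)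
    also have "\<dots> = indicator {0..1} x * (\<integral>\<^sup>+v. indicator unit_ball (e x *s v) * ennreal (cmod (F (L (e x *s v)))) \<partial>lborel)"
    proof (rule nn_integral_cmult)
      have ex: "(\<lambda>v :: complex ^ 'n. e x *s v) \<in> borel_measurable lborel"
        unfolding measurable_lborel1 by (rule borel_measurable_scale_vec) simp_all
      have "(indicator unit_ball :: complex ^ 'n \<Rightarrow> ennreal) \<in> borel_measurable borel"
        by (rule borel_measurable_indicator) simp
      with ex have "(\<lambda>v :: complex ^ 'n. indicator unit_ball (e x *s v) :: ennreal) \<in> borel_measurable lborel"
        by (rule measurable_compose)
      moreover have "(\<lambda>v. ennreal (cmod (F (L v)))) \<in> borel_measurable borel" by measurable
      with ex have "(\<lambda>v. ennreal (cmod (F (L (e x *s v))))) \<in> borel_measurable lborel"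
        by (rule measurable_compose)
      ultimately show "(\<lambda>v. indicator unit_ball (e x *s v) * ennreal (cmod (F (L (e x *s v))))) \<in> borel_measurable lborel"
        by (rule borel_measurable_times_ennreal)
    qed
    also have "(\<integral>\<^sup>+v. indicator unit_ball (e x *s v) * ennreal (cmod (F (L (e x *s v)))) \<partial>lborel)
       = (\<integral>\<^sup>+v. indicator unit_ball v * ennreal (cmod (F (L v))) \<partial>lborel)"
    proof (rule nn_integral_isometry[OF lin iso])
      have "(indicator unit_ball :: complex ^ 'n \<Rightarrow> ennreal) \<in> borel_measurable borel"
        by (rule borel_measurable_indicator) simp
      then show "(\<lambda>v. indicator unit_ball v * ennreal (cmod (F (L v)))) \<in> borel_measurable borel"
        by (rule borel_measurable_times_ennreal) measurable
    qed
    finally show "(\<integral>\<^sup>+v. indicator unit_ball v * (indicator {0..1} x * ennreal (cmod (F (L (e x *s v))))) \<partial>lborel)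
       = indicator {0..1} x * (\<integral>\<^sup>+v. indicator unit_ball v * ennreal (cmod (F (L v))) \<partial>lborel)" .
  qed
  also have "\<dots> = (\<integral>\<^sup>+v. indicator unit_ball v * ennreal (cmod (F (L v))) \<partial>lborel)"
    by (subst nn_integral_multc) auto
  also have "\<dots> = (\<integral>\<^sup>+v. indicator unit_ball v * ennreal (cmod (f (L v))) \<partial>lborel)"
    using L1 by (intro nn_integral_cong) (auto simp: F_def indicator_def)
  finally show ?thesis by (simp add: L_def)
qed

text \<open>On the ellipsoid the kernel times the weight is at least a constant over
  \<open>sn z ^ (2 * CARD('n) + 2)\<close>. This is the Jacobian of the map onto the ellipsoid up to
  a constant, so the mean value estimate turns into an integral against the Bergman kernel.\<close>

lemma inv_grad_le_Bop:
  assumes \<alpha>: "-1 < \<alpha>"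
  shows "\<exists>C>0. \<forall>f :: complex ^ 'n::finite \<Rightarrow> complex. \<forall>z. holomorphic_vec_on f unit_ball \<longrightarrow>
    integrable (v_alpha \<alpha>) f \<longrightarrow> norm z < 1 \<longrightarrow> norm (inv_grad f z) \<le> C * Bop \<alpha> f z"
proof -
  let ?V = "v_alpha \<alpha> :: (complex ^ 'n) measure"
  define m where "m = real CARD('n) + 1 + \<alpha>"
  have m: "0 < m" using \<alpha> by (simp add: m_def add_pos_nonneg)
  define b4 where "b4 = measure lborel (ball (0 :: complex ^ 'n) (1/4))"
  have b4: "0 < b4" unfolding b4_def by (simp add: content_ball unit_ball_vol_pos)
  \<comment> \<open>The powers of 1/4 and 4 bound \<open>(1 - |u|^2) powr - \<alpha>\<close> for
    either sign of \<open>\<alpha>\<close>, as \<open>1 - |u|^2\<close> lies between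
    \<open>S / 4\<close> and \<open>4 * S\<close> with \<open>S = (sn z)^2\<close>;
    \<open>2 powr m\<close> comes from \<open>|1 - hprod z u| \<le> 2 * S\<close>.\<close>
  define K where "K = ((1/4) powr - \<alpha> + 4 powr - \<alpha>) * 2 powr m"
  have K: "0 < K" by (simp add: K_def add_pos_pos)
  define vc where "vc = v_const \<alpha> TYPE('n)"
  have vc: "0 < vc" unfolding vc_def by (rule v_const_pos[OF \<alpha>])
  define C where "C = 16 / b4 * (4 ^ (2 * CARD('n)) * K / vc)"
  show ?thesis
  proof (intro exI[of _ C] conjI allI impI)
    show "0 < C" using b4 K vc by (simp add: C_def)
    fix f :: "complex ^ 'n \<Rightarrow> complex" and z :: "complex ^ 'n"
    assume f: "holomorphic_vec_on f unit_ball" and fi: "integrable ?V f" and z: "norm z < 1"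
    have s0: "0 < sn z" using z by (rule sn_pos)
    have fm: "f \<in> borel_measurable ?V" using fi by simp
    then have meas: "f \<in> borel_measurable (restrict_space borel unit_ball)"
      by (simp cong: measurable_cong_sets[OF sets_v_alpha])
    define F where "F u = indicator unit_ball u *\<^sub>R f u" for u
    have [measurable]: "F \<in> borel_measurable borel"
      using meas unfolding F_def by (subst (asm) borel_measurable_restrict_space_iff) auto
    \<comment> \<open>The cut-off keeps only the inequalities of \<open>ellipsoid_bounds\<close>.
      They hold on the whole ellipsoid, so after the change of variables the integral may be taken
      over the entire space.\<close>
    define H where "H u = (if norm u < 1 \<and> (sn z)\<^sup>2 / 4 \<le> 1 - (norm u)\<^sup>2 \<and> cmod (1 - hprod z u) \<le> 2 * (sn z)\<^sup>2
       then ennreal (cmod (F u)) else 0)" for u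
    have [measurable]: "H \<in> borel_measurable borel"
      unfolding H_def by measurable
    have Hf: "H u \<le> ennreal (K * sn z ^ (2 * CARD('n) + 2)) *
        (indicator unit_ball u * (ennreal ((1 - (norm u)\<^sup>2) powr \<alpha>) * ennreal (cmod (1 - hprod z u) powr - m * cmod (F u))))" for u
    proof (cases "norm u < 1 \<and> (sn z)\<^sup>2 / 4 \<le> 1 - (norm u)\<^sup>2 \<and> cmod (1 - hprod z u) \<le> 2 * (sn z)\<^sup>2")
      case True
      define x d S where "x = 1 - (norm u)\<^sup>2" and "d = cmod (1 - hprod z u)" and "S = (sn z)\<^sup>2"
      have S: "0 < S" using s0 by (simp add: S_def)
      have x: "1/4 * S \<le> x" "x \<le> 4 * S" "d \<le> 2 * S"
        using True one_minus_norm_sq_le(1)[of z u] z by (auto simp: x_def d_def S_def)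
      have d: "0 < d" using one_minus_hprod_neq_0[OF z, of u] True by (simp add: d_def)
      have x0: "0 < x" using x S by linarith
      have "x powr - \<alpha> \<le> ((1/4) powr - \<alpha> + 4 powr - \<alpha>) * S powr - \<alpha>"
        using x S by (intro powr_le_of_bounds) auto
      moreover have "d powr m \<le> 2 powr m * S powr m"
        using x d m powr_mono2[of m d "2 * S"] by (simp add: powr_mult)
      ultimately have "x powr - \<alpha> * d powr m \<le> (((1/4) powr - \<alpha> + 4 powr - \<alpha>) * S powr - \<alpha>) * (2 powr m * S powr m)"
        by (intro mult_mono) (auto intro!: mult_nonneg_nonneg add_nonneg_nonneg)
      also have "\<dots> = K * S powr (m - \<alpha>)"
      proof -
        have "S powr (m - \<alpha>) = S powr - \<alpha> * S powr m"
          by (simp add: powr_add[symmetric])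
        then show ?thesis by (simp only: K_def mult_ac)
      qed
      also have "S powr (m - \<alpha>) = sn z ^ (2 * CARD('n) + 2)"
      proof -
        have "S powr (m - \<alpha>) = S ^ (CARD('n) + 1)"
          using S powr_realpow[of S "CARD('n) + 1"] by (simp add: m_def add.commute)
        also have "\<dots> = sn z ^ (2 * (CARD('n) + 1))"
          unfolding S_def by (rule power_mult[symmetric])
        finally show ?thesis by simp
      qed
      finally have "x powr - \<alpha> * d powr m \<le> K * sn z ^ (2 * CARD('n) + 2)" .
      then have "(x powr - \<alpha> * d powr m) * (x powr \<alpha> * d powr - m) \<le> (K * sn z ^ (2 * CARD('n) + 2)) * (x powr \<alpha> * d powr - m)"
        by (intro mult_right_mono) auto
      also have "(x powr - \<alpha> * d powr m) * (x powr \<alpha> * d powr - m) = 1"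
        using x0 d by (simp add: powr_minus field_simps)
      finally have "1 * cmod (F u) \<le> (K * sn z ^ (2 * CARD('n) + 2)) * (x powr \<alpha> * d powr - m) * cmod (F u)"
        by (intro mult_right_mono) auto
      then have "ennreal (cmod (F u)) \<le> ennreal ((K * sn z ^ (2 * CARD('n) + 2)) * (x powr \<alpha> * (d powr - m * cmod (F u))))"
        by (intro ennreal_leI) (simp add: mult_ac)
      also have "\<dots> = ennreal (K * sn z ^ (2 * CARD('n) + 2)) * (ennreal (x powr \<alpha>) * ennreal (d powr - m * cmod (F u)))"
        using K s0 by (simp add: ennreal_mult[symmetric])
      finally show ?thesis
        using True by (simp add: H_def x_def d_def)
    next
      case False
      then have "H u = 0" unfolding H_def by (rule if_not_P)
      then show ?thesis by simp
    qed
    have fin: "(\<integral>\<^sup>+u. ennreal (cmod (1 - hprod z u) powr - m * cmod (f u)) \<partial>?V) = ennreal (Bop \<alpha> f z)"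
      unfolding Bop_def m_def by (rule nn_integral_eq_integral[OF Bop_integrable[OF \<alpha> z fi]]) auto
    have "ennreal (norm (inv_grad f z) / 16 * b4)
      \<le> (\<integral>\<^sup>+v. indicator unit_ball v * ennreal (cmod (f (z + complex_of_real (1/4 * sn z) *s G z v))) \<partial>lborel)"
      unfolding b4_def by (rule inv_grad_mean_value[OF f meas z])
    also have "\<dots> \<le> (\<integral>\<^sup>+v. H (z + complex_of_real (1/4 * sn z) *s G z v) \<partial>lborel)"
    proof (rule nn_integral_mono)
      fix v :: "complex ^ 'n"
      show "indicator unit_ball v * ennreal (cmod (f (z + complex_of_real (1/4 * sn z) *s G z v)))
        \<le> H (z + complex_of_real (1/4 * sn z) *s G z v)"
        using ellipsoid_bounds[OF z, of v] by (auto simp: indicator_def H_def F_def)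
    qed
    also have "\<dots> \<le> ennreal (4 ^ (2 * CARD('n)) / sn z ^ (2 * CARD('n) + 2)) * (\<integral>\<^sup>+u. H u \<partial>lborel)"
    proof -
      define J where "J = (\<integral>\<^sup>+v. H (z + complex_of_real (1/4 * sn z) *s G z v) \<partial>lborel)"
      have "(\<integral>\<^sup>+u. H u \<partial>lborel) = ennreal ((1/4) ^ (2 * CARD('n)) * sn z ^ (2 * CARD('n) + 2)) * J"
        unfolding J_def by (rule nn_integral_ellipsoid[OF _ z]) auto
      moreover have "4 ^ (2 * CARD('n)) / sn z ^ (2 * CARD('n) + 2) * ((1/4) ^ (2 * CARD('n)) * sn z ^ (2 * CARD('n) + 2)) = 1"
        using s0 by (simp add: power_divide del: power_Suc)
      ultimately have "ennreal (4 ^ (2 * CARD('n)) / sn z ^ (2 * CARD('n) + 2)) * (\<integral>\<^sup>+u. H u \<partial>lborel) = J"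
        using s0 by (simp only: mult.assoc[symmetric]) (simp add: ennreal_mult[symmetric] del: power_Suc)
      then show ?thesis by (simp add: J_def)
    qed
    also have "\<dots> \<le> ennreal (4 ^ (2 * CARD('n)) / sn z ^ (2 * CARD('n) + 2)) * (ennreal (K * sn z ^ (2 * CARD('n) + 2)) *
        (\<integral>\<^sup>+u. indicator unit_ball u * (ennreal ((1 - (norm u)\<^sup>2) powr \<alpha>) * ennreal (cmod (1 - hprod z u) powr - m * cmod (F u))) \<partial>lborel))"
    proof (intro mult_left_mono)
      show "(\<integral>\<^sup>+u. H u \<partial>lborel) \<le> ennreal (K * sn z ^ (2 * CARD('n) + 2)) *
        (\<integral>\<^sup>+u. indicator unit_ball u * (ennreal ((1 - (norm u)\<^sup>2) powr \<alpha>) * ennreal (cmod (1 - hprod z u) powr - m * cmod (F u))) \<partial>lborel)"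
      proof (subst nn_integral_cmult[symmetric])
        have "(unit_ball :: (complex ^ 'n) set) \<in> sets lborel" by simp
        moreover have "(\<lambda>u. ennreal ((1 - (norm u)\<^sup>2) powr \<alpha>)) \<in> borel_measurable lborel"
          by (intro measurable_compose[OF _ measurable_ennreal] powr_real_measurable borel_measurable_diff
              borel_measurable_power borel_measurable_norm borel_measurable_const) simp
        moreover have "(\<lambda>u. ennreal (cmod (1 - hprod z u) powr - m * cmod (F u))) \<in> borel_measurable lborel"
          by (intro measurable_compose[OF _ measurable_ennreal] borel_measurable_times powr_real_measurable
              borel_measurable_norm borel_measurable_diff borel_measurable_hprod borel_measurable_const) simp_all
        ultimately show "(\<lambda>u. indicator unit_ball u * (ennreal ((1 - (norm u)\<^sup>2) powr \<alpha>) * ennreal (cmod (1 - hprod z u) powr - m * cmod (F u)))) \<in> borel_measurable lborel"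
          by (intro borel_measurable_times_ennreal borel_measurable_indicator)
      qed (intro nn_integral_mono Hf)
    qed simp
    also have "(\<integral>\<^sup>+u. indicator unit_ball u * (ennreal ((1 - (norm u)\<^sup>2) powr \<alpha>) * ennreal (cmod (1 - hprod z u) powr - m * cmod (F u))) \<partial>lborel)
       = ennreal (Bop \<alpha> f z / vc)"
    proof -
      define J where "J = (\<integral>\<^sup>+u. indicator unit_ball u * (ennreal ((1 - (norm u)\<^sup>2) powr \<alpha>) * ennreal (cmod (1 - hprod z u) powr - m * cmod (F u))) \<partial>lborel)"
      have "ennreal (Bop \<alpha> f z) = (\<integral>\<^sup>+u. ennreal (cmod (1 - hprod z u) powr - m * cmod (F u)) \<partial>?V)"
        unfolding fin[symmetric] by (intro nn_integral_cong) (simp add: F_def)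
      also have "\<dots> = ennreal vc * J"
        unfolding vc_def J_def by (rule nn_integral_v_alpha[OF \<alpha>]) (rule borel_measurable_v_alpha, measurable)
      finally have "ennreal (1 / vc) * ennreal (Bop \<alpha> f z) = ennreal (1 / vc) * ennreal vc * J"
        by (simp add: mult.assoc)
      also have "ennreal (1 / vc) * ennreal vc = 1"
        using vc by (simp add: ennreal_mult[symmetric])
      finally have "J = ennreal (1 / vc) * ennreal (Bop \<alpha> f z)" by simp
      also have "\<dots> = ennreal (Bop \<alpha> f z / vc)"
        using vc by (simp add: ennreal_mult'[symmetric])
      finally show ?thesis by (simp add: J_def)
    qed
    also have "ennreal (4 ^ (2 * CARD('n)) / sn z ^ (2 * CARD('n) + 2)) * (ennreal (K * sn z ^ (2 * CARD('n) + 2)) * ennreal (Bop \<alpha> f z / vc))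
       = ennreal (4 ^ (2 * CARD('n)) * K / vc * Bop \<alpha> f z)"
      using s0 K by (simp add: ennreal_mult'[symmetric] mult.assoc del: power_Suc)
    finally have "norm (inv_grad f z) / 16 * b4 \<le> 4 ^ (2 * CARD('n)) * K / vc * Bop \<alpha> f z"
      using K vc by (subst (asm) ennreal_le_iff) (auto simp: Bop_def intro!: mult_nonneg_nonneg integral_nonneg_AE)
    then have "16 / b4 * (norm (inv_grad f z) / 16 * b4) \<le> 16 / b4 * (4 ^ (2 * CARD('n)) * K / vc * Bop \<alpha> f z)"
      using b4 by (intro mult_left_mono) auto
    then show "norm (inv_grad f z) \<le> C * Bop \<alpha> f z"
      using b4 by (simp add: C_def mult.assoc)
  qed
qed

section \<open>Area functions\<close>

lemma bergman_ball_phi: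
  assumes z: "norm z < 1" and w: "w \<in> bergman_ball z \<gamma>"
  obtains om where "w = phi z om" "norm om \<le> bradius \<gamma>" "norm om < 1"
  using that[of "phi z w"] phi_phi[OF z norm_phi_le_bradius(1)[OF z w]] norm_phi_le_bradius[OF z w]
    norm_phi_lt_1[OF z norm_phi_le_bradius(1)[OF z w]] by auto

text \<open>A Harnack inequality: a point of the Bergman ball is \<open>phi z om\<close> with
  \<open>norm om \<le> R\<close>, so \<open>cmod_1_hprod_phi_ge\<close> compares the two positive
  kernels pointwise in \<open>u\<close>.\<close>

lemma Bop_le_Bop:
  assumes \<alpha>: "-1 < \<alpha>" and \<gamma>: "0 < \<gamma>"
  shows "\<exists>C>0. \<forall>f :: complex ^ 'n::finite \<Rightarrow> complex. \<forall>z. \<forall>w \<in> bergman_ball z \<gamma>.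
    integrable (v_alpha \<alpha>) f \<longrightarrow> norm z < 1 \<longrightarrow> Bop \<alpha> f w \<le> C * Bop \<alpha> f z"
proof -
  define m where "m = real CARD('n) + 1 + \<alpha>"
  have m: "0 < m" using \<alpha> by (simp add: m_def add_pos_nonneg)
  define R where "R = bradius \<gamma>"
  have R: "0 \<le> R" "R < 1" using bradius_bounds \<gamma> by (auto simp: R_def)
  define C where "C = ((1 - R) / 2) powr - m"
  show ?thesis
  proof (intro exI[of _ C] conjI allI ballI impI)
    show "0 < C" using R by (simp add: C_def)
    fix f :: "complex ^ 'n \<Rightarrow> complex" and z w :: "complex ^ 'n"
    assume w: "w \<in> bergman_ball z \<gamma>" and f: "integrable (v_alpha \<alpha>) f" and z: "norm z < 1"
    have w1: "norm w < 1" by (rule norm_phi_le_bradius(1)[OF z w])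
    obtain om where om: "w = phi z om" "norm om \<le> R" "norm om < 1"
      using bergman_ball_phi[OF z w] unfolding R_def by blast
    have "Bop \<alpha> f w \<le> (\<integral>u. C * (cmod (1 - hprod z u) powr - m * cmod (f u)) \<partial>v_alpha \<alpha>)"
      unfolding Bop_def m_def[symmetric]
    proof (rule integral_mono)
      show "integrable (v_alpha \<alpha>) (\<lambda>u. cmod (1 - hprod w u) powr - m * cmod (f u))"
        unfolding m_def by (rule Bop_integrable[OF \<alpha> w1 f])
      have "integrable (v_alpha \<alpha>) (\<lambda>u. cmod (1 - hprod z u) powr - m * cmod (f u))"
        unfolding m_def by (rule Bop_integrable[OF \<alpha> z f])
      then show "integrable (v_alpha \<alpha>) (\<lambda>u. C * (cmod (1 - hprod z u) powr - m * cmod (f u)))" by simp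
      fix u :: "complex ^ 'n" assume "u \<in> space (v_alpha \<alpha>)"
      then have u: "norm u < 1" by simp
      have "0 < cmod (1 - hprod z u)" using one_minus_hprod_neq_0[OF z, of u] u by simp
      moreover have "(1 - R) / 2 * cmod (1 - hprod z u) \<le> cmod (1 - hprod w u)"
        unfolding om(1) by (rule cmod_1_hprod_phi_ge[OF _ R z u om(2)]) (rule order_refl)
      ultimately have "cmod (1 - hprod w u) powr - m \<le> ((1 - R) / 2 * cmod (1 - hprod z u)) powr - m"
        using R m by (intro powr_mono2') auto
      also have "\<dots> = C * cmod (1 - hprod z u) powr - m"
        unfolding C_def by (rule powr_mult)
      finally have "cmod (1 - hprod w u) powr - m * cmod (f u) \<le> C * cmod (1 - hprod z u) powr - m * cmod (f u)"
        by (intro mult_right_mono) auto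
      then show "cmod (1 - hprod w u) powr - m * cmod (f u) \<le> C * (cmod (1 - hprod z u) powr - m * cmod (f u))"
        by (simp add: mult.assoc)
    qed
    then show "Bop \<alpha> f w \<le> C * Bop \<alpha> f z"
      by (simp add: Bop_def m_def)
  qed
qed

text \<open>The Bergman ball lies in an ellipsoid of volume of order \<open>S ^ N\<close>, and on it
  the density of \<open>tau\<close> has order at most \<open>1 / S ^ N\<close>; with
  \<open>N = CARD('n) + 1\<close> the powers cancel exactly.\<close>

lemma tau_bergman_ball_le:
  assumes \<gamma>: "0 < \<gamma>"
  shows "\<exists>C\<ge>0. \<forall>z :: complex ^ 'n::finite. norm z < 1 \<longrightarrow> emeasure tau (bergman_ball z \<gamma>) \<le> ennreal C"
proof -
  define R where "R = bradius \<gamma>"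
  have R: "0 \<le> R" "R < 1" using bradius_bounds \<gamma> by (auto simp: R_def)
  have R2: "0 < 1 - R\<^sup>2" using R by (simp add: abs_square_less_1)
  define N where "N = CARD('n) + 1"
  define b where "b = measure lborel (unit_ball :: (complex ^ 'n) set)"
  have b: "0 < b" unfolding b_def by (rule ball_content_pos)
  define B where "B = measure lborel (cball (0 :: complex ^ 'n) (1 / (1 - R)))"
  define C where "C = 1 / b * ((4 / (1 - R\<^sup>2)) ^ N * B)"
  show ?thesis
  proof (intro exI[of _ C] conjI allI impI)
    show "0 \<le> C" using b R2 by (simp add: C_def B_def)
    fix z :: "complex ^ 'n" assume z: "norm z < 1"
    define D where "D = bergman_ball z \<gamma>"
    define S where "S = (sn z)\<^sup>2"
    have S: "0 < S" using sn_pos[OF z] by (simp add: S_def)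
    have lower: "S * (1 - R\<^sup>2) / 4 \<le> 1 - (norm w)\<^sup>2" if "w \<in> D" for w
    proof -
      have "w \<in> bergman_ball z \<gamma>" using that by (simp add: D_def)
      then obtain om where om: "w = phi z om" "norm om \<le> R" "norm om < 1"
        using bergman_ball_phi[OF z, of w \<gamma>] unfolding R_def by blast
      have "cmod (1 - hprod om z) \<le> 2" "0 < cmod (1 - hprod om z)"
        using cmod_1_hprod_le_2[OF om(3) z] one_minus_hprod_neq_0[OF z, of om] om(3) by auto
      then have "(cmod (1 - hprod om z))\<^sup>2 \<le> 2\<^sup>2" "0 < (cmod (1 - hprod om z))\<^sup>2"
        using power_mono[of "cmod (1 - hprod om z)" 2 2] by auto
      moreover have "(norm om)\<^sup>2 \<le> R\<^sup>2" using om(2) by (intro power_mono) auto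
      ultimately have "S * (1 - R\<^sup>2) / 2\<^sup>2 \<le> S * (1 - (norm om)\<^sup>2) / (cmod (1 - hprod om z))\<^sup>2"
        using S R2 by (intro frac_le mult_left_mono mult_nonneg_nonneg) auto
      also have "\<dots> = 1 - (norm w)\<^sup>2"
        using one_minus_norm_phi_sq[OF z, of om] om(3) z by (simp add: om(1) S_def sn_sq)
      finally show ?thesis by simp
    qed
    have "emeasure tau D = (\<integral>\<^sup>+w. indicator D w \<partial>tau)"
      using bergman_ball_sets_tau[of z \<gamma>] by (simp add: D_def)
    also have "\<dots> = ennreal (1 / b) * (\<integral>\<^sup>+x. indicator unit_ball x * (ennreal (1 / (1 - (norm x)\<^sup>2) ^ N) * indicator D x) \<partial>lborel)"
      unfolding b_def N_def by (rule nn_integral_tau) (use bergman_ball_sets_tau[of z \<gamma>] in \<open>simp add: D_def\<close>)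
    also have "\<dots> \<le> ennreal (1 / b) * (\<integral>\<^sup>+x. ennreal ((4 / (1 - R\<^sup>2)) ^ N / S ^ N) *
        indicator ((\<lambda>x. z + complex_of_real (sn z) *s G z x) ` cball 0 (1 / (1 - R))) x \<partial>lborel)"
    proof (intro mult_left_mono nn_integral_mono)
      fix w :: "complex ^ 'n"
      show "indicator unit_ball w * (ennreal (1 / (1 - (norm w)\<^sup>2) ^ N) * indicator D w)
        \<le> ennreal ((4 / (1 - R\<^sup>2)) ^ N / S ^ N) * indicator ((\<lambda>x. z + complex_of_real (sn z) *s G z x) ` cball 0 (1 / (1 - R))) w"
      proof (cases "w \<in> D")
        case True
        then have "w \<in> {u \<in> unit_ball. norm (phi z u) \<le> R}"
          using norm_phi_le_bradius[OF z, of w \<gamma>] by (auto simp: D_def R_def)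
        then have im: "w \<in> (\<lambda>x. z + complex_of_real (sn z) *s G z x) ` cball 0 (1 / (1 - R))"
          using phi_level_subset[OF z R(2)] by blast
        have pos: "0 < S * (1 - R\<^sup>2) / 4" using S R2 by simp
        have "1 / (1 - (norm w)\<^sup>2) ^ N \<le> 1 / (S * (1 - R\<^sup>2) / 4) ^ N"
          using lower[OF True] pos by (intro divide_left_mono power_mono mult_pos_pos zero_less_power) auto
        also have "\<dots> = (4 / (1 - R\<^sup>2)) ^ N / S ^ N"
          by (simp only: power_divide power_mult_distrib) simp
        finally show ?thesis
          using im True by (auto simp: indicator_def intro!: ennreal_leI)
      qed simp
    qed simp
    also have "\<dots> = ennreal (1 / b) * (ennreal ((4 / (1 - R\<^sup>2)) ^ N / S ^ N) *
        emeasure lborel ((\<lambda>x. z + complex_of_real (sn z) *s G z x) ` cball 0 (1 / (1 - R))))"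
    proof -
      have "compact ((\<lambda>x. z + complex_of_real (sn z) *s G z x) ` cball 0 (1 / (1 - R)))"
        by (intro compact_continuous_image continuous_intros continuous_on_subset[OF continuous_G]) auto
      then have "(\<lambda>x. z + complex_of_real (sn z) *s G z x) ` cball 0 (1 / (1 - R)) \<in> sets borel"
        by (intro borel_closed compact_imp_closed)
      then show ?thesis by (subst nn_integral_cmult) (auto intro!: borel_measurable_indicator)
    qed
    also have "emeasure lborel ((\<lambda>x. z + complex_of_real (sn z) *s G z x) ` cball 0 (1 / (1 - R))) = ennreal (S ^ N) * ennreal B"
    proof -
      have "sn z ^ (2 * CARD('n) + 2) = S ^ N"
        unfolding S_def N_def by (subst power_mult[symmetric]) (simp add: algebra_simps)
      moreover have "emeasure lborel (cball (0 :: complex ^ 'n) (1 / (1 - R))) = ennreal B"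
        unfolding B_def using emeasure_lborel_cball_finite[of "0 :: complex ^ 'n" "1 / (1 - R)"]
        by (intro emeasure_eq_ennreal_measure) auto
      ultimately show ?thesis by (simp only: emeasure_ellipsoid[OF z])
    qed
    also have "ennreal (1 / b) * (ennreal ((4 / (1 - R\<^sup>2)) ^ N / S ^ N) * (ennreal (S ^ N) * ennreal B)) = ennreal C"
    proof -
      have B: "0 \<le> B" by (simp add: B_def)
      have Q: "0 \<le> (4 / (1 - R\<^sup>2)) ^ N / S ^ N" and S': "0 \<le> S ^ N" and b': "0 \<le> 1 / b"
        using b R2 S by auto
      have "ennreal x * (ennreal y * (ennreal u * ennreal v)) = ennreal (x * (y * (u * v)))"
        if "0 \<le> x" "0 \<le> y" "0 \<le> u" "0 \<le> v" for x y u v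
        using that by (simp add: ennreal_mult)
      from this[OF b' Q S' B] have "ennreal (1 / b) * (ennreal ((4 / (1 - R\<^sup>2)) ^ N / S ^ N) * (ennreal (S ^ N) * ennreal B))
         = ennreal (1 / b * ((4 / (1 - R\<^sup>2)) ^ N / S ^ N * (S ^ N * B)))" .
      also have "(4 / (1 - R\<^sup>2)) ^ N / S ^ N * (S ^ N * B) = (4 / (1 - R\<^sup>2)) ^ N * B"
        using S by simp
      finally show ?thesis by (simp add: C_def)
    qed
    finally show "emeasure tau (bergman_ball z \<gamma>) \<le> ennreal C" by (simp add: D_def)
  qed
qed

section \<open>Measurability of gradients and area functions\<close>

lemma sigma_finite_tau: "sigma_finite_measure (tau :: (complex ^ 'n::finite) measure)"
proof -
  have "emeasure (ball_measure :: (complex ^ 'n) measure) (space ball_measure) = (\<integral>\<^sup>+x. 1 \<partial>(ball_measure :: (complex ^ 'n) measure))"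
    by simp
  also have "\<dots> = ennreal (1 / measure lborel (unit_ball :: (complex ^ 'n) set)) * (\<integral>\<^sup>+x. indicator unit_ball x * 1 \<partial>(lborel :: (complex ^ 'n) measure))"
    by (rule nn_integral_ball_measure) simp
  also have "\<dots> < \<infinity>"
    using emeasure_lborel_ball_finite[of "0 :: complex ^ 'n" 1] by (simp add: ennreal_mult_less_top)
  finally interpret finite_measure "ball_measure :: (complex ^ 'n) measure"
    by (intro finite_measureI) simp
  show ?thesis
    unfolding tau_def by (subst sigma_finite_iff_density_finite) auto
qed

text \<open>A pointwise limit of difference quotients with steps \<open>1 / (k + 1)\<close>. They
  are formed with the extension of \<open>f\<close> by 0, which agrees with \<open>f\<close> once
  the step stays inside the ball.\<close>

lemma partial_deriv_measurable:
  fixes f :: "complex ^ 'n::finite \<Rightarrow> complex"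
  assumes f: "holomorphic_vec_on f unit_ball" and meas: "f \<in> borel_measurable (restrict_space borel unit_ball)"
  shows "partial_deriv j f \<in> borel_measurable tau"
proof (rule borel_measurable_LIMSEQ_metric)
  define F where "F u = indicator unit_ball u *\<^sub>R f u" for u
  have [measurable]: "F \<in> borel_measurable borel"
    using meas unfolding F_def by (subst (asm) borel_measurable_restrict_space_iff) auto
  define h where "h k = complex_of_real (inverse (real (Suc k)))" for k
  show "(\<lambda>z. (F (z + axis j (h k)) - F z) / h k) \<in> borel_measurable tau" for k
    by (subst axis_eq_scale) measurable
  fix z :: "complex ^ 'n" assume "z \<in> space tau"
  then have z: "norm z < 1" by simp
  have h0: "h \<longlonglongrightarrow> 0"
    unfolding h_def[abs_def] using tendsto_of_real[OF LIMSEQ_inverse_real_of_nat, where 'a = complex]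
    by (simp only: of_real_0)
  have hne: "h k \<noteq> 0" for k by (simp add: h_def del: of_nat_Suc)
  have "((\<lambda>t. f (z + axis j t)) has_field_derivative partial_deriv j f z) (at 0)"
  proof -
    have ax: "(\<lambda>t. f (z + axis j t)) = (\<lambda>t. f (z + t *s axis j 1))"
      by (rule ext, subst axis_eq_scale) (rule refl)
    define S where "S = {t :: complex. norm (z + t *s axis j 1) < 1}"
    have "open S" unfolding S_def by (intro open_Collect_less continuous_intros)
    have "(\<lambda>t. f (z + t *s axis j 1)) holomorphic_on S"
      by (rule holomorphic_slice(1)[OF f _ \<open>open S\<close>]) (simp add: S_def)
    moreover have "0 \<in> S" using z by (simp add: S_def)
    ultimately have "((\<lambda>t. f (z + t *s axis j 1)) has_field_derivative deriv (\<lambda>t. f (z + t *s axis j 1)) 0) (at 0)"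
      using \<open>open S\<close> by (intro holomorphic_derivI)
    then show ?thesis by (simp only: partial_deriv_def ax)
  qed
  then have "((\<lambda>t. (f (z + axis j t) - f z) / t) \<longlongrightarrow> partial_deriv j f z) (at 0)"
  proof -
    have a0: "axis j (0 :: complex) = 0" by (simp add: axis_def vec_eq_iff)
    assume "((\<lambda>t. f (z + axis j t)) has_field_derivative partial_deriv j f z) (at 0)"
    then show ?thesis by (simp only: has_field_derivative_iff a0 add_0_right diff_zero)
  qed
  then have lim: "(\<lambda>k. (f (z + axis j (h k)) - f z) / h k) \<longlonglongrightarrow> partial_deriv j f z"
    by (rule filterlim_compose) (use h0 hne in \<open>auto simp: filterlim_at\<close>)
  have "(\<lambda>k. norm (z + h k *s axis j 1)) \<longlonglongrightarrow> norm (z + 0 *s axis j 1)"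
    by (intro tendsto_intros bounded_bilinear.tendsto[OF bounded_bilinear_scale_vec] h0)
  then have "\<forall>\<^sub>F k in sequentially. norm (z + h k *s axis j 1) < 1"
    by (rule order_tendstoD) (use z in simp)
  then have "\<forall>\<^sub>F k in sequentially. (f (z + axis j (h k)) - f z) / h k = (F (z + axis j (h k)) - F z) / h k"
  proof eventually_elim
    case (elim k)
    then show ?case using z by (simp add: F_def axis_eq_scale[of j "h k"])
  qed
  with lim show "(\<lambda>k. (F (z + axis j (h k)) - F z) / h k) \<longlonglongrightarrow> partial_deriv j f z"
    by (rule Lim_transform_eventually)
qed

lemma grad_measurable:
  fixes f :: "complex ^ 'n::finite \<Rightarrow> complex"
  assumes "holomorphic_vec_on f unit_ball" "f \<in> borel_measurable (restrict_space borel unit_ball)"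
  shows "grad f \<in> borel_measurable tau"
proof -
  note [measurable] = partial_deriv_measurable[OF assms]
  have "grad f = (\<lambda>z. \<Sum>j\<in>UNIV. partial_deriv j f z *s axis j 1)"
    by (rule ext, subst vec_eq_sum_axis) (simp add: grad_def)
  also have "\<dots> \<in> borel_measurable tau" by measurable
  finally show ?thesis .
qed

lemma sn_measurable [measurable]: "sn \<in> borel_measurable borel"
  by (intro borel_measurable_continuous_onI continuous_at_imp_continuous_on ballI isCont_sn)

lemma area_bound:
  fixes h :: "complex ^ 'n::finite \<Rightarrow> real"
  assumes \<gamma>: "0 < \<gamma>" and q: "1 < q" and z: "norm z < 1"
    and C: "emeasure tau (bergman_ball z \<gamma>) \<le> ennreal C" "0 \<le> C"
    and h: "\<And>w. 0 \<le> h w" "\<And>w. w \<in> bergman_ball z \<gamma> \<Longrightarrow> h w \<le> B"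
  shows "(LINT w:bergman_ball z \<gamma>|tau. h w powr q) powr (1 / q) \<le> C powr (1 / q) * B"
proof -
  \<comment> \<open>The centre belongs to its Bergman ball, so the ball is nonempty and the
    hypotheses on \<open>h\<close> force \<open>B\<close> to be nonnegative.\<close>
  have "norm (phi z z) = 0"
  proof -
    have "1 - (norm (phi z z))\<^sup>2 = (1 - (norm z)\<^sup>2) * (1 - (norm z)\<^sup>2) / (cmod (1 - hprod z z))\<^sup>2"
      using one_minus_norm_phi_sq[OF z, of z] z by simp
    moreover have "cmod (1 - hprod z z) = 1 - (norm z)\<^sup>2"
    proof -
      have "1 - hprod z z = complex_of_real (1 - (norm z)\<^sup>2)" by (simp add: hprod_self)
      then have "cmod (1 - hprod z z) = \<bar>1 - (norm z)\<^sup>2\<bar>" by (simp only: norm_of_real)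
      then show ?thesis using z by (simp add: power_le_one)
    qed
    moreover have "(norm z)\<^sup>2 < 1" using z by (simp add: abs_square_less_1)
    ultimately have "1 - (norm (phi z z))\<^sup>2 = 1" by (simp add: power2_eq_square)
    then show ?thesis by simp
  qed
  then have "z \<in> bergman_ball z \<gamma>"
    using z \<gamma> by (simp add: bergman_ball_def bergman_metric_def)
  then have B: "0 \<le> B" using h order_trans by blast
  let ?D = "bergman_ball z \<gamma>"
  have fin: "emeasure tau ?D < \<infinity>" using C by (auto intro: le_less_trans)
  have "(LINT w:?D|tau. h w powr q) \<le> C * B powr q"
  proof (cases "integrable tau (\<lambda>w. indicator ?D w *\<^sub>R h w powr q)")
    case True
    have "(LINT w:?D|tau. h w powr q) \<le> (\<integral>w. indicator ?D w *\<^sub>R B powr q \<partial>tau)"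
      unfolding set_lebesgue_integral_def
    proof (rule integral_mono[OF True])
      show "integrable tau (\<lambda>w. indicator ?D w *\<^sub>R B powr q)"
        by (intro integrable_scaleR_left integrable_real_indicator bergman_ball_sets_tau fin)
      fix w :: "complex ^ 'n"
      show "indicator ?D w *\<^sub>R h w powr q \<le> indicator ?D w *\<^sub>R B powr q"
        using h q by (auto simp: indicator_def intro!: powr_mono2)
    qed
    also have "\<dots> = measure tau ?D * B powr q"
    proof -
      have "?D \<inter> space tau = ?D" by (auto simp: bergman_ball_def)
      then show ?thesis
        using integrable_real_indicator[OF bergman_ball_sets_tau fin] by (subst integral_scaleR_left) simp_all
    qed
    also have "\<dots> \<le> C * B powr q"
      using C by (intro mult_right_mono) (auto simp: measure_def enn2real_leI)
    finally show ?thesis .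
  next
    case False
    then show ?thesis
      using C by (simp add: set_lebesgue_integral_def not_integrable_integral_eq)
  qed
  moreover have "0 \<le> (LINT w:?D|tau. h w powr q)"
    unfolding set_lebesgue_integral_def by (intro integral_nonneg_AE) (simp add: indicator_def)
  ultimately have "(LINT w:?D|tau. h w powr q) powr (1 / q) \<le> (C * B powr q) powr (1 / q)"
    using q by (intro powr_mono2) auto
  also have "\<dots> = C powr (1 / q) * B"
    using B q by (simp add: powr_mult powr_powr)
  finally show ?thesis .
qed

lemma area_measurable:
  fixes h :: "complex ^ 'n::finite \<Rightarrow> real"
  assumes [measurable]: "h \<in> borel_measurable tau"
  shows "(\<lambda>z. (LINT w:bergman_ball z \<gamma>|tau. h w powr q) powr (1 / q)) \<in> borel_measurable (v_alpha \<alpha>)"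
proof -
  interpret sigma_finite_measure "tau :: (complex ^ 'n) measure" by (rule sigma_finite_tau)
  have fst_m [measurable]: "(\<lambda>x. fst x) \<in> borel_measurable (v_alpha \<alpha> \<Otimes>\<^sub>M tau :: ((complex ^ 'n) \<times> (complex ^ 'n)) measure)"
    by (rule measurable_compose[OF measurable_fst ident_v_alpha])
  have snd_m [measurable]: "(\<lambda>x. snd x) \<in> borel_measurable (v_alpha \<alpha> \<Otimes>\<^sub>M tau :: ((complex ^ 'n) \<times> (complex ^ 'n)) measure)"
    by (rule measurable_compose[OF measurable_snd ident_tau])
  have h_m [measurable]: "(\<lambda>x. h (snd x)) \<in> borel_measurable (v_alpha \<alpha> \<Otimes>\<^sub>M tau :: ((complex ^ 'n) \<times> (complex ^ 'n)) measure)"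
    by (rule measurable_compose[OF measurable_snd assms])
  have [measurable]: "(\<lambda>x. bergman_metric (fst x) (snd x)) \<in> borel_measurable (v_alpha \<alpha> \<Otimes>\<^sub>M tau :: ((complex ^ 'n) \<times> (complex ^ 'n)) measure)"
    unfolding bergman_metric_def by measurable
  have "(\<lambda>x. if bergman_metric (fst x) (snd x) < \<gamma> then h (snd x) powr q else 0) \<in> borel_measurable (v_alpha \<alpha> \<Otimes>\<^sub>M tau :: ((complex ^ 'n) \<times> (complex ^ 'n)) measure)"
    by measurable
  then have "(\<lambda>(z, w). indicator (bergman_ball z \<gamma>) w *\<^sub>R h w powr q) \<in> borel_measurable (v_alpha \<alpha> \<Otimes>\<^sub>M tau :: ((complex ^ 'n) \<times> (complex ^ 'n)) measure)"
    by (rule measurable_cong[THEN iffD1, rotated]) (auto simp: space_pair_measure bergman_ball_def indicator_def)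
  from borel_measurable_lebesgue_integral[OF this] have "(\<lambda>z. LINT w:bergman_ball z \<gamma>|tau. h w powr q) \<in> borel_measurable (v_alpha \<alpha>)"
    by (simp add: set_lebesgue_integral_def)
  then show ?thesis by measurable
qed

lemma Lp_of_le_Bop:
  fixes f :: "complex ^ 'n::finite \<Rightarrow> complex" and Ar :: "complex ^ 'n \<Rightarrow> real"
  assumes p: "1 < p" and C: "0 < C" "0 < C1"
    and Ar: "Ar \<in> borel_measurable (v_alpha \<alpha>)" "\<And>z. 0 \<le> Ar z" "\<And>z. norm z < 1 \<Longrightarrow> Ar z \<le> C * Bop \<alpha> f z"
    and Bop: "Bop \<alpha> f \<in> Lp (v_alpha \<alpha>) p"
      "(\<integral>z. Bop \<alpha> f z powr p \<partial>v_alpha \<alpha>) \<le> C1 * (\<integral>z. cmod (f z) powr p \<partial>v_alpha \<alpha>)"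
  shows "Ar \<in> Lp (v_alpha \<alpha>) p" "Lp_norm (v_alpha \<alpha>) p Ar \<le> (C powr p * C1) powr (1 / p) * Lp_norm (v_alpha \<alpha>) p f"
proof -
  let ?V = "v_alpha \<alpha> :: (complex ^ 'n) measure"
  note [measurable] = Ar(1)
  have Bop0: "0 \<le> Bop \<alpha> f z" for z
    unfolding Bop_def by (rule integral_nonneg_AE) simp
  have Bint: "integrable ?V (\<lambda>z. C powr p * Bop \<alpha> f z powr p)"
    using Bop(1) Bop0 by (simp add: Lp_def)
  have le: "Ar z powr p \<le> C powr p * Bop \<alpha> f z powr p" if "z \<in> space ?V" for z
  proof -
    have "Ar z powr p \<le> (C * Bop \<alpha> f z) powr p"
      using Ar(2,3)[of z] that p by (intro powr_mono2) auto
    then show ?thesis by (simp add: powr_mult)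
  qed
  have int: "integrable ?V (\<lambda>z. Ar z powr p)"
    by (rule Bochner_Integration.integrable_bound[OF Bint]) (use le in \<open>auto simp: abs_mult\<close>)
  then show "Ar \<in> Lp ?V p" using Ar(2) by (simp add: Lp_def)
  have "(\<integral>z. Ar z powr p \<partial>?V) \<le> (\<integral>z. C powr p * Bop \<alpha> f z powr p \<partial>?V)"
    by (rule integral_mono[OF int Bint le])
  also have "\<dots> \<le> C powr p * C1 * (\<integral>z. cmod (f z) powr p \<partial>?V)"
    using Bop(2) by (simp add: mult.assoc mult_left_mono)
  finally have "(\<integral>z. Ar z powr p \<partial>?V) powr (1 / p) \<le> (C powr p * C1 * (\<integral>z. cmod (f z) powr p \<partial>?V)) powr (1 / p)"
    using p by (intro powr_mono2 integral_nonneg_AE) auto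
  then show "Lp_norm ?V p Ar \<le> (C powr p * C1) powr (1 / p) * Lp_norm ?V p f"
    using Ar(2) by (simp add: Lp_norm_def powr_mult)
qed

theorem area_functions_bounded:
  fixes \<alpha> \<gamma> q p :: real
  assumes \<gamma>: "0 < \<gamma>" and q: "1 < q" and \<alpha>: "-1 < \<alpha>" and p: "1 < p"
  shows "\<exists>C>0. \<forall>f\<in>(bergman_space \<alpha> p :: (complex ^ 'n::finite \<Rightarrow> complex) set).
     (area_radial \<gamma> q f \<in> Lp (v_alpha \<alpha>) p \<and>
      Lp_norm (v_alpha \<alpha>) p (area_radial \<gamma> q f) \<le> C * Lp_norm (v_alpha \<alpha>) p f) \<and>
     (area_grad \<gamma> q f \<in> Lp (v_alpha \<alpha>) p \<and>
      Lp_norm (v_alpha \<alpha>) p (area_grad \<gamma> q f) \<le> C * Lp_norm (v_alpha \<alpha>) p f) \<and>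
     (area_inv_grad \<gamma> q f \<in> Lp (v_alpha \<alpha>) p \<and>
      Lp_norm (v_alpha \<alpha>) p (area_inv_grad \<gamma> q f) \<le> C * Lp_norm (v_alpha \<alpha>) p f)"
proof -
  obtain C1 where C1: "0 < C1" "\<And>(f :: complex ^ 'n \<Rightarrow> complex) z. holomorphic_vec_on f unit_ball \<Longrightarrow>
    integrable (v_alpha \<alpha>) f \<Longrightarrow> norm z < 1 \<Longrightarrow> norm (inv_grad f z) \<le> C1 * Bop \<alpha> f z"
    using inv_grad_le_Bop[OF \<alpha>, where 'n = 'n] by blast
  obtain C2 where C2: "0 < C2" "\<And>(f :: complex ^ 'n \<Rightarrow> complex) z w. w \<in> bergman_ball z \<gamma> \<Longrightarrow>
    integrable (v_alpha \<alpha>) f \<Longrightarrow> norm z < 1 \<Longrightarrow> Bop \<alpha> f w \<le> C2 * Bop \<alpha> f z"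
    using Bop_le_Bop[OF \<alpha> \<gamma>, where 'n = 'n] by blast
  obtain C3 where C3: "0 \<le> C3" "\<And>z :: complex ^ 'n. norm z < 1 \<Longrightarrow> emeasure tau (bergman_ball z \<gamma>) \<le> ennreal C3"
    using tau_bergman_ball_le[OF \<gamma>, where 'n = 'n] by blast
  obtain C4 where C4: "0 < C4" "\<And>f :: complex ^ 'n \<Rightarrow> complex. f \<in> Lp (v_alpha \<alpha>) p \<Longrightarrow> Bop \<alpha> f \<in> Lp (v_alpha \<alpha>) p"
    "\<And>f :: complex ^ 'n \<Rightarrow> complex. f \<in> Lp (v_alpha \<alpha>) p \<Longrightarrow>
      (\<integral>z. Bop \<alpha> f z powr p \<partial>v_alpha \<alpha>) \<le> C4 * (\<integral>z. cmod (f z) powr p \<partial>v_alpha \<alpha>)"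
    using Bop_bounded[OF \<alpha> p, where 'n = 'n] by blast
  \<comment> \<open>The summand 1 ensures positivity, since \<open>C3\<close> is only known to be
    nonnegative.\<close>
  define C where "C = C3 powr (1 / q) * (C1 * C2) + 1"
  have C: "0 < C" using C1 C2 by (simp add: C_def add_nonneg_pos)
  show ?thesis
  proof (intro exI[of _ "(C powr p * C4) powr (1 / p)"] conjI[of "0 < _"] ballI)
    show "0 < (C powr p * C4) powr (1 / p)" using C C4(1) by simp
    fix f :: "complex ^ 'n \<Rightarrow> complex" assume "f \<in> bergman_space \<alpha> p"
    then have hol: "holomorphic_vec_on f unit_ball" and f: "f \<in> Lp (v_alpha \<alpha>) p"
      by (auto simp: bergman_space_def)
    have fi: "integrable (v_alpha \<alpha>) f"
      by (rule Lp_integrable_norm(1)[OF finite_measure_v_alpha[OF \<alpha>] p f])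
    have "f \<in> borel_measurable (v_alpha \<alpha>)" using fi by simp
    then have meas: "f \<in> borel_measurable (restrict_space borel unit_ball)"
      by (simp cong: measurable_cong_sets[OF sets_v_alpha])
    note pd [measurable] = partial_deriv_measurable[OF hol meas] and gm [measurable] = grad_measurable[OF hol meas]
    have Bop0: "0 \<le> Bop \<alpha> f z" for z
      unfolding Bop_def by (rule integral_nonneg_AE) simp
    \<comment> \<open>The invariant gradient dominates the other two integrands, so a single
      estimate for an arbitrary \<open>h\<close> below it handles all three area functions.\<close>
    have generic: "(\<lambda>z. (LINT w:bergman_ball z \<gamma>|tau. h w powr q) powr (1 / q)) \<in> Lp (v_alpha \<alpha>) p \<and>
      Lp_norm (v_alpha \<alpha>) p (\<lambda>z. (LINT w:bergman_ball z \<gamma>|tau. h w powr q) powr (1 / q))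
        \<le> (C powr p * C4) powr (1 / p) * Lp_norm (v_alpha \<alpha>) p f"
      if h: "h \<in> borel_measurable tau" "\<And>w. 0 \<le> h w" "\<And>w. norm w < 1 \<Longrightarrow> h w \<le> norm (inv_grad f w)"
      for h :: "complex ^ 'n \<Rightarrow> real"
    proof -
      have le: "(LINT w:bergman_ball z \<gamma>|tau. h w powr q) powr (1 / q) \<le> C * Bop \<alpha> f z"
        if z: "norm z < 1" for z
      proof -
      have "(LINT w:bergman_ball z \<gamma>|tau. h w powr q) powr (1 / q) \<le> C3 powr (1 / q) * (C1 * (C2 * Bop \<alpha> f z))"
      proof (rule area_bound[OF \<gamma> q z C3(2)[OF z] C3(1) h(2)])
        fix w assume w: "w \<in> bergman_ball z \<gamma>"
        have w1: "norm w < 1" by (rule norm_phi_le_bradius(1)[OF z w])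
        have "h w \<le> C1 * Bop \<alpha> f w"
          using h(3)[OF w1] C1(2)[OF hol fi w1] by linarith
        also have "\<dots> \<le> C1 * (C2 * Bop \<alpha> f z)"
          using C1(1) C2(2)[OF w fi z] by (intro mult_left_mono) auto
        finally show "h w \<le> C1 * (C2 * Bop \<alpha> f z)" .
      qed
      also have "\<dots> \<le> C * Bop \<alpha> f z"
        using Bop0[of z] by (simp add: C_def algebra_simps)
      finally show ?thesis .
      qed
      show ?thesis
        using Lp_of_le_Bop[OF p C C4(1) area_measurable[OF h(1)] _ le C4(2,3)[OF f]] by simp
    qed
    have grad_le: "norm (complex_of_real (1 - (norm w)\<^sup>2) *s grad f w) \<le> norm (inv_grad f w)" if "norm w < 1" for w
      using grad_le_inv_grad[OF hol that] that unfolding norm_scale_vec norm_of_real by (simp add: power_le_one)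
    have m1: "(\<lambda>w. cmod (complex_of_real (1 - (norm w)\<^sup>2) * radial_deriv f w)) \<in> borel_measurable tau"
    proof -
      have "(\<lambda>w. radial_deriv f w) = (\<lambda>w. hprod w (cnj_vec (grad f w)))"
        by (simp add: fun_eq_iff radial_deriv_def hprod_def cnj_vec_def grad_def)
      then show ?thesis by (simp only:) measurable
    qed
    have m2: "(\<lambda>w. norm (complex_of_real (1 - (norm w)\<^sup>2) *s grad f w)) \<in> borel_measurable tau"
      by measurable
    have m3: "(\<lambda>w. norm (inv_grad f w)) \<in> borel_measurable tau"
    proof -
      have "(\<lambda>w. norm (complex_of_real (sn w) *s G w (cnj_vec (grad f w)))) \<in> borel_measurable tau"
        unfolding G_def by measurable
      then show ?thesis
        by (rule measurable_cong[THEN iffD1, rotated]) (simp add: inv_grad_eq[OF hol])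
    qed
    show "(area_radial \<gamma> q f \<in> Lp (v_alpha \<alpha>) p \<and>
      Lp_norm (v_alpha \<alpha>) p (area_radial \<gamma> q f) \<le> (C powr p * C4) powr (1 / p) * Lp_norm (v_alpha \<alpha>) p f) \<and>
     (area_grad \<gamma> q f \<in> Lp (v_alpha \<alpha>) p \<and>
      Lp_norm (v_alpha \<alpha>) p (area_grad \<gamma> q f) \<le> (C powr p * C4) powr (1 / p) * Lp_norm (v_alpha \<alpha>) p f) \<and>
     (area_inv_grad \<gamma> q f \<in> Lp (v_alpha \<alpha>) p \<and>
      Lp_norm (v_alpha \<alpha>) p (area_inv_grad \<gamma> q f) \<le> (C powr p * C4) powr (1 / p) * Lp_norm (v_alpha \<alpha>) p f)"
    proof (intro conjI[of "_ \<and> _"])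
      show "area_radial \<gamma> q f \<in> Lp (v_alpha \<alpha>) p \<and>
        Lp_norm (v_alpha \<alpha>) p (area_radial \<gamma> q f) \<le> (C powr p * C4) powr (1 / p) * Lp_norm (v_alpha \<alpha>) p f"
        unfolding area_radial_def[abs_def]
      proof (rule generic[OF m1])
        fix w :: "complex ^ 'n" assume w: "norm w < 1"
        have "cmod (complex_of_real (1 - (norm w)\<^sup>2) * radial_deriv f w) \<le> norm (complex_of_real (1 - (norm w)\<^sup>2) *s grad f w)"
          unfolding norm_mult norm_scale_vec by (intro mult_left_mono radial_le_grad[OF w]) simp
        then show "cmod (complex_of_real (1 - (norm w)\<^sup>2) * radial_deriv f w) \<le> norm (inv_grad f w)"
          using grad_le[OF w] by (rule order_trans)
      qed simp
      show "area_grad \<gamma> q f \<in> Lp (v_alpha \<alpha>) p \<and>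
        Lp_norm (v_alpha \<alpha>) p (area_grad \<gamma> q f) \<le> (C powr p * C4) powr (1 / p) * Lp_norm (v_alpha \<alpha>) p f"
        unfolding area_grad_def[abs_def] by (rule generic[OF m2 _ grad_le]) simp_all
      show "area_inv_grad \<gamma> q f \<in> Lp (v_alpha \<alpha>) p \<and>
        Lp_norm (v_alpha \<alpha>) p (area_inv_grad \<gamma> q f) \<le> (C powr p * C4) powr (1 / p) * Lp_norm (v_alpha \<alpha>) p f"
        unfolding area_inv_grad_def[abs_def] by (rule generic[OF m3]) simp_all
    qed
  qed
qed

theorem theorem5p3:
  fixes \<alpha> \<gamma> q :: real
  assumes "\<gamma> > 0" and "1 < q" and "-1 < \<alpha>"
  shows "(T_radial \<alpha> :: (complex ^ 'n::finite \<Rightarrow> complex) \<Rightarrow> complex ^ 'n \<Rightarrow> complex ^ 'n \<Rightarrow> complex)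
           \<in> BIO \<alpha> (Lp_space (tau_on (bergman_ball 0 \<gamma>)) q (*)) \<and>
         (T_grad \<alpha> :: (complex ^ 'n::finite \<Rightarrow> complex) \<Rightarrow> complex ^ 'n \<Rightarrow> complex ^ 'n \<Rightarrow> complex ^ 'n)
           \<in> BIO \<alpha> (Lp_space (tau_on (bergman_ball 0 \<gamma>)) q (*s)) \<and>
         (T_invgrad \<alpha> :: (complex ^ 'n::finite \<Rightarrow> complex) \<Rightarrow> complex ^ 'n \<Rightarrow> complex ^ 'n \<Rightarrow> complex ^ 'n)
           \<in> BIO \<alpha> (Lp_space (tau_on (bergman_ball 0 \<gamma>)) q (*s)) \<and>
         (\<forall>p>1. \<exists>C>0. \<forall>f\<in>(bergman_space \<alpha> p :: (complex ^ 'n::finite \<Rightarrow> complex) set).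
           (area_radial \<gamma> q f \<in> Lp (v_alpha \<alpha>) p \<and>
            Lp_norm (v_alpha \<alpha>) p (area_radial \<gamma> q f) \<le> C * Lp_norm (v_alpha \<alpha>) p f) \<and>
           (area_grad \<gamma> q f \<in> Lp (v_alpha \<alpha>) p \<and>
            Lp_norm (v_alpha \<alpha>) p (area_grad \<gamma> q f) \<le> C * Lp_norm (v_alpha \<alpha>) p f) \<and>
           (area_inv_grad \<gamma> q f \<in> Lp (v_alpha \<alpha>) p \<and>
            Lp_norm (v_alpha \<alpha>) p (area_inv_grad \<gamma> q f) \<le> C * Lp_norm (v_alpha \<alpha>) p f))"
  using T_radial_BIO[OF assms] T_grad_BIO[OF assms] T_invgrad_BIO[OF assms] area_functions_bounded[OF assms]
  by blast

end
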